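(* Let $\ell,n\ge1$ and $0\le k\le\ell$ be integers. Then $$\Big(\prod_{i=1}^{\ell n}w_i\Big)\ \langle k|\,E^{n}\,\mathbf f(w_1)\cdots \mathbf f(w_{\ell n})\,|k\rangle\ \prod_{1\le i<j\le \ell n}\frac{w_j-q^2w_i}{w_j-w_i}\;=\;\gamma^{(k)}_{\ell,n}\,P_{Y^{(k)}_{\ell,n}}(w_1,\ldots,w_{\ell n}),$$ where $P_{Y^{(k)}_{\ell,n}}$ is the Macdonald polynomial in $\ell n$ variables with parameters $t_M=q^{-2}$, $q_M=q^{2(\ell+1)}$ and $$\gamma^{(k)}_{\ell,n}=q^{\ell^2n(n-1)+n\binom{\ell}{2}}\,\big([k]!\,[\ell-k]!\big)^n .$$
   Context: $q$ is a complex number with $0<|q|<1$ (a square root $q^{1/2}$ is fixed); $[m]=\frac{q^m-q^{-m}}{q-q^{-1}}$, $[m]!=[1][2]\cdots[m]$. Level-one Fock space: $\mathcal F=\bigoplus_{h\in\mathbb Z}\mathbb C[a_{-1},a_{-2},\ldots]\,|h\rangle$, with operators $a_m$ ($m\in\mathbb Z$), $[a_m,a_{m'}]=\delta_{m+m',0}\frac{[2m][m]}{m}$ for $m\neq0$, $a_0$ commuting with all $a_m$, $a_m|h\rangle=0$ for $m>0$, $a_0|h\rangle=h|h\rangle$, and $e^{c\alpha}$ ($c\in\frac12\mathbb Z$) commuting with all $a_m$, $m\ne0$, with $e^{c\alpha}|h\rangle=|h+2c\rangle$. Define $$f(z)=e^{-\alpha}z^{-a_0}\exp\Big(-\sum_{m>0}q^{m/2}\tfrac{a_{-m}}{[m]}z^m\Big)\exp\Big(\sum_{m>0}q^{m/2}\tfrac{a_m}{[m]}z^{-m}\Big),\qquad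 k^+(z)=q^{a_0}\exp\Big((q-q^{-1})\sum_{m>0}a_mz^{-m}\Big).$$ Level-$\ell$ current: on $\mathcal F^{\otimes\ell}$, $\mathbf f(z)=\sum_{i=1}^{\ell}\mathbf f^i(z)$, where $\mathbf f^i(z)$ acts as the identity on tensor factors $j<i$, as $f(q^{\ell-i}z)$ on factor $i$, and as $k^+(q^{\ell-j+1/2}z)$ on factors $j>i$. Put $E=(e^{\alpha})^{\otimes\ell}$ (denoted $e^{2\ell\boldsymbol\beta}$ in the source). $|k\rangle$ denotes any one of the vectors $|k_1\rangle\otimes\cdots\otimes|k_\ell\rangle$ with all $k_i\in\{0,1\}$ and $\sum_ik_i=k$; $\langle k|$ is the dual linear functional, equal to $1$ on this vector and $0$ on all other basis vectors (tensor products of monomials in the $a_{-m}$ applied to $|h_1\rangle\otimes\cdots\otimes|h_\ell\rangle$). The matrix element is a series converging for $|w_1|\gg|w_2|\gg\cdots$ to a rational function, with which it is identified. $Y^{(k)}_{\ell,n}$ is the partition with $\ell n$ parts consisting of $n$ successive blocks of $\ell$ parts; for $m=1,\ldots,n$ the $m$-th block consists of $\ell-k$ parts equal to $2(n-m)+1$ followed by $k$ parts equal to $2(n-m)$. $P_\lambda(w_1,\dots,w_N;q_M,t_M)$ is the usual monic symmetric Macdonald polynomial (coefficient of $m_\lambda$ equal to $1$), specialized at the indicated values of $q_M,t_M$, at which it is regular for the partition in question. *)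

theory Defs
  imports
    "HOL-Analysis.Infinite_Sum"
    "HOL-Library.Poly_Mapping"
    "HOL-Computational_Algebra.Computational_Algebra"
begin

section \<open>Finitely supported vectors\<close>

text \<open>The vector space with basis \<open>'b\<close> is \<open>'b \<Rightarrow>\<^sub>0 'a\<close>; the basis vector of \<open>b\<close> is
  \<open>Poly_Mapping.single b 1\<close>.\<close>

definition scl :: "'a \<Rightarrow> ('b \<Rightarrow>\<^sub>0 'a) \<Rightarrow> 'b \<Rightarrow>\<^sub>0 'a::mult_zero"
  where "scl c v = Poly_Mapping.map ((*) c) v"

definition lin_ext :: "('b \<Rightarrow> ('c \<Rightarrow>\<^sub>0 complex)) \<Rightarrow> ('b \<Rightarrow>\<^sub>0 complex) \<Rightarrow> ('c \<Rightarrow>\<^sub>0 complex)"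
  where "lin_ext g v = (\<Sum>b\<in>Poly_Mapping.keys v. scl (Poly_Mapping.lookup v b) (g b))"

lemma lookup_scl: "Poly_Mapping.lookup (scl c v) b = c * Poly_Mapping.lookup v b"
  by (simp add: scl_def map.rep_eq when_def)

lemma scl_simps:
  fixes c d :: complex
  shows "scl c (u + v) = scl c u + scl c v" "scl (c + d) u = scl c u + scl d u"
    "scl c (u - v) = scl c u - scl c v" "scl c (scl d u) = scl (c * d) u"
    "scl 0 u = 0" "scl c 0 = 0" "scl 1 u = u"
    "scl c (Poly_Mapping.single b d) = Poly_Mapping.single b (c * d)"
  by (auto intro!: poly_mapping_eqI
      simp: lookup_scl lookup_add lookup_minus lookup_single when_def algebra_simps)

lemma lin_ext_superset:
  assumes "finite A" "Poly_Mapping.keys v \<subseteq> A"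
  shows "lin_ext g v = (\<Sum>b\<in>A. scl (Poly_Mapping.lookup v b) (g b))"
  unfolding lin_ext_def using assms
  by (intro sum.mono_neutral_left) (auto simp: in_keys_iff scl_simps)

lemma lin_ext_single: "lin_ext g (Poly_Mapping.single b c) = scl c (g b)"
  by (simp add: lin_ext_superset[of "{b}"])

lemma lin_ext_add: "lin_ext g (u + v) = lin_ext g u + lin_ext g v"
proof -
  let ?A = "Poly_Mapping.keys u \<union> Poly_Mapping.keys v"
  have "Poly_Mapping.keys (u + v) \<subseteq> ?A" by (rule keys_add)
  then show ?thesis
    by (simp add: lin_ext_superset[of ?A] lookup_add scl_simps sum.distrib)
qed

lemma lin_ext_scl: "lin_ext g (scl c v) = scl c (lin_ext g v)"
proof -
  have "Poly_Mapping.keys (scl c v) \<subseteq> Poly_Mapping.keys v"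
    by (auto simp: in_keys_iff lookup_scl)
  then have "lin_ext g (scl c v) =
      (\<Sum>b\<in>Poly_Mapping.keys v. scl c (scl (Poly_Mapping.lookup v b) (g b)))"
    by (simp add: lin_ext_superset[of "Poly_Mapping.keys v"] lookup_scl scl_simps)
  also have "\<dots> = scl c (lin_ext g v)"
    unfolding lin_ext_def
    by (induction rule: infinite_finite_induct) (simp_all add: scl_simps)
  finally show ?thesis .
qed

lemma lin_ext_0: "lin_ext g 0 = 0"
  by (simp add: lin_ext_def)

lemma lin_ext_sum: "finite A \<Longrightarrow> lin_ext g (sum x A) = (\<Sum>b\<in>A. lin_ext g (x b))"
  by (induction rule: finite_induct) (simp_all add: lin_ext_add lin_ext_0)

lemma lin_ext_lin_ext: "lin_ext g (lin_ext h v) = lin_ext (\<lambda>b. lin_ext g (h b)) v"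
proof -
  have "lin_ext g (lin_ext h v) =
      lin_ext g (\<Sum>b\<in>Poly_Mapping.keys v. scl (Poly_Mapping.lookup v b) (h b))"
    by (simp only: lin_ext_def[of h])
  also have "\<dots> = (\<Sum>b\<in>Poly_Mapping.keys v. scl (Poly_Mapping.lookup v b) (lin_ext g (h b)))"
    by (simp only: lin_ext_sum finite_keys lin_ext_scl)
  finally show ?thesis by (simp only: lin_ext_def[of "\<lambda>b. lin_ext g (h b)"])
qed

lemma lin_ext_diff: "lin_ext g v - lin_ext h v = lin_ext (\<lambda>b. g b - h b) v"
  by (simp add: lin_ext_def scl_simps sum_subtractf)

lemma lin_ext_single_eq_scl: "lin_ext (\<lambda>b. Poly_Mapping.single b c) v = scl c v"
  by (rule poly_mapping_eqI)
    (auto simp: lin_ext_def lookup_sum lookup_scl lookup_single when_def scl_simps mult.commute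
      in_keys_iff sum.delta)


section \<open>The level-one Fock space\<close>

definition qnum :: "complex \<Rightarrow> int \<Rightarrow> complex"
  where "qnum q m = (q powi m - q powi (- m)) / (q - inverse q)"

definition qfact :: "complex \<Rightarrow> nat \<Rightarrow> complex"
  where "qfact q m = (\<Prod>i=1..m. qnum q (int i))"

text \<open>\<open>(h, \<mu>)\<close> stands for \<open>(\<Prod>m\<ge>1. a\<^bsub>-m\<^esub> ^ \<mu> m) |h\<rangle>\<close>; the index \<open>0\<close> of \<open>\<mu>\<close> is unused.\<close>

type_synonym fbasis = "int \<times> (nat \<Rightarrow>\<^sub>0 nat)"
type_synonym fock = "fbasis \<Rightarrow>\<^sub>0 complex"

text \<open>For \<open>m < 0\<close> the boson is multiplication by a variable; for \<open>m > 0\<close> the commutation relations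
  together with \<open>a\<^sub>m |h\<rangle> = 0\<close> force it to be \<open>[2m][m]/m\<close> times the derivative with respect to
  \<open>a\<^bsub>-m\<^esub>\<close>.\<close>

definition boson :: "complex \<Rightarrow> int \<Rightarrow> fock \<Rightarrow> fock"
  where "boson q m = lin_ext (\<lambda>(h, \<mu>).
     if m < 0 then Poly_Mapping.single (h, \<mu> + Poly_Mapping.single (nat (- m)) 1) 1
     else if m = 0 then Poly_Mapping.single (h, \<mu>) (of_int h)
     else Poly_Mapping.single (h, \<mu> - Poly_Mapping.single (nat m) 1)
            (qnum q (2 * m) * qnum q m / of_int m * of_nat (Poly_Mapping.lookup \<mu> (nat m))))"

lemma boson_single:
  "boson q m (Poly_Mapping.single (h, \<mu>) x) = (
     if m < 0 then Poly_Mapping.single (h, \<mu> + Poly_Mapping.single (nat (- m)) 1) x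
     else if m = 0 then Poly_Mapping.single (h, \<mu>) (x * of_int h)
     else Poly_Mapping.single (h, \<mu> - Poly_Mapping.single (nat m) 1)
            (x * (qnum q (2 * m) * qnum q m / of_int m * of_nat (Poly_Mapping.lookup \<mu> (nat m)))))"
  by (simp add: boson_def lin_ext_single scl_simps)

lemma boson_0: "boson q m 0 = 0"
  by (simp add: boson_def lin_ext_0)

lemma boson_commutator:
  "boson q m (boson q m' v) - boson q m' (boson q m v) =
     (if m + m' = 0 \<and> m \<noteq> 0 then scl (qnum q (2 * m) * qnum q m / of_int m) v else 0)"
proof -
  define c where "c m m' = (if m + m' = 0 \<and> m \<noteq> 0
    then qnum q (2 * m) * qnum q m / of_int m else 0)" for m m'
  define D where "D m m' h \<mu> =
    boson q m (boson q m' (Poly_Mapping.single (h, \<mu>) 1))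
    - boson q m' (boson q m (Poly_Mapping.single (h, \<mu>) 1))" for m m' h \<mu>
  have neg: "qnum q (- j) = - qnum q j" for j
    by (simp add: qnum_def divide_simps)
  have anti: "c m m' = - c m' m" for m m'
  proof (cases "m + m' = 0")
    case True
    then have "m' = - m" by simp
    then show ?thesis using neg[of m] neg[of "2 * m"] by (simp add: c_def)
  qed (simp add: c_def add.commute)
  have pn: "D m m' h \<mu> = Poly_Mapping.single (h, \<mu>) (c m m')" if "m > 0" "m' < 0" for m m' h \<mu>
  proof (cases "nat m = nat (- m')")
    case True
    then have m': "m' = - m" using that by auto
    define \<nu> where "\<nu> = Poly_Mapping.lookup \<mu> (nat m)"
    have "\<mu> - Poly_Mapping.single (nat m) 1 + Poly_Mapping.single (nat m) 1 = \<mu>" if "\<nu> \<noteq> 0"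
      using that by (intro poly_mapping_eqI)
        (auto simp: \<nu>_def lookup_add lookup_minus lookup_single when_def)
    then show ?thesis
      using that unfolding D_def m'
      by (cases "\<nu> = 0")
        (auto simp: boson_single c_def lookup_add lookup_single \<nu>_def[symmetric] ring_distribs
          boson_0 simp flip: single_diff)
  next
    case False
    have "\<mu> + Poly_Mapping.single (nat (- m')) 1 - Poly_Mapping.single (nat m) 1
        = \<mu> - Poly_Mapping.single (nat m) 1 + Poly_Mapping.single (nat (- m')) 1"
      using False by (intro poly_mapping_eqI)
        (auto simp: lookup_add lookup_minus lookup_single when_def)
    moreover have "m + m' \<noteq> 0" using False that by auto
    ultimately show ?thesis
      using that False by (simp add: D_def boson_single c_def lookup_add lookup_single)
  qed
  have D: "D m m' h \<mu> = Poly_Mapping.single (h, \<mu>) (c m m')" for m m' h \<mu>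
  proof -
    consider "m > 0" "m' < 0" | "m < 0" "m' > 0" | "m = 0 \<or> m' = 0 \<or> m = m'"
      | "m < 0" "m' < 0" | "m > 0" "m' > 0" "m \<noteq> m'"
      by linarith
    then show ?thesis
    proof cases
      case 1 then show ?thesis by (rule pn)
    next
      case 2
      have "D m m' h \<mu> = - D m' m h \<mu>" by (simp add: D_def)
      then show ?thesis using pn[OF 2(2,1)] anti[of m m'] by (simp add: single_uminus)
    next
      case 3
      then show ?thesis by (auto simp: D_def boson_single c_def mult_ac)
    next
      case 4
      then show ?thesis by (simp add: D_def boson_single c_def add_ac)
    next
      case 5
      have "\<mu> - Poly_Mapping.single (nat m') 1 - Poly_Mapping.single (nat m) 1
          = \<mu> - Poly_Mapping.single (nat m) 1 - Poly_Mapping.single (nat m') 1"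
        by (intro poly_mapping_eqI) (simp add: lookup_minus)
      moreover have "nat m \<noteq> nat m'" using 5 by auto
      ultimately show ?thesis
        using 5 by (simp add: D_def boson_single c_def lookup_minus lookup_single mult_ac)
    qed
  qed
  have "boson q m (boson q m' v) - boson q m' (boson q m v) =
      lin_ext (\<lambda>b. Poly_Mapping.single b (c m m')) v"
  proof -
    have b: "boson q j u = lin_ext (\<lambda>b. boson q j (Poly_Mapping.single b 1)) u" for j u
      by (simp add: boson_def lin_ext_single scl_simps)
    have "boson q j (boson q i v) =
        lin_ext (\<lambda>b. boson q j (boson q i (Poly_Mapping.single b 1))) v" for i j
      by (subst b[of i], subst b[of j], subst lin_ext_lin_ext, subst b[of j, symmetric]) simp
    then have "boson q m (boson q m' v) - boson q m' (boson q m v) =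
        lin_ext (\<lambda>b. D m m' (fst b) (snd b)) v"
      by (simp add: lin_ext_diff D_def)
    then show ?thesis by (simp add: D)
  qed
  then show ?thesis
    by (simp add: lin_ext_single_eq_scl c_def scl_simps)
qed

text \<open>\<open>e\<^bsup>c\<alpha>\<^esup>\<close>; only integral \<open>c\<close> are needed.\<close>

definition exp_alpha :: "int \<Rightarrow> fock \<Rightarrow> fock"
  where "exp_alpha c = lin_ext (\<lambda>(h, \<mu>). Poly_Mapping.single (h + 2 * c, \<mu>) 1)"

definition q_pow_a0 :: "complex \<Rightarrow> fock \<Rightarrow> fock"
  where "q_pow_a0 q = lin_ext (\<lambda>(h, \<mu>). Poly_Mapping.single (h, \<mu>) (q powi h))"


section \<open>Operator-valued formal series\<close>

text \<open>\<open>X :: 'b opser\<close> encodes \<open>\<Sum>p\<in>\<int>. X p z\<^sup>p\<close>. The series below act so that, on every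
  vector, each sum over modes written with \<^const>\<open>Sum_any\<close> has only finitely many nonzero terms.\<close>

type_synonym 'b opser = "int \<Rightarrow> ('b \<Rightarrow>\<^sub>0 complex) \<Rightarrow> ('b \<Rightarrow>\<^sub>0 complex)"

definition ser_const :: "(('b \<Rightarrow>\<^sub>0 complex) \<Rightarrow> ('b \<Rightarrow>\<^sub>0 complex)) \<Rightarrow> 'b opser"
  where "ser_const A p v = (if p = 0 then A v else 0)"

definition ser_mult :: "'b opser \<Rightarrow> 'b opser \<Rightarrow> 'b opser"  (infixr \<open>\<star>\<close> 70)
  where "(X \<star> Y) p v = Sum_any (\<lambda>i. X i (Y (p - i) v))"

primrec ser_pow :: "'b opser \<Rightarrow> nat \<Rightarrow> 'b opser"
  where
    "ser_pow X 0 = ser_const id"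
  | "ser_pow X (Suc j) = X \<star> ser_pow X j"

definition ser_exp :: "'b opser \<Rightarrow> 'b opser"
  where "ser_exp X p v = Sum_any (\<lambda>j. scl (1 / fact j) (ser_pow X j p v))"

definition ser_rescale :: "complex \<Rightarrow> 'b opser \<Rightarrow> 'b opser"  \<comment> \<open>\<open>X(z) \<mapsto> X(cz)\<close>\<close>
  where "ser_rescale c X p v = scl (c powi p) (X p v)"

text \<open>\<open>z\<^bsup>-a\<^sub>0\<^esup>\<close> multiplies vectors of charge \<open>h\<close> by \<open>z\<^bsup>-h\<^esup>\<close>.\<close>

definition z_pow_minus_a0 :: "fbasis opser"
  where "z_pow_minus_a0 p =
    lin_ext (\<lambda>(h, \<mu>). if p = - h then Poly_Mapping.single (h, \<mu>) 1 else 0)"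

text \<open>\<open>r\<close> is the chosen square root \<open>q\<^bsup>1/2\<^esup>\<close>.\<close>

definition f_current :: "complex \<Rightarrow> complex \<Rightarrow> fbasis opser"
  where "f_current q r =
    ser_const (exp_alpha (- 1)) \<star> z_pow_minus_a0
    \<star> ser_exp (\<lambda>p v. if p > 0 then scl (- (r powi p / qnum q p)) (boson q (- p) v) else 0)
    \<star> ser_exp (\<lambda>p v. if p < 0 then scl (r powi (- p) / qnum q (- p)) (boson q (- p) v) else 0)"

definition k_plus :: "complex \<Rightarrow> fbasis opser"
  where "k_plus q =
    ser_const (q_pow_a0 q)
    \<star> ser_exp (\<lambda>p v. if p < 0 then scl (q - inverse q) (boson q (- p) v) else 0)"


section \<open>The level-\<open>l\<close> current\<close>

text \<open>The basis of the \<open>l\<close>-fold tensor power consists of the lists of length \<open>l\<close>; tensor factors are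
  numbered from \<open>1\<close>.\<close>

type_synonym tfock = "fbasis list \<Rightarrow>\<^sub>0 complex"

definition at_factor :: "nat \<Rightarrow> (fock \<Rightarrow> fock) \<Rightarrow> tfock \<Rightarrow> tfock"
  where "at_factor i A = lin_ext (\<lambda>bs.
    lin_ext (\<lambda>b. Poly_Mapping.single (bs[i - 1 := b]) 1) (A (Poly_Mapping.single (bs ! (i - 1)) 1)))"

definition ser_at_factor :: "nat \<Rightarrow> fbasis opser \<Rightarrow> fbasis list opser"
  where "ser_at_factor i X p = at_factor i (X p)"

definition f_level_summand :: "complex \<Rightarrow> complex \<Rightarrow> nat \<Rightarrow> nat \<Rightarrow> fbasis list opser"
  where "f_level_summand q r l i =
    ser_at_factor i (ser_rescale (q ^ (l - i)) (f_current q r))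
    \<star> foldr (\<star>) (map (\<lambda>j. ser_at_factor j (ser_rescale (q ^ (l - j) * r) (k_plus q))) [Suc i..<Suc l])
        (ser_const id)"

definition f_level :: "complex \<Rightarrow> complex \<Rightarrow> nat \<Rightarrow> fbasis list opser"
  where "f_level q r l p v = (\<Sum>i=1..l. f_level_summand q r l i p v)"

definition E_op :: "nat \<Rightarrow> tfock \<Rightarrow> tfock"  \<comment> \<open>\<open>(e\<^bsup>\<alpha>\<^esup>)\<^bsup>\<otimes>l\<^esup>\<close>\<close>
  where "E_op l = foldr (\<lambda>j. (\<circ>) (at_factor j (exp_alpha 1))) [1..<Suc l] id"

definition vac :: "nat list \<Rightarrow> fbasis list"  \<comment> \<open>index of \<open>|k\<^sub>1\<rangle> \<otimes> \<dots> \<otimes> |k\<^sub>l\<rangle>\<close>\<close>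
  where "vac ks = map (\<lambda>k. (int k, 0)) ks"

text \<open>Coefficient of \<open>w\<^sub>1 ^ p\<^sub>1 \<cdots> w\<^sub>N ^ p\<^sub>N\<close>, for \<open>ps = [p\<^sub>1, \<dots>, p\<^sub>N]\<close>, in
  \<open>\<langle>k| E\<^sup>n f(w\<^sub>1) \<cdots> f(w\<^sub>N) |k\<rangle>\<close>.\<close>

definition mat_coeff :: "complex \<Rightarrow> complex \<Rightarrow> nat \<Rightarrow> nat \<Rightarrow> nat list \<Rightarrow> int list \<Rightarrow> complex"
  where "mat_coeff q r l n ks ps =
    Poly_Mapping.lookup
      ((E_op l ^^ n) (foldr (f_level q r l) ps (Poly_Mapping.single (vac ks) 1)))
      (vac ks)"


section \<open>Polynomials and rational functions in \<open>w\<^sub>1, w\<^sub>2, \<dots>\<close>\<close>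

type_synonym 'a mpol = "(nat \<Rightarrow>\<^sub>0 nat) \<Rightarrow>\<^sub>0 'a"

definition var :: "nat \<Rightarrow> 'a::zero_neq_one mpol"
  where "var i = Poly_Mapping.single (Poly_Mapping.single i 1) 1"

definition mpol_eval :: "(nat \<Rightarrow> 'a) \<Rightarrow> 'a mpol \<Rightarrow> 'a::comm_semiring_1"
  where "mpol_eval w P = (\<Sum>\<alpha>\<in>Poly_Mapping.keys P.
    Poly_Mapping.lookup P \<alpha> * (\<Prod>i\<in>Poly_Mapping.keys \<alpha>. w i ^ Poly_Mapping.lookup \<alpha> i))"

definition rat_has_value :: "complex mpol fract \<Rightarrow> (nat \<Rightarrow> complex) \<Rightarrow> complex \<Rightarrow> bool"
  where "rat_has_value M w v \<longleftrightarrow> (\<exists>a b. M = Fraction_Field.Fract a b \<and> mpol_eval w b \<noteq> 0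
    \<and> v = mpol_eval w a / mpol_eval w b)"

text \<open>\<open>|w\<^sub>1| \<ggreater> |w\<^sub>2| \<ggreater> \<dots> \<ggreater> |w\<^sub>N| > 0\<close>\<close>

definition ordered_region :: "nat \<Rightarrow> real \<Rightarrow> (nat \<Rightarrow> complex) set"
  where "ordered_region N R =
    {w. (\<forall>i\<in>{1..N}. w i \<noteq> 0) \<and> (\<forall>i\<in>{1..<N}. norm (w i) > R * norm (w (Suc i)))}"

text \<open>The rational function to which the multiple series converges (absolutely) in such a region; it is
  unique, since a rational function is determined by its values on a nonempty open set.\<close>

definition matrix_element ::
    "complex \<Rightarrow> complex \<Rightarrow> nat \<Rightarrow> nat \<Rightarrow> nat list \<Rightarrow> complex mpol fract"
  where "matrix_element q r l n ks =
    (THE M. \<exists>R. \<forall>w\<in>ordered_region (l * n) R. \<exists>v. rat_has_value M w v \<and>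
       ((\<lambda>ps. mat_coeff q r l n ks ps * (\<Prod>i=1..l * n. w i powi (ps ! (i - 1)))) has_sum v)
         {ps. length ps = l * n})"


section \<open>Macdonald polynomials\<close>

text \<open>Partitions with at most \<open>N\<close> nonzero parts are weakly decreasing lists of length \<open>N\<close>.\<close>

definition is_partition :: "nat \<Rightarrow> nat list \<Rightarrow> bool"
  where "is_partition N \<mu> \<longleftrightarrow> length \<mu> = N \<and> sorted_wrt (\<ge>) \<mu>"

definition dominated :: "nat list \<Rightarrow> nat list \<Rightarrow> bool"
  where "dominated \<mu> \<nu> \<longleftrightarrow> length \<mu> = length \<nu> \<and> sum_list \<mu> = sum_list \<nu> \<and>
    (\<forall>j\<le>length \<mu>. sum_list (take j \<mu>) \<le> sum_list (take j \<nu>))"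

definition monomial_sym :: "nat list \<Rightarrow> 'a::comm_semiring_1 mpol"
  where "monomial_sym \<mu> = (\<Sum>\<alpha>\<in>{\<alpha>. mset \<alpha> = mset \<mu>}. \<Prod>i<length \<alpha>. var (Suc i) ^ (\<alpha> ! i))"

definition q_shift :: "'a \<Rightarrow> nat \<Rightarrow> 'a mpol \<Rightarrow> 'a::comm_semiring_1 mpol"  \<comment> \<open>\<open>x\<^sub>i \<mapsto> q x\<^sub>i\<close>\<close>
  where "q_shift q i = Poly_Mapping.mapp (\<lambda>\<alpha> c. c * q ^ Poly_Mapping.lookup \<alpha> i)"

text \<open>Macdonald's operator \<open>\<Sum>\<^sub>i (\<Prod>\<^sub>j\<^sub>\<noteq>\<^sub>i (t x\<^sub>i - x\<^sub>j) / (x\<^sub>i - x\<^sub>j)) T\<^sub>i\<close>, with values in the field of rational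
  functions.\<close>

definition macdonald_op :: "'a \<Rightarrow> 'a \<Rightarrow> nat \<Rightarrow> 'a mpol \<Rightarrow> 'a::field mpol fract"
  where "macdonald_op q t N P =
    (\<Sum>i=1..N. (\<Prod>j\<in>{1..N} - {i}. to_fract (scl t (var i) - var j) / to_fract (var i - var j))
       * to_fract (q_shift q i P))"

definition is_macdonald :: "'a \<Rightarrow> 'a \<Rightarrow> nat \<Rightarrow> nat list \<Rightarrow> 'a::field mpol \<Rightarrow> bool"
  where "is_macdonald q t N \<nu> P \<longleftrightarrow>
    (\<exists>c. P = monomial_sym \<nu> +
       (\<Sum>\<mu>\<in>{\<mu>. is_partition N \<mu> \<and> dominated \<mu> \<nu> \<and> \<mu> \<noteq> \<nu>}. scl (c \<mu>) (monomial_sym \<mu>))) \<and>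
    (\<exists>e. macdonald_op q t N P = to_fract (scl e P))"

text \<open>\<open>\<complex>(q\<^sub>M, t\<^sub>M)\<close> is the fraction field of \<open>\<complex>[q\<^sub>M][t\<^sub>M]\<close>.\<close>

type_synonym qt_field = "complex poly poly fract"

definition q_gen :: qt_field where "q_gen = to_fract [:[:0, 1:]:]"
definition t_gen :: qt_field where "t_gen = to_fract [:0, 1:]"

text \<open>For generic parameters the eigenvalues are pairwise distinct, so that the triangular monic
  eigenfunction is unique.\<close>

definition macdonald_generic :: "nat \<Rightarrow> nat list \<Rightarrow> qt_field mpol"
  where "macdonald_generic N \<nu> = (THE P. is_macdonald q_gen t_gen N \<nu> P)"

definition qt_eval :: "complex \<Rightarrow> complex \<Rightarrow> complex poly poly \<Rightarrow> complex"
  where "qt_eval q0 t0 a = poly (poly a [:t0:]) q0"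

text \<open>The value at \<open>(q\<^sub>M, t\<^sub>M) = (q0, t0)\<close> of a rational function regular at that point.\<close>

definition qt_specialize :: "complex \<Rightarrow> complex \<Rightarrow> qt_field \<Rightarrow> complex"
  where "qt_specialize q0 t0 c = (THE v. \<exists>a b. c = Fraction_Field.Fract a b \<and>
    qt_eval q0 t0 b \<noteq> 0 \<and> v = qt_eval q0 t0 a / qt_eval q0 t0 b)"

lemma qt_specialize_Fract:
  assumes "qt_eval q0 t0 b \<noteq> 0"
  shows "qt_specialize q0 t0 (Fraction_Field.Fract a b) = qt_eval q0 t0 a / qt_eval q0 t0 b"
proof -
  have nz: "d \<noteq> 0" if "qt_eval q0 t0 d \<noteq> 0" for d
    using that by (auto simp: qt_eval_def)
  have "qt_eval q0 t0 a / qt_eval q0 t0 b = qt_eval q0 t0 c / qt_eval q0 t0 d"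
    if "Fraction_Field.Fract a b = Fraction_Field.Fract c d" "qt_eval q0 t0 d \<noteq> 0" for c d
  proof -
    have "a * d = c * b"
      using that nz[OF assms] nz[OF that(2)] by (simp add: Fraction_Field.eq_fract)
    then have "qt_eval q0 t0 (a * d) = qt_eval q0 t0 (c * b)" by simp
    with assms that(2) show ?thesis by (simp add: qt_eval_def field_simps)
  qed
  then show ?thesis
    unfolding qt_specialize_def using assms by (intro the_equality) (blast, metis)
qed

definition macdonald_poly :: "complex \<Rightarrow> complex \<Rightarrow> nat \<Rightarrow> nat list \<Rightarrow> complex mpol"
  where "macdonald_poly q0 t0 N \<nu> =
    Poly_Mapping.map (qt_specialize q0 t0) (macdonald_generic N \<nu>)"

definition Y_partition :: "nat \<Rightarrow> nat \<Rightarrow> nat \<Rightarrow> nat list"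
  where "Y_partition l n k = concat (map (\<lambda>m.
    replicate (l - k) (2 * (n - m) + 1) @ replicate k (2 * (n - m))) [1..<Suc n])"

definition gamma_const :: "complex \<Rightarrow> nat \<Rightarrow> nat \<Rightarrow> nat \<Rightarrow> complex"
  where "gamma_const q l n k =
    q ^ (l\<^sup>2 * n * (n - 1) + n * (l choose 2)) * (qfact q k * qfact q (l - k)) ^ n"

end

theory Submission
	imports Defs "HOL-Combinatorics.Multiset_Permutations" "HOL-Analysis.Analysis"
begin

text \<open>A coherent functional on the Fock space, with values \<open>\<Prod>\<^sub>m u\<^sub>m\<^bsup>\<mu> m\<^esup>\<close> on the vectors of one charge, is an eigenfunctional of
	the creation modes, while exponentials of annihilation modes shift \<open>u\<close>. Moving the functional \<open>\<langle>k| E\<^sup>n\<close> through the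
	currents therefore turns the matrix element into a finite sum over all ways \<open>\<sigma>\<close> of choosing a summand \<open>f\<^sup>i\<close> for each
	variable. After multiplication by the prefactors it is a constant times the symmetric polynomial
	\<open>F = \<Sum>\<^sub>\<sigma> \<Prod>\<^sub>a w\<^sub>a\<^bsup>1-k(\<sigma> a)\<^esup> \<Prod>\<^sub>a\<^sub><\<^sub>b D(\<sigma> a, \<sigma> b; w\<^sub>a, w\<^sub>b) / (w\<^sub>a - w\<^sub>b)\<close>.

	\<open>F\<close> is dominated by \<open>Y\<close> and vanishes when \<open>l + 1\<close> variables form a string \<open>x, t x, \<dots>, t\<^sup>l x\<close>, because \<open>\<sigma>\<close> would have to
	decrease strictly along the string. When \<open>q t\<^bsup>l+1\<^esup> = 1\<close>, Macdonald's operators preserve this wheel condition, and a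
	polynomial satisfying it and dominated by \<open>Y\<close> is determined by its value on one configuration of \<open>n\<close> generic strings
	of length \<open>l\<close>. Hence \<open>F\<close> is a joint eigenvector. The commuting operators together separate \<open>Y\<close> from the smaller partitions
	even at the point of specialization, so \<open>F\<close> is the Macdonald polynomial times its leading coefficient, a sum over
	permutations of powers of \<open>q\<^sup>2\<close>.\<close>

text \<open>Macdonald's first operator alone may have coinciding eigenvalues where q t^(l+1) = 1,
  and \<open>macdonald_poly\<close> is the specialization of a polynomial over a field of rational
  functions. Hence the operators are written with the Vandermonde product multiplied out, which
  makes them compatible with every change of coefficients, and eigenvectors are built over C[q, t]
  with an explicit leading coefficient, a product of eigenvalue differences. The series of operators
  with weights c^r has the eigenvalue \<Prod>(1 + c t^(N-i) q^(nu_i)), which as a polynomial in c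
  knows all the numbers t^(N-i) q^(nu_i); the fall of Y by 2 over every l places lets them determine
  Y at the special point. The same relation closes a string x, ..., t^l x into a cycle up to the
  factor q, so a partial shift only rotates it: this is why the wheel condition is preserved.
  Products of currents are infinite sums over modes, so functionals are transported from the left
  together with majorants. The contractions are logarithm series that converge for |w_j| < |q^2
  w_i|, i < j; the pole at w_j = q^2 w_i is what the prefactor cancels.\<close>

abbreviation "lookup \<equiv> Poly_Mapping.lookup"
abbreviation "keys \<equiv> Poly_Mapping.keys"
abbreviation "single \<equiv> Poly_Mapping.single"

section \<open>Ring homomorphisms, evaluation and substitution for polynomials in several
  variables\<close>

definition rhom :: "('a::comm_ring_1 => 'b::comm_ring_1) => bool"
	where "rhom h \<longleftrightarrow> h 0 = 0 \<and> h 1 = 1 \<and> (\<forall>a b. h (a + b) = h a + h b \<and> h (a * b) = h a * h b)"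

lemma rhom_simps:
	assumes "rhom h"
	shows "h 0 = 0" "h 1 = 1" "h (a + b) = h a + h b" "h (a * b) = h a * h b"
		"h (- a) = - h a" "h (a - b) = h a - h b" "h (a ^ m) = h a ^ m"
proof -
	show 1: "h 0 = 0" "h 1 = 1" and 2: "h (a + b) = h a + h b" "h (a * b) = h a * h b" for a b
		using assms by (auto simp: rhom_def)
	show 3: "h (- a) = - h a" for a
		using 1(1) 2(1)[of a "- a"] by (simp add: eq_neg_iff_add_eq_0 add.commute)
	show "h (a - b) = h a - h b" using 2(1)[of a "- b"] 3[of b] by simp
	show "h (a ^ m) = h a ^ m" by (induction m) (simp_all add: 1 2)
qed

lemma rhom_sum: "rhom h ==> h (sum f A) = (\<Sum>x\<in>A. h (f x))"
	by (induction A rule: infinite_finite_induct) (simp_all add: rhom_simps)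

lemma rhom_prod: "rhom h ==> h (prod f A) = (\<Prod>x\<in>A. h (f x))"
	by (induction A rule: infinite_finite_induct) (simp_all add: rhom_simps)

lemma rhom_comp: "rhom g ==> rhom h ==> rhom (%x. g (h x))"
	by (simp add: rhom_def)

lemma rhom_id [simp]: "rhom (%x. x)"
	by (simp add: rhom_def)

definition monv :: "(nat => 'b::comm_ring_1) => (nat \<Rightarrow>\<^sub>0 nat) => 'b"
	where "monv u al = (\<Prod>i\<in>keys al. u i ^ lookup al i)"

lemma monv_superset:
	"finite A ==> keys al \<subseteq> A ==> monv u al = (\<Prod>i\<in>A. u i ^ lookup al i)"
	unfolding monv_def by (rule prod.mono_neutral_left) (auto simp: in_keys_iff)

lemma monv_0 [simp]: "monv u 0 = 1"
	by (simp add: monv_def)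

lemma monv_add: "monv u (al + bt) = monv u al * monv u bt"
proof -
	let ?A = "keys al \<union> keys bt"
	have "keys (al + bt) \<subseteq> ?A" by (rule keys_add)
	then show ?thesis
		by (simp add: monv_superset[of ?A] lookup_add power_add prod.distrib)
qed

lemma monv_single [simp]: "monv u (single i m) = u i ^ m"
	by (simp add: monv_superset[of "{i}"])

lemma monv_cong: "(\<And>i. i \<in> keys al ==> u i = v i) ==> monv u al = monv v al"
	by (simp add: monv_def)

lemma rhom_monv: "rhom g ==> g (monv u al) = monv (%i. g (u i)) al"
	by (simp add: monv_def rhom_prod rhom_simps)

lemma poly_mapping_sum_single:
	"P = (\<Sum>al\<in>keys P. single al (lookup P al))"
	by (rule poly_mapping_eqI)
		(auto simp: lookup_sum lookup_single when_def in_keys_iff sum.delta)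

lemma monv_var: "monv var al = single al (1::'a::comm_ring_1)"
proof -
	have *: "var i ^ m = single (single i m) (1::'a)" for i m
		by (induction m) (simp_all add: var_def mult_single flip: single_add)
	have **: "(\<Prod>i\<in>A. single (f i) (1::'a)) = single (\<Sum>i\<in>A. f i) 1" if "finite A" for f A
		using that by (induction A rule: finite_induct) (simp_all add: mult_single)
	show ?thesis
		unfolding monv_def * by (subst **) (simp_all add: poly_mapping_sum_single[of al, symmetric])
qed

text \<open>Coefficients pass through \<open>h\<close> and variables through \<open>u\<close> into
  one target ring. Evaluation (\<open>ev\<close>), substitution (\<open>subst\<close>), change of
  coefficients (\<open>mmap\<close>) and grading (\<open>grade\<close>) are instances, so
  \<open>rhom_pev\<close> makes all of them homomorphisms and \<open>rhom_pev_comp\<close> composes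
  them.\<close>

definition pev :: "('a::comm_ring_1 => 'b::comm_ring_1) => (nat => 'b) => 'a mpol => 'b"
	where "pev h u P = (\<Sum>al\<in>keys P. h (lookup P al) * monv u al)"

lemma mpol_eval_pev: "mpol_eval w P = pev (%c. c) w P"
	by (simp add: mpol_eval_def pev_def monv_def)

context
	fixes h :: "'a::comm_ring_1 => 'b::comm_ring_1"
	assumes h: "rhom h"
begin

lemma pev_superset:
	"finite A ==> keys P \<subseteq> A ==>
		pev h u P = (\<Sum>al\<in>A. h (lookup P al) * monv u al)"
	unfolding pev_def
	by (rule sum.mono_neutral_left) (auto simp: in_keys_iff rhom_simps[OF h])

lemma pev_single: "pev h u (single al c) = h c * monv u al"
	by (simp add: pev_superset[of "{al}"])

lemma pev_add: "pev h u (P + R) = pev h u P + pev h u R"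
proof -
	let ?A = "keys P \<union> keys R"
	have "keys (P + R) \<subseteq> ?A" by (rule keys_add)
	then show ?thesis
		by (simp add: pev_superset[of ?A] lookup_add rhom_simps[OF h] ring_distribs sum.distrib)
qed

lemma pev_0: "pev h u 0 = 0"
	by (simp add: pev_def)

lemma pev_sum': "pev h u (sum f A) = (\<Sum>x\<in>A. pev h u (f x))"
	by (induction A rule: infinite_finite_induct) (simp_all add: pev_add pev_0)

lemma pev_mult: "pev h u (P * R) = pev h u P * pev h u R"
proof -
	have s: "pev h u (single al c * R) = h c * monv u al * pev h u R" for al c
	proof -
		have "pev h u (single al c * R) = pev h u (\<Sum>bt\<in>keys R.
				single al c * single bt (lookup R bt))"
			by (simp add: sum_distrib_left[symmetric] poly_mapping_sum_single[of R, symmetric])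
		then show ?thesis
			by (simp add: pev_sum' mult_single pev_single monv_add rhom_simps[OF h] pev_def[of _ _ R]
					sum_distrib_left mult_ac)
	qed
	have "pev h u (P * R) = pev h u (\<Sum>al\<in>keys P.
			single al (lookup P al) * R)"
		by (simp add: sum_distrib_right[symmetric] poly_mapping_sum_single[of P, symmetric])
	then show ?thesis
		by (simp add: pev_sum' s pev_def[of _ _ P] sum_distrib_right)
qed

lemma rhom_pev: "rhom (pev h u)"
proof -
	have "pev h u 1 = 1" using pev_single[of u 0 1] by (simp add: rhom_simps[OF h])
	then show ?thesis by (simp add: rhom_def pev_0 pev_add pev_mult)
qed

lemma pev_var [simp]: "pev h u (var i) = u i"
	by (simp add: var_def pev_single rhom_simps[OF h])

lemma pev_scl: "pev h u (scl c P) = h c * pev h u P"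
proof -
	have "scl c P = single 0 c * P" by (simp add: scl_def mult_map_scale_conv_mult)
	then show ?thesis by (simp add: pev_mult pev_single)
qed

end

lemma scl_mult_single: "scl c P = single 0 c * (P :: 'a::comm_ring_1 mpol)"
	by (simp add: scl_def mult_map_scale_conv_mult)

lemma rhom_single0: "rhom (single (0::nat \<Rightarrow>\<^sub>0 nat) :: 'a::comm_ring_1 => _)"
	by (simp add: rhom_def single_add mult_single)

lemma pev_cong:
	"(\<And>al i. al \<in> keys P ==> i \<in> keys al ==> u i = v i) ==> pev h u P = pev h v P"
	unfolding pev_def by (intro sum.cong refl arg_cong2[of _ _ _ _ "(*)"] monv_cong) auto

lemma rhom_pev_comp:
	assumes "rhom g" "rhom h"
	shows "g (pev h u P) = pev (%c. g (h c)) (%i. g (u i)) P"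
	by (simp add: pev_def rhom_sum[OF assms(1)] rhom_simps[OF assms(1)] rhom_monv[OF assms(1)])

lemma pev_single_var: "pev (single 0) var P = P"
	by (simp add: pev_def monv_var mult_single poly_mapping_sum_single[of P, symmetric])

definition mmap :: "('a => 'b) => 'a::comm_ring_1 mpol => 'b::comm_ring_1 mpol"
	where "mmap h = pev (%c. single 0 (h c)) var"

lemma lookup_mmap:
	assumes "rhom h"
	shows "lookup (mmap h P) al = h (lookup P al)"
	by (auto simp: mmap_def pev_def lookup_sum monv_var mult_single lookup_single when_def sum.delta
			in_keys_iff rhom_simps[OF assms])

lemma rhom_mmap: "rhom h ==> rhom (mmap h)"
	unfolding mmap_def by (intro rhom_pev rhom_comp[OF rhom_single0])

lemma pev_mmap:
	assumes "rhom h" "rhom g"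
	shows "pev g u (mmap h P) = pev (%c. g (h c)) u P"
	unfolding mmap_def
	by (subst rhom_pev_comp[OF rhom_pev[OF assms(2)] rhom_comp[OF rhom_single0 assms(1)]])
		(simp add: pev_single[OF assms(2)] pev_var[OF assms(2)])

definition subst :: "(nat => 'a::comm_ring_1 mpol) => 'a mpol => 'a mpol"
	where "subst = pev (single 0)"

lemma rhom_subst: "rhom (subst u)"
	unfolding subst_def by (intro rhom_pev rhom_single0)

lemma pev_subst: "rhom h ==> pev h w (subst u P) = pev h (%i. pev h w (u i)) P"
	unfolding subst_def by (simp add: rhom_pev_comp[OF rhom_pev rhom_single0] pev_single)

lemma subst_var [simp]: "subst u (var i) = u i"
	by (simp add: subst_def pev_var rhom_single0)

lemma subst_scl: "subst u (scl c P) = scl c (subst u P)"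
	unfolding subst_def pev_scl[OF rhom_single0] by (simp add: scl_mult_single)

abbreviation ev :: "(nat => 'a::comm_ring_1) => 'a mpol => 'a"
	where "ev \<equiv> pev (%c. c)"

lemma rhom_ev: "rhom (ev w)" by (intro rhom_pev rhom_id)

lemma mmap_simps:
	assumes "rhom h"
	shows "mmap h (var i) = var i" "mmap h (scl c P) = scl (h c) (mmap h P)"
		"mmap h (single al c) = single al (h c)"
	unfolding mmap_def pev_scl[OF rhom_comp[OF rhom_single0 assms]]
	by (simp_all add: pev_var[OF rhom_comp[OF rhom_single0 assms]] scl_mult_single
			pev_single[OF rhom_comp[OF rhom_single0 assms]] monv_var mult_single)

section \<open>Weights\<close>

definition wt :: "(nat => nat) => (nat \<Rightarrow>\<^sub>0 nat) => nat"
	where "wt e al = (\<Sum>i\<in>keys al. e i * lookup al i)"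

lemma wt_superset:
	"finite A ==> keys al \<subseteq> A ==> wt e al = (\<Sum>i\<in>A. e i * lookup al i)"
	unfolding wt_def by (rule sum.mono_neutral_left) (auto simp: in_keys_iff)

text \<open>\<open>x\<^sub>i \<mapsto> x\<^sub>i z\<^bsup>e i\<^esup>\<close>\<close>

definition grade :: "(nat => nat) => 'a::comm_ring_1 mpol => 'a mpol poly"
	where "grade e = pev (%c. [:single 0 c:]) (%i. monom (var i) (e i))"

lemma rhom_const_poly: "rhom (%c. [:c:])"
	by (simp add: rhom_def)

lemma rhom_grade: "rhom (grade e)"
	unfolding grade_def by (intro rhom_pev rhom_comp[OF rhom_const_poly rhom_single0])

lemma monom_power': "monom (c::'a::comm_ring_1) d ^ m = monom (c ^ m) (d * m)"
	by (induction m) (simp_all add: mult_monom algebra_simps one_pCons monom_0)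

lemma monv_monom:
	"monv (%i. monom (u i) (e i)) al = monom (monv u al) (wt e al)"
proof -
	have "finite A ==> (\<Prod>i\<in>A. monom (f i) (d i)) = monom (\<Prod>i\<in>A. f i) (\<Sum>i\<in>A. d i)"
		for f :: "nat => 'a" and d A
		by (induction A rule: finite_induct) (simp_all add: mult_monom one_pCons monom_0)
	then show ?thesis by (simp add: monv_def wt_def monom_power')
qed

lemma grade_single: "grade e (single al c) = monom (single al c) (wt e al)"
proof -
	have "[:x:] * monom y d = monom (x * y) d" for x y :: "'a mpol" and d
		by (simp add: smult_monom)
	then show ?thesis
		by (simp add: grade_def pev_single[OF rhom_comp[OF rhom_const_poly rhom_single0]] monv_monom
				monv_var mult_single smult_monom)
qed

lemma grade_var: "grade e (var i) = monom (var i) (e i)"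
	by (simp add: grade_def pev_var[OF rhom_comp[OF rhom_const_poly rhom_single0]])

lemma lookup_coeff_grade:
	"lookup (coeff (grade e P) d) al = (if wt e al = d then lookup P al else 0)"
proof -
	have g: "grade e P = (\<Sum>al\<in>keys P. monom (single al (lookup P al)) (wt e al))"
		by (subst arg_cong[OF poly_mapping_sum_single[of P], of "grade e"])
			(simp add: rhom_sum[OF rhom_grade] grade_single)
	have "lookup (coeff (grade e P) d) al = (\<Sum>bt\<in>keys P.
				if bt = al then if wt e al = d then lookup P al else 0 else 0)"
			unfolding g coeff_sum lookup_sum
			by (intro sum.cong) (auto simp: lookup_single when_def)
		then show ?thesis by (simp add: sum.delta' in_keys_iff)
qed

lemma degree_grade_le_iff:
	"degree (grade e P) \<le> d \<longleftrightarrow> (\<forall>al\<in>keys P. wt e al \<le> d)"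
proof
	assume d: "degree (grade e P) \<le> d"
	show "\<forall>al\<in>keys P. wt e al \<le> d"
	proof (rule ballI, rule ccontr)
		fix al assume a: "al \<in> keys P" "\<not> wt e al \<le> d"
		then have "coeff (grade e P) (wt e al) = 0" using d by (intro coeff_eq_0) auto
		then show False using lookup_coeff_grade[of e P "wt e al" al] a by (auto simp: in_keys_iff)
	qed
next
	assume a: "\<forall>al\<in>keys P. wt e al \<le> d"
	show "degree (grade e P) \<le> d"
	proof (rule degree_le, intro allI impI, rule poly_mapping_eqI)
		fix i al assume "d < i"
		then show "lookup (coeff (grade e P) i) al = lookup 0 al"
			using a by (force simp: lookup_coeff_grade in_keys_iff)
	qed
qed

section \<open>Polynomials as functions\<close>

lemma digits_inj:
	fixes f g :: "nat => nat"
	assumes "\<And>i. i \<le> K ==> f i < B" "\<And>i. i \<le> K ==> g i < B"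
		and "(\<Sum>i\<le>K. B ^ (K - i) * f i) = (\<Sum>i\<le>K. B ^ (K - i) * g i)"
	shows "i \<le> K ==> f i = g i"
	using assms
proof (induction K arbitrary: i)
	case (Suc K)
	have *: "(\<Sum>i\<le>Suc K. B ^ (Suc K - i) * h i) = B * (\<Sum>i\<le>K. B ^ (K - i) * h i) + h (Suc K)" for h :: "nat => nat"
		by (simp add: sum_distrib_left Suc_diff_le mult.assoc)
	have eq: "B * (\<Sum>i\<le>K. B ^ (K - i) * f i) + f (Suc K) = B * (\<Sum>i\<le>K. B ^ (K - i) * g i) + g (Suc K)"
		using Suc.prems(4) by (simp only: *)
	have lt: "f (Suc K) < B" "g (Suc K) < B" using Suc.prems(2,3) by auto
	have 1: "f (Suc K) = g (Suc K)" using arg_cong[OF eq, of "%x. x mod B"] lt by simp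
	have "(\<Sum>i\<le>K. B ^ (K - i) * f i) = (\<Sum>i\<le>K. B ^ (K - i) * g i)"
		using arg_cong[OF eq, of "%x. x div B"] lt by simp
	then have "i \<le> K ==> f i = g i"
		using Suc.prems(2,3) by (intro Suc.IH) auto
	then show ?case using 1 Suc.prems(1) by (cases "i = Suc K") auto
qed simp

text \<open>Kronecker substitution: along a curve \<open>z \<mapsto> (z\<^bsup>e i\<^esup>)\<^sub>i\<close> with exponents that are the powers of a large
	base, different monomials have different degrees.\<close>

lemma kronecker_substitution:
	fixes P :: "'a::idom mpol"
	assumes "P \<noteq> 0"
	obtains e p where "p \<noteq> 0" "\<And>z. poly p z = ev (%i. z ^ e i) P"
		"\<And>i. i \<in> {1..<N} ==> e i > e (Suc i)"
proof -
	define A where "A = (\<Union>al\<in>keys P. keys al)"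
	define K where "K = Max (insert N A)"
	\<comment> \<open>Above every exponent, so that exponents become base-\<open>B\<close> digits, and
	  at least 2, so that the weights \<open>B ^ (K - i)\<close> decrease strictly.\<close>
	define B where "B = Suc (Suc (Max (\<Union>al\<in>keys P. lookup al ` {..K})))"
	define e where "e i = B ^ (K - i)" for i
	have finA: "finite A" by (simp add: A_def)
	have K: "keys al \<subseteq> {..K}" if "al \<in> keys P" for al
	proof
		fix x assume "x \<in> keys al"
		then have "x \<in> insert N A" using that by (auto simp: A_def)
		then have "x \<le> K" unfolding K_def using finA by (intro Max_ge) auto
		then show "x \<in> {..K}" by simp
	qed
	have "N \<le> K" using finA by (simp add: K_def)
	have B: "lookup al i < B" if "al \<in> keys P" "i \<le> K" for al i
	proof -
		have "lookup al i \<in> (\<Union>al\<in>keys P. lookup al ` {..K})"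
			using that by auto
		then have "lookup al i \<le> Max (\<Union>al\<in>keys P. lookup al ` {..K})"
			by (intro Max_ge) auto
		then show ?thesis by (simp add: B_def)
	qed
	have w: "wt e al = (\<Sum>i\<le>K. B ^ (K - i) * lookup al i)" if "al \<in> keys P" for al
		using K[OF that] by (simp add: wt_superset[of "{..K}"] e_def)
	have inj: "al = bt" if "al \<in> keys P" "bt \<in> keys P" "wt e al = wt e bt" for al bt
	proof (rule poly_mapping_eqI)
		fix i
		show "lookup al i = lookup bt i"
		proof (cases "i \<le> K")
			case True
			then show ?thesis
				using that B by (intro digits_inj[of K "lookup al" B]) (auto simp: w)
		next
			case False
			then have "i \<notin> keys al" "i \<notin> keys bt" using K that by auto
			then show ?thesis by (simp add: in_keys_iff)
		qed
	qed
	define p where "p = (\<Sum>al\<in>keys P. monom (lookup P al) (wt e al))"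
	have "monv (%i. z ^ e i) al = z ^ wt e al" for z :: 'a and al
		by (simp add: monv_def wt_def power_sum power_mult)
	then have 2: "poly p z = ev (%i. z ^ e i) P" for z
		by (simp add: p_def poly_sum poly_monom pev_def)
	obtain al where al: "al \<in> keys P" using assms keys_eq_empty by (metis ex_in_conv)
	have "coeff p (wt e al) = (\<Sum>bt\<in>keys P. if bt = al then lookup P al else 0)"
		unfolding p_def coeff_sum by (intro sum.cong) (use inj al in auto)
	then have "coeff p (wt e al) \<noteq> 0" using al by (simp add: in_keys_iff)
	then have 1: "p \<noteq> 0" by auto
	have 3: "e (Suc i) < e i" if "i \<in> {1..<N}" for i
		using that \<open>N \<le> K\<close> by (auto simp: e_def B_def)
	show ?thesis using that[OF 1 2 3] .
qed

lemma ev_eq_0_imp: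
	fixes P :: "'a::{idom,ring_char_0} mpol"
	assumes "\<And>w. ev w P = 0"
	shows "P = 0"
proof (rule ccontr)
	assume "P \<noteq> 0"
	then obtain e p where p: "p \<noteq> 0" "\<And>z. poly p z = ev (%i. z ^ e i) P"
		using kronecker_substitution[of P] by metis
	then have "{z. poly p z = 0} = UNIV" using assms by auto
	then show False using poly_roots_finite[OF p(1)] infinite_UNIV_char_0[where 'a='a] by simp
qed

section \<open>The Vandermonde product\<close>

definition pairs :: "nat => (nat \<times> nat) set"
	where "pairs N = {(i, j). 1 \<le> i \<and> i < j \<and> j \<le> N}"

definition vdm :: "nat => (nat => 'a::comm_ring_1) => 'a"
	where "vdm N u = (\<Prod>(i, j)\<in>pairs N. u i - u j)"

lemma finite_pairs [simp]: "finite (pairs N)"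
	by (rule finite_subset[of _ "{1..N} \<times> {1..N}"]) (auto simp: pairs_def)

lemma rhom_vdm: "rhom h ==> h (vdm N u) = vdm N (%i. h (u i))"
	by (simp add: vdm_def rhom_prod rhom_simps split_def)

lemma transpose_inversions:
	fixes a b :: nat
	assumes "a < b"
	shows "{(i, j). i < j \<and> Transposition.transpose a b j < Transposition.transpose a b i}
		= insert (a, b) ((%c. (a, c)) ` {a<..<b} \<union> (%c. (c, b)) ` {a<..<b})"
	using assms by (auto simp: Transposition.transpose_def image_iff split: if_splits)

text \<open>Sorting each transposed pair again permutes \<open>pairs N\<close>, at the price of one
  sign per inverted pair; by \<open>transpose_inversions\<close> there are 2 (b - a - 1) + 1 of
  these. A general antisymmetric \<open>g\<close> serves both the Vandermonde product and the
  products of \<open>dfac\<close>.\<close>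

lemma prod_pairs_transpose:
	fixes g :: "nat => nat => 'a::comm_ring_1"
	assumes "a \<in> {1..N}" "b \<in> {1..N}" "a < b"
		and anti: "\<And>i j. i \<noteq> j ==> g j i = - g i j"
	shows "(\<Prod>(i, j)\<in>pairs N. g (Transposition.transpose a b i) (Transposition.transpose a b j)) =
		- (\<Prod>(i, j)\<in>pairs N. g i j)"
proof -
	let ?t = "Transposition.transpose a b"
	define ph where "ph = (%(i, j). (min (?t i) (?t j), max (?t i) (?t j)))"
	define s where "s = (%(i, j). if ?t j < ?t i then - 1 else (1::'a))"
	let ?I = "{(i, j). i < j \<and> ?t j < ?t i}"
	have inv: "?t (?t x) = x" for x by simp
	have rng: "?t x \<in> {1..N}" if "x \<in> {1..N}" for x
		using that assms by (auto simp: Transposition.transpose_def)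
	have ne: "?t i \<noteq> ?t j" if "i \<noteq> j" for i j using that by (metis inv)
	have ph: "ph p \<in> pairs N" "ph (ph p) = p" if "p \<in> pairs N" for p
	proof -
		obtain i j where p: "p = (i, j)" by force
		have *: "?t i \<in> {1..N}" "?t j \<in> {1..N}" "?t i \<noteq> ?t j"
			using that rng[of i] rng[of j] ne[of i j] by (auto simp: p pairs_def)
		then show "ph p \<in> pairs N" by (auto simp: ph_def pairs_def p)
		show "ph (ph p) = p"
			using that * by (auto simp: ph_def pairs_def p min_def max_def)
	qed
	have bij: "bij_betw ph (pairs N) (pairs N)"
		by (rule bij_betw_byWitness[of _ ph]) (use ph in auto)
	have "(case p of (i, j) => g (?t i) (?t j)) = s p * (case ph p of (i, j) => g i j)"
		if p: "p \<in> pairs N" for p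
	proof -
		obtain i j where ij: "p = (i, j)" by force
		then have "?t i \<noteq> ?t j" using p ne[of i j] by (auto simp: pairs_def)
		then show ?thesis using anti[of "?t j" "?t i"] by (auto simp: ij s_def ph_def min_def max_def)
	qed
	then have "(\<Prod>(i, j)\<in>pairs N. g (?t i) (?t j)) = (\<Prod>p\<in>pairs N. s p) * (\<Prod>p\<in>pairs N. case ph p of (i, j) => g i j)"
		by (simp add: prod.distrib[symmetric] cong: prod.cong)
	also have "(\<Prod>p\<in>pairs N. case ph p of (i, j) => g i j) = (\<Prod>(i, j)\<in>pairs N. g i j)"
		by (rule prod.reindex_bij_betw[OF bij])
	also have "(\<Prod>p\<in>pairs N. s p) = - 1"
	proof -
		have sub: "?I \<subseteq> pairs N"
			unfolding transpose_inversions[OF assms(3)] using assms by (auto simp: pairs_def)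
		have "(\<Prod>p\<in>pairs N. s p) = (\<Prod>p\<in>?I. - 1)"
			by (rule prod.mono_neutral_cong_right[OF finite_pairs sub]) (auto simp: s_def pairs_def split: if_splits)
		also have "card ?I = Suc (card {a<..<b} + card {a<..<b})"
			unfolding transpose_inversions[OF assms(3)]
			by (subst card_insert_disjoint, simp, force, subst card_Un_disjoint)
				(auto simp: card_image inj_on_def)
		then have "(\<Prod>p\<in>?I. - 1) = (- 1 :: 'a)" by (simp only: prod_constant) simp
		finally show ?thesis .
	qed
	finally show ?thesis by simp
qed

lemma vdm_transpose:
	assumes "a \<in> {1..N}" "b \<in> {1..N}" "a < b"
	shows "vdm N (%i. u (Transposition.transpose a b i)) = - vdm N u"
	unfolding vdm_def by (rule prod_pairs_transpose[OF assms]) simp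

lemma vdm_eq_0_iff:
	fixes u :: "nat => 'a::idom"
	shows "vdm N u = 0 \<longleftrightarrow> \<not> inj_on u {1..N}"
proof
	assume "vdm N u = 0"
	then obtain i j where "(i, j) \<in> pairs N" "u i = u j" by (auto simp: vdm_def)
	then have "i \<in> {1..N}" "j \<in> {1..N}" "i \<noteq> j" by (auto simp: pairs_def)
	then show "\<not> inj_on u {1..N}" using \<open>u i = u j\<close> by (meson inj_onD)
next
	assume "\<not> inj_on u {1..N}"
	then obtain i j where "i \<in> {1..N}" "j \<in> {1..N}" "u i = u j" "i \<noteq> j" by (auto simp: inj_on_def)
	then have "(min i j, max i j) \<in> pairs N" "u (min i j) - u (max i j) = 0"
		by (auto simp: pairs_def min_def max_def)
	then show "vdm N u = 0" unfolding vdm_def by (intro prod_zero bexI[of _ "(min i j, max i j)"]) auto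
qed

lemma var_eq_iff [simp]: "var i = (var j :: 'a::comm_ring_1 mpol) \<longleftrightarrow> i = j"
proof
	assume "var i = (var j :: 'a mpol)"
	then have "lookup (var i :: 'a mpol) (single i 1) =
		lookup (var j :: 'a mpol) (single i 1)" by simp
	then have *: "single i (1::nat) = single j 1"
		by (auto simp: var_def lookup_single when_def split: if_splits)
	show "i = j" using arg_cong[OF *, of "%al. lookup al i"]
		by (auto simp: lookup_single when_def split: if_splits)
qed simp

lemma vdm_var_nonzero: "vdm N (var :: nat => 'a::idom mpol) \<noteq> 0"
	by (simp add: vdm_eq_0_iff inj_on_def)

text \<open>The factor theorem for the root x_i = x_j: the polynomials with this property contain
  constants and variables and are closed under sums and products.\<close>

lemma dvd_minus_subst:
	fixes P :: "'a::comm_ring_1 mpol"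
	shows "var i - var j dvd P - subst (var(i := var j)) P"
proof -
	let ?s = "subst (var(i := var j)) :: 'a mpol => _"
	let ?D = "%P. var i - var j dvd P - ?s P"
	note s = rhom_simps[OF rhom_subst]
	have add: "?D (P + R)" if "?D P" "?D R" for P R
		using dvd_add[OF that] by (simp add: s algebra_simps)
	have mult: "?D (P * R)" if "?D P" "?D R" for P R
	proof -
		have "P * R - ?s (P * R) = (P - ?s P) * R + ?s P * (R - ?s R)"
			by (simp add: s algebra_simps)
		then show ?thesis using that by (metis dvd_add dvd_mult dvd_mult2)
	qed
	have zero: "?D 0" by (simp add: s)
	have const: "?D (single 0 c)" for c
		by (simp add: subst_def pev_single rhom_single0)
	have v: "?D (var m)" for m by (simp add: subst_def pev_var rhom_single0)
	have one: "?D 1" by (simp add: s)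
	have pow: "?D (var m ^ d)" for m d
		by (induction d) (simp_all only: power_0 power_Suc one mult v)
	have prod: "?D (prod f A)" if "\<And>x. ?D (f x)" for f :: "nat => _" and A
		by (induction A rule: infinite_finite_induct)
			(simp_all only: prod.infinite prod.empty prod.insert one mult that not_False_eq_True)
	have "?D (single al c)" for al c
	proof -
		have "single al c = single 0 c * monv var al"
			by (simp add: monv_var mult_single)
		then show ?thesis unfolding monv_def by (auto intro!: mult const prod pow)
	qed
	then have "?D (\<Sum>al\<in>A. single al (f al))" for f A
		by (induction A rule: infinite_finite_induct)
			(simp_all only: sum.infinite sum.empty sum.insert zero add not_False_eq_True)
	then show ?thesis by (subst (1 2) poly_mapping_sum_single)
qed

text \<open>Identifying x_a with x_b absorbs the transposition, so \<open>R\<close> equals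
  \<open>- R\<close> there and vanishes in characteristic 0. Linear factors are split off one by
  one: those already removed stay nonzero under the next identification, so the zero passes to the
  cofactor.\<close>

lemma vdm_dvd_antisymmetric:
	fixes R :: "'a::{idom,ring_char_0} mpol"
	assumes "\<And>a b. a \<in> {1..N} ==> b \<in> {1..N} ==> a < b ==> subst (%i. var (Transposition.transpose a b i)) R = - R"
	shows "vdm N var dvd R"
proof -
	let ?\<sigma> = "%a b. subst (var(a := var b)) :: 'a mpol => _"
	have vanish: "?\<sigma> a b R = 0" if "(a, b) \<in> pairs N" for a b
	proof -
		have "?\<sigma> a b (subst (%i. var (Transposition.transpose a b i)) R) = ?\<sigma> a b R"
			unfolding subst_def
			by (subst rhom_pev_comp[OF rhom_pev[OF rhom_single0] rhom_single0])
				(simp add: pev_single rhom_single0 pev_var, rule pev_cong,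
					auto simp: Transposition.transpose_def)
		then have "?\<sigma> a b R = - ?\<sigma> a b R"
			using assms[of a b] that by (simp add: pairs_def rhom_simps[OF rhom_subst])
		then have "of_nat 2 * ?\<sigma> a b R = 0" by (simp add: eq_neg_iff_add_eq_0)
		then show ?thesis by (simp only: mult_eq_0_iff of_nat_eq_0_iff) simp
	qed
	have "(\<Prod>(i, j)\<in>S. var i - var j) dvd R" if "S \<subseteq> pairs N" for S
		using finite_subset[OF that finite_pairs] that
	proof (induction S rule: finite_induct)
		case (insert p S)
		obtain a b where p: "p = (a, b)" by force
		obtain Q where Q: "R = (\<Prod>(i, j)\<in>S. var i - var j) * Q" using insert by auto
		have ab: "(a, b) \<in> pairs N" "S \<subseteq> pairs N" "(a, b) \<notin> S" using insert.prems insert.hyps by (auto simp: p)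
		have "?\<sigma> a b (\<Prod>(i, j)\<in>S. var i - var j) = (\<Prod>(i, j)\<in>S. ?\<sigma> a b (var i) - ?\<sigma> a b (var j))"
			by (simp add: rhom_prod[OF rhom_subst] rhom_simps[OF rhom_subst] split_def)
		moreover have "(\<Prod>(i, j)\<in>S. ?\<sigma> a b (var i) - ?\<sigma> a b (var j)) \<noteq> 0"
		proof (subst prod_zero_iff[OF insert.hyps(1)], safe)
			fix i j assume "(i, j) \<in> S" "?\<sigma> a b (var i) - ?\<sigma> a b (var j) = 0"
			then show False using ab by (auto simp: pairs_def split: if_splits)
		qed
		ultimately have "?\<sigma> a b Q = 0"
			using vanish[OF ab(1)] by (simp add: Q rhom_simps[OF rhom_subst])
		then have "var a - var b dvd Q" using dvd_minus_subst[of a b Q] by simp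
		then show ?case using insert.hyps by (simp add: p Q mult.commute mult_dvd_mono)
	qed simp
	from this[of "pairs N"] show ?thesis by (simp add: vdm_def)
qed

section \<open>Symmetric polynomials\<close>

definition mon :: "nat list => (nat \<Rightarrow>\<^sub>0 nat)"
	where "mon al = (\<Sum>i<length al. single (Suc i) (al ! i))"

lemma lookup_mon: "lookup (mon al) i = (if i \<in> {1..length al} then al ! (i - 1) else 0)"
proof -
	have "lookup (mon al) i = (\<Sum>m<length al. if m = i - 1 \<and> 1 \<le> i then al ! (i - 1) else 0)"
		unfolding mon_def lookup_sum by (intro sum.cong) (auto simp: lookup_single when_def)
	then show ?thesis by (cases "1 \<le> i") (auto simp: sum.delta')
qed

lemma keys_mon: "keys (mon al) \<subseteq> {1..length al}"
	by (auto simp: in_keys_iff lookup_mon split: if_splits)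

lemma mon_inject: "length al = length bt ==> mon al = mon bt \<longleftrightarrow> al = bt"
proof
	assume l: "length al = length bt" and m: "mon al = mon bt"
	show "al = bt"
	proof (rule nth_equalityI[OF l])
		fix i assume "i < length al"
		then show "al ! i = bt ! i"
			using arg_cong[OF m, of "%m. lookup m (Suc i)"] l by (simp add: lookup_mon)
	qed
qed simp

lemma exponent_mon:
	"keys ga \<subseteq> {1..N} ==> ga = mon (map (lookup ga) [1..<Suc N])"
	by (rule poly_mapping_eqI) (auto simp: lookup_mon in_keys_iff simp del: upt_Suc)

definition symp :: "nat => 'a::comm_ring_1 mpol => bool"
	where "symp N P \<longleftrightarrow> (\<forall>\<pi>. \<pi> permutes {1..N} \<longrightarrow> subst (%i. var (\<pi> i)) P = P)"

lemma subst_subst: "subst u (subst v P) = subst (%i. subst u (v i)) P"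
	unfolding subst_def
	by (subst rhom_pev_comp[OF rhom_pev[OF rhom_single0] rhom_single0]) (simp add: pev_single rhom_single0)

lemma subst_ident: "subst var P = P"
	by (simp add: subst_def pev_single_var)

lemma symp_if_transpositions:
	assumes "\<And>a b. a \<in> {1..N} ==> b \<in> {1..N} ==> a < b ==>
		subst (%i. var (Transposition.transpose a b i)) P = P"
	shows "symp N P"
	unfolding symp_def
proof (intro allI impI)
	fix \<pi> :: "nat => nat" assume \<pi>: "\<pi> permutes {1..N}"
	have *: "subst (%i. var (Transposition.transpose a b i)) P = P" if "a \<in> {1..N}" "b \<in> {1..N}" "a \<noteq> b" for a b
		using that assms[of a b] assms[of b a] by (metis linorder_neqE_nat transpose_commute)
	show "subst (%i. var (\<pi> i)) P = P"
	proof (rule permutes_induct[OF \<pi> finite_atLeastAtMost, where P = "%\<pi>. subst (%i. var (\<pi> i)) P = P"])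
		fix a b p assume h: "a \<in> {1..N}" "b \<in> {1..N}" "a \<noteq> b" "subst (%i. var (p i)) P = P"
		have "subst (%i. var ((Transposition.transpose a b \<circ> p) i)) P
				= subst (%i. var (Transposition.transpose a b i)) (subst (%i. var (p i)) P)"
			by (simp add: subst_subst)
		then show "subst (%i. var ((Transposition.transpose a b \<circ> p) i)) P = P"
			using h * by simp
	qed (simp add: subst_ident)
qed

lemma lookup_subst_bij:
	assumes "bij \<pi>"
	shows "lookup (subst (%i. var (\<pi> i)) P) bt = lookup P (Poly_Mapping.map_key \<pi> bt)"
proof -
	have inj: "inj \<pi>" using assms bij_is_inj by auto
	define pm where "pm al = Poly_Mapping.map_key (inv \<pi>) al" for al :: "nat \<Rightarrow>\<^sub>0 nat"
	have inji: "inj (inv \<pi>)" using assms bij_imp_bij_inv bij_is_inj by blast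
	have mk: "Poly_Mapping.map_key \<pi> bt = al \<longleftrightarrow> pm al = bt" for al bt
	proof -
		have "Poly_Mapping.map_key \<pi> bt = al \<longleftrightarrow> (\<forall>i. lookup bt (\<pi> i) = lookup al i)"
			by (simp add: poly_mapping_eq_iff fun_eq_iff map_key.rep_eq[OF inj])
		also have "\<dots> \<longleftrightarrow> (\<forall>i. lookup al (inv \<pi> i) = lookup bt i)"
			using inj bij_is_surj[OF assms] by (metis inv_f_f surj_f_inv_f)
		also have "\<dots> \<longleftrightarrow> pm al = bt"
			by (simp add: pm_def poly_mapping_eq_iff fun_eq_iff map_key.rep_eq[OF inji])
		finally show ?thesis .
	qed
	have pm: "monv (%i. var (\<pi> i)) al = single (pm al) (1::'a)" for al
	proof -
		have "keys (pm al) = \<pi> ` keys al"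
			unfolding pm_def using assms
			by (simp add: keys_map_key[OF inji] bij_vimage_eq_inv_image bij_imp_bij_inv inv_inv_eq)
		then have "monv var (pm al) = (\<Prod>i\<in>\<pi> ` keys al. var i ^ lookup (pm al) i :: 'a mpol)"
			by (simp add: monv_def)
		also have "\<dots> = (\<Prod>i\<in>keys al. var (\<pi> i) ^ lookup al i)"
			by (subst prod.reindex) (use inj in "auto simp: inj_on_def pm_def map_key.rep_eq[OF inji] inv_f_f[OF inj]")
		finally show ?thesis by (simp only: monv_var) (simp only: monv_def)
	qed
	have "lookup (subst (%i. var (\<pi> i)) P) bt =
			(\<Sum>al\<in>keys P. if al = Poly_Mapping.map_key \<pi> bt then lookup P (Poly_Mapping.map_key \<pi> bt) else 0)"
		unfolding subst_def pev_def lookup_sum pm mult_single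
	proof (intro sum.cong refl)
		fix al
		show "lookup (single (0 + pm al) (lookup P al * 1)) bt =
			(if al = Poly_Mapping.map_key \<pi> bt then lookup P (Poly_Mapping.map_key \<pi> bt) else 0)"
			using mk[of bt al] by (auto simp: lookup_single when_def)
	qed
	then show ?thesis by (simp add: sum.delta' in_keys_iff)
qed

lemma symp_iff_lookup:
	"symp N P \<longleftrightarrow> (\<forall>\<pi> bt. \<pi> permutes {1..N} \<longrightarrow>
		lookup P (Poly_Mapping.map_key \<pi> bt) = lookup P bt)"
	unfolding symp_def poly_mapping_eq_iff fun_eq_iff
	by (simp add: lookup_subst_bij permutes_bij)

lemma map_key_mon:
	assumes "\<pi> permutes {1..length al}"
	shows "Poly_Mapping.map_key \<pi> (mon al) = mon (map (%i. al ! (\<pi> i - 1)) [1..<Suc (length al)])"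
proof (rule poly_mapping_eqI)
	fix i
	show "lookup (Poly_Mapping.map_key \<pi> (mon al)) i =
		lookup (mon (map (%i. al ! (\<pi> i - 1)) [1..<Suc (length al)])) i"
		using permutes_in_image[OF assms, of i]
		by (auto simp: map_key.rep_eq[OF permutes_inj[OF assms]] lookup_mon simp del: upt_Suc)
qed

lemma symp_lookup:
	assumes "symp N P" "mset al = mset bt" "length bt = N"
	shows "lookup P (mon al) = lookup P (mon bt)"
proof -
	obtain p where p: "p permutes {..<length bt}" "permute_list p bt = al"
		using mset_eq_permutation[OF assms(2)] by blast
	define \<pi> where "\<pi> i = (if i \<in> {1..N} then Suc (p (i - 1)) else i)" for i
	have *: "p i < N" if "i < N" for i using permutes_in_image[OF p(1), of i] that assms(3) by simp
	have "\<pi> permutes {1..N}"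
	proof (rule bij_imp_permutes)
		have "inj_on \<pi> {1..N}"
		proof (rule inj_onI)
			fix x y assume h: "x \<in> {1..N}" "y \<in> {1..N}" "\<pi> x = \<pi> y"
			then have "x - 1 = y - 1" using injD[OF permutes_inj[OF p(1)]] by (auto simp: \<pi>_def)
			then show "x = y" using h by auto
		qed
		moreover have "\<pi> ` {1..N} \<subseteq> {1..N}"
		proof (rule image_subsetI)
			fix i assume i: "i \<in> {1..N}"
			then have "i - 1 < N" by auto
			then show "\<pi> i \<in> {1..N}" using i *[of "i - 1"] by (simp add: \<pi>_def)
		qed
		ultimately show "bij_betw \<pi> {1..N} {1..N}"
			by (simp add: bij_betw_def endo_inj_surj)
	qed (auto simp: \<pi>_def)
	then have \<pi>: "\<pi> permutes {1..length bt}" using assms(3) by simp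
	have m: "map (%i. bt ! (\<pi> i - 1)) [1..<Suc (length bt)] = al"
		using assms(3) by (simp add: p(2)[symmetric] permute_list_def list_eq_iff_nth_eq \<pi>_def del: upt_Suc)
	have "lookup P (mon al) = lookup P (Poly_Mapping.map_key \<pi> (mon bt))"
		unfolding map_key_mon[OF \<pi>] m ..
	also have "\<dots> = lookup P (mon bt)"
		using assms(1) \<pi> assms(3) unfolding symp_iff_lookup by blast
	finally show ?thesis .
qed

lemma lookup_monomial_sym:
	"lookup (monomial_sym mu :: 'a::comm_ring_1 mpol) bt =
		(if \<exists>al. mset al = mset mu \<and> bt = mon al then 1 else 0)"
proof -
	have fin: "finite {al. mset al = mset mu}" by (rule mset_eq_finite)
	have m: "(\<Prod>i<length al. var (Suc i) ^ (al ! i)) = single (mon al) (1::'a)" for al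
	proof -
		have "monv var (mon al) = (\<Prod>i\<in>{1..length al}. var i ^ lookup (mon al) i :: 'a mpol)"
			by (rule monv_superset[OF _ keys_mon]) simp
		also have "\<dots> = (\<Prod>i<length al. var (Suc i) ^ (al ! i))"
			by (rule prod.reindex_bij_witness[of _ Suc "%i. i - 1"]) (auto simp: lookup_mon)
		finally show ?thesis by (simp add: monv_var)
	qed
	have u: "al = al'" if "mset al = mset mu" "mset al' = mset mu" "mon al = mon al'" for al al'
		using that mon_inject[of al al'] by (metis mset_eq_length)
	show ?thesis
	proof (cases "\<exists>al. mset al = mset mu \<and> bt = mon al")
		case True
		then obtain al where al: "mset al = mset mu" "bt = mon al" by blast
		have "lookup (monomial_sym mu :: 'a mpol) bt = (\<Sum>al'\<in>{al. mset al = mset mu}. if al' = al then 1 else 0)"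
			unfolding monomial_sym_def lookup_sum m
			by (intro sum.cong refl) (use u al in "auto simp: lookup_single when_def")
		then show ?thesis using True al fin by (simp add: sum.delta')
	next
		case False
		then show ?thesis
			by (auto simp: monomial_sym_def lookup_sum m lookup_single when_def intro!: sum.neutral)
	qed
qed

lemma symp_monomial_sym: "length mu = N ==> symp N (monomial_sym mu :: 'a::comm_ring_1 mpol)"
	unfolding symp_iff_lookup
proof (intro allI impI)
	fix \<pi> and bt :: "nat \<Rightarrow>\<^sub>0 nat" assume N: "length mu = N" and \<pi>: "\<pi> permutes {1..N}"
	have perm: "mset (map (%i. al ! (\<rho> i - 1)) [1..<Suc N]) = mset al"
		if "\<rho> permutes {1..N}" "length al = N" for \<rho> and al :: "nat list"
	proof -
		have "mset (map (%i. al ! (\<rho> i - 1)) [1..<Suc N]) =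
				image_mset (%i. al ! (i - 1)) (image_mset \<rho> (mset_set {1..N}))"
			by (simp add: atLeastLessThanSuc_atLeastAtMost multiset.map_comp o_def del: upt_Suc)
		also have "image_mset \<rho> (mset_set {1..N}) = mset_set {1..N}"
			using that(1) by (simp add: image_mset_mset_set permutes_inj_on permutes_image)
		also have "image_mset (%i. al ! (i - 1)) (mset_set {1..N}) = mset (map (%i. al ! (i - 1)) [1..<Suc N])"
			by (simp add: atLeastLessThanSuc_atLeastAtMost del: upt_Suc)
		also have "map (%i. al ! (i - 1)) [1..<Suc N] = al"
			using that(2) by (simp add: list_eq_iff_nth_eq del: upt_Suc)
		finally show ?thesis .
	qed
	have 1: "\<exists>al. mset al = mset mu \<and> Poly_Mapping.map_key \<rho> bt = mon al"
		if "\<rho> permutes {1..N}" "mset al = mset mu" "bt = mon al" for \<rho> al and bt :: "nat \<Rightarrow>\<^sub>0 nat"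
	proof -
		have "length al = N" using N that(2) by (metis mset_eq_length)
		then show ?thesis
			using perm[OF that(1), of al] map_key_mon[of \<rho> al] that by metis
	qed
	have inv: "bt = Poly_Mapping.map_key (inv \<pi>) (Poly_Mapping.map_key \<pi> bt)"
		using \<pi> permutes_inv[OF \<pi>]
		by (subst map_key_compose) (auto simp: permutes_inj permutes_inv_o map_key_id id_def)
	have "(\<exists>al. mset al = mset mu \<and> Poly_Mapping.map_key \<pi> bt = mon al) \<longleftrightarrow> (\<exists>al. mset al = mset mu \<and> bt = mon al)"
	proof
		assume "\<exists>al. mset al = mset mu \<and> Poly_Mapping.map_key \<pi> bt = mon al"
		then show "\<exists>al. mset al = mset mu \<and> bt = mon al"
			using 1[OF permutes_inv[OF \<pi>]] inv[symmetric] by auto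
	qed (use 1[OF \<pi>] in auto)
	then show "lookup (monomial_sym mu :: 'a mpol) (Poly_Mapping.map_key \<pi> bt) = lookup (monomial_sym mu) bt"
		by (simp add: lookup_monomial_sym)
qed

lemma symp_simps:
	"symp N P ==> symp N R ==> symp N (P + R)"
	"symp N P ==> symp N R ==> symp N (P - R)"
	"symp N P ==> symp N (scl c P)"
	"symp N 0"
	by (simp_all add: symp_def rhom_simps[OF rhom_subst] subst_scl)

section \<open>Dominance\<close>

definition sortd :: "nat list => nat list" where "sortd al = rev (sort al)"

lemma sortd_simps [simp]: "mset (sortd al) = mset al" "length (sortd al) = length al"
	by (simp_all add: sortd_def)

lemma is_partition_sortd: "length al = N ==> is_partition N (sortd al)"
	by (simp add: is_partition_def sortd_def sorted_wrt_rev)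

lemma sortd_partition: "is_partition N mu ==> sortd mu = mu"
proof -
	assume "is_partition N mu"
	then have "sorted (rev mu)" by (simp add: is_partition_def sorted_wrt_rev)
	then show ?thesis unfolding sortd_def
		by (metis mset_rev properties_for_sort rev_rev_ident)
qed

lemma sortd_eq_iff: "is_partition N mu ==> sortd al = mu \<longleftrightarrow> mset al = mset mu"
	by (metis sortd_partition sortd_simps(1) sortd_def properties_for_sort sorted_list_of_multiset_mset)

text \<open>If the head \<open>y\<close> is not in \<open>A\<close>, induction bounds
  \<open>A\<close> by a prefix of the tail; moving that prefix one place to the left trades its last
  entry for \<open>y\<close>, which is at least as large.\<close>

lemma sum_mset_le_take:
	fixes ys :: "nat list"
	assumes "sorted_wrt (\<ge>) ys" "A \<subseteq># mset ys"
	shows "sum_mset A \<le> sum_list (take (size A) ys)"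
	using assms
proof (induction ys arbitrary: A)
	case (Cons y ys)
	show ?case
	proof (cases "y \<in># A")
		case True
		then obtain B where B: "A = add_mset y B" by (metis insert_DiffM)
		then have "sum_mset B \<le> sum_list (take (size B) ys)"
			using Cons.prems by (intro Cons.IH) auto
		then show ?thesis by (simp add: B)
	next
		case False
		then have A: "A \<subseteq># mset ys"
			using Cons.prems(2) by (metis diff_single_trivial mset.simps(2) subset_eq_diff_conv add_mset_add_single)
		then have 1: "sum_mset A \<le> sum_list (take (size A) ys)"
			using Cons.prems by (intro Cons.IH) auto
		show ?thesis
		proof (cases "size A")
			case (Suc m)
			have m: "m < length ys" using size_mset_mono[OF A] Suc by simp
			then have "sum_list (take (Suc m) ys) = sum_list (take m ys) + ys ! m"
				by (simp add: take_Suc_conv_app_nth)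
			also have "ys ! m \<le> y" using Cons.prems(1) m by auto
			finally show ?thesis using 1 Suc by simp
		qed (use 1 in auto)
	qed
qed simp

lemma sum_take_le_sorted:
	fixes xs :: "nat list"
	assumes "mset xs = mset ys" "sorted_wrt (\<ge>) ys"
	shows "sum_list (take j xs) \<le> sum_list (take j ys)"
proof -
	have l: "length xs = length ys" using assms(1) mset_eq_length by blast
	have "mset (take j xs) \<subseteq># mset xs" by (metis append_take_drop_id mset_append mset_subset_eq_add_left)
	then have "sum_mset (mset (take j xs)) \<le> sum_list (take (size (mset (take j xs))) ys)"
		using assms by (intro sum_mset_le_take) auto
	then show ?thesis using l by (auto simp: sum_mset_sum_list min_def split: if_splits)
qed

lemma sum_take_le_sortd: "sum_list (take j al) \<le> sum_list (take j (sortd al))"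
	using is_partition_sortd[of al "length al"]
	by (intro sum_take_le_sorted) (auto simp: is_partition_def)

lemma dominated_refl: "dominated mu mu" by (simp add: dominated_def)

lemma dominated_trans: "dominated \<eta> mu ==> dominated mu nu ==> dominated \<eta> nu"
	unfolding dominated_def by (auto, meson le_trans)

lemma dominated_sortd_self: "dominated al (sortd al)"
proof -
	have "sum_list (sortd al) = sum_list al"
		by (simp only: sum_mset_sum_list[symmetric] sortd_simps)
	then show ?thesis by (simp add: dominated_def sum_take_le_sortd)
qed

text \<open>A strictly monotone numerical refinement of dominance. It is the weight of the exponent
  when the variables weigh N, N - 1, ..., 1 (\<open>wt_stair\<close>), so a single grading singles
  out the leading monomial.\<close>

definition psum :: "nat list => nat" where "psum al = (\<Sum>j\<in>{1..length al}. sum_list (take j al))"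

lemma dominated_psum:
	assumes "dominated al nu"
	shows "psum al \<le> psum nu" "psum al = psum nu ==> al = nu"
proof -
	have l: "length al = length nu" and le: "\<And>j. j \<le> length al ==> sum_list (take j al) \<le> sum_list (take j nu)"
		using assms by (auto simp: dominated_def)
	show "psum al \<le> psum nu" unfolding psum_def l using le l by (intro sum_mono) auto
	assume eq: "psum al = psum nu"
	have t: "sum_list (take j al) = sum_list (take j nu)" if "j \<le> length nu" for j
	proof (cases "j = 0")
		case False
		show ?thesis
		proof (rule ccontr)
			assume "\<not> ?thesis"
			then have "psum al < psum nu" unfolding psum_def l
				using le that False l by (intro sum_strict_mono_ex1) (auto intro!: bexI[of _ j] simp: le_neq_implies_less)
			then show False using eq by simp
		qed
	qed simp
	show "al = nu"
	proof (rule nth_equalityI[OF l])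
		fix i assume i: "i < length al"
		then show "al ! i = nu ! i"
			using t[of i] t[of "Suc i"] l by (simp add: take_Suc_conv_app_nth)
	qed
qed

lemma dominated_antisym: "dominated al nu ==> dominated nu al ==> al = nu"
	using dominated_psum(1)[of nu al] dominated_psum[of al nu] by simp

definition pre :: "nat => nat => nat" where "pre j i = (if 1 \<le> i \<and> i \<le> j then 1 else 0)"

definition stair :: "nat => nat => nat" where "stair N i = (if 1 \<le> i then Suc N - i else 0)"

lemma wt_pre:
	assumes "j \<le> length al"
	shows "wt (pre j) (mon al) = sum_list (take j al)"
proof -
	have "wt (pre j) (mon al) = (\<Sum>i\<in>{1..length al}. pre j i * lookup (mon al) i)"
		by (rule wt_superset[OF _ keys_mon]) simp
	also have "\<dots> = (\<Sum>i\<in>{1..j}. al ! (i - 1))"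
		using assms by (intro sum.mono_neutral_cong_right) (auto simp: pre_def lookup_mon)
	also have "\<dots> = (\<Sum>i<j. al ! i)"
		by (rule sum.reindex_bij_witness[of _ Suc "%i. i - 1"]) auto
	also have "\<dots> = sum_list (take j al)"
		using assms by (simp add: sum_list_sum_nth atLeast0LessThan)
	finally show ?thesis .
qed

lemma wt_stair:
	assumes "length al = N"
	shows "wt (stair N) (mon al) = psum al"
proof -
	have s: "stair N i = (\<Sum>j\<in>{1..N}. pre j i)" for i
	proof -
		have "(\<Sum>j\<in>{1..N}. pre j i) = (\<Sum>j\<in>(if 1 \<le> i then {i..N} else {}). 1)"
			by (intro sum.mono_neutral_cong_right) (auto simp: pre_def split: if_splits)
		then show ?thesis by (simp add: stair_def)
	qed
	have "wt (stair N) (mon al) = (\<Sum>j\<in>{1..N}. wt (pre j) (mon al))"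
		unfolding wt_def s sum_distrib_right by (rule sum.swap)
	also have "\<dots> = psum al" unfolding psum_def assms using assms by (intro sum.cong) (auto simp: wt_pre)
	finally show ?thesis .
qed

section \<open>Spans of monomial symmetric polynomials\<close>

text \<open>The span of the monomial symmetric polynomials of \<open>D\<close>, described by
  supports: closure properties and degree estimates then speak about exponents alone, and
  \<open>mspan_expand\<close> recovers the linear combination.\<close>

definition mspan :: "nat => nat list set => 'a::comm_ring_1 mpol => bool"
	where "mspan N D P \<longleftrightarrow> symp N P \<and> (\<forall>ga\<in>keys P. \<exists>al. ga = mon al \<and> length al = N \<and> sortd al \<in> D)"

definition below :: "nat => nat list => nat list set"
	where "below N nu = {mu. is_partition N mu \<and> dominated mu nu}"

lemma mspan_mono: "mspan N D P ==> D \<subseteq> D' ==> mspan N D' P"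
	unfolding mspan_def by blast

lemma mspan_simps:
	"mspan N D P ==> mspan N D R ==> mspan N D (P + R)"
	"mspan N D P ==> mspan N D R ==> mspan N D (P - R)"
	"mspan N D P ==> mspan N D (scl c P)"
	"mspan N D 0"
proof -
	show "mspan N D P ==> mspan N D R ==> mspan N D (P + R)"
		using keys_add[of P R] by (auto simp: mspan_def symp_simps)
	show "mspan N D P ==> mspan N D R ==> mspan N D (P - R)"
		using keys_diff[of P R] by (auto simp: mspan_def symp_simps)
	show "mspan N D P ==> mspan N D (scl c P)"
		by (auto simp: mspan_def symp_simps in_keys_iff lookup_scl)
	show "mspan N D 0" by (simp add: mspan_def symp_simps)
qed

lemma mspan_sum: "(\<And>x. x \<in> A ==> mspan N D (f x)) ==> mspan N D (sum f A)"
	by (induction A rule: infinite_finite_induct) (auto intro: mspan_simps)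

lemma mspan_monomial_sym:
	assumes "is_partition N mu" "mu \<in> D"
	shows "mspan N D (monomial_sym mu)"
	unfolding mspan_def
proof (intro conjI ballI)
	show "symp N (monomial_sym mu)" using assms by (intro symp_monomial_sym) (simp add: is_partition_def)
	fix ga assume "ga \<in> keys (monomial_sym mu :: 'a mpol)"
	then obtain al where "mset al = mset mu" "ga = mon al"
		by (auto simp: in_keys_iff lookup_monomial_sym split: if_splits)
	moreover have "length al = N" using calculation assms by (metis is_partition_def mset_eq_length)
	ultimately show "\<exists>al. ga = mon al \<and> length al = N \<and> sortd al \<in> D"
		using assms by (metis sortd_eq_iff)
qed

lemma lookup_monomial_sym_partition:
	assumes "is_partition N mu" "is_partition N \<eta>"
	shows "lookup (monomial_sym mu :: 'a::comm_ring_1 mpol) (mon \<eta>) = (if \<eta> = mu then 1 else 0)"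
proof -
	have "\<eta> = mu" if "mset al = mset mu" "mon \<eta> = mon al" for al
		using that assms mon_inject[of \<eta> al] by (metis is_partition_def mset_eq_length sortd_eq_iff sortd_partition)
	then show ?thesis by (auto simp: lookup_monomial_sym)
qed

lemma mspan_expand:
	assumes "mspan N D P" "finite D" "\<And>mu. mu \<in> D ==> is_partition N mu"
	shows "P = (\<Sum>mu\<in>D. scl (lookup P (mon mu)) (monomial_sym mu))"
proof (rule poly_mapping_eqI)
	fix ga
	have *: "lookup P (mon mu) * lookup (monomial_sym mu) (mon al) =
			(if mu = sortd al then lookup P (mon al) else 0)"
		if "mu \<in> D" "length al = N" for mu al
	proof -
		have "(\<exists>bt. mset bt = mset mu \<and> mon al = mon bt) \<longleftrightarrow> mset al = mset mu"
			using assms(3)[OF that(1)] that(2) mon_inject[of al] by (metis is_partition_def mset_eq_length)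
		moreover have "mset al = mset mu ==> lookup P (mon mu) = lookup P (mon al)"
			using assms(1) that by (intro symp_lookup[of N]) (auto simp: mspan_def)
		ultimately show ?thesis using sortd_eq_iff[OF assms(3)[OF that(1)], of al]
			by (auto simp: lookup_monomial_sym)
	qed
	show "lookup P ga = lookup (\<Sum>mu\<in>D. scl (lookup P (mon mu)) (monomial_sym mu)) ga"
	proof (cases "\<exists>al. ga = mon al \<and> length al = N \<and> sortd al \<in> D")
		case True
		then obtain al where al: "ga = mon al" "length al = N" "sortd al \<in> D" by blast
		then show ?thesis
			using assms(2) by (simp add: lookup_sum lookup_scl * sum.delta cong: sum.cong)
	next
		case False
		then have "ga \<notin> keys P" using assms(1) by (auto simp: mspan_def)
		moreover have "lookup (monomial_sym mu :: 'a mpol) ga = 0" if "mu \<in> D" for mu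
			using False that assms(3)[OF that]
			by (auto simp: lookup_monomial_sym) (metis is_partition_def mset_eq_length sortd_eq_iff)
		ultimately show ?thesis by (simp add: in_keys_iff lookup_sum lookup_scl)
	qed
qed

lemma finite_below: "finite (below N nu)"
proof (rule finite_subset)
	show "below N nu \<subseteq> {mu. set mu \<subseteq> {..sum_list nu} \<and> length mu = N}"
		using member_le_sum_list by (fastforce simp: below_def is_partition_def dominated_def)
qed (simp add: finite_lists_length_eq)

text \<open>Sorting an exponent only moves it up in dominance, and symmetry carries every exponent
  of \<open>P\<close> to its sorted form; hence bounding all exponents amounts to bounding the
  sorted ones.\<close>

lemma mspan_below:
	assumes "length nu = N"
	shows "mspan N (below N nu) P \<longleftrightarrow> symp N P \<and> (\<forall>ga\<in>keys P. \<exists>al. ga = mon al \<and> dominated al nu)"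
proof (cases "symp N P")
	case True
	have l: "\<exists>al. ga = mon al \<and> dominated al nu" if "ga = mon al" "sortd al \<in> below N nu" for ga al
		using that dominated_trans[OF dominated_sortd_self[of al], of nu] unfolding below_def by blast
	have r: "length al = N \<and> sortd al \<in> below N nu"
		if h: "\<forall>ga\<in>keys P. \<exists>al. ga = mon al \<and> dominated al nu" "mon al \<in> keys P" "dominated al nu" for al
	proof -
		have len: "length al = N" using h(3) assms by (simp add: dominated_def)
		have "mon (sortd al) \<in> keys P"
			using h(2) symp_lookup[OF True, of "sortd al" al] len by (simp add: in_keys_iff)
		then obtain bt where "mon (sortd al) = mon bt" "dominated bt nu" using h(1) by blast
		then have "dominated (sortd al) nu"
			using mon_inject[of "sortd al" bt] assms len by (simp add: dominated_def)
		then show ?thesis using is_partition_sortd[OF len] len by (simp add: below_def)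
	qed
	show ?thesis
	proof
		assume "mspan N (below N nu) P"
		then show "symp N P \<and> (\<forall>ga\<in>keys P. \<exists>al. ga = mon al \<and> dominated al nu)"
			unfolding mspan_def using l by blast
	next
		assume h: "symp N P \<and> (\<forall>ga\<in>keys P. \<exists>al. ga = mon al \<and> dominated al nu)"
		show "mspan N (below N nu) P"
			unfolding mspan_def
		proof (intro conjI ballI)
			fix ga assume ga: "ga \<in> keys P"
			then obtain al where "ga = mon al" "dominated al nu" using h by blast
			then show "\<exists>al. ga = mon al \<and> length al = N \<and> sortd al \<in> below N nu"
				using r[of al] h ga by blast
		qed (rule True)
	qed
qed (simp add: mspan_def)

section \<open>Macdonald operators\<close>

definition shf :: "nat set => 'a::comm_ring_1 => nat => 'a"
	where "shf I c i = (if i \<in> I then c else 1)"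

definition scv :: "(nat => 'a::comm_ring_1) => nat => 'a mpol"
	where "scv c i = single 0 (c i) * var i"

text \<open>The Vandermonde product times \<open>\<Sum>\<^sub>r kp r t\<^bsup>-r(r-1)/2\<^esup> D\<^sub>r\<close>, for Macdonald's commuting operators \<open>D\<^sub>r\<close>.\<close>

definition Rop :: "(nat => 'a) => 'a => 'a => nat => 'a::comm_ring_1 mpol => 'a mpol"
	where "Rop kp q t N P = (\<Sum>I\<in>Pow {1..N}.
		scl (kp (card I)) (vdm N (scv (shf I t)) * subst (scv (shf I q)) P))"

text \<open>The quotient exists on symmetric polynomials, where \<open>Rop\<close> is antisymmetric,
  and is unique because the Vandermonde product is nonzero. The weights \<open>kp\<close> cover both
  Macdonald's own operator (\<open>kap1\<close>) and the generating series
  \<open>%r. c ^ r\<close>.\<close>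

definition Lop :: "(nat => 'a) => 'a => 'a => nat => 'a::comm_ring_1 mpol => 'a mpol"
	where "Lop kp q t N P = (SOME Q. vdm N var * Q = Rop kp q t N P)"

lemma scl_lin:
	fixes P R :: "'a::comm_ring_1 mpol"
	shows "scl c (P + R) = scl c P + scl c R" "scl c (P - R) = scl c P - scl c R"
		"scl c (P * R) = scl c P * R" "scl c (P * R) = P * scl c R" "scl c (scl d P) = scl (c * d) P"
		"scl c 0 = (0 :: 'a mpol)" "scl 0 P = 0" "scl 1 P = P" "scl (- c) P = - scl c P"
		"scl (c + d) P = scl c P + scl d P" "scl (c - d) P = scl c P - scl d P"
	by (simp_all add: scl_mult_single algebra_simps mult_single single_add single_diff single_uminus flip: mult.assoc)

lemma scl_sum: "scl c (sum f A) = (\<Sum>x\<in>A. scl c (f x :: 'a::comm_ring_1 mpol))"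
	by (simp add: scl_mult_single sum_distrib_left)

lemma Rop_lin:
	"Rop kp q t N (P + R) = Rop kp q t N P + Rop kp q t N R"
	"Rop kp q t N (P - R) = Rop kp q t N P - Rop kp q t N R"
	"Rop kp q t N (scl c P) = scl c (Rop kp q t N P)"
proof -
	show "Rop kp q t N (P + R) = Rop kp q t N P + Rop kp q t N R"
		by (simp add: Rop_def rhom_simps[OF rhom_subst] algebra_simps scl_lin sum.distrib)
	show "Rop kp q t N (P - R) = Rop kp q t N P - Rop kp q t N R"
		by (simp add: Rop_def rhom_simps[OF rhom_subst] algebra_simps scl_lin(1,2) sum_subtractf)
	have "scl a (V * scl c S) = scl c (scl a (V * S))" for a and V S :: "'a mpol"
		by (simp add: scl_mult_single mult_ac)
	then show "Rop kp q t N (scl c P) = scl c (Rop kp q t N P)"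
		by (simp add: Rop_def subst_scl scl_sum)
qed

lemma transpose_image_shf: "shf ((Transposition.transpose a b) ` I) c i = shf I c (Transposition.transpose a b i)"
proof -
	have "i \<in> Transposition.transpose a b ` I \<longleftrightarrow> Transposition.transpose a b i \<in> I"
		by (metis image_iff transpose_involutory)
	then show ?thesis by (simp add: shf_def)
qed

lemma subst_scv: "subst u (scv c i) = single 0 (c i) * u i"
	by (simp add: scv_def rhom_simps[OF rhom_subst]) (simp add: subst_def pev_single rhom_single0)

text \<open>The transposition carries the summand of \<open>I\<close> to that of its image, a set of
  the same size; only the shifted Vandermonde product changes its sign.\<close>

lemma Rop_antisymmetric:
	assumes P: "symp N P" and ab: "a \<in> {1..N}" "b \<in> {1..N}" "a < b"
	shows "subst (%i. var (Transposition.transpose a b i)) (Rop kp q t N P) = - Rop kp q t N P"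
proof -
	let ?t = "Transposition.transpose a b"
	let ?s = "subst (%i. var (?t i)) :: 'a mpol => 'a mpol"
	have perm: "?t permutes {1..N}" using ab by (intro permutes_swap_id) auto
	have 1: "?s (vdm N (scv (shf (?t ` I) t))) = - vdm N (scv (shf I t))" for I t
	proof -
		have "?s (scv (shf (?t ` I) t) i) = scv (shf I t) (?t i)" for i
			by (simp add: subst_scv transpose_image_shf) (simp add: scv_def)
		then show ?thesis
			by (simp add: rhom_vdm[OF rhom_subst]) (rule vdm_transpose[OF ab])
	qed
	have 2: "?s (subst (scv (shf (?t ` I) q)) P) = subst (scv (shf I q)) P" for I
	proof -
		have "?s (subst (scv (shf (?t ` I) q)) P) = subst (%i. scv (shf I q) (?t i)) P"
			by (simp add: subst_subst subst_scv transpose_image_shf) (simp add: scv_def)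
		also have "\<dots> = subst (scv (shf I q)) (?s P)" by (simp add: subst_subst)
		also have "?s P = P" using P perm by (simp add: symp_def)
		finally show ?thesis .
	qed
	have bij: "bij_betw (%I. ?t ` I) (Pow {1..N}) (Pow {1..N})"
	proof (rule bij_betw_byWitness[of _ "%I. ?t ` I"])
		have "?t ` I \<subseteq> {1..N}" if "I \<subseteq> {1..N}" for I
			using that permutes_image[OF perm] by blast
		then show "(`) ?t ` Pow {1..N} \<subseteq> Pow {1..N}" "(`) ?t ` Pow {1..N} \<subseteq> Pow {1..N}" by auto
	qed (auto simp: image_image)
	have c: "card (?t ` I) = card I" for I by (simp add: card_image)
	have "?s (Rop kp q t N P) = (\<Sum>I\<in>Pow {1..N}. scl (kp (card I))
			(?s (vdm N (scv (shf I t))) * ?s (subst (scv (shf I q)) P)))"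
		by (simp only: Rop_def rhom_sum[OF rhom_subst] rhom_simps[OF rhom_subst] subst_scl)
	also have "\<dots> = (\<Sum>I\<in>Pow {1..N}. scl (kp (card (?t ` I)))
			(?s (vdm N (scv (shf (?t ` I) t))) * ?s (subst (scv (shf (?t ` I) q)) P)))"
		by (rule sum.reindex_bij_betw[OF bij, symmetric])
	also have "\<dots> = - Rop kp q t N P"
		unfolding 1 2 c Rop_def sum_negf[symmetric]
		by (intro sum.cong refl) (simp add: scl_mult_single)
	finally show ?thesis .
qed

lemma Lop:
	fixes P :: "'a::{idom,ring_char_0} mpol"
	assumes "symp N P"
	shows "vdm N var * Lop kp q t N P = Rop kp q t N P"
proof -
	have "vdm N var dvd Rop kp q t N P"
		by (rule vdm_dvd_antisymmetric) (rule Rop_antisymmetric[OF assms])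
	then show ?thesis unfolding Lop_def by (intro someI_ex[of "%Q. vdm N var * Q = Rop kp q t N P"]) (auto elim: dvdE)
qed

lemma Lop_unique:
	fixes P :: "'a::idom mpol"
	assumes "vdm N var * Q = Rop kp q t N P"
	shows "Lop kp q t N P = Q"
proof -
	have "vdm N var * Lop kp q t N P = Rop kp q t N P"
		unfolding Lop_def by (rule someI[of "%Q. vdm N var * Q = Rop kp q t N P"]) (rule assms)
	then show ?thesis using assms vdm_var_nonzero[of N, where 'a='a] by (metis mult_cancel_left)
qed

lemma Lop_lin:
	fixes P R :: "'a::{idom,ring_char_0} mpol"
	assumes "symp N P"
	shows "symp N R ==> Lop kp q t N (P + R) = Lop kp q t N P + Lop kp q t N R"
		"symp N R ==> Lop kp q t N (P - R) = Lop kp q t N P - Lop kp q t N R"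
		"Lop kp q t N (scl c P) = scl c (Lop kp q t N P)"
	by (rule Lop_unique, simp add: ring_distribs Lop assms Rop_lin scl_lin(4)[symmetric])+

lemma symp_quotient:
	fixes Q :: "'a::idom mpol"
	assumes "\<And>a b. a \<in> {1..N} ==> b \<in> {1..N} ==> a < b ==>
		subst (%i. var (Transposition.transpose a b i)) (vdm N var * Q) = - (vdm N var * Q)"
	shows "symp N Q"
proof (rule symp_if_transpositions)
	fix a b assume ab: "a \<in> {1..N}" "b \<in> {1..N}" "a < b"
	let ?s = "subst (%i. var (Transposition.transpose a b i)) :: 'a mpol => 'a mpol"
	have "?s (vdm N var) = - vdm N var"
		by (simp add: rhom_vdm[OF rhom_subst] vdm_transpose[OF ab, of var])
	then have "- vdm N var * ?s Q = - (vdm N var * Q)"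
		using assms[OF ab] by (simp add: rhom_simps[OF rhom_subst])
	then show "?s Q = Q" using vdm_var_nonzero[of N, where 'a='a] by simp
qed

lemma Lop_symp:
	fixes P :: "'a::{idom,ring_char_0} mpol"
	assumes "symp N P"
	shows "symp N (Lop kp q t N P)"
	by (rule symp_quotient) (simp only: Lop[OF assms] Rop_antisymmetric[OF assms])

text \<open>\<open>Rop\<close> involves no denominators, so it is compatible with every homomorphism
  of coefficients. This serves both the passage to the fraction field and the specialization of the
  parameters.\<close>

lemma Lop_mmap:
	fixes P :: "'a::{idom,ring_char_0} mpol" and h :: "'a => 'b::idom"
	assumes "symp N P" and h: "rhom h"
	shows "mmap h (Lop kp q t N P) = Lop (%r. h (kp r)) (h q) (h t) N (mmap h P)"
proof (rule Lop_unique[symmetric])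
	have s: "mmap h (scv (shf I c) i) = scv (shf I (h c)) i" for I c i
		by (simp add: scv_def rhom_simps[OF rhom_mmap[OF h]] mmap_simps[OF h] shf_def rhom_simps[OF h])
	have "mmap h (subst (scv (shf I c)) P) = subst (scv (shf I (h c))) (mmap h P)" for I c
	proof -
		have "mmap h (subst (scv (shf I c)) P) = pev (%c. single 0 (h c)) (scv (shf I (h c))) P"
			unfolding subst_def rhom_pev_comp[OF rhom_mmap[OF h] rhom_single0] s mmap_simps(3)[OF h] ..
		then show ?thesis by (simp add: subst_def pev_mmap[OF h rhom_single0])
	qed
	moreover have "mmap h (vdm N (scv (shf I c))) = vdm N (scv (shf I (h c)))" for I c
		by (simp add: rhom_vdm[OF rhom_mmap[OF h]] s)
	ultimately have "mmap h (Rop kp q t N P) = Rop (%r. h (kp r)) (h q) (h t) N (mmap h P)"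
		by (simp add: Rop_def rhom_sum[OF rhom_mmap[OF h]] mmap_simps[OF h] rhom_simps[OF rhom_mmap[OF h]])
	moreover have "mmap h (vdm N var) = vdm N var"
		by (simp add: rhom_vdm[OF rhom_mmap[OF h]] mmap_simps[OF h])
	ultimately show "vdm N var * mmap h (Lop kp q t N P) = Rop (%r. h (kp r)) (h q) (h t) N (mmap h P)"
		using arg_cong[OF Lop[OF assms(1), of kp q t], of "mmap h"] by (simp add: rhom_simps[OF rhom_mmap[OF h]])
qed

subsection \<open>Triangularity\<close>

text \<open>Degrees are only bounded from above, as the leading coefficients in question may
  vanish.\<close>

lemma coeff_mult_bounded:
	assumes "degree p \<le> m" "degree r \<le> n"
	shows "coeff (p * r) (m + n) = coeff p m * coeff r (n::nat)"
proof -
	have "coeff p i * coeff r (m + n - i) = 0" if "i \<noteq> m" "i \<le> m + n" for i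
		using that assms by (cases "i < m") (auto simp: coeff_eq_0)
	then have "(\<Sum>i\<le>m + n. coeff p i * coeff r (m + n - i)) = (\<Sum>i\<le>m + n. if i = m then coeff p m * coeff r n else 0)"
		by (intro sum.cong) auto
	then show ?thesis by (simp add: coeff_mult)
qed

lemma coeff_prod_bounded:
	assumes "\<And>x. x \<in> A ==> degree (f x) \<le> d x"
	shows "degree (prod f A) \<le> sum d A \<and> coeff (prod f A) (sum d A) = (\<Prod>x\<in>A. coeff (f x) (d x))"
	using assms
proof (induction A rule: infinite_finite_induct)
	case (insert x A)
	then have 1: "degree (f x) \<le> d x" "degree (prod f A) \<le> sum d A" "coeff (prod f A) (sum d A) = (\<Prod>x\<in>A. coeff (f x) (d x))"
		by auto
	have "degree (f x * prod f A) \<le> d x + sum d A"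
		using degree_mult_le[of "f x" "prod f A"] 1 by linarith
	then show ?case using insert.hyps coeff_mult_bounded[OF 1(1,2)] 1(3) by simp
qed auto

definition vdeg :: "(nat => nat) => nat => nat"
	where "vdeg e N = (\<Sum>(i, j)\<in>pairs N. max (e i) (e j))"

lemma grade_scv: "grade e (scv c i) = monom (scv c i) (e i)"
proof -
	have "scv c i = single (single i 1) (c i)"
		by (simp add: scv_def var_def mult_single)
	moreover have "wt e (single i 1) = e i" by (simp add: wt_superset[of "{i}"])
	ultimately show ?thesis by (simp add: grade_single)
qed

lemma scv_1: "scv (%i. 1) = var"
	by (simp add: scv_def fun_eq_iff)

lemma grade_vdm_scv:
	"degree (grade e (vdm N (scv c))) \<le> vdeg e N"
	"coeff (grade e (vdm N (scv c))) (vdeg e N) =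
		(\<Prod>(i, j)\<in>pairs N. (if e i \<ge> e j then scv c i else 0) - (if e j \<ge> e i then scv c j else 0))"
proof -
	have g: "grade e (vdm N (scv c)) = (\<Prod>p\<in>pairs N. monom (scv c (fst p)) (e (fst p)) - monom (scv c (snd p)) (e (snd p)))"
		by (simp add: vdm_def rhom_prod[OF rhom_grade] rhom_simps[OF rhom_grade] grade_scv split_def)
	have d: "degree (monom a m - monom b n) \<le> max m n" for a b :: "'a mpol" and m n
		by (rule order_trans[OF degree_diff_le_max]) (intro max.mono degree_monom_le)
	have "degree (grade e (vdm N (scv c))) \<le> (\<Sum>p\<in>pairs N. max (e (fst p)) (e (snd p))) \<and>
		coeff (grade e (vdm N (scv c))) (\<Sum>p\<in>pairs N. max (e (fst p)) (e (snd p))) =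
		(\<Prod>p\<in>pairs N. coeff (monom (scv c (fst p)) (e (fst p)) - monom (scv c (snd p)) (e (snd p))) (max (e (fst p)) (e (snd p))))"
		unfolding g by (rule coeff_prod_bounded) (rule d)
	moreover have "coeff (monom a (e i) - monom b (e j)) (max (e i) (e j)) =
		(if e i \<ge> e j then a else 0) - (if e j \<ge> e i then b else 0)" for a b :: "'a mpol" and i j
		by (auto simp: max_def)
	ultimately show "degree (grade e (vdm N (scv c))) \<le> vdeg e N"
		"coeff (grade e (vdm N (scv c))) (vdeg e N) =
			(\<Prod>(i, j)\<in>pairs N. (if e i \<ge> e j then scv c i else 0) - (if e j \<ge> e i then scv c j else 0))"
		by (simp_all add: vdeg_def split_def)
qed

lemma degree_grade_vdm:
	"degree (grade e (vdm N (var :: nat => 'a::idom mpol))) = vdeg e N"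
proof (rule antisym)
	show "degree (grade e (vdm N (var :: nat => 'a mpol))) \<le> vdeg e N"
		using grade_vdm_scv(1)[of e N "%_. 1 :: 'a"] by (simp add: scv_1)
	have v: "var i \<noteq> (0 :: 'a mpol)" for i
		by (metis lookup_single_eq lookup_zero var_def zero_neq_one)
	have "coeff (grade e (vdm N (var :: nat => 'a mpol))) (vdeg e N) \<noteq> 0"
		using grade_vdm_scv(2)[of e N "%_. 1 :: 'a"]
	proof (subst (asm) scv_1, simp only: scv_1, subst prod_zero_iff[OF finite_pairs], safe)
		fix i j assume "(i, j) \<in> pairs N"
			and "(if e i \<ge> e j then var i else (0 :: 'a mpol)) - (if e j \<ge> e i then var j else 0) = 0"
		then show False using v[of i] v[of j] by (auto simp: pairs_def split: if_splits)
	qed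
	then show "vdeg e N \<le> degree (grade e (vdm N (var :: nat => 'a mpol)))" by (rule le_degree)
qed

text \<open>Degrees add over a domain, and the Vandermonde product attains its bound
  \<open>vdeg e N\<close> exactly, so division by it lowers a degree bound by that amount.\<close>

lemma degree_grade_quotient:
	fixes Q :: "'a::idom mpol"
	assumes "degree (grade e (vdm N var * Q)) \<le> vdeg e N + d"
	shows "degree (grade e Q) \<le> d"
proof (cases "grade e Q = 0")
	case False
	have nz: "grade e (vdm N (var :: nat => 'a mpol)) \<noteq> 0"
	proof
		assume z: "grade e (vdm N (var :: nat => 'a mpol)) = 0"
		have "vdm N (var :: nat => 'a mpol) = 0"
			by (rule poly_mapping_eqI) (metis z coeff_0 lookup_coeff_grade lookup_zero)
		then show False by (simp add: vdm_var_nonzero)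
	qed
	show ?thesis
		using assms degree_mult_eq[OF nz False] by (simp add: rhom_simps[OF rhom_grade] degree_grade_vdm)
qed simp

lemma lookup_subst_scv:
	"lookup (subst (scv c) P) ga = monv c ga * lookup P ga"
proof -
	have "monv (scv c) al = single al (monv c al)" for al
	proof -
		have "monv (scv c) al = monv (%i. single 0 (c i)) al * monv var al"
			by (simp add: monv_def scv_def power_mult_distrib prod.distrib)
		also have "monv (%i. single 0 (c i)) al = (single 0 (monv c al) :: 'a mpol)"
			by (rule rhom_monv[OF rhom_single0, symmetric])
		finally show ?thesis by (simp add: monv_var mult_single)
	qed
	then have "lookup (subst (scv c) P) ga = (\<Sum>al\<in>keys P.
			if al = ga then monv c ga * lookup P ga else 0)"
		unfolding subst_def pev_def lookup_sum
		by (intro sum.cong) (auto simp: mult_single lookup_single when_def mult.commute)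
	then show ?thesis by (simp add: sum.delta' in_keys_iff)
qed

lemma degree_grade_scl: "degree (grade e (scl c P)) \<le> degree (grade e P)"
proof -
	have "\<forall>al\<in>keys P. wt e al \<le> degree (grade e P)" using degree_grade_le_iff by blast
	then show ?thesis unfolding degree_grade_le_iff by (auto simp: in_keys_iff lookup_scl)
qed

lemma degree_grade_subst_scv: "degree (grade e (subst (scv c) P)) \<le> degree (grade e P)"
proof -
	have "\<forall>al\<in>keys P. wt e al \<le> degree (grade e P)" using degree_grade_le_iff by blast
	then show ?thesis unfolding degree_grade_le_iff by (auto simp: in_keys_iff lookup_subst_scv)
qed

lemma degree_grade_Rop:
	assumes "degree (grade e P) \<le> d"
	shows "degree (grade e (Rop kp q t N P)) \<le> vdeg e N + d"
proof -
	have "degree (grade e (scl (kp (card I)) (vdm N (scv (shf I t)) * subst (scv (shf I q)) P))) \<le> vdeg e N + d" for I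
	proof -
		have "degree (grade e (vdm N (scv (shf I t)) * subst (scv (shf I q)) P)) \<le>
				degree (grade e (vdm N (scv (shf I t)))) + degree (grade e (subst (scv (shf I q)) P))"
			by (simp add: rhom_simps[OF rhom_grade] degree_mult_le)
		then show ?thesis
			using grade_vdm_scv(1)[of e N "shf I t"] degree_grade_subst_scv[of e "shf I q" P] assms
				degree_grade_scl[of e "kp (card I)" "vdm N (scv (shf I t)) * subst (scv (shf I q)) P"] by linarith
	qed
	then show ?thesis
		unfolding Rop_def rhom_sum[OF rhom_grade] by (intro degree_sum_le) auto
qed

lemma degree_grade_Lop:
	fixes P :: "'a::{idom,ring_char_0} mpol"
	assumes "symp N P" "degree (grade e P) \<le> d"
	shows "degree (grade e (Lop kp q t N P)) \<le> d"
	by (rule degree_grade_quotient[of e N]) (simp add: Lop[OF assms(1)] degree_grade_Rop[OF assms(2)])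

definition homog :: "nat => nat => 'a::comm_ring_1 mpol => bool"
	where "homog N d P \<longleftrightarrow> (\<forall>ga\<in>keys P. wt (pre N) ga = d)"

lemma homog_grade: "homog N d P \<longleftrightarrow> grade (pre N) P = monom P d"
proof
	assume h: "homog N d P"
	show "grade (pre N) P = monom P d"
	proof (rule poly_eqI, rule poly_mapping_eqI)
		fix n ga
		show "lookup (coeff (grade (pre N) P) n) ga = lookup (coeff (monom P d) n) ga"
			using h by (auto simp: homog_def lookup_coeff_grade in_keys_iff)
	qed
next
	assume g: "grade (pre N) P = monom P d"
	show "homog N d P"
		unfolding homog_def
	proof
		fix ga assume ga: "ga \<in> keys P"
		have "lookup (coeff (grade (pre N) P) (wt (pre N) ga)) ga = lookup P ga"
			by (simp add: lookup_coeff_grade)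
		then show "wt (pre N) ga = d" using ga unfolding g by (auto simp: in_keys_iff split: if_splits)
	qed
qed

lemma homog_quotient:
	fixes V Q :: "'a::idom mpol"
	assumes "V \<noteq> 0" "homog N a V" "homog N (a + d) (V * Q)"
	shows "homog N d Q"
proof -
	have "monom V a * grade (pre N) Q = monom (V * Q) (a + d)"
		using assms(2,3) by (simp add: homog_grade rhom_simps[OF rhom_grade])
	also have "\<dots> = monom V a * monom Q d" by (simp add: mult_monom)
	finally show ?thesis using assms(1) by (simp add: homog_grade)
qed

lemma homog_simps:
	"homog N a P ==> homog N b R ==> homog N (a + b) (P * R)"
	"homog N a P ==> homog N a R ==> homog N a (P + R)"
	"homog N a P ==> homog N a R ==> homog N a (P - R)"
	"homog N a P ==> homog N a (scl c P)"
	"homog N a 0" "homog N 0 1"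
	"i \<in> {1..N} ==> homog N 1 (scv f i)"
	"i \<in> {1..N} ==> homog N 1 (var i)"
proof -
	show "homog N a P ==> homog N b R ==> homog N (a + b) (P * R)"
		by (simp add: homog_grade rhom_simps[OF rhom_grade] mult_monom)
	show "homog N a P ==> homog N a R ==> homog N a (P + R)"
		"homog N a P ==> homog N a R ==> homog N a (P - R)"
		by (simp_all add: homog_grade rhom_simps[OF rhom_grade] add_monom diff_monom)
	show "homog N a P ==> homog N a (scl c P)" by (auto simp: homog_def in_keys_iff lookup_scl)
	show "homog N a 0" "homog N 0 1" by (auto simp: homog_def in_keys_iff lookup_one when_def wt_def)
	show "i \<in> {1..N} ==> homog N 1 (scv f i)" "i \<in> {1..N} ==> homog N 1 (var i)"
		by (simp_all add: homog_grade grade_scv grade_var pre_def)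
qed

lemma homog_sum: "(\<And>x. x \<in> A ==> homog N d (f x)) ==> homog N d (sum f A)"
	by (induction A rule: infinite_finite_induct) (auto intro: homog_simps)

lemma homog_prod: "(\<And>x. x \<in> A ==> homog N (d x) (f x)) ==> homog N (sum d A) (prod f A)"
	by (induction A rule: infinite_finite_induct) (auto intro: homog_simps)

lemma homog_vdm_scv: "homog N (card (pairs N)) (vdm N (scv c))"
proof -
	have "homog N (sum (%_. 1) (pairs N)) (vdm N (scv c))"
		unfolding vdm_def by (rule homog_prod) (auto simp: pairs_def intro!: homog_simps(3,7)[unfolded One_nat_def])
	then show ?thesis by simp
qed

lemma homog_vdm: "homog N (card (pairs N)) (vdm N (var :: nat => 'a::comm_ring_1 mpol))"
	using homog_vdm_scv[of N "%_. 1 :: 'a"] by (simp add: scv_1)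

lemma homog_Lop:
	fixes P :: "'a::{idom,ring_char_0} mpol"
	assumes "symp N P" "homog N d P"
	shows "homog N d (Lop kp q t N P)"
proof (rule homog_quotient[OF vdm_var_nonzero homog_vdm])
	have "homog N d (subst (scv c) P)" for c
		using assms(2) by (auto simp: homog_def in_keys_iff lookup_subst_scv)
	then have "homog N (card (pairs N) + d) (Rop kp q t N P)"
		unfolding Rop_def by (intro homog_sum homog_simps homog_vdm_scv)
	then show "homog N (card (pairs N) + d) (vdm N var * Lop kp q t N P)" by (simp add: Lop[OF assms(1)])
qed

text \<open>Dominance as degree conditions: the total degree, the degree in the first j variables
  for each j, and no further variables. Each condition is preserved by \<open>Lop\<close>, which
  gives triangularity without computing matrix entries.\<close>

lemma mspan_below_iff:
	assumes "length nu = N" "symp N P"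
	shows "mspan N (below N nu) P \<longleftrightarrow> homog N (sum_list nu) P \<and>
		(\<forall>j\<le>N. degree (grade (pre j) P) \<le> sum_list (take j nu)) \<and>
		(\<forall>k. k \<notin> {1..N} \<longrightarrow> degree (grade (%i. if i = k then 1 else 0) P) \<le> 0)"
proof -
	have w: "wt (%i. if i = k then 1 else 0) ga = lookup ga k" for k ga
		by (subst wt_superset[of "insert k (keys ga)"]) (auto simp: if_distrib[of "%x. x * _"] sum.delta' cong: if_cong)
	have "(\<exists>al. ga = mon al \<and> dominated al nu) \<longleftrightarrow> wt (pre N) ga = sum_list nu \<and>
		(\<forall>j\<le>N. wt (pre j) ga \<le> sum_list (take j nu)) \<and> (\<forall>k. k \<notin> {1..N} \<longrightarrow> lookup ga k = 0)" for ga
	proof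
		assume "\<exists>al. ga = mon al \<and> dominated al nu"
		then show "wt (pre N) ga = sum_list nu \<and>
			(\<forall>j\<le>N. wt (pre j) ga \<le> sum_list (take j nu)) \<and> (\<forall>k. k \<notin> {1..N} \<longrightarrow> lookup ga k = 0)"
			using assms(1) by (auto simp: dominated_def wt_pre lookup_mon)
	next
		assume h: "wt (pre N) ga = sum_list nu \<and>
			(\<forall>j\<le>N. wt (pre j) ga \<le> sum_list (take j nu)) \<and> (\<forall>k. k \<notin> {1..N} \<longrightarrow> lookup ga k = 0)"
		then have "keys ga \<subseteq> {1..N}" by (auto simp: in_keys_iff)
		then obtain al where al: "ga = mon al" "length al = N" using exponent_mon[of ga N] by (metis length_map length_upt diff_Suc_1)
		have "sum_list (take j al) \<le> sum_list (take j nu)" if "j \<le> N" for j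
			using h that al wt_pre[of j al] by auto
		moreover have "sum_list al = sum_list nu" using h al wt_pre[of N al] by auto
		ultimately show "\<exists>al. ga = mon al \<and> dominated al nu" using al assms(1) by (auto simp: dominated_def)
	qed
	then show ?thesis
		unfolding mspan_below[OF assms(1)] degree_grade_le_iff homog_def w using assms(2) by auto
qed

lemma mspan_below_Lop:
	fixes P :: "'a::{idom,ring_char_0} mpol"
	assumes "length nu = N" "mspan N (below N nu) P"
	shows "mspan N (below N nu) (Lop kp q t N P)"
proof -
	have s: "symp N P" using assms(2) by (simp add: mspan_def)
	show ?thesis
		using assms(2) unfolding mspan_below_iff[OF assms(1) s] mspan_below_iff[OF assms(1) Lop_symp[OF s]]
		by (auto intro!: homog_Lop degree_grade_Lop[OF s] s simp del: le_zero_eq)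
qed

text \<open>The elementary symmetric functions of the numbers t^(N-i) q^(nu_i), combined with the
  weights \<open>kp\<close>.\<close>

definition eig :: "(nat => 'a) => 'a => 'a => nat => nat list => 'a::comm_ring_1"
	where "eig kp q t N nu = (\<Sum>I\<in>Pow {1..N}. kp (card I) * (\<Prod>i\<in>I. t ^ (N - i) * q ^ (nu ! (i - 1))))"

lemma mspan_stair:
	assumes "length nu = N" "mspan N (below N nu) P"
	shows "degree (grade (stair N) P) \<le> psum nu"
		"coeff (grade (stair N) P) (psum nu) = single (mon nu) (lookup P (mon nu))"
proof -
	have k: "\<exists>al. ga = mon al \<and> dominated al nu" if "ga \<in> keys P" for ga
		using assms that by (auto simp: mspan_below)
	show "degree (grade (stair N) P) \<le> psum nu"
		unfolding degree_grade_le_iff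
	proof
		fix ga assume "ga \<in> keys P"
		then obtain al where "ga = mon al" "dominated al nu" using k[of ga] by blast
		then show "wt (stair N) ga \<le> psum nu"
			using assms(1) wt_stair[of al N] dominated_psum(1) by (auto simp: dominated_def)
	qed
	show "coeff (grade (stair N) P) (psum nu) = single (mon nu) (lookup P (mon nu))"
	proof (rule poly_mapping_eqI)
		fix ga
		have "ga = mon nu" if h: "lookup P ga \<noteq> 0" "wt (stair N) ga = psum nu"
		proof -
			obtain al where al: "ga = mon al" "dominated al nu" using k[of ga] h(1) by (auto simp: in_keys_iff)
			then have "length al = N" using assms(1) by (simp add: dominated_def)
			then have "psum al = psum nu" using h(2) wt_stair al by metis
			then show ?thesis using dominated_psum(2)[OF al(2)] al(1) by simp
		qed
		then show "lookup (coeff (grade (stair N) P) (psum nu)) ga =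
			lookup (single (mon nu) (lookup P (mon nu))) ga"
			using wt_stair[OF assms(1)] by (auto simp: lookup_coeff_grade lookup_single when_def)
	qed
qed

lemma prod_pairs_fst: "(\<Prod>(i, j)\<in>pairs N. f i) = (\<Prod>i\<in>{1..N}. f i ^ (N - i) :: 'a::comm_monoid_mult)"
proof -
	have "pairs N = Sigma {1..N} (%i. {i<..N})" by (auto simp: pairs_def)
	then show ?thesis by (simp add: prod.Sigma[symmetric])
qed

lemma single_sum: "single k (sum f A) = (\<Sum>x\<in>A. single k (f x))"
	by (induction A rule: infinite_finite_induct) (simp_all add: single_add)

text \<open>In the stair grading every factor x_i - x_j with i < j contributes x_i at top degree, so
  shifting \<open>I\<close> yields t^(N-i) for each i in \<open>I\<close>; the top degree of
  \<open>P\<close> is the single monomial of \<open>nu\<close>, which yields q^(nu_i).\<close>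

lemma Lop_leading:
	fixes P :: "'a::{idom,ring_char_0} mpol"
	assumes nu: "length nu = N" and P: "mspan N (below N nu) P"
	shows "lookup (Lop kp q t N P) (mon nu) = eig kp q t N nu * lookup P (mon nu)"
proof -
	let ?e = "stair N" and ?c = "lookup P (mon nu)"
	let ?V = "\<Prod>(i, j)\<in>pairs N. var i :: 'a mpol"
	have s: "symp N P" using P by (simp add: mspan_def)
	have dec: "?e i > ?e j" if "(i, j) \<in> pairs N" for i j using that by (auto simp: pairs_def stair_def)
	have V: "coeff (grade ?e (vdm N (scv c))) (vdeg ?e N) = single 0 (\<Prod>(i, j)\<in>pairs N. c i) * ?V" for c :: "nat => 'a"
	proof -
		have "coeff (grade ?e (vdm N (scv c))) (vdeg ?e N) = (\<Prod>(i, j)\<in>pairs N. scv c i)"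
			unfolding grade_vdm_scv(2) by (intro prod.cong refl) (use dec in "fastforce")
		then show ?thesis
			by (simp add: scv_def split_def prod.distrib rhom_prod[OF rhom_single0])
	qed
	have "coeff (grade ?e (vdm N var * Lop kp q t N P)) (vdeg ?e N + psum nu) =
			coeff (grade ?e (vdm N var)) (vdeg ?e N) * coeff (grade ?e (Lop kp q t N P)) (psum nu)"
		unfolding rhom_simps(4)[OF rhom_grade]
		by (rule coeff_mult_bounded) (simp_all add: degree_grade_vdm degree_grade_Lop[OF s] mspan_stair(1)[OF nu P])
	also have "\<dots> = ?V * single (mon nu) (lookup (Lop kp q t N P) (mon nu))"
		using V[of "%_. 1"] mspan_stair(2)[OF nu mspan_below_Lop[OF nu P]] by (simp add: scv_1)
	finally have 1: "coeff (grade ?e (Rop kp q t N P)) (vdeg ?e N + psum nu) =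
			?V * single (mon nu) (lookup (Lop kp q t N P) (mon nu))"
		by (simp add: Lop[OF s])
	have summand: "coeff (grade ?e (scl (kp (card I)) (vdm N (scv (shf I t)) * subst (scv (shf I q)) P))) (vdeg ?e N + psum nu)
			= ?V * single (mon nu) (kp (card I) * (\<Prod>i\<in>I. t ^ (N - i) * q ^ (nu ! (i - 1))) * ?c)"
		if "I \<in> Pow {1..N}" for I
	proof -
		have fin: "finite I" using that finite_subset by auto
		have "coeff (grade ?e (subst (scv (shf I q)) P)) (psum nu) = single (mon nu) (monv (shf I q) (mon nu) * ?c)"
		proof (rule poly_mapping_eqI)
			fix ga
			show "lookup (coeff (grade ?e (subst (scv (shf I q)) P)) (psum nu)) ga =
				lookup (single (mon nu) (monv (shf I q) (mon nu) * ?c)) ga"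
				using arg_cong[OF mspan_stair(2)[OF nu P], of "%x. lookup x ga"]
				by (auto simp: lookup_coeff_grade lookup_subst_scv lookup_single when_def split: if_splits)
		qed
		moreover have "monv (shf I q) (mon nu) = (\<Prod>i\<in>I. q ^ (nu ! (i - 1)))"
		proof -
			have "monv (shf I q) (mon nu) = (\<Prod>i\<in>{1..N}. shf I q i ^ lookup (mon nu) i)"
				by (rule monv_superset) (use keys_mon[of nu] nu in auto)
			also have "\<dots> = (\<Prod>i\<in>I. q ^ (nu ! (i - 1)))"
				using that nu by (intro prod.mono_neutral_cong_right) (auto simp: shf_def lookup_mon)
			finally show ?thesis .
		qed
		moreover have "(\<Prod>(i, j)\<in>pairs N. shf I t i) = (\<Prod>i\<in>I. t ^ (N - i))"
			unfolding prod_pairs_fst using that by (intro prod.mono_neutral_cong_right) (auto simp: shf_def)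
		moreover have "coeff (grade ?e (vdm N (scv (shf I t)) * subst (scv (shf I q)) P)) (vdeg ?e N + psum nu) =
			coeff (grade ?e (vdm N (scv (shf I t)))) (vdeg ?e N) * coeff (grade ?e (subst (scv (shf I q)) P)) (psum nu)"
			unfolding rhom_simps(4)[OF rhom_grade]
			by (rule coeff_mult_bounded[OF grade_vdm_scv(1)])
				(rule order_trans[OF degree_grade_subst_scv mspan_stair(1)[OF nu P]])
		moreover have "grade ?e (scl c R) = [:single 0 c:] * grade ?e R" for c and R :: "'a mpol"
			by (simp add: scl_mult_single rhom_simps[OF rhom_grade] grade_single wt_def monom_0)
		ultimately show ?thesis by (simp add: V mult_single prod.distrib mult_ac)
	qed
	have "coeff (grade ?e (Rop kp q t N P)) (vdeg ?e N + psum nu) = ?V * single (mon nu) (eig kp q t N nu * ?c)"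
	proof -
		have "coeff (grade ?e (Rop kp q t N P)) (vdeg ?e N + psum nu) = (\<Sum>I\<in>Pow {1..N}.
				?V * single (mon nu) (kp (card I) * (\<Prod>i\<in>I. t ^ (N - i) * q ^ (nu ! (i - 1))) * ?c))"
			unfolding Rop_def rhom_sum[OF rhom_grade] coeff_sum by (intro sum.cong refl summand)
		also have "\<dots> = ?V * single (mon nu) (eig kp q t N nu * ?c)"
			by (simp only: sum_distrib_left[symmetric] single_sum eig_def sum_distrib_right)
		finally show ?thesis .
	qed
	then have "?V * single (mon nu) (lookup (Lop kp q t N P) (mon nu)) =
			?V * single (mon nu) (eig kp q t N nu * ?c)" using 1 by simp
	moreover have "?V \<noteq> 0"
	proof -
		have "var i \<noteq> (0 :: 'a mpol)" for i by (metis lookup_single_eq lookup_zero var_def zero_neq_one)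
		then show ?thesis by (auto simp: prod_zero_iff)
	qed
	ultimately have "single (mon nu) (lookup (Lop kp q t N P) (mon nu)) =
			single (mon nu) (eig kp q t N nu * ?c)" by simp
	then show ?thesis by (metis lookup_single_eq)
qed

subsection \<open>Commutativity\<close>

text \<open>Interpolation at the nodes \<open>S\<close> reproduces \<open>p\<close>; compare the
  coefficients of degree \<open>card S - 1\<close>. Below it plays the role of the residue
  theorem.\<close>

lemma lagrange_leading_coeff:
	fixes S :: "'a::field set"
	assumes S: "finite S" "S \<noteq> {}" and deg: "degree p < card S"
	shows "(\<Sum>a\<in>S. poly p a / (\<Prod>b\<in>S - {a}. a - b)) = coeff p (card S - 1)"
proof -
	define L where "L a = (\<Prod>b\<in>S - {a}. [:- b, 1:])" for a
	define c where "c a = poly p a / (\<Prod>b\<in>S - {a}. a - b)" for a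
	define r where "r = p - (\<Sum>a\<in>S. smult (c a) (L a))"
	have L: "degree (L a) = card S - 1" "coeff (L a) (card S - 1) = 1" if "a \<in> S" for a
	proof -
		have "degree (L a) = (\<Sum>b\<in>S - {a}. degree [:- b, 1:])"
			unfolding L_def by (rule degree_prod_eq_sum_degree) auto
		then show d: "degree (L a) = card S - 1" using S that by simp
		have "lead_coeff (L a) = 1" unfolding L_def by (simp add: lead_coeff_prod)
		then show "coeff (L a) (card S - 1) = 1" by (simp add: d)
	qed
	have pL: "poly (L a) b = (if a = b then (\<Prod>b\<in>S - {a}. a - b) else 0)" if "a \<in> S" "b \<in> S" for a b
	proof (cases "a = b")
		case False
		then have "\<exists>x\<in>S - {a}. poly [:- x, 1:] b = 0" using that by (intro bexI[of _ b]) auto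
		then have "(\<Prod>x\<in>S - {a}. poly [:- x, 1:] b) = 0" using S by (intro prod_zero) auto
		then show ?thesis using False by (simp add: L_def poly_prod)
	qed (simp add: L_def poly_prod)
	have nz: "(\<Prod>b\<in>S - {a}. a - b) \<noteq> 0" for a using S by auto
	have root: "poly r b = 0" if "b \<in> S" for b
	proof -
		have "(\<Sum>a\<in>S. c a * poly (L a) b) = (\<Sum>a\<in>S. if a = b then poly p b else 0)"
			using that nz by (intro sum.cong) (auto simp: pL c_def)
		then show ?thesis using S that by (simp add: r_def poly_sum sum.delta')
	qed
	have "degree (\<Sum>a\<in>S. smult (c a) (L a)) \<le> card S - 1"
		using S L by (intro degree_sum_le) (auto intro: order_trans[OF degree_smult_le])
	then have dr: "degree r \<le> card S - 1"
		unfolding r_def using deg by (intro degree_diff_le) auto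
	have "r = 0"
	proof (rule ccontr)
		assume "r \<noteq> 0"
		then have "card {x. poly r x = 0} \<le> degree r" by (rule card_poly_roots_bound)
		moreover have "card S \<le> card {x. poly r x = 0}"
			using root \<open>r \<noteq> 0\<close> by (intro card_mono poly_roots_finite) auto
		moreover have "card S > 0" using S by (simp add: card_gt_0_iff)
		ultimately show False using dr by linarith
	qed
	then have "coeff p (card S - 1) = (\<Sum>a\<in>S. c a * coeff (L a) (card S - 1))"
		by (simp add: r_def coeff_sum)
	also have "\<dots> = (\<Sum>a\<in>S. c a)" using L by (intro sum.cong) auto
	finally show ?thesis by (simp add: c_def)
qed

text \<open>The sum of the residues of \<open>\<Prod>\<^sub>k (t z - x\<^sub>k) (t x\<^sub>k - q z) / ((z - x\<^sub>k) (x\<^sub>k - q z)) dz/z\<close> vanishes.\<close>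

lemma commutation_identity:
	fixes x :: "nat => 'a::field"
	assumes K: "finite K" and x0: "\<And>i. i \<in> K ==> x i \<noteq> 0" and inj: "inj_on x K"
		and qx: "\<And>i k. i \<in> K ==> k \<in> K ==> i \<noteq> k ==> x k \<noteq> q * x i"
		and qt: "q \<noteq> 0" "q \<noteq> 1" "t \<noteq> 1" "t \<noteq> q"
	shows "(\<Sum>i\<in>K. \<Prod>k\<in>K - {i}. (t * x i - x k) / (x i - x k) * ((t * x k - q * x i) / (x k - q * x i))) =
		(\<Sum>i\<in>K. \<Prod>k\<in>K - {i}. (t * x k - x i) / (x k - x i) * ((t * x i - q * x k) / (x i - q * x k)))"
proof -
	define m where "m = card K"
	define y where "y i = x i / q" for i
	define p where "p = (\<Prod>k\<in>K. [:- x k, t:] * [:t * x k, - q:])"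
	define A where "A = x ` K"
	define B where "B = y ` K"
	\<comment> \<open>The poles 0, \<open>x i\<close> and \<open>x i / q\<close>, pairwise distinct by
	  genericity. There are 2 m + 1 of them, and \<open>p\<close> has degree at most 2 m.\<close>
	define S where "S = insert 0 (A \<union> B)"
	have injy: "inj_on y K" using inj qt by (auto simp: inj_on_def y_def)
	have disj: "x i \<noteq> y k" if "i \<in> K" "k \<in> K" for i k
		using that qx[of i k] x0[of i] qt by (cases "i = k") (auto simp: y_def field_simps)
	have AB: "A \<inter> B = {}" using disj by (auto simp: A_def B_def)
	have zero: "0 \<notin> A \<union> B" using x0 qt by (force simp: A_def B_def y_def)
	have fin: "finite A" "finite B" using K by (auto simp: A_def B_def)
	have cardS: "card S = Suc (2 * m)"
		using zero fin AB by (simp add: S_def card_Un_disjoint)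
			(simp add: A_def B_def card_image inj injy m_def)
	have deg: "degree p \<le> 2 * m \<and> coeff p (2 * m) = (- t * q) ^ m"
	proof -
		have "degree p \<le> (\<Sum>k\<in>K. 2) \<and> coeff p (\<Sum>k\<in>K. 2) = (\<Prod>k\<in>K. coeff ([:- x k, t:] * [:t * x k, - q:]) 2)"
			unfolding p_def
			by (rule coeff_prod_bounded) (rule order_trans[OF degree_mult_le], simp)
		then show ?thesis by (simp add: m_def numeral_2_eq_2 mult.commute)
	qed
	have pp: "poly p z = (\<Prod>k\<in>K. (t * z - x k) * (t * x k - q * z))" for z
		by (simp add: p_def poly_prod algebra_simps)
	have "(\<Sum>a\<in>S. poly p a / (\<Prod>b\<in>S - {a}. a - b)) = (- t * q) ^ m"
		using lagrange_leading_coeff[of S p] deg cardS fin by (simp add: S_def)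
	moreover have "(\<Sum>a\<in>S. poly p a / (\<Prod>b\<in>S - {a}. a - b)) = poly p 0 / (\<Prod>b\<in>S - {0}. 0 - b)
			+ (\<Sum>i\<in>K. poly p (x i) / (\<Prod>b\<in>S - {x i}. x i - b)) + (\<Sum>i\<in>K. poly p (y i) / (\<Prod>b\<in>S - {y i}. y i - b))"
	proof -
		have "(\<Sum>a\<in>S. F a) = F 0 + (\<Sum>i\<in>K. F (x i)) + (\<Sum>i\<in>K. F (y i))" for F :: "'a => 'a"
			using zero fin AB unfolding S_def
			by (simp add: sum.union_disjoint) (simp add: A_def B_def sum.reindex inj injy)
		then show ?thesis .
	qed
	\<comment> \<open>The pole at 0 accounts for the whole leading coefficient, so the contributions of
	  the remaining poles cancel.\<close>
	moreover have "poly p 0 / (\<Prod>b\<in>S - {0}. 0 - b) = (- t * q) ^ m"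
	proof -
		have "S - {0} = A \<union> B" using zero by (auto simp: S_def)
		then have "(\<Prod>b\<in>S - {0}. 0 - b) = (\<Prod>i\<in>K. - x i) * (\<Prod>i\<in>K. - y i)"
			using fin AB by (simp add: prod.union_disjoint) (simp add: A_def B_def prod.reindex inj injy)
		also have "\<dots> = (\<Prod>i\<in>K. x i * y i)" by (simp add: prod.distrib[symmetric])
		finally have d: "(\<Prod>b\<in>S - {0}. 0 - b) = (\<Prod>i\<in>K. x i * y i)" .
		have n: "poly p 0 = (\<Prod>k\<in>K. - x k * (t * x k))" by (simp add: pp)
		have "poly p 0 / (\<Prod>b\<in>S - {0}. 0 - b) = (\<Prod>k\<in>K. (- x k * (t * x k)) / (x k * y k))"
			unfolding d n by (rule prod_dividef[symmetric])
		also have "\<dots> = (\<Prod>k\<in>K. - t * q)" using x0 qt by (intro prod.cong) (auto simp: y_def field_simps)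
		finally show ?thesis by (simp add: m_def)
	qed
	ultimately have sum0: "(\<Sum>i\<in>K. poly p (x i) / (\<Prod>b\<in>S - {x i}. x i - b)) + (\<Sum>i\<in>K. poly p (y i) / (\<Prod>b\<in>S - {y i}. y i - b)) = 0"
		by simp
	\<comment> \<open>The factor common to all residues at the \<open>x i\<close>; those at the
	  \<open>x i / q\<close> carry its negative.\<close>
	define c where "c = (t - 1) * (t - q) * q / (q - 1) * (- q) ^ (m - 1)"
	have "c \<noteq> 0" using qt by (simp add: c_def)
	have Sx: "(\<Prod>b\<in>S - {x i}. x i - b) = x i * (x i - y i) * (\<Prod>k\<in>K - {i}. (x i - x k) * (x i - y k))" if i: "i \<in> K" for i
	proof -
		have "S - {x i} = insert 0 (x ` (K - {i}) \<union> B)"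
			using i x0 inj AB by (auto simp: S_def A_def inj_on_def)
		moreover have "0 \<notin> x ` (K - {i}) \<union> B" "x ` (K - {i}) \<inter> B = {}" using zero AB by (auto simp: A_def)
		ultimately have "(\<Prod>b\<in>S - {x i}. x i - b) = x i * ((\<Prod>k\<in>K - {i}. x i - x k) * (\<Prod>k\<in>K. x i - y k))"
			using fin K inj injy by (simp add: prod.union_disjoint)
				(simp add: B_def prod.reindex inj_on_diff)
		then show ?thesis using i K by (simp add: prod.remove[of K i "%k. x i - y k"] prod.distrib mult_ac)
	qed
	have Sy: "(\<Prod>b\<in>S - {y i}. y i - b) = y i * (y i - x i) * (\<Prod>k\<in>K - {i}. (y i - x k) * (y i - y k))" if i: "i \<in> K" for i
	proof -
		have "S - {y i} = insert 0 (A \<union> y ` (K - {i}))"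
			using i x0 qt injy AB by (auto simp: S_def B_def inj_on_def y_def)
		moreover have "0 \<notin> A \<union> y ` (K - {i})" "A \<inter> y ` (K - {i}) = {}" using zero AB by (auto simp: B_def)
		ultimately have "(\<Prod>b\<in>S - {y i}. y i - b) = y i * ((\<Prod>k\<in>K. y i - x k) * (\<Prod>k\<in>K - {i}. y i - y k))"
			using fin K inj injy by (simp add: prod.union_disjoint)
				(simp add: A_def prod.reindex inj_on_diff)
		then show ?thesis using i K by (simp add: prod.remove[of K i "%k. y i - x k"] prod.distrib mult_ac)
	qed
	have pow: "(\<Prod>k\<in>K - {i}. - q) = (- q) ^ (m - 1)" if "i \<in> K" for i
		using that K by (simp add: m_def)
	have 1: "poly p (x i) / (\<Prod>b\<in>S - {x i}. x i - b) =
			c * (\<Prod>k\<in>K - {i}. (t * x i - x k) / (x i - x k) * ((t * x k - q * x i) / (x k - q * x i)))" if i: "i \<in> K" for i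
	proof -
		have "poly p (x i) = (t * x i - x i) * (t * x i - q * x i) * (\<Prod>k\<in>K - {i}. (t * x i - x k) * (t * x k - q * x i))"
			using K i by (simp add: pp prod.remove[of K i])
		then have "poly p (x i) / (\<Prod>b\<in>S - {x i}. x i - b) = (t * x i - x i) * (t * x i - q * x i) / (x i * (x i - y i)) *
			(\<Prod>k\<in>K - {i}. ((t * x i - x k) * (t * x k - q * x i)) / ((x i - x k) * (x i - y k)))"
			unfolding Sx[OF i] by (simp add: prod_dividef)
		also have "(t * x i - x i) * (t * x i - q * x i) / (x i * (x i - y i)) = (t - 1) * (t - q) * q / (q - 1)"
			using x0[OF i] qt by (simp add: y_def divide_simps) (simp add: algebra_simps)
		also have "(\<Prod>k\<in>K - {i}. ((t * x i - x k) * (t * x k - q * x i)) / ((x i - x k) * (x i - y k))) =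
			(\<Prod>k\<in>K - {i}. - q * ((t * x i - x k) / (x i - x k) * ((t * x k - q * x i) / (x k - q * x i))))"
		proof (intro prod.cong refl)
			fix k assume k: "k \<in> K - {i}"
			have "x i - y k = - ((x k - q * x i) / q)" using qt by (simp add: y_def field_simps)
			then show "((t * x i - x k) * (t * x k - q * x i)) / ((x i - x k) * (x i - y k)) =
				- q * ((t * x i - x k) / (x i - x k) * ((t * x k - q * x i) / (x k - q * x i)))"
				by simp
		qed
		finally show ?thesis by (simp only: prod.distrib pow[OF i] c_def mult.assoc)
	qed
	have 2: "poly p (y i) / (\<Prod>b\<in>S - {y i}. y i - b) =
			- c * (\<Prod>k\<in>K - {i}. (t * x k - x i) / (x k - x i) * ((t * x i - q * x k) / (x i - q * x k)))" if i: "i \<in> K" for i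
	proof -
		have "poly p (y i) = (t * y i - x i) * (t * x i - q * y i) * (\<Prod>k\<in>K - {i}. (t * y i - x k) * (t * x k - q * y i))"
			using K i by (simp add: pp prod.remove[of K i])
		then have "poly p (y i) / (\<Prod>b\<in>S - {y i}. y i - b) = (t * y i - x i) * (t * x i - q * y i) / (y i * (y i - x i)) *
			(\<Prod>k\<in>K - {i}. ((t * y i - x k) * (t * x k - q * y i)) / ((y i - x k) * (y i - y k)))"
			unfolding Sy[OF i] by (simp add: prod_dividef)
		also have "(t * y i - x i) * (t * x i - q * y i) / (y i * (y i - x i)) = - ((t - 1) * (t - q) * q / (q - 1))"
			using x0[OF i] qt by (simp add: y_def divide_simps) (simp add: algebra_simps)
		also have "(\<Prod>k\<in>K - {i}. ((t * y i - x k) * (t * x k - q * y i)) / ((y i - x k) * (y i - y k))) =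
			(\<Prod>k\<in>K - {i}. - q * ((t * x k - x i) / (x k - x i) * ((t * x i - q * x k) / (x i - q * x k))))"
		proof (intro prod.cong refl)
			fix k assume k: "k \<in> K - {i}"
			have e: "y i - x k = (x i - q * x k) / q" "y i - y k = - ((x k - x i) / q)" "t * y i - x k = (t * x i - q * x k) / q"
				"q * y i = x i" using qt by (simp_all add: y_def field_simps)
			show "((t * y i - x k) * (t * x k - q * y i)) / ((y i - x k) * (y i - y k)) =
				- q * ((t * x k - x i) / (x k - x i) * ((t * x i - q * x k) / (x i - q * x k)))"
				unfolding e using qt by (simp add: mult_ac)
		qed
		finally show ?thesis
			unfolding prod.distrib pow[OF i] c_def by (simp only: mult.assoc mult_minus_left)
	qed
	let ?L = "\<Sum>i\<in>K. \<Prod>k\<in>K - {i}. (t * x i - x k) / (x i - x k) * ((t * x k - q * x i) / (x k - q * x i))"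
	let ?R = "\<Sum>i\<in>K. \<Prod>k\<in>K - {i}. (t * x k - x i) / (x k - x i) * ((t * x i - q * x k) / (x i - q * x k))"
	have "c * ?L + (- c) * ?R = 0"
		using sum0 by (simp only: 1 2 sum_distrib_left cong: sum.cong)
	then show ?thesis using \<open>c \<noteq> 0\<close> by (simp add: algebra_simps)
qed

lemma cross_product:
	assumes I: "I \<subseteq> {1..N}"
	shows "(\<Prod>i\<in>I. \<Prod>j\<in>{1..N} - I. h i j) = (\<Prod>(a, b)\<in>pairs N.
		if a \<in> I \<and> b \<notin> I then h a b else if a \<notin> I \<and> b \<in> I then h b a else (1 :: 'a::comm_monoid_mult))"
proof -
	let ?S = "{p \<in> pairs N. (fst p \<in> I) \<noteq> (snd p \<in> I)}"
	let ?g = "%(a, b). if a \<in> I \<and> b \<notin> I then h a b else if a \<notin> I \<and> b \<in> I then h b a else 1"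
	have "(\<Prod>i\<in>I. \<Prod>j\<in>{1..N} - I. h i j) = (\<Prod>(i, j)\<in>I \<times> ({1..N} - I). h i j)"
		by (rule prod.cartesian_product)
	also have "\<dots> = (\<Prod>p\<in>?S. ?g p)"
		by (rule prod.reindex_bij_witness[of _ "%(a, b). if a \<in> I then (a, b) else (b, a)" "%(i, j). (min i j, max i j)"])
			(use I in "auto simp: pairs_def min_def max_def le_less split: if_splits")
	also have "\<dots> = (\<Prod>p\<in>pairs N. ?g p)"
	proof (rule prod.mono_neutral_left)
		show "\<forall>p\<in>pairs N - ?S. ?g p = 1"
		proof
			fix p assume "p \<in> pairs N - ?S"
			then have "(fst p \<in> I) = (snd p \<in> I)" by simp
			then show "?g p = 1" by (simp add: split_def)
		qed
	qed auto
	finally show ?thesis by simp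
qed

text \<open>A pair inside \<open>I\<close> is multiplied by t, a pair outside is unchanged, and only
  pairs separated by \<open>I\<close> change shape. With the denominators multiplied out it applies
  to the variables themselves as well as to values.\<close>

lemma vdm_shift:
	assumes I: "I \<subseteq> {1..N}"
	shows "vdm N (%i. shf I t i * x i) * (\<Prod>i\<in>I. \<Prod>j\<in>{1..N} - I. x i - x j) =
		vdm N x * (t ^ card {(a, b) \<in> pairs N. a \<in> I \<and> b \<in> I} * (\<Prod>i\<in>I. \<Prod>j\<in>{1..N} - I. t * x i - x j))"
proof -
	have "t ^ card {(a, b) \<in> pairs N. a \<in> I \<and> b \<in> I} = (\<Prod>(a, b)\<in>pairs N. if a \<in> I \<and> b \<in> I then t else 1)"
	proof -
		have "(\<Prod>(a, b)\<in>pairs N. if a \<in> I \<and> b \<in> I then t else 1) = (\<Prod>p\<in>{(a, b) \<in> pairs N. a \<in> I \<and> b \<in> I}. t)"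
			by (rule prod.mono_neutral_cong_right) (auto split: if_splits)
		then show ?thesis by simp
	qed
	then show ?thesis
		unfolding cross_product[OF I] vdm_def prod.distrib[symmetric]
		by (simp only: prod.distrib[symmetric])
			(intro prod.cong refl, auto simp: shf_def algebra_simps)
qed

lemma card_pairs_in:
	assumes I: "I \<subseteq> {1..N}"
	shows "card {(a, b) \<in> pairs N. a \<in> I \<and> b \<in> I} = card I choose 2"
proof -
	have "bij_betw (%(a, b). {a, b}) {(a, b) \<in> pairs N. a \<in> I \<and> b \<in> I} {K. K \<subseteq> I \<and> card K = 2}"
	proof (rule bij_betw_imageI)
		show "inj_on (%(a, b). {a, b}) {(a, b) \<in> pairs N. a \<in> I \<and> b \<in> I}"
			by (auto simp: inj_on_def pairs_def doubleton_eq_iff)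
		show "(%(a, b). {a, b}) ` {(a, b) \<in> pairs N. a \<in> I \<and> b \<in> I} = {K. K \<subseteq> I \<and> card K = 2}"
		proof (intro equalityI subsetI)
			fix K assume "K \<in> {K. K \<subseteq> I \<and> card K = 2}"
			then obtain a b where ab: "K = {a, b}" "a \<noteq> b" "a \<in> I" "b \<in> I" by (auto simp: card_2_iff)
			have "a \<in> {1..N}" "b \<in> {1..N}" using ab I by auto
			then have "(min a b, max a b) \<in> {(a, b) \<in> pairs N. a \<in> I \<and> b \<in> I}" "K = {min a b, max a b}"
				using ab by (cases "a < b"; simp add: pairs_def insert_commute)+
			then show "K \<in> (%(a, b). {a, b}) ` {(a, b) \<in> pairs N. a \<in> I \<and> b \<in> I}"
				by (intro image_eqI[of _ _ "(min a b, max a b)"]) auto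
		qed (auto simp: pairs_def card_2_iff)
	qed
	then have "card {(a, b) \<in> pairs N. a \<in> I \<and> b \<in> I} = card {K. K \<subseteq> I \<and> card K = 2}"
		by (rule bij_betw_same_card)
	then show ?thesis using n_subsets[of I 2] finite_subset[OF I] by simp
qed

text \<open>Up to a power of t, the coefficient of the shift of \<open>I\<close> in Macdonald's
  operators when \<open>J\<close> is the complement of \<open>I\<close>; a general \<open>J\<close>
  allows splitting over unions.\<close>

definition crs :: "'a::field => nat set => nat set => (nat => 'a) => 'a"
	where "crs t I J x = (\<Prod>i\<in>I. \<Prod>j\<in>J. (t * x i - x j) / (x i - x j))"

definition shp :: "nat set => 'a::comm_ring_1 => (nat => 'a) => nat => 'a"
	where "shp I q x i = shf I q i * x i"

lemma ev_Rop:
	fixes P :: "'a::comm_ring_1 mpol"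
	shows "ev x (Rop kp q t N P) = (\<Sum>I\<in>Pow {1..N}. kp (card I) * (vdm N (shp I t x) * ev (shp I q x) P))"
proof -
	have "ev x (scv c i) = c i * x i" for c i
		by (simp add: scv_def rhom_simps[OF rhom_ev] pev_single[OF rhom_id] pev_var[OF rhom_id])
	then show ?thesis
		by (simp add: Rop_def rhom_sum[OF rhom_ev] pev_scl[OF rhom_id] rhom_simps[OF rhom_ev]
				rhom_vdm[OF rhom_ev] pev_subst[OF rhom_id] shp_def[abs_def])
qed

lemma ev_Lop:
	fixes P :: "'a::{field,ring_char_0} mpol"
	assumes "symp N P" "inj_on x {1..N}"
	shows "ev x (Lop kp q t N P) = (\<Sum>I\<in>Pow {1..N}.
		kp (card I) * t ^ (card I choose 2) * crs t I ({1..N} - I) x * ev (shp I q x) P)"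
proof -
	have v: "vdm N x \<noteq> 0" using assms(2) by (simp add: vdm_eq_0_iff)
	have r: "vdm N (shp I t x) = vdm N x * (t ^ (card I choose 2) * crs t I ({1..N} - I) x)" if "I \<in> Pow {1..N}" for I
	proof -
		have I: "I \<subseteq> {1..N}" "finite I" using that finite_subset by auto
		have nz: "(\<Prod>i\<in>I. \<Prod>j\<in>{1..N} - I. x i - x j) \<noteq> 0"
			using I assms(2) by (auto simp: inj_on_def)
		have "(\<Prod>i\<in>I. \<Prod>j\<in>{1..N} - I. t * x i - x j) = crs t I ({1..N} - I) x * (\<Prod>i\<in>I. \<Prod>j\<in>{1..N} - I. x i - x j)"
			using nz by (simp add: crs_def prod_dividef)
		then show ?thesis
			using vdm_shift[OF I(1), of t x] nz by (simp add: card_pairs_in[OF I(1)] shp_def[abs_def])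
	qed
	have "ev x (vdm N var * Lop kp q t N P) = vdm N x * ev x (Lop kp q t N P)"
		by (simp add: rhom_simps[OF rhom_ev] rhom_vdm[OF rhom_ev] pev_var[OF rhom_id])
	then have "vdm N x * ev x (Lop kp q t N P) = vdm N x * (\<Sum>I\<in>Pow {1..N}.
		kp (card I) * t ^ (card I choose 2) * crs t I ({1..N} - I) x * ev (shp I q x) P)"
		unfolding Lop[OF assms(1)] ev_Rop sum_distrib_left
	proof -
		assume h: "(\<Sum>I\<in>Pow {1..N}. kp (card I) * (vdm N (shp I t x) * ev (shp I q x) P)) = vdm N x * ev x (Lop kp q t N P)"
		show "vdm N x * ev x (Lop kp q t N P) = (\<Sum>I\<in>Pow {1..N}.
				vdm N x * (kp (card I) * t ^ (card I choose 2) * crs t I ({1..N} - I) x * ev (shp I q x) P))"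
			unfolding h[symmetric] by (intro sum.cong refl) (simp only: r mult_ac)
	qed
	then show ?thesis using v by simp
qed

definition kap1 :: "nat => 'a::comm_ring_1" where "kap1 r = (if r = 1 then 1 else 0)"

lemma sum_kap1:
	fixes F :: "nat set => 'a::comm_ring_1"
	shows "(\<Sum>I\<in>Pow {1..N}. kap1 (card I) * F I) = (\<Sum>i\<in>{1..N}. F {i})"
proof -
	have "(\<Sum>I\<in>Pow {1..N}. kap1 (card I) * F I) = (\<Sum>I\<in>(%i. {i}) ` {1..N}. F I)"
		by (rule sum.mono_neutral_cong_right) (auto simp: kap1_def card_1_singleton_iff)
	also have "\<dots> = (\<Sum>i\<in>{1..N}. F {i})" by (subst sum.reindex) auto
	finally show ?thesis .
qed

lemma ev_Lop_kap1:
	fixes P :: "'a::{field,ring_char_0} mpol"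
	assumes "symp N P" "inj_on x {1..N}"
	shows "ev x (Lop kap1 q t N P) = (\<Sum>i\<in>{1..N}. crs t {i} ({1..N} - {i}) x * ev (shp {i} q x) P)"
	unfolding ev_Lop[OF assms] mult.assoc sum_kap1 by (simp add: numeral_2_eq_2)

lemma crs_simps:
	"finite I ==> finite I' ==> I \<inter> I' = {} ==> crs t (I \<union> I') J x = crs t I J x * crs t I' J x"
	"finite J ==> finite J' ==> J \<inter> J' = {} ==> crs t I (J \<union> J') x = crs t I J x * crs t I J' x"
	by (simp_all add: crs_def prod.union_disjoint prod.distrib)

lemma crs_cong: "(\<And>i. i \<in> I \<union> J ==> x i = y i) ==> crs t I J x = crs t I J y"
	by (simp add: crs_def cong: prod.cong)

text \<open>Pairs with i outside \<open>I\<close> are recorded by \<open>K = insert i I\<close>.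
  Terms with i inside \<open>I\<close> will commute one by one, the others only after summation over
  i in \<open>K\<close>.\<close>

lemma sum_insert_pairs:
	fixes F :: "nat => nat set => 'a::comm_monoid_add"
	assumes "finite E"
	shows "(\<Sum>i\<in>E. \<Sum>I\<in>Pow E. F i I) =
		(\<Sum>I\<in>Pow E. \<Sum>i\<in>I. F i I) + (\<Sum>K\<in>Pow E. \<Sum>i\<in>K. F i (K - {i}))"
proof -
	have fin: "finite I" if "I \<in> Pow E" for I using that assms finite_subset by auto
	have "(\<Sum>i\<in>E. \<Sum>I\<in>Pow E. F i I) = (\<Sum>I\<in>Pow E. \<Sum>i\<in>E. F i I)" by (rule sum.swap)
	also have "\<dots> = (\<Sum>I\<in>Pow E. (\<Sum>i\<in>I. F i I) + (\<Sum>i\<in>E - I. F i I))"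
		using assms by (intro sum.cong refl) (metis PowD add.commute sum.subset_diff)
	also have "\<dots> = (\<Sum>I\<in>Pow E. \<Sum>i\<in>I. F i I) + (\<Sum>I\<in>Pow E. \<Sum>i\<in>E - I. F i I)" by (rule sum.distrib)
	also have "(\<Sum>I\<in>Pow E. \<Sum>i\<in>E - I. F i I) = (\<Sum>(I, i)\<in>(SIGMA I:Pow E. E - I). F i I)"
		using assms by (intro sum.Sigma) auto
	also have "\<dots> = (\<Sum>(K, i)\<in>(SIGMA K:Pow E. K). F i (K - {i}))"
		by (rule sum.reindex_bij_witness[of _ "%(K, i). (K - {i}, i)" "%(I, i). (insert i I, i)"]) auto
	also have "\<dots> = (\<Sum>K\<in>Pow E. \<Sum>i\<in>K. F i (K - {i}))"
		using assms fin by (intro sum.Sigma[symmetric]) auto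
	finally show ?thesis .
qed

text \<open>At generic points both compositions are sums over an index i and a set \<open>I\<close>.
  If i lies in \<open>I\<close> the summands agree; otherwise, for a fixed union \<open>K\<close>, a
  factor belonging to \<open>K\<close> splits off and the rest is
  \<open>commutation_identity\<close>.\<close>

lemma Lop_commute_field:
	fixes P :: "'a::{field,ring_char_0} mpol"
	assumes P: "symp N P" and qt: "q \<noteq> 0" "q \<noteq> 1" "t \<noteq> 1" "t \<noteq> q"
	shows "Lop kap1 q t N (Lop kp q t N P) = Lop kp q t N (Lop kap1 q t N P)"
proof -
	let ?E = "{1..N}"
	define D where "D = Lop kap1 q t N (Lop kp q t N P) - Lop kp q t N (Lop kap1 q t N P)"
	\<comment> \<open>Vanishes exactly at the points to which \<open>gen\<close> does not apply, so
	  \<open>D * G\<close> vanishes everywhere.\<close>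
	define G where "G = vdm N var * (\<Prod>i\<in>?E. var i) * (\<Prod>i\<in>?E. \<Prod>j\<in>?E - {i}. var j - scl q (var i) :: 'a mpol)"
	have gen: "ev x D = 0" if x0: "\<And>i. i \<in> ?E ==> x i \<noteq> 0" and inj: "inj_on x ?E"
		and qx: "\<And>i k. i \<in> ?E ==> k \<in> ?E ==> i \<noteq> k ==> x k \<noteq> q * x i" for x
	proof -
		have inj': "inj_on (shp I q x) ?E" for I
		proof (rule inj_onI)
			fix i j assume h: "i \<in> ?E" "j \<in> ?E" "shp I q x i = shp I q x j"
			show "i = j"
			proof (rule ccontr)
				assume "i \<noteq> j"
				then show False using h qx[of i j] qx[of j i] qt(1) inj_onD[OF inj _ h(1,2)]
					by (auto simp: shp_def shf_def split: if_splits)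
			qed
		qed
		have comm: "shp I q (shp J q x) = shp J q (shp I q x)" for I J
			by (simp add: shp_def fun_eq_iff mult_ac)
		define v where "v I i = ev (shp {i} q (shp I q x)) P" for I i
		define \<tau> where "\<tau> I = kp (card I) * t ^ (card I choose 2)" for I :: "nat set"
		have L: "ev x (Lop kap1 q t N (Lop kp q t N P)) = (\<Sum>i\<in>?E. \<Sum>I\<in>Pow ?E.
				\<tau> I * v I i * (crs t {i} (?E - {i}) x * crs t I (?E - I) (shp {i} q x)))"
			unfolding ev_Lop_kap1[OF Lop_symp[OF P] inj] ev_Lop[OF P inj'] sum_distrib_left
			by (simp add: \<tau>_def v_def comm mult_ac)
		have "ev x (Lop kp q t N (Lop kap1 q t N P)) = (\<Sum>I\<in>Pow ?E. \<Sum>i\<in>?E.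
				\<tau> I * v I i * (crs t I (?E - I) x * crs t {i} (?E - {i}) (shp I q x)))"
			unfolding ev_Lop[OF Lop_symp[OF P] inj] ev_Lop_kap1[OF P inj'] sum_distrib_left
			by (simp add: \<tau>_def v_def mult_ac)
		then have R: "ev x (Lop kp q t N (Lop kap1 q t N P)) = (\<Sum>i\<in>?E. \<Sum>I\<in>Pow ?E.
				\<tau> I * v I i * (crs t I (?E - I) x * crs t {i} (?E - {i}) (shp I q x)))"
			by (subst sum.swap)
		have A: "crs t {i} (?E - {i}) x * crs t I (?E - I) (shp {i} q x) =
				crs t I (?E - I) x * crs t {i} (?E - {i}) (shp I q x)" if I: "I \<in> Pow ?E" and i: "i \<in> I" for I i
		proof -
			define K where "K = I - {i}"
			have K: "?E - {i} = K \<union> (?E - I)" "K \<inter> (?E - I) = {}" "finite K" "finite (?E - I)"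
				"I = {i} \<union> K" "{i} \<inter> K = {}" using I i finite_subset by (auto simp: K_def)
			have 1: "crs t {i} (?E - {i}) y = crs t {i} K y * crs t {i} (?E - I) y" for y
				unfolding K(1) by (rule crs_simps(2)) (use K in auto)
			have 2: "crs t I (?E - I) y = crs t {i} (?E - I) y * crs t K (?E - I) y" for y
				using crs_simps(1)[of "{i}" K t "?E - I" y] K by simp
			have 3: "crs t {i} K (shp I q x) = crs t {i} K x"
				unfolding crs_def using K(5) qt(1)
				by (intro prod.cong refl) (auto simp: shp_def shf_def mult.left_commute[of t q] right_diff_distrib[symmetric])
			have 4: "crs t {i} (?E - I) (shp I q x) = crs t {i} (?E - I) (shp {i} q x)"
				by (rule crs_cong) (use i in "auto simp: shp_def shf_def")
			have 5: "crs t K (?E - I) (shp {i} q x) = crs t K (?E - I) x"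
				by (rule crs_cong) (use i in "auto simp: shp_def shf_def K_def")
			show ?thesis unfolding 1 2 3 4 5 by (simp add: mult_ac)
		qed
		have B: "(\<Sum>i\<in>K. crs t {i} (?E - {i}) x * crs t (K - {i}) (?E - (K - {i})) (shp {i} q x)) =
				(\<Sum>i\<in>K. crs t (K - {i}) (?E - (K - {i})) x * crs t {i} (?E - {i}) (shp (K - {i}) q x))"
			if K: "K \<in> Pow ?E" for K
		proof -
			have finK: "finite K" using K finite_subset by auto
			have s: "?E - {i} = (K - {i}) \<union> (?E - K)" "?E - (K - {i}) = {i} \<union> (?E - K)" "K = {i} \<union> (K - {i})"
				if "i \<in> K" for i using that K by auto
			have 1: "crs t {i} (?E - {i}) y = crs t {i} (K - {i}) y * crs t {i} (?E - K) y" if "i \<in> K" for i y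
				unfolding s(1)[OF that] by (rule crs_simps(2)) (use finK in auto)
			have 2: "crs t (K - {i}) (?E - (K - {i})) y = crs t (K - {i}) {i} y * crs t (K - {i}) (?E - K) y" if "i \<in> K" for i y
				unfolding s(2)[OF that] by (rule crs_simps(2)) (use that in auto)
			have 3: "crs t K (?E - K) y = crs t {i} (?E - K) y * crs t (K - {i}) (?E - K) y" if "i \<in> K" for i y
				using crs_simps(1)[of "{i}" "K - {i}" t "?E - K" y] finK s(3)[OF that] by simp
			have 4: "crs t (K - {i}) (?E - K) (shp {i} q x) = crs t (K - {i}) (?E - K) x"
				"crs t {i} (?E - K) (shp (K - {i}) q x) = crs t {i} (?E - K) x" if "i \<in> K" for i
				using that by (auto intro!: crs_cong simp: shp_def shf_def split: if_splits)
			have L: "crs t {i} (?E - {i}) x * crs t (K - {i}) (?E - (K - {i})) (shp {i} q x) =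
				crs t K (?E - K) x * (\<Prod>k\<in>K - {i}. (t * x i - x k) / (x i - x k) * ((t * x k - q * x i) / (x k - q * x i)))"
				if i: "i \<in> K" for i
			proof -
				have "crs t {i} (K - {i}) x * crs t (K - {i}) {i} (shp {i} q x) =
					(\<Prod>k\<in>K - {i}. (t * x i - x k) / (x i - x k) * ((t * x k - q * x i) / (x k - q * x i)))"
					unfolding prod.distrib crs_def
					by (intro arg_cong2[of _ _ _ _ "(*)"]) (auto simp: shp_def shf_def intro!: prod.cong)
				then show ?thesis unfolding 1[OF i] 2[OF i] 3[OF i] 4[OF i] by (simp add: mult_ac)
			qed
			have R: "crs t (K - {i}) (?E - (K - {i})) x * crs t {i} (?E - {i}) (shp (K - {i}) q x) =
				crs t K (?E - K) x * (\<Prod>k\<in>K - {i}. (t * x k - x i) / (x k - x i) * ((t * x i - q * x k) / (x i - q * x k)))"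
				if i: "i \<in> K" for i
			proof -
				have "crs t (K - {i}) {i} x * crs t {i} (K - {i}) (shp (K - {i}) q x) =
					(\<Prod>k\<in>K - {i}. (t * x k - x i) / (x k - x i) * ((t * x i - q * x k) / (x i - q * x k)))"
					unfolding prod.distrib crs_def
					by (intro arg_cong2[of _ _ _ _ "(*)"]) (auto simp: shp_def shf_def intro!: prod.cong)
				then show ?thesis unfolding 1[OF i] 2[OF i] 3[OF i] 4[OF i] by (simp add: mult_ac)
			qed
			have sub: "K \<subseteq> ?E" using K by auto
			have id: "(\<Sum>i\<in>K. \<Prod>k\<in>K - {i}. (t * x i - x k) / (x i - x k) * ((t * x k - q * x i) / (x k - q * x i))) =
				(\<Sum>i\<in>K. \<Prod>k\<in>K - {i}. (t * x k - x i) / (x k - x i) * ((t * x i - q * x k) / (x i - q * x k)))"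
			proof (rule commutation_identity[OF finK _ _ _ qt])
				show "x i \<noteq> 0" if "i \<in> K" for i using x0 that sub by blast
				show "inj_on x K" by (rule inj_on_subset[OF inj sub])
				show "x k \<noteq> q * x i" if "i \<in> K" "k \<in> K" "i \<noteq> k" for i k using qx that sub by blast
			qed
			show ?thesis
				using id by (simp only: sum.cong[OF refl L] sum.cong[OF refl R] sum_distrib_left[symmetric])
		qed
		have C: "(\<Sum>i\<in>K. \<tau> (K - {i}) * v (K - {i}) i * X i) = kp (card K - 1) * t ^ (card K - 1 choose 2) * ev (shp K q x) P * (\<Sum>i\<in>K. X i)"
			if K: "K \<in> Pow ?E" for K and X :: "nat => 'a"
		proof -
			have "finite K" using K finite_subset by auto
			moreover have "shp {i} q (shp (K - {i}) q x) = shp K q x" if "i \<in> K" for i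
			proof
				fix j show "shp {i} q (shp (K - {i}) q x) j = shp K q x j"
					using that by (cases "j = i") (simp_all add: shp_def shf_def)
			qed
			ultimately show ?thesis
				unfolding sum_distrib_left by (intro sum.cong refl) (simp add: \<tau>_def v_def)
		qed
		have "ev x (Lop kap1 q t N (Lop kp q t N P)) = ev x (Lop kp q t N (Lop kap1 q t N P))"
			unfolding L R sum_insert_pairs[OF finite_atLeastAtMost]
		proof (rule arg_cong2[of _ _ _ _ "(+)"])
			show "(\<Sum>I\<in>Pow ?E. \<Sum>i\<in>I. \<tau> I * v I i * (crs t {i} (?E - {i}) x * crs t I (?E - I) (shp {i} q x))) =
				(\<Sum>I\<in>Pow ?E. \<Sum>i\<in>I. \<tau> I * v I i * (crs t I (?E - I) x * crs t {i} (?E - {i}) (shp I q x)))"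
				by (intro sum.cong refl arg_cong2[of _ _ _ _ "(*)"] A)
			show "(\<Sum>K\<in>Pow ?E. \<Sum>i\<in>K. \<tau> (K - {i}) * v (K - {i}) i *
					(crs t {i} (?E - {i}) x * crs t (K - {i}) (?E - (K - {i})) (shp {i} q x))) =
				(\<Sum>K\<in>Pow ?E. \<Sum>i\<in>K. \<tau> (K - {i}) * v (K - {i}) i *
					(crs t (K - {i}) (?E - (K - {i})) x * crs t {i} (?E - {i}) (shp (K - {i}) q x)))"
				by (rule sum.cong[OF refl]) (simp only: C B)
		qed
		then show ?thesis by (simp add: D_def rhom_simps[OF rhom_ev])
	qed
	have "ev x (D * G) = 0" for x
	proof (cases "ev x G = 0")
		case False
		have "ev x G = vdm N x * (\<Prod>i\<in>?E. x i) * (\<Prod>i\<in>?E. \<Prod>j\<in>?E - {i}. x j - q * x i)"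
			by (simp add: G_def rhom_simps[OF rhom_ev] rhom_prod[OF rhom_ev] rhom_vdm[OF rhom_ev] pev_var[OF rhom_id] pev_scl[OF rhom_id])
		then have "ev x D = 0"
			using False by (intro gen) (auto simp: vdm_eq_0_iff)
		then show ?thesis by (simp add: rhom_simps[OF rhom_ev])
	qed (simp add: rhom_simps[OF rhom_ev])
	then have "D * G = 0" by (rule ev_eq_0_imp)
	moreover have "G \<noteq> 0"
	proof -
		have "var i \<noteq> (0 :: 'a mpol)" for i by (metis lookup_single_eq lookup_zero var_def zero_neq_one)
		moreover have "var j - scl q (var i) \<noteq> (0 :: 'a mpol)" if "j \<noteq> i" for i j
		proof
			assume "var j - scl q (var i) = (0 :: 'a mpol)"
			then have "ev (%m. if m = j then 1 else 0) (var j - scl q (var i)) = (0 :: 'a)"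
				by (simp add: rhom_simps[OF rhom_ev])
			then show False using that by (simp add: rhom_simps[OF rhom_ev] pev_scl[OF rhom_id] pev_var[OF rhom_id])
		qed
		ultimately show ?thesis by (auto simp: G_def vdm_var_nonzero)
	qed
	ultimately show ?thesis by (simp add: D_def)
qed

instance fract :: ("{idom,ring_char_0}") ring_char_0
proof
	have "of_nat n = to_fract (of_nat n :: 'a)" for n by (induction n) simp_all
	then show "inj (of_nat :: nat => 'a fract)" by (simp add: inj_on_def)
qed

lemma rhom_to_fract: "rhom to_fract"
	by (simp add: rhom_def)

lemma mmap_to_fract_inject: "mmap to_fract P = mmap to_fract R \<longleftrightarrow> P = R"
	by (auto simp: poly_mapping_eq_iff fun_eq_iff lookup_mmap rhom_to_fract)

lemma symp_mmap: "rhom h ==> symp N P ==> symp N (mmap h P)"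
	by (simp add: symp_iff_lookup lookup_mmap)

lemma mspan_mmap: "rhom h ==> mspan N D P ==> mspan N D (mmap h P)"
	by (auto simp: mspan_def symp_mmap in_keys_iff lookup_mmap rhom_simps)

text \<open>Evaluation of the operators at points requires division, so the coefficients are
  embedded into the fraction field, which again has characteristic 0.\<close>

lemma Lop_commute:
	fixes P :: "'a::{idom,ring_char_0} mpol"
	assumes "symp N P" "q \<noteq> 0" "q \<noteq> 1" "t \<noteq> 1" "t \<noteq> q"
	shows "Lop kap1 q t N (Lop kp q t N P) = Lop kp q t N (Lop kap1 q t N P)"
proof -
	have k: "(%r. to_fract (kap1 r)) = (kap1 :: nat => 'a fract)" by (simp add: kap1_def fun_eq_iff)
	have "to_fract q \<noteq> to_fract 0" "to_fract q \<noteq> to_fract 1" "to_fract t \<noteq> to_fract 1" "to_fract t \<noteq> to_fract q"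
		using assms(2-) by (simp_all only: to_fract_eq_iff not_False_eq_True)
	then have "mmap to_fract (Lop kap1 q t N (Lop kp q t N P)) = mmap to_fract (Lop kp q t N (Lop kap1 q t N P))"
		unfolding Lop_mmap[OF Lop_symp[OF assms(1)] rhom_to_fract] Lop_mmap[OF assms(1) rhom_to_fract] k
		by (intro Lop_commute_field symp_mmap assms rhom_to_fract) simp_all
	then show ?thesis by (simp only: mmap_to_fract_inject)
qed

subsection \<open>Eigenvectors\<close>

definition lowerset :: "nat => nat list set => bool"
	where "lowerset N D \<longleftrightarrow> finite D \<and> (\<forall>mu\<in>D. is_partition N mu \<and> below N mu \<subseteq> D)"

lemma self_below: "is_partition N mu ==> mu \<in> below N mu"
	by (simp add: below_def dominated_refl)

lemma lowerset_below: "is_partition N nu ==> lowerset N (below N nu)"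
	unfolding lowerset_def using dominated_trans by (auto simp: below_def finite_below[unfolded below_def])

lemma lowerset_remove:
	assumes "lowerset N D" "nu \<in> D" "\<And>mu. mu \<in> D ==> nu \<in> below N mu ==> mu = nu"
	shows "lowerset N (D - {nu})"
	using assms by (auto simp: lowerset_def)

lemma mspan_remove:
	assumes "mspan N D P" "is_partition N nu" "lookup P (mon nu) = 0"
	shows "mspan N (D - {nu}) P"
	unfolding mspan_def
proof (intro conjI ballI)
	show s: "symp N P" using assms(1) by (simp add: mspan_def)
	fix ga assume ga: "ga \<in> keys P"
	then obtain al where al: "ga = mon al" "length al = N" "sortd al \<in> D" using assms(1) by (auto simp: mspan_def)
	have "sortd al \<noteq> nu"
	proof
		assume "sortd al = nu"
		then have "lookup P (mon al) = lookup P (mon nu)"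
			using al(2) by (intro symp_lookup[OF s]) auto
		then show False using assms(3) ga al(1) by (simp add: in_keys_iff)
	qed
	then show "\<exists>al. ga = mon al \<and> length al = N \<and> sortd al \<in> D - {nu}" using al by auto
qed

lemma mspan_lookup_eq_0:
	assumes "mspan N D P" "is_partition N nu" "nu \<notin> D"
	shows "lookup P (mon nu) = 0"
proof (rule ccontr)
	assume "lookup P (mon nu) \<noteq> 0"
	then have "mon nu \<in> keys P" by (simp add: in_keys_iff)
	then obtain al where "mon nu = mon al" "length al = N" "sortd al \<in> D"
		using assms(1) unfolding mspan_def by blast
	then show False using assms mon_inject[of nu al] sortd_partition[OF assms(2)] by (simp add: is_partition_def)
qed

lemma Lop_sum:
	fixes f :: "'b => 'a::{idom,ring_char_0} mpol"
	assumes "\<And>x. x \<in> A ==> symp N (f x)"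
	shows "symp N (sum f A) \<and> Lop kp q t N (sum f A) = (\<Sum>x\<in>A. Lop kp q t N (f x))"
proof -
	have "Lop kp q t N 0 = (0 :: 'a mpol)"
		by (rule Lop_unique) (simp add: Rop_def rhom_simps[OF rhom_subst] scl_lin)
	with assms show ?thesis
		by (induction A rule: infinite_finite_induct) (auto simp: symp_simps Lop_lin)
qed

text \<open>Expansion into monomial symmetric polynomials reduces a lower set to principal ones. To
  the coefficient of a maximal \<open>nu\<close> only the monomial symmetric polynomial of
  \<open>nu\<close> itself contributes.\<close>

lemma mspan_Lop:
	fixes P :: "'a::{idom,ring_char_0} mpol"
	assumes D: "lowerset N D" and P: "mspan N D P"
	shows "mspan N D (Lop kp q t N P)"
		"\<lbrakk>nu \<in> D; \<And>mu. mu \<in> D ==> nu \<in> below N mu ==> mu = nu\<rbrakk> \<Longrightarrow>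
			lookup (Lop kp q t N P) (mon nu) = eig kp q t N nu * lookup P (mon nu)"
proof -
	let ?c = "%mu. lookup P (mon mu)" and ?m = "monomial_sym :: _ => 'a mpol"
	have fin: "finite D" and part: "\<And>mu. mu \<in> D ==> is_partition N mu" and low: "\<And>mu. mu \<in> D ==> below N mu \<subseteq> D"
		using D by (auto simp: lowerset_def)
	have len: "length mu = N" if "mu \<in> D" for mu using part[OF that] by (simp add: is_partition_def)
	have m: "mspan N (below N mu) (?m mu)" if "mu \<in> D" for mu
		by (rule mspan_monomial_sym[OF part[OF that] self_below[OF part[OF that]]])
	have s: "symp N (?m mu)" if "mu \<in> D" for mu using m[OF that] by (simp add: mspan_def)
	have "Lop kp q t N P = Lop kp q t N (\<Sum>mu\<in>D. scl (?c mu) (?m mu))"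
		using mspan_expand[OF P fin part] by simp
	also have "\<dots> = (\<Sum>mu\<in>D. Lop kp q t N (scl (?c mu) (?m mu)))"
		using s by (intro Lop_sum[THEN conjunct2] symp_simps)
	also have "\<dots> = (\<Sum>mu\<in>D. scl (?c mu) (Lop kp q t N (?m mu)))"
		using s by (intro sum.cong refl Lop_lin(3))
	finally have L: "Lop kp q t N P = (\<Sum>mu\<in>D. scl (?c mu) (Lop kp q t N (?m mu)))" .
	have Lm: "mspan N (below N mu) (Lop kp q t N (?m mu))" if "mu \<in> D" for mu
		by (rule mspan_below_Lop[OF len[OF that] m[OF that]])
	show "mspan N D (Lop kp q t N P)"
		unfolding L by (intro mspan_sum mspan_simps mspan_mono[OF Lm low])
	assume nu: "nu \<in> D" and mx: "\<And>mu. mu \<in> D ==> nu \<in> below N mu ==> mu = nu"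
	have "?c mu * lookup (Lop kp q t N (?m mu)) (mon nu) =
			(if mu = nu then eig kp q t N nu * ?c nu else 0)" if mu: "mu \<in> D" for mu
	proof (cases "mu = nu")
		case True
		then show ?thesis
			using Lop_leading[OF len[OF nu] m[OF nu], of kp q t] lookup_monomial_sym_partition[OF part[OF nu] part[OF nu], where 'a='a]
			by simp
	next
		case False
		then have "nu \<notin> below N mu" using mx[OF mu] by auto
		then show ?thesis using False mspan_lookup_eq_0[OF Lm[OF mu] part[OF nu]] by simp
	qed
	then show "lookup (Lop kp q t N P) (mon nu) = eig kp q t N nu * ?c nu"
		unfolding L lookup_sum lookup_scl using fin nu by (simp add: sum.delta cong: sum.cong)
qed

definition Lmu :: "(nat => 'a) => 'a => 'a => nat => nat list => 'a::comm_ring_1 mpol => 'a mpol"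
	where "Lmu kp q t N mu P = Lop kp q t N P - scl (eig kp q t N mu) P"

text \<open>Cayley-Hamilton for a triangular operator: the factor of a partition with maximal
  \<open>psum\<close> removes its term and leaves a smaller lower set. Eigenvalues are allowed to
  coincide.\<close>

lemma annihilating_product:
	assumes "lowerset N D"
	shows "\<exists>es. set es = D \<and> distinct es \<and>
		(\<forall>P :: 'a::{idom,ring_char_0} mpol. mspan N D P \<longrightarrow> fold (Lmu kp q t N) es P = 0)"
	using assms
proof (induction "card D" arbitrary: D)
	case 0
	then have "D = {}" by (simp add: lowerset_def)
	moreover have "P = 0" if "mspan N {} P" for P :: "'a mpol"
		using that by (auto simp: mspan_def)
	ultimately show ?case by (intro exI[of _ "[]"]) auto
next
	case (Suc n)
	have fin: "finite D" and ne: "D \<noteq> {}" and part: "\<And>mu. mu \<in> D ==> is_partition N mu"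
		using Suc.hyps(2) Suc.prems by (auto simp: lowerset_def)
	define M where "M = Max (psum ` D)"
	have "M \<in> psum ` D" unfolding M_def using fin ne by (intro Max_in) auto
	then obtain nu where nu: "nu \<in> D" "psum nu = M" by auto
	have mx: "mu = nu" if "mu \<in> D" "nu \<in> below N mu" for mu
	proof -
		have d: "dominated nu mu" using that(2) by (simp add: below_def)
		have "psum mu \<le> M" unfolding M_def using fin that(1) by simp
		then have "psum nu = psum mu" using dominated_psum(1)[OF d] nu(2) by simp
		then show ?thesis using dominated_psum(2)[OF d] by simp
	qed
	have low: "lowerset N (D - {nu})" by (rule lowerset_remove[OF Suc.prems nu(1) mx])
	obtain es where es: "set es = D - {nu}" "distinct es"
		"\<And>P :: 'a mpol. mspan N (D - {nu}) P ==> fold (Lmu kp q t N) es P = 0"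
	proof -
		have "n = card (D - {nu})" using Suc.hyps(2) nu(1) fin by simp
		then show ?thesis using that Suc.hyps(1)[OF _ low] by blast
	qed
	have "fold (Lmu kp q t N) (nu # es) P = 0" if P: "mspan N D P" for P :: "'a mpol"
	proof -
		have "mspan N D (Lmu kp q t N nu P)"
			unfolding Lmu_def by (intro mspan_simps mspan_Lop(1)[OF Suc.prems P] P)
		moreover have "lookup (Lmu kp q t N nu P) (mon nu) = 0"
			using mspan_Lop(2)[OF Suc.prems P nu(1) mx] by (simp add: Lmu_def lookup_minus lookup_scl)
		ultimately have "mspan N (D - {nu}) (Lmu kp q t N nu P)" by (rule mspan_remove[OF _ part[OF nu(1)]])
		then show ?thesis using es(3) by simp
	qed
	then show ?case using es nu(1) by (intro exI[of _ "nu # es"]) auto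
qed

lemma Lmu_symp: "symp N P ==> symp N (Lmu kp q t N mu (P :: 'a::{idom,ring_char_0} mpol))"
	by (simp add: Lmu_def symp_simps Lop_symp)

lemma fold_Lmu_commute:
	"symp N P ==> Lmu kp q t N mu (fold (Lmu kp q t N) es P) = fold (Lmu kp q t N) es (Lmu kp q t N mu (P :: 'a::{idom,ring_char_0} mpol))"
proof (induction es arbitrary: P)
	case (Cons mu' es)
	have "Lmu kp q t N mu (Lmu kp q t N mu' P) = Lmu kp q t N mu' (Lmu kp q t N mu P)"
		using Cons.prems by (simp add: Lmu_def Lop_lin Lop_symp symp_simps scl_lin(1,2,5) mult.commute)
	then show ?case using Cons by (simp add: Lmu_symp)
qed simp

lemma fold_Lmu_eigenvector:
	assumes "symp N P" "Lop kp q t N P = scl (eig kp q t N nu) (P :: 'a::{idom,ring_char_0} mpol)"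
	shows "fold (Lmu kp q t N) es P = scl (\<Prod>mu\<leftarrow>es. eig kp q t N nu - eig kp q t N mu) P"
	using assms
proof (induction es arbitrary: P)
	case (Cons mu es)
	have 1: "Lmu kp q t N mu P = scl (eig kp q t N nu - eig kp q t N mu) P"
		using Cons.prems by (simp add: Lmu_def scl_lin)
	have 2: "fold (Lmu kp q t N) es (scl c P) = scl (\<Prod>mu\<leftarrow>es. eig kp q t N nu - eig kp q t N mu) (scl c P)" for c
		using Cons.prems by (intro Cons.IH) (auto simp: symp_simps Lop_lin scl_lin mult.commute)
	show ?case by (simp only: fold_simps 1 2) (simp add: scl_lin(5) mult.commute)
qed (simp add: scl_lin)

lemma fold_Lmu_leading:
	assumes nu: "is_partition N nu" and P: "mspan N (below N nu) (P :: 'a::{idom,ring_char_0} mpol)"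
	shows "mspan N (below N nu) (fold (Lmu kp q t N) es P) \<and>
		lookup (fold (Lmu kp q t N) es P) (mon nu) =
			(\<Prod>mu\<leftarrow>es. eig kp q t N nu - eig kp q t N mu) * lookup P (mon nu)"
	using P
proof (induction es arbitrary: P)
	case (Cons mu es)
	have len: "length nu = N" using nu by (simp add: is_partition_def)
	have "mspan N (below N nu) (Lmu kp q t N mu P)"
		unfolding Lmu_def by (intro mspan_simps mspan_below_Lop[OF len] Cons.prems)
	moreover have "lookup (Lmu kp q t N mu P) (mon nu) =
			(eig kp q t N nu - eig kp q t N mu) * lookup P (mon nu)"
		by (simp add: Lmu_def lookup_minus lookup_scl Lop_leading[OF len Cons.prems] algebra_simps)
	ultimately show ?case using Cons.IH[of "Lmu kp q t N mu P"] by simp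
qed simp

lemma lowerset_below_remove: "is_partition N nu ==> lowerset N (below N nu - {nu})"
	by (rule lowerset_remove[OF lowerset_below self_below])
		(auto simp: below_def intro: dominated_antisym)

text \<open>The annihilating product of the smaller partitions multiplies an eigenvector by the
  product of the eigenvalue differences, which is nonzero.\<close>

lemma eigenvector_eq_0:
	fixes P :: "'a::{idom,ring_char_0} mpol"
	assumes nu: "is_partition N nu" and P: "mspan N (below N nu - {nu}) P"
		and L: "Lop kp q t N P = scl (eig kp q t N nu) P"
		and d: "\<And>mu. mu \<in> below N nu - {nu} ==> eig kp q t N mu \<noteq> eig kp q t N nu"
	shows "P = 0"
proof -
	obtain es where es: "set es = below N nu - {nu}" "fold (Lmu kp q t N) es P = 0"
		using annihilating_product[OF lowerset_below_remove[OF nu], of kp q t] P by blast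
	have "symp N P" using P by (simp add: mspan_def)
	then have "scl (\<Prod>mu\<leftarrow>es. eig kp q t N nu - eig kp q t N mu) P = 0"
		using es(2) fold_Lmu_eigenvector[OF _ L] by simp
	moreover have "(\<Prod>mu\<leftarrow>es. eig kp q t N nu - eig kp q t N mu) \<noteq> 0"
	proof -
		have "eig kp q t N nu - eig kp q t N mu \<noteq> 0" if "mu \<in> set es" for mu
			using d[of mu] es(1) that by auto
		then show ?thesis by (auto simp: prod_list_zero_iff)
	qed
	moreover have "single 0 c \<noteq> (0 :: 'a mpol)" if "c \<noteq> 0" for c
		using that by (metis lookup_single_eq lookup_zero)
	ultimately show ?thesis by (simp add: scl_mult_single)
qed

text \<open>Apply the annihilating product of the smaller partitions to the monomial symmetric
  polynomial of \<open>nu\<close>. Leaving the result unnormalized keeps it over the domain and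
  displays the denominator that a monic version acquires.\<close>

lemma eigenvector_exists:
	assumes nu: "is_partition N nu"
	shows "\<exists>es. \<exists>P :: 'a::{idom,ring_char_0} mpol. set es = below N nu - {nu} \<and> mspan N (below N nu) P \<and>
		lookup P (mon nu) = (\<Prod>mu\<leftarrow>es. eig kp q t N nu - eig kp q t N mu) \<and>
		Lop kp q t N P = scl (eig kp q t N nu) P"
proof -
	obtain es where es: "set es = below N nu - {nu}"
		"\<And>P :: 'a mpol. mspan N (below N nu - {nu}) P ==> fold (Lmu kp q t N) es P = 0"
		using annihilating_product[OF lowerset_below_remove[OF nu], of kp q t] by blast
	let ?m = "monomial_sym nu :: 'a mpol"
	have len: "length nu = N" using nu by (simp add: is_partition_def)
	have m: "mspan N (below N nu) ?m" by (rule mspan_monomial_sym[OF nu self_below[OF nu]])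
	have "mspan N (below N nu) (Lmu kp q t N nu ?m)"
		unfolding Lmu_def by (intro mspan_simps mspan_below_Lop[OF len] m)
	moreover have "lookup (Lmu kp q t N nu ?m) (mon nu) = 0"
		by (simp add: Lmu_def lookup_minus lookup_scl Lop_leading[OF len m])
	ultimately have "fold (Lmu kp q t N) es (Lmu kp q t N nu ?m) = 0"
		by (intro es(2) mspan_remove[OF _ nu])
	then have "Lmu kp q t N nu (fold (Lmu kp q t N) es ?m) = 0"
		using m by (subst fold_Lmu_commute) (simp_all add: mspan_def)
	then show ?thesis
		using es(1) fold_Lmu_leading[OF nu m, of kp q t es] lookup_monomial_sym_partition[OF nu nu, where 'a='a]
		by (intro exI[of _ es] exI[of _ "fold (Lmu kp q t N) es ?m"]) (simp add: Lmu_def)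
qed

subsection \<open>Macdonald polynomials\<close>

lemma q_shift_eq_subst: "q_shift q i P = subst (scv (shf {i} q)) P"
proof (rule poly_mapping_eqI)
	fix ga
	have "monv (shf {i} q) ga = q ^ lookup ga i"
	proof -
		have "monv (shf {i} q) ga = (\<Prod>j\<in>insert i (keys ga). shf {i} q j ^ lookup ga j)"
			by (rule monv_superset) auto
		also have "\<dots> = (\<Prod>j\<in>{i}. q ^ lookup ga j)"
			by (rule prod.mono_neutral_cong_right) (auto simp: shf_def)
		finally show ?thesis by simp
	qed
	then show "lookup (q_shift q i P) ga = lookup (subst (scv (shf {i} q)) P) ga"
		by (simp add: q_shift_def lookup_mapp lookup_subst_scv when_def in_keys_iff mult.commute)
qed

lemma macdonald_op_Rop:
	"to_fract (vdm N var) * macdonald_op q t N P = to_fract (Rop kap1 q t N (P :: 'a::field mpol))"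
proof -
	have sum_hom: "to_fract (sum f A) = (\<Sum>x\<in>A. to_fract (f x))" for f :: "nat => 'a mpol" and A
		by (rule rhom_sum[OF rhom_to_fract])
	have "Rop kap1 q t N P = (\<Sum>I\<in>Pow {1..N}. kap1 (card I) * (vdm N (scv (shf I t)) * subst (scv (shf I q)) P))"
		unfolding Rop_def by (intro sum.cong refl) (simp add: kap1_def scl_lin)
	then have R: "Rop kap1 q t N P = (\<Sum>i\<in>{1..N}. vdm N (scv (shf {i} t)) * subst (scv (shf {i} q)) P)"
		by (simp only: sum_kap1)
	have "to_fract (vdm N var) * (\<Prod>j\<in>{1..N} - {i}. to_fract (scl t (var i) - var j) / to_fract (var i - var j)) =
			to_fract (vdm N (scv (shf {i} t)) :: 'a mpol)" if i: "i \<in> {1..N}" for i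
	proof -
		have v: "(%j. shf {i} (single 0 t) j * var j) = scv (shf {i} t)"
			by (auto simp: scv_def shf_def fun_eq_iff)
		have "vdm N (scv (shf {i} t)) * (\<Prod>j\<in>{1..N} - {i}. var i - var j) =
				vdm N var * (\<Prod>j\<in>{1..N} - {i}. scl t (var i) - var j :: 'a mpol)"
		proof -
			have c: "card {(a, b) \<in> pairs N. a \<in> {i} \<and> b \<in> {i}} = 0"
				using card_pairs_in[of "{i}" N] i by simp
			show ?thesis
				using vdm_shift[of "{i}" N "single 0 t" "var :: nat => 'a mpol"] i
				unfolding v c by (simp add: scl_mult_single)
		qed
		then have "to_fract (vdm N (scv (shf {i} t))) * (\<Prod>j\<in>{1..N} - {i}. to_fract (var i - var j :: 'a mpol)) =
				to_fract (vdm N var) * (\<Prod>j\<in>{1..N} - {i}. to_fract (scl t (var i) - var j :: 'a mpol))"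
			by (simp only: rhom_prod[OF rhom_to_fract, symmetric] to_fract_mult[symmetric])
		moreover have "(\<Prod>j\<in>{1..N} - {i}. to_fract (var i - var j :: 'a mpol)) \<noteq> 0"
		proof -
			have "to_fract (var i - var j :: 'a mpol) \<noteq> 0" if "j \<noteq> i" for j
				using that by (simp del: to_fract_diff)
			then show ?thesis by (simp add: prod_zero_iff del: to_fract_diff)
		qed
		ultimately show ?thesis by (simp add: prod_dividef divide_simps del: to_fract_diff)
	qed
	then show ?thesis
		unfolding macdonald_op_def R sum_hom sum_distrib_left
		by (intro sum.cong refl) (simp add: q_shift_eq_subst mult.assoc[symmetric] del: to_fract_diff)
qed

lemma macdonald_op_iff_Lop:
	fixes P :: "'a::{field,ring_char_0} mpol"
	assumes "symp N P"
	shows "macdonald_op q t N P = to_fract (scl e P) \<longleftrightarrow> Lop kap1 q t N P = scl e P"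
proof -
	have nz: "to_fract (vdm N (var :: nat => 'a mpol)) \<noteq> 0" by (simp add: vdm_var_nonzero)
	have "macdonald_op q t N P = to_fract (scl e P) \<longleftrightarrow>
			to_fract (vdm N var) * macdonald_op q t N P = to_fract (vdm N var) * to_fract (scl e P)"
		using nz by simp
	also have "\<dots> \<longleftrightarrow> vdm N var * Lop kap1 q t N P = vdm N var * scl e P"
		unfolding macdonald_op_Rop Lop[OF assms] by (simp only: to_fract_mult[symmetric] to_fract_eq_iff)
	also have "\<dots> \<longleftrightarrow> Lop kap1 q t N P = scl e P" using vdm_var_nonzero[of N, where 'a='a] by simp
	finally show ?thesis .
qed

lemma is_macdonald_iff:
	fixes P :: "'a::{field,ring_char_0} mpol"
	assumes nu: "is_partition N nu"
	shows "is_macdonald q t N nu P \<longleftrightarrow> mspan N (below N nu) P \<and> lookup P (mon nu) = 1 \<and>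
		(\<exists>e. Lop kap1 q t N P = scl e P)"
proof -
	let ?D = "{mu. is_partition N mu \<and> dominated mu nu \<and> mu \<noteq> nu}"
	let ?m = "monomial_sym :: _ => 'a mpol"
	have D: "?D = below N nu - {nu}" "\<And>mu. mu \<in> ?D ==> is_partition N mu"
		by (auto simp: below_def)
	have "(\<exists>c. P = ?m nu + (\<Sum>mu\<in>?D. scl (c mu) (?m mu))) \<longleftrightarrow>
		mspan N (below N nu) P \<and> lookup P (mon nu) = 1"
	proof
		assume "\<exists>c. P = ?m nu + (\<Sum>mu\<in>?D. scl (c mu) (?m mu))"
		then obtain c where P: "P = ?m nu + (\<Sum>mu\<in>?D. scl (c mu) (?m mu))" by blast
		have "mspan N (below N nu) P"
			unfolding P by (intro mspan_simps(1,3) mspan_sum mspan_monomial_sym nu self_below D(2)) (auto simp: D(1))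
		moreover have "lookup P (mon nu) = 1 + (\<Sum>mu\<in>?D. 0)"
			unfolding P lookup_add lookup_sum lookup_scl
			by (intro arg_cong2[of _ _ _ _ "(+)"] sum.cong refl) (auto simp: lookup_monomial_sym_partition[OF _ nu] nu)
		ultimately show "mspan N (below N nu) P \<and> lookup P (mon nu) = 1" by simp
	next
		assume h: "mspan N (below N nu) P \<and> lookup P (mon nu) = 1"
		have "P = (\<Sum>mu\<in>below N nu. scl (lookup P (mon mu)) (?m mu))"
			by (rule mspan_expand) (use h finite_below in "auto simp: below_def")
		also have "\<dots> = ?m nu + (\<Sum>mu\<in>?D. scl (lookup P (mon mu)) (?m mu))"
			unfolding D(1) using h finite_below self_below[OF nu]
			by (subst sum.remove[of _ nu]) (auto simp: scl_lin)
		finally have "P = ?m nu + (\<Sum>mu\<in>?D. scl (lookup P (mon mu)) (?m mu))" .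
		then show "\<exists>c. P = ?m nu + (\<Sum>mu\<in>?D. scl (c mu) (?m mu))" by (rule exI[of _ "%mu. lookup P (mon mu)"])
	qed
	then show ?thesis
		unfolding is_macdonald_def using macdonald_op_iff_Lop[of N P q t]
		by (metis (no_types, lifting) mspan_def)
qed

lemma eig_kap1: "eig kap1 q t N nu = (\<Sum>i\<in>{1..N}. t ^ (N - i) * q ^ (nu ! (i - 1)))"
	unfolding eig_def sum_kap1 by simp

lemma rhom_eig: "rhom h ==> h (eig kp q t N nu) = eig (%r. h (kp r)) (h q) (h t) N nu"
	by (simp add: eig_def rhom_sum rhom_prod rhom_simps)

abbreviation q_ind :: "complex poly poly" where "q_ind \<equiv> [:[:0, 1:]:]"
abbreviation t_ind :: "complex poly poly" where "t_ind \<equiv> [:0, 1:]"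

lemma rhom_qt_eval: "rhom (qt_eval q0 t0)"
	by (simp add: rhom_def qt_eval_def)

lemma qt_eval_ind [simp]: "qt_eval q0 t0 q_ind = q0" "qt_eval q0 t0 t_ind = t0"
	by (simp_all add: qt_eval_def)

text \<open>As a polynomial in t the eigenvalue has the coefficient q^(nu_i) at t^(N-i), which
  reveals each part.\<close>

lemma eig_generic_distinct:
	assumes "length mu = N" "length nu = N" "eig kap1 q_ind t_ind N mu = eig kap1 q_ind t_ind N nu"
	shows "mu = nu"
proof (rule nth_equalityI)
	fix i assume i: "i < length mu"
	have c: "coeff (eig kap1 q_ind t_ind N \<rho>) (N - Suc i) = monom 1 (\<rho> ! i)" if "length \<rho> = N" for \<rho>
	proof -
		have qp: "q_ind ^ m = [:monom 1 m:]" for m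
			by (induction m) (simp_all add: monom_Suc monom_0 one_pCons)
		have tp: "t_ind ^ m = monom 1 m" for m by (simp add: monom_altdef)
		have "coeff (eig kap1 q_ind t_ind N \<rho>) (N - Suc i) =
			(\<Sum>j\<in>{1..N}. if j = Suc i then monom 1 (\<rho> ! i) else 0)"
			unfolding eig_kap1 coeff_sum using i assms(1)
			by (intro sum.cong refl) (auto simp: qp tp smult_monom mult.commute[of "monom _ _"])
		then show ?thesis using i assms(1) by (simp add: sum.delta')
	qed
	have "monom (1::complex) (mu ! i) = monom 1 (nu ! i)" using c[OF assms(1)] c[OF assms(2)] assms(3) by simp
	then show "mu ! i = nu ! i" by (metis monom_eq_iff' zero_neq_one)
qed (use assms in simp)

text \<open>The operator with weights \<open>c\<^sup>r\<close> separates the eigenvalues at the point of specialization, where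
	those of Macdonald's operator itself may collide; as the two operators commute, its eigenvectors, whose
	denominators do not vanish there, are the generic Macdonald polynomials.\<close>

theorem macdonald_poly_eq:
	fixes q0 t0 c :: complex and F :: "complex mpol"
	assumes nu: "is_partition N nu" and F: "mspan N (below N nu) F"
		and L: "Lop (%r. c ^ r) q0 t0 N F = scl e F" and nz: "lookup F (mon nu) \<noteq> 0"
		and d: "\<And>mu. mu \<in> below N nu - {nu} ==> eig (%r. c ^ r) q0 t0 N mu \<noteq> eig (%r. c ^ r) q0 t0 N nu"
	shows "F = scl (lookup F (mon nu)) (macdonald_poly q0 t0 N nu)"
proof -
	have len: "length nu = N" using nu by (simp add: is_partition_def)
	let ?ev = "qt_eval q0 t0"
	let ?kp = "%r. [:[:c ^ r:]:] :: complex poly poly"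
	have evk: "(%r. ?ev (?kp r)) = (%r. c ^ r)" by (simp add: qt_eval_def)
	have eig_ev: "?ev (eig ?kp q_ind t_ind N mu) = eig (%r. c ^ r) q0 t0 N mu" for mu
		using rhom_eig[OF rhom_qt_eval, of q0 t0 ?kp] by (simp only: evk qt_eval_ind)
	have dA: "eig ?kp q_ind t_ind N mu \<noteq> eig ?kp q_ind t_ind N nu" if "mu \<in> below N nu - {nu}" for mu
		using d[OF that] eig_ev by metis
	obtain es P where P: "set es = below N nu - {nu}" "mspan N (below N nu) P"
		"lookup P (mon nu) = (\<Prod>mu\<leftarrow>es. eig ?kp q_ind t_ind N nu - eig ?kp q_ind t_ind N mu)"
		"Lop ?kp q_ind t_ind N P = scl (eig ?kp q_ind t_ind N nu) P"
		using eigenvector_exists[OF nu, of ?kp q_ind t_ind] by blast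
	define g where "g = lookup P (mon nu)"
	\<comment> \<open>The leading coefficient is a product of eigenvalue differences and survives the
	  specialization by \<open>d\<close>; hence the monic polynomial is regular there.\<close>
	have gev: "?ev g \<noteq> 0"
	proof -
		have "?ev (\<Prod>mu\<leftarrow>es. G mu) = (\<Prod>mu\<leftarrow>es. ?ev (G mu))" for G
			by (induction es) (simp_all add: rhom_simps[OF rhom_qt_eval])
		moreover have "eig (%r. c ^ r) q0 t0 N nu - eig (%r. c ^ r) q0 t0 N mu \<noteq> 0" if "mu \<in> set es" for mu
			using d[of mu] P(1) that by auto
		ultimately show ?thesis
			by (auto simp: g_def P(3) prod_list_zero_iff rhom_simps[OF rhom_qt_eval] eig_ev)
	qed
	then have g0: "g \<noteq> 0" by (auto simp: rhom_simps[OF rhom_qt_eval])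
	have symP: "symp N P" using P(2) by (simp add: mspan_def)
	define E1 where "E1 = eig kap1 q_ind t_ind N nu"
	have L1: "Lop kap1 q_ind t_ind N P = scl E1 P"
	proof -
		\<comment> \<open>By commutation \<open>R\<close> is again an eigenvector of the generating
		  operator with the eigenvalue of \<open>nu\<close>, but its leading term is gone.\<close>
		define R where "R = Lop kap1 q_ind t_ind N P - scl E1 P"
		have "mspan N (below N nu) R"
			unfolding R_def by (intro mspan_simps mspan_below_Lop[OF len] P)
		moreover have "lookup R (mon nu) = 0"
			by (simp add: R_def lookup_minus lookup_scl Lop_leading[OF len P(2)] E1_def)
		ultimately have R: "mspan N (below N nu - {nu}) R" by (rule mspan_remove[OF _ nu])
		have "Lop ?kp q_ind t_ind N (Lop kap1 q_ind t_ind N P) = Lop kap1 q_ind t_ind N (Lop ?kp q_ind t_ind N P)"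
			by (rule Lop_commute[OF symP, symmetric]) (auto simp: one_pCons)
		also have "\<dots> = scl (eig ?kp q_ind t_ind N nu) (Lop kap1 q_ind t_ind N P)"
			by (simp only: P(4) Lop_lin(3)[OF symP])
		finally have c: "Lop ?kp q_ind t_ind N (Lop kap1 q_ind t_ind N P) =
			scl (eig ?kp q_ind t_ind N nu) (Lop kap1 q_ind t_ind N P)" .
		have "Lop ?kp q_ind t_ind N R = scl (eig ?kp q_ind t_ind N nu) R"
			unfolding R_def Lop_lin(2)[OF Lop_symp[OF symP] symp_simps(3)[OF symP]] c Lop_lin(3)[OF symP] P(4)
			by (simp only: scl_lin(2,5) mult.commute)
		then have "R = 0" by (rule eigenvector_eq_0[OF nu R]) (rule dA)
		then show ?thesis by (simp add: R_def)
	qed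
	define PK where "PK = scl (inverse (to_fract g)) (mmap to_fract P)"
	have spanK: "mspan N (below N nu) PK"
		unfolding PK_def by (intro mspan_simps mspan_mmap rhom_to_fract P)
	have symK: "symp N (mmap to_fract P)" by (intro symp_mmap rhom_to_fract symP)
	have gens: "to_fract q_ind = q_gen" "to_fract t_ind = t_gen" by (simp_all add: q_gen_def t_gen_def)
	have k: "(%r. to_fract (kap1 r)) = (kap1 :: nat => qt_field)" by (simp add: kap1_def fun_eq_iff)
	have LK: "Lop kap1 q_gen t_gen N PK = scl (to_fract E1) PK"
	proof -
		have "Lop kap1 q_gen t_gen N (mmap to_fract P) = scl (to_fract E1) (mmap to_fract P)"
			using Lop_mmap[OF symP rhom_to_fract, of kap1 q_ind t_ind]
			by (simp only: k gens L1 mmap_simps[OF rhom_to_fract])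
		then show ?thesis unfolding PK_def by (simp add: Lop_lin(3)[OF symK] scl_lin mult.commute)
	qed
	have "lookup PK (mon nu) = 1"
		using g0 by (simp add: PK_def lookup_scl lookup_mmap rhom_to_fract g_def)
	then have macK: "is_macdonald q_gen t_gen N nu PK"
		unfolding is_macdonald_iff[OF nu] using spanK LK by blast
	have eigK: "to_fract (eig kap1 q_ind t_ind N mu) = eig kap1 q_gen t_gen N mu" for mu
		using rhom_eig[OF rhom_to_fract, of kap1 q_ind t_ind N mu] by (simp only: k gens)
	have "macdonald_generic N nu = PK"
		unfolding macdonald_generic_def
	proof (rule the_equality)
		show "is_macdonald q_gen t_gen N nu PK" by (rule macK)
		fix P' assume "is_macdonald q_gen t_gen N nu P'"
		then obtain e' where P': "mspan N (below N nu) P'" "lookup P' (mon nu) = 1"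
			"Lop kap1 q_gen t_gen N P' = scl e' P'" unfolding is_macdonald_iff[OF nu] by blast
		have e': "e' = eig kap1 q_gen t_gen N nu"
			using Lop_leading[OF len P'(1), of kap1 q_gen t_gen] P'(2,3) by (simp add: lookup_scl)
		have sym': "symp N P'" "symp N PK" using P'(1) spanK by (simp_all add: mspan_def)
		have "P' - PK = 0"
		proof (rule eigenvector_eq_0[OF nu])
			show "mspan N (below N nu - {nu}) (P' - PK)"
				by (intro mspan_remove[OF _ nu] mspan_simps P' spanK)
					(simp add: lookup_minus P' \<open>lookup PK (mon nu) = 1\<close>)
			show "Lop kap1 q_gen t_gen N (P' - PK) = scl (eig kap1 q_gen t_gen N nu) (P' - PK)"
				unfolding Lop_lin(2)[OF sym'] P'(3) LK e' E1_def eigK by (simp only: scl_lin(2))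
			fix mu assume mu: "mu \<in> below N nu - {nu}"
			then have "eig kap1 q_ind t_ind N mu \<noteq> eig kap1 q_ind t_ind N nu"
				using eig_generic_distinct[OF _ len, of mu] by (auto simp: below_def is_partition_def)
			then show "eig kap1 q_gen t_gen N mu \<noteq> eig kap1 q_gen t_gen N nu"
				unfolding eigK[symmetric] by simp
		qed
		then show "P' = PK" by simp
	qed
	then have mac: "macdonald_poly q0 t0 N nu = scl (inverse (?ev g)) (mmap ?ev P)"
	proof -
		assume m: "macdonald_generic N nu = PK"
		show ?thesis
		proof (rule poly_mapping_eqI)
			fix al
			have z: "qt_specialize q0 t0 0 = 0"
				using qt_specialize_Fract[of q0 t0 1 0] by (simp add: qt_eval_def Zero_fract_def)
			have "lookup PK al = Fraction_Field.Fract (lookup P al) g"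
				by (simp add: PK_def lookup_scl lookup_mmap rhom_to_fract Fract_conv_to_fract field_simps)
			then have "qt_specialize q0 t0 (lookup PK al) = ?ev (lookup P al) / ?ev g"
				by (simp add: qt_specialize_Fract[OF gev])
			then show "lookup (macdonald_poly q0 t0 N nu) al = lookup (scl (inverse (?ev g)) (mmap ?ev P)) al"
				using z by (auto simp: macdonald_poly_def m map.rep_eq lookup_scl lookup_mmap rhom_qt_eval when_def field_simps)
		qed
	qed
	define M where "M = scl (inverse (?ev g)) (mmap ?ev P)"
	define \<epsilon> where "\<epsilon> = eig (%r. c ^ r) q0 t0 N nu"
	have spanM: "mspan N (below N nu) M"
		unfolding M_def by (intro mspan_simps mspan_mmap rhom_qt_eval P)
	have symM: "symp N (mmap ?ev P)" by (intro symp_mmap rhom_qt_eval symP)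
	have LM: "Lop (%r. c ^ r) q0 t0 N M = scl \<epsilon> M"
	proof -
		have "Lop (%r. c ^ r) q0 t0 N (mmap ?ev P) = scl \<epsilon> (mmap ?ev P)"
			using Lop_mmap[OF symP rhom_qt_eval, of q0 t0 ?kp q_ind t_ind]
			by (simp only: evk qt_eval_ind P(4) mmap_simps[OF rhom_qt_eval] eig_ev \<epsilon>_def)
		then show ?thesis unfolding M_def by (simp add: Lop_lin(3)[OF symM] scl_lin mult.commute)
	qed
	have lM: "lookup M (mon nu) = 1"
		using gev by (simp add: M_def lookup_scl lookup_mmap rhom_qt_eval g_def)
	have e: "e = \<epsilon>"
		using Lop_leading[OF len F, of "%r. c ^ r" q0 t0] L nz by (simp add: lookup_scl \<epsilon>_def)
	let ?a = "lookup F (mon nu)"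
	have sym: "symp N F" "symp N (scl ?a M)" "symp N M" using F spanM by (simp_all add: mspan_def symp_simps)
	\<comment> \<open>Two eigenvectors at the specialized parameters with the same leading term;
	  \<open>d\<close> separates \<open>nu\<close> from all partitions below it.\<close>
	have "F - scl ?a M = 0"
	proof (rule eigenvector_eq_0[OF nu])
		show "mspan N (below N nu - {nu}) (F - scl ?a M)"
			by (intro mspan_remove[OF _ nu] mspan_simps F spanM) (simp add: lookup_minus lookup_scl lM)
		show "Lop (%r. c ^ r) q0 t0 N (F - scl ?a M) = scl (eig (%r. c ^ r) q0 t0 N nu) (F - scl ?a M)"
			unfolding Lop_lin(2)[OF sym(1,2)] Lop_lin(3)[OF sym(3)] L LM e \<epsilon>_def[symmetric]
			by (simp only: scl_lin(2,5) mult.commute)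
	qed (rule d)
	then show ?thesis by (simp add: mac M_def)
qed

section \<open>The wheel condition\<close>

text \<open>Values as a list: for symmetric \<open>G\<close> only their multiset matters
  (\<open>gl_perm\<close>), so strings can be concatenated and regrouped freely. All other variables
  get 0.\<close>

definition gl :: "'a::comm_ring_1 mpol => 'a list => 'a"
	where "gl G xs = ev (%i. if i \<in> {1..length xs} then xs ! (i - 1) else 0) G"

lemma permutes_lift:
	assumes p: "p permutes {..<N}"
	defines "\<pi> \<equiv> %i. if i \<in> {1..N} then Suc (p (i - 1)) else i"
	shows "\<pi> permutes {1..N}"
proof (rule bij_imp_permutes)
	have *: "p i < N" if "i < N" for i using permutes_in_image[OF p, of i] that by simp
	have "inj_on \<pi> {1..N}"
	proof (rule inj_onI)
		fix x y assume h: "x \<in> {1..N}" "y \<in> {1..N}" "\<pi> x = \<pi> y"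
		then have "x - 1 = y - 1" using injD[OF permutes_inj[OF p]] by (auto simp: \<pi>_def)
		then show "x = y" using h by auto
	qed
	moreover have "\<pi> ` {1..N} \<subseteq> {1..N}"
	proof (rule image_subsetI)
		fix i assume i: "i \<in> {1..N}"
		then have "i - 1 < N" by auto
		then show "\<pi> i \<in> {1..N}" using i *[of "i - 1"] by (simp add: \<pi>_def)
	qed
	ultimately show "bij_betw \<pi> {1..N} {1..N}"
		by (simp add: bij_betw_def endo_inj_surj)
qed (auto simp: \<pi>_def)

lemma symp_ev: "symp N G ==> \<pi> permutes {1..N} ==> ev (%i. w (\<pi> i)) G = ev w G"
proof -
	assume "symp N G" "\<pi> permutes {1..N}"
	then have "ev w (subst (%i. var (\<pi> i)) G) = ev w G" by (simp add: symp_def)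
	then show ?thesis by (simp add: pev_subst[OF rhom_id] pev_var[OF rhom_id])
qed

lemma gl_perm:
	assumes G: "symp N G" and l: "length xs = N" and m: "mset xs = mset ys"
	shows "gl G xs = gl G ys"
proof -
	obtain p where p: "p permutes {..<length ys}" "permute_list p ys = xs"
		using mset_eq_permutation[OF m] by blast
	have ly: "length ys = N" using l m mset_eq_length by metis
	define \<pi> where "\<pi> i = (if i \<in> {1..N} then Suc (p (i - 1)) else i)" for i
	have \<pi>: "\<pi> permutes {1..N}" using permutes_lift[of p N] p(1) ly by (simp add: \<pi>_def[abs_def])
	have "(if i \<in> {1..N} then xs ! (i - 1) else 0) = (if \<pi> i \<in> {1..N} then ys ! (\<pi> i - 1) else 0)" for i
		using permutes_in_image[OF \<pi>, of i] p(2) l ly by (auto simp: \<pi>_def permute_list_def)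
	then show ?thesis
		unfolding gl_def l ly using symp_ev[OF G \<pi>, of "%i. if i \<in> {1..N} then ys ! (i - 1) else 0"] by simp
qed

lemma gl_poly:
	fixes G :: "'a::comm_ring_1 mpol"
	obtains p where "\<And>y. poly p y = gl G (map (%f. poly f y) fs)"
proof
	let ?u = "%i. if i \<in> {1..length fs} then fs ! (i - 1) else 0"
	fix y :: 'a
	have r: "rhom (%p. poly p y)" by (simp add: rhom_def)
	have "poly (pev (%c. [:c:]) ?u G) y = pev (%c. poly [:c:] y) (%i. poly (?u i) y) G"
		by (rule rhom_pev_comp[OF r rhom_const_poly])
	also have "\<dots> = gl G (map (%f. poly f y) fs)"
		unfolding gl_def by (intro arg_cong2[of _ _ _ _ "%h u. pev h u G"]) (auto simp: fun_eq_iff)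
	finally show "poly (pev (%c. [:c:]) ?u G) y = gl G (map (%f. poly f y) fs)" .
qed

text \<open>The weight of a monomial in the first \<open>length cs\<close> variables is its power of
  y. The lower bound \<open>m\<close> splits off the zero at y = 0, so that \<open>d\<close> alone
  bounds the number of nonzero roots.\<close>

lemma gl_poly_scaled:
	fixes G :: "'a::comm_ring_1 mpol"
	assumes "\<And>ga. ga \<in> keys G ==> m \<le> wt (pre (length cs)) ga \<and> wt (pre (length cs)) ga \<le> m + d"
	shows "\<exists>p. degree p \<le> d \<and> (\<forall>y. y ^ m * poly p y = gl G (map (%c. c * y) cs @ as))"
proof -
	let ?j = "length cs"
	let ?w = "%i. if i \<in> {1..length (cs @ as)} then (cs @ as) ! (i - 1) else 0"
	define p where "p = (\<Sum>ga\<in>keys G. monom (lookup G ga * monv ?w ga) (wt (pre ?j) ga - m))"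
	have "degree p \<le> d"
		unfolding p_def
	proof (intro degree_sum_le)
		fix ga assume "ga \<in> keys G"
		then have "wt (pre ?j) ga - m \<le> d" using assms[of ga] by linarith
		then show "degree (monom (lookup G ga * monv ?w ga) (wt (pre ?j) ga - m)) \<le> d"
			using degree_monom_le order_trans by blast
	qed simp
	moreover have "y ^ m * poly p y = gl G (map (%c. c * y) cs @ as)" for y
	proof -
		have "(if i \<in> {1..length (map (%c. c * y) cs @ as)} then (map (%c. c * y) cs @ as) ! (i - 1) else 0) =
				?w i * y ^ pre ?j i" for i
			by (auto simp: pre_def nth_append)
		then have "gl G (map (%c. c * y) cs @ as) = ev (%i. ?w i * y ^ pre ?j i) G"
			by (simp add: gl_def)
		also have "\<dots> = (\<Sum>ga\<in>keys G. lookup G ga * (monv ?w ga * y ^ wt (pre ?j) ga))"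
			unfolding pev_def
			by (intro sum.cong refl)
				(simp add: monv_def wt_def power_mult_distrib prod.distrib power_sum power_mult[symmetric])
		also have "\<dots> = y ^ m * poly p y"
			unfolding p_def poly_sum sum_distrib_left
		proof (intro sum.cong refl)
			fix ga assume "ga \<in> keys G"
			then have "y ^ wt (pre ?j) ga = y ^ m * y ^ (wt (pre ?j) ga - m)"
				using assms by (simp add: power_add[symmetric])
			then show "lookup G ga * (monv ?w ga * y ^ wt (pre ?j) ga) =
				y ^ m * poly (monom (lookup G ga * monv ?w ga) (wt (pre ?j) ga - m)) y"
				by (simp add: poly_monom mult_ac)
		qed
		finally show ?thesis by simp
	qed
	ultimately show ?thesis by blast
qed

text \<open>Genericity excludes the multiples of given values by all integral powers of t, a
  countable set; this lemma lifts such restrictions again.\<close>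

lemma poly_eq_0_off_countable:
	fixes p :: "complex poly"
	assumes "countable B" "\<And>y. y \<notin> B ==> poly p y = 0"
	shows "poly p y = 0"
proof (rule ccontr)
	assume "poly p y \<noteq> 0"
	then have "p \<noteq> 0" by auto
	then have "finite {y. poly p y = 0}" by (rule poly_roots_finite)
	then have "countable (B \<union> {y. poly p y = 0})" using assms(1) by (simp add: countable_finite)
	moreover have "B \<union> {y. poly p y = 0} = UNIV" using assms(2) by auto
	ultimately show False using uncountable_UNIV_complex by simp
qed

lemma poly_eq_0_many_roots:
	fixes p :: "'a::idom poly"
	assumes "degree p < card R" "\<And>x. x \<in> R ==> poly p x = 0"
	shows "p = 0"
proof (rule ccontr)
	assume "p \<noteq> 0"
	then have "card R \<le> card {x. poly p x = 0}"
		using assms(2) by (intro card_mono poly_roots_finite) auto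
	also have "\<dots> \<le> degree p" using \<open>p \<noteq> 0\<close> by (rule card_poly_roots_bound)
	finally show False using assms(1) by simp
qed

section \<open>Strings of ratio t, generic configurations and uniqueness under the wheel
  condition\<close>

context
	fixes t :: complex
	assumes t: "norm t > 1"
begin

lemma t0 [simp]: "t \<noteq> 0" using t by auto

lemma t_powi_inj: "t powi a = t powi b \<longleftrightarrow> a = b"
proof
	assume "t powi a = t powi b"
	then have "norm t powi a = norm t powi b" by (metis norm_power_int)
	then show "a = b" using t by (metis less_irrefl linorder_neqE power_int_strict_increasing)
qed simp

definition str :: "nat => complex => complex list"
	where "str s y = map (%i. t ^ i * y) [0..<s]"

lemma length_str [simp]: "length (str s y) = s" by (simp add: str_def)

lemma str_Suc: "str (Suc s) y = str s y @ [t ^ s * y]" by (simp add: str_def)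

lemma str_add: "str (a + b) y = str a y @ str b (t ^ a * y)"
	by (induction b) (simp_all add: str_Suc power_add mult_ac, simp add: str_def)

lemma str_Suc': "str (Suc s) y = y # str s (t * y)"
	using str_add[of 1 s y] by (simp add: str_def)

text \<open>Values on different orbits of multiplication by t: strings starting there never meet,
  however far they are prolonged.\<close>

definition indep :: "complex => complex => bool"
	where "indep x y \<longleftrightarrow> (\<forall>k::int. x \<noteq> t powi k * y)"

lemma indep_sym: "indep x y \<longleftrightarrow> indep y x"
proof -
	have "indep y x" if "indep x y" for x y
		unfolding indep_def
	proof (intro allI notI)
		fix k assume "y = t powi k * x"
		then have "x = t powi (- k) * y" by (simp add: power_int_minus)
		then show False using that unfolding indep_def by blast
	qed
	then show ?thesis by blast
qed

definition genr :: "complex list => bool"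
	where "genr ys \<longleftrightarrow> 0 \<notin> set ys \<and> sorted_wrt indep ys"

lemma genr_append: "genr (xs @ ys) \<longleftrightarrow> genr xs \<and> genr ys \<and> (\<forall>x\<in>set xs. \<forall>y\<in>set ys. indep x y)"
	by (auto simp: genr_def sorted_wrt_append)

lemma genr_Cons: "genr (y # ys) \<longleftrightarrow> y \<noteq> 0 \<and> genr ys \<and> (\<forall>x\<in>set ys. indep y x)"
	by (auto simp: genr_def)

lemma genr_single: "genr [y] \<longleftrightarrow> y \<noteq> 0"
	by (auto simp: genr_def)

lemma genr_distinct: "genr ys ==> distinct ys"
proof (induction ys)
	case (Cons y ys)
	have "\<not> indep y y" unfolding indep_def by (metis mult_1 power_int_0_right)
	then show ?case using Cons by (auto simp: genr_def)
qed simp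

lemma countable_not_indep: "countable {y. y = 0 \<or> (\<exists>x\<in>set xs. \<not> indep y x)}"
proof -
	have "{y. y = 0 \<or> (\<exists>x\<in>set xs. \<not> indep y x)} \<subseteq> {0} \<union> (\<Union>x\<in>set xs. range (%k::int. t powi k * x))"
		by (auto simp: indep_def)
	then show ?thesis by (rule countable_subset) (intro countable_Un countable_UN, auto intro: countable_finite)
qed

lemma indep_powi: "indep x y ==> t powi a * x \<noteq> t powi b * y"
proof
	assume "indep x y" "t powi a * x = t powi b * y"
	then have "x = t powi (b - a) * y" by (simp add: power_int_diff field_simps)
	then show False using \<open>indep x y\<close> unfolding indep_def by blast
qed

definition conf :: "(complex \<times> nat) list => complex list"
	where "conf S = concat (map (%(y, s). str s y) S)"

text \<open>The values that prolong a string: just past its last entry and just before its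
  first.\<close>

definition ends :: "(complex \<times> nat) list => complex set"
	where "ends S = (\<Union>(y, s)\<in>set S. {t powi int s * y, t powi (- 1) * y})"

lemma conf_append: "conf (S @ S') = conf S @ conf S'" by (simp add: conf_def)
lemma conf_single: "conf [(y, s)] = str s y" by (simp add: conf_def)
lemma ends_append: "ends (S @ S') = ends S \<union> ends S'" by (auto simp: ends_def)

lemma ends_single: "ends [(y, s)] = {t powi int s * y, t powi (- 1) * y}" by (simp add: ends_def)

lemma card_ends: "genr (map fst S) ==> card (ends S) = 2 * length S"
proof (induction S)
	case (Cons p S)
	obtain y s where p: "p = (y, s)" by force
	have g: "genr (map fst S)" "y \<noteq> 0" "\<And>x. x \<in> fst ` set S ==> indep y x"
		using Cons.prems by (auto simp: genr_def p)
	have "t powi a * y \<notin> ends S" for a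
	proof
		assume "t powi a * y \<in> ends S"
		then obtain y' s' where "(y', s') \<in> set S" and "t powi a * y = t powi int s' * y' \<or> t powi a * y = t powi (- 1) * y'"
			unfolding ends_def by blast
		moreover have "y' \<in> fst ` set S" using calculation(1) by force
		ultimately show False using indep_powi[OF g(3)[of y']] by blast
	qed
	moreover have "t powi int s * y \<noteq> t powi (- 1) * y"
	proof -
		have "t powi int s \<noteq> t powi (- 1)" unfolding t_powi_inj by simp
		then show ?thesis using g(2) by (simp only: mult_cancel_right) simp
	qed
	moreover have "ends (p # S) = insert (t powi int s * y) (insert (t powi (- 1) * y) (ends S))"
		by (auto simp: ends_def p)
	moreover have "finite (ends S)" by (auto simp: ends_def)
	ultimately have "card (ends (p # S)) = Suc (Suc (card (ends S)))"
		by (simp only: card_insert_disjoint finite_insert insert_iff simp_thms)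
	then show ?case using Cons.IH[OF g(1)] by simp
qed (simp add: ends_def)

text \<open>A polynomial of degree less than \<open>2 n\<close> in each variable that vanishes whenever one of \<open>n\<close> strings is
	prolonged at one of its two ends vanishes on all configurations containing these \<open>n\<close> strings; the general
	case is reduced to this one by adjoining further strings, first of length \<open>s\<close>, then shorter ones.\<close>

lemma vanishing_of_strings:
	assumes G: "symp N G" and deg: "\<And>ga. ga \<in> keys G ==> wt (pre 1) ga < 2 * n"
		and S: "genr (map fst S)" "length S \<le> n"
		and H1: "\<And>x A. x \<in> ends S ==> length A + 1 + length (conf S) = N ==> gl G (conf S @ x # A) = 0"
		and H2: "\<And>y A. length A + Suc s + length (conf S) = N ==> gl G (conf S @ str (Suc s) y @ A) = 0"
		and big: "s * (n - length S) + length (conf S) < N"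
		and A: "length A + length (conf S) = N"
	shows "gl G (conf S @ A) = 0"
	using S H1 H2 big A
proof (induction s arbitrary: S A)
	case 0
	then obtain T A' where "A = T # A'" by (cases A) auto
	then show ?case using 0(4)[of A' T] 0(6) by (simp add: str_def)
next
	case (Suc s S A)
	note outer = Suc.IH
	show ?case
		using Suc.prems
	proof (induction "n - length S" arbitrary: S A)
		case 0
		then obtain x A' where A: "A = x # A'" by (cases A) auto
		have len: "length S = n" using 0 by simp
		\<comment> \<open>The \<open>n\<close> strings have 2 n distinct ends, all of them roots of this
		  polynomial in one free variable, whose degree is below 2 n. The case \<open>n = 0\<close>, where
		  natural subtraction spoils the bound, is treated apart.\<close>
		obtain p where p: "degree p \<le> 2 * n - 1" "\<And>y. y ^ 0 * poly p y = gl G (map (%c. c * y) [1] @ (conf S @ A'))"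
		proof -
			have "0 \<le> wt (pre (length [1::complex])) ga \<and> wt (pre (length [1::complex])) ga \<le> 0 + (2 * n - 1)"
				if "ga \<in> keys G" for ga using deg[OF that] by simp
			from gl_poly_scaled[OF this, where as = "conf S @ A'"] show ?thesis using that by blast
		qed
		have pv: "poly p y = gl G (conf S @ y # A')" for y
		proof -
			have "poly p y = gl G (y # conf S @ A')" using p(2)[of y] by simp
			also have "\<dots> = gl G (conf S @ y # A')"
				using 0(7) A by (intro gl_perm[OF G]) auto
			finally show ?thesis .
		qed
		have "wt (pre 1) ga = 0" if "n = 0" "ga \<in> keys G" for ga using deg[OF that(2)] that(1) by simp
		have "p = 0 \<or> n = 0"
		proof (cases "n = 0")
			case False
			then show ?thesis
				using p(1) card_ends[OF 0(2)] 0(4) pv 0(7) A len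
				by (intro disjI1 poly_eq_0_many_roots[of p "ends S"]) auto
		qed simp
		moreover have "gl G (conf S @ x # A') = 0" if "n = 0"
		proof -
			have "keys G = {}" using deg that by fastforce
			then show ?thesis by (simp add: gl_def pev_def)
		qed
		ultimately show ?case using pv[of x] A by auto
	next
		case (Suc k S A)
		have lt: "length S < n" using Suc.hyps(2) by simp
		have gen: "gl G (conf S @ str (Suc s) T @ A') = 0"
			if T: "genr (map fst S @ [T])" and A': "length A' + Suc s + length (conf S) = N" for T A'
		proof -
			let ?S = "S @ [(T, Suc s)]"
			have lenS: "length (conf ?S) = length (conf S) + Suc s" by (simp add: conf_append conf_single)
			\<comment> \<open>A string of length \<open>s + 1\<close> leaves the first summand and enters the
			  second, so the same room for a free variable remains.\<close>
			have big': "Suc s * (n - length ?S) + length (conf ?S) < N"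
			proof -
				have "n - length S = Suc (n - length ?S)" using lt by simp
				then show ?thesis using Suc.prems(5) lenS by (simp add: algebra_simps)
			qed
			have "gl G (conf ?S @ A') = 0"
			proof (rule Suc.hyps(1))
				show "k = n - length ?S" using Suc.hyps(2) by simp
				show "genr (map fst ?S)" using T by simp
				show "length ?S \<le> n" using lt by simp
				show "Suc s * (n - length ?S) + length (conf ?S) < N" by (rule big')
				show "length A' + length (conf ?S) = N" using A' lenS by simp
				fix y and B :: "complex list" assume "length B + Suc (Suc s) + length (conf ?S) = N"
				then show "gl G (conf ?S @ str (Suc (Suc s)) y @ B) = 0"
					using Suc.prems(4)[of "str (Suc s) T @ B" y] lenS
						gl_perm[OF G, of "conf ?S @ str (Suc (Suc s)) y @ B" "conf S @ str (Suc (Suc s)) y @ str (Suc s) T @ B"]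
					by (simp add: conf_append conf_single)
			next
				\<comment> \<open>An end of an old string is covered by hypothesis; an end of the new string
				  makes that string one longer, where the hypothesis on adjoined strings applies.\<close>
				fix x and B :: "complex list" assume x: "x \<in> ends ?S" and B: "length B + 1 + length (conf ?S) = N"
				consider "x \<in> ends S" | "x = t powi int (Suc s) * T" | "x = t powi (- 1) * T"
					using x unfolding ends_append ends_single by blast
				then show "gl G (conf ?S @ x # B) = 0"
				proof cases
					case 1
					then show ?thesis
						using Suc.prems(3)[of x "str (Suc s) T @ B"] lenS B
							gl_perm[OF G, of "conf ?S @ x # B" "conf S @ x # str (Suc s) T @ B"]
						by (simp add: conf_append conf_single)
				next
					case 2
					then have x: "x = t ^ Suc s * T" by (simp only: power_int_of_nat)
					have eq: "conf ?S @ x # B = conf S @ str (Suc (Suc s)) T @ B"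
						by (simp only: conf_append conf_single str_Suc[of "Suc s"] x append_assoc append.simps)
					show ?thesis unfolding eq using Suc.prems(4)[of B T] B lenS by simp
				next
					case 3
					then have "T = t * x" by (simp add: power_int_minus)
					then have m: "mset (conf ?S @ x # B) = mset (conf S @ str (Suc (Suc s)) x @ B)"
						by (simp add: conf_append conf_single str_Suc'[of "Suc s"])
					have "gl G (conf ?S @ x # B) = gl G (conf S @ str (Suc (Suc s)) x @ B)"
						by (rule gl_perm[OF G _ m]) (use B in simp)
					then show ?thesis using Suc.prems(4)[of B x] B lenS by simp
				qed
			qed
			then show ?thesis by (simp add: conf_append conf_single)
		qed
		\<comment> \<open>The value is polynomial in \<open>T\<close>, so genericity of \<open>T\<close>
		  may be dropped. This is the hypothesis on adjoined strings for the next smaller length, and the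
		  outer induction takes over.\<close>
		have all: "gl G (conf S @ str (Suc s) T @ A') = 0" if A': "length A' + Suc s + length (conf S) = N" for T A'
		proof -
			obtain p where p: "\<And>y. poly p y = gl G (map (%f. poly f y)
					(map (%c. [:c:]) (conf S) @ map (%i. [:0, t ^ i:]) [0..<Suc s] @ map (%c. [:c:]) A'))"
				using gl_poly by blast
			have p': "poly p y = gl G (conf S @ str (Suc s) y @ A')" for y
				unfolding p by (simp add: o_def str_def mult.commute)
			have "poly p T = 0"
			proof (rule poly_eq_0_off_countable[OF countable_not_indep[of "map fst S"]])
				fix y assume "y \<notin> {y. y = 0 \<or> (\<exists>x\<in>set (map fst S). \<not> indep y x)}"
				then have "genr (map fst S @ [y])"
					using Suc.prems(1) by (auto simp: genr_append genr_single) (metis indep_sym fst_conv image_eqI)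
				then show "poly p y = 0" unfolding p' by (rule gen[OF _ A'])
			qed
			then show ?thesis by (simp add: p')
		qed
		show ?case
		proof (rule outer)
			show "s * (n - length S) + length (conf S) < N" using Suc.prems(5) by simp
		qed (use Suc.prems all in auto)
	qed
qed

definition cl :: "nat => complex list => complex list"
	where "cl l ys = concat (map (str l) ys)"

lemma cl_append: "cl l (xs @ ys) = cl l xs @ cl l ys" by (simp add: cl_def)
lemma cl_Cons: "cl l (y # ys) = str l y @ cl l ys" by (simp add: cl_def)
lemma cl_Nil: "cl l [] = []" by (simp add: cl_def)
lemma length_cl [simp]: "length (cl l ys) = l * length ys"
	by (induction ys) (simp_all add: cl_def)
lemma conf_cl: "conf (map (%y. (y, l)) ys) = cl l ys"
	by (simp add: conf_def cl_def o_def)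

definition wheel :: "nat => nat => complex mpol => bool"
	where "wheel N l G \<longleftrightarrow> (\<forall>y A. length A + Suc l = N \<longrightarrow> gl G (str (Suc l) y @ A) = 0)"

text \<open>A string of length l together with a value prolonging it at either end is a string of
  length l + 1.\<close>

lemma wheel_ends:
	assumes G: "symp N G" "wheel N l G" and N: "length A + 1 + l * length os = N"
		and y: "y \<in> set os" and x: "x = t ^ l * y \<or> t * x = y"
	shows "gl G (cl l os @ x # A) = 0"
proof -
	obtain o1 o2 where os: "os = o1 @ y # o2" using y by (meson split_list)
	let ?A = "cl l o1 @ cl l o2 @ A"
	have len: "length ?A + Suc l = N" using N by (simp add: os algebra_simps)
	consider "x = t ^ l * y" | "y = t * x" using x by blast
	then obtain z where z: "mset (cl l os @ x # A) = mset (str (Suc l) z @ ?A)"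
	proof cases
		case 1
		then show ?thesis using that[of y] by (simp add: os cl_append cl_Cons str_Suc)
	next
		case 2
		then show ?thesis using that[of x] by (simp add: os cl_append cl_Cons str_Suc')
	qed
	have "gl G (cl l os @ x # A) = gl G (str (Suc l) z @ ?A)"
		by (rule gl_perm[OF G(1) _ z]) (use N in simp)
	also have "\<dots> = 0" using G(2) len unfolding wheel_def by blast
	finally show ?thesis .
qed

text \<open>A symmetric polynomial with the wheel condition restricts, on \<open>n\<close> strings of length \<open>l\<close>, to a multiple
	of \<open>\<Prod>\<^sub>a y\<^sub>a\<^sup>m \<Prod>\<^sub>a\<^sub><\<^sub>b \<Prod>\<^sub>e (y\<^sub>a - t\<^sup>e y\<^sub>b)\<close> with \<open>0 < |e| \<le> l\<close>, so that one value decides whether it vanishes there.\<close>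

lemma wheel_strings:
	assumes G: "symp N G" "wheel N l G" and N: "N = l * n"
		and deg: "\<And>ga. ga \<in> keys G ==> m \<le> wt (pre l) ga \<and> wt (pre l) ga \<le> m + 2 * l * (n - 1)"
		and y0: "length y0 = n" "genr y0" "gl G (cl l y0) = 0"
	shows "k \<le> n ==> length ys = k ==> genr (ys @ y0) ==> gl G (cl l (ys @ drop k y0)) = 0"
proof (induction k arbitrary: ys)
	\<comment> \<open>The strings of \<open>y0\<close> are exchanged for other generic ones one at a
	  time; the exchanged starting point is the variable of the polynomial \<open>p\<close>
	  below.\<close>
	case (Suc k)
	obtain ys' y where ys: "ys = ys' @ [y]" "length ys' = k" using Suc.prems(2) by (cases ys rule: rev_cases) auto
	define os where "os = ys' @ drop (Suc k) y0"
	have k: "k < n" using Suc.prems by simp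
	have dr: "drop k y0 = y0 ! k # drop (Suc k) y0" using y0(1) k by (simp add: Cons_nth_drop_Suc)
	have los: "length os = n - 1" using ys y0(1) k by (simp add: os_def)
	have gs: "genr (ys' @ y0)" using Suc.prems(3) by (auto simp: ys genr_append genr_Cons)
	have sub: "set (drop (Suc k) y0) \<subseteq> set y0" by (rule set_drop_subset)
	have gd: "genr (drop k y0)" using y0(2) genr_append[of "take k y0" "drop k y0"] by simp
	then have gd': "genr (drop (Suc k) y0)" "\<And>b. b \<in> set (drop (Suc k) y0) ==> indep (y0 ! k) b" "y0 ! k \<noteq> 0"
		unfolding dr by (auto simp: genr_def)
	have gos: "genr os" using gs gd'(1) sub by (auto simp: os_def genr_append)
	have ind: "indep (y0 ! k) b" if "b \<in> set os" for b
	proof -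
		have "y0 ! k \<in> set y0" using k y0(1) by simp
		then show ?thesis using that gd'(2) gs indep_sym by (auto simp: os_def genr_append)
	qed
	have perm: "gl G (cl l (ys' @ Y # drop (Suc k) y0)) = gl G (str l Y @ cl l os)" for Y
	proof (rule gl_perm[OF G(1)])
		have "length (ys' @ Y # drop (Suc k) y0) = n" using ys(2) y0(1) k by simp
		then show "length (cl l (ys' @ Y # drop (Suc k) y0)) = N" unfolding length_cl N by simp
	qed (simp add: os_def cl_append cl_Cons)
	obtain p where p: "degree p \<le> 2 * l * (n - 1)" "\<And>Y. Y ^ m * poly p Y = gl G (str l Y @ cl l os)"
	proof -
		have "\<exists>p. degree p \<le> 2 * l * (n - 1) \<and> (\<forall>Y. Y ^ m * poly p Y = gl G (map (%c. c * Y) (map (%i. t ^ i) [0..<l]) @ cl l os))"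
			by (rule gl_poly_scaled) (use deg in simp)
		then show ?thesis using that by (auto simp: str_def o_def)
	qed
	\<comment> \<open>If Y = t^e b with 0 < |e| \<le> l, then the string of Y contains an end of the
	  string of b. This gives 2 l roots for each of the n - 1 other strings.\<close>
	define E where "E = {- int l..- 1} \<union> {1..int l}"
	define R where "R = (%(b, e). t powi e * b) ` (set os \<times> E)"
	have "inj_on (%(b, e). t powi e * b) (set os \<times> E)"
	proof (rule inj_onI, clarify)
		fix b e b' e' assume h: "b \<in> set os" "b' \<in> set os" "t powi e * b = t powi e' * b'"
		have "b = b'"
		proof (rule ccontr)
			assume "b \<noteq> b'"
			have "indep b b'"
			proof -
				obtain i j where ij: "i < length os" "j < length os" "b = os ! i" "b' = os ! j" using h by (metis in_set_conv_nth)
				have "sorted_wrt indep os" using gos by (simp add: genr_def)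
				then show ?thesis using ij \<open>b \<noteq> b'\<close> indep_sym by (metis linorder_neqE_nat sorted_wrt_nth_less)
			qed
			then show False using indep_powi h(3) by blast
		qed
		moreover have "b \<noteq> 0" using gos h(1) by (auto simp: genr_def)
		ultimately show "b = b' \<and> e = e'" using h(3) by (simp add: t_powi_inj)
	qed
	then have "card R = card (set os) * card E" unfolding R_def by (simp add: card_image card_cartesian_product)
	also have "card (set os) = n - 1" using genr_distinct[OF gos] los by (simp add: distinct_card)
	also have "card E = 2 * l" unfolding E_def by (subst card_Un_disjoint) auto
	finally have cR: "card R = 2 * l * (n - 1)" by simp
	have y0R: "y0 ! k \<notin> R"
	proof
		assume "y0 ! k \<in> R"
		then obtain b e where "b \<in> set os" "y0 ! k = t powi e * b" unfolding R_def by auto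
		then show False using ind unfolding indep_def by blast
	qed
	have finR: "finite R" by (simp add: R_def E_def)
	have zR: "poly p Y = 0" if Y: "Y \<in> R" for Y
	proof -
		obtain b e where be: "b \<in> set os" "e \<in> E" "Y = t powi e * b" using Y unfolding R_def by auto
		have b0: "b \<noteq> 0" using gos be(1) by (auto simp: genr_def)
		\<comment> \<open>For e > 0 the entry l - e of the string of Y comes just after the string of b;
		  for e = -d the entry d - 1 comes just before it.\<close>
		obtain i where i: "i < l" "t ^ i * Y = t ^ l * b \<or> t * (t ^ i * Y) = b"
		proof (cases "e > 0")
			case True
			then have e: "e = int (nat e)" "nat e \<le> l" "nat e > 0" using be(2) by (auto simp: E_def)
			then have "Y = t ^ nat e * b" using be(3) by (metis power_int_of_nat)
			then have "t ^ (l - nat e) * Y = t ^ l * b" using e(2) by (simp add: power_add[symmetric] mult.assoc[symmetric])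
			then show ?thesis using that[of "l - nat e"] e by auto
		next
			case False
			define d where "d = nat (- e)"
			have e: "e = - int d" "d \<le> l" "d > 0" using False be(2) by (auto simp: E_def d_def)
			have "t ^ d * Y = b" using be(3) unfolding e(1) by (simp add: power_int_minus)
			then have "t * (t ^ (d - 1) * Y) = b" using e(3) by (metis Suc_diff_1 mult.assoc power_Suc)
			then show ?thesis using that[of "d - 1"] e by auto
		qed
		have "t ^ i * Y \<in> set (str l Y)" using i(1) by (auto simp: str_def)
		then obtain s1 s2 where s: "str l Y = s1 @ (t ^ i * Y) # s2" by (meson split_list)
		have ls: "length s1 + length s2 + 1 = l" using arg_cong[OF s, of length] by simp
		have N': "N = l + l * (n - 1)" using N k by (cases n) auto
		have "gl G (str l Y @ cl l os) = gl G (cl l os @ (t ^ i * Y) # (s1 @ s2))"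
			by (rule gl_perm[OF G(1)]) (use los N' in "simp_all add: s, use ls in simp")
		also have "\<dots> = 0"
			by (rule wheel_ends[OF G _ be(1) i(2)]) (use los N' ls in simp)
		finally have "Y ^ m * poly p Y = 0" by (simp add: p(2))
		then show ?thesis using be(3) b0 by simp
	qed
	have "gl G (cl l (ys' @ drop k y0)) = 0"
		using Suc.IH[OF _ ys(2) gs] k by simp
	then have "(y0 ! k) ^ m * poly p (y0 ! k) = 0" unfolding dr perm p(2) .
	then have "poly p (y0 ! k) = 0" using gd'(3) by simp
	\<comment> \<open>\<open>y0 ! k\<close> is one root more than the degree admits.\<close>
	then have "p = 0"
		using p(1) cR y0R finR zR by (intro poly_eq_0_many_roots[of p "insert (y0 ! k) R"]) auto
	then have "gl G (str l y @ cl l os) = 0" using p(2)[of y] by simp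
	then show ?case using perm[of y] by (simp add: ys)
qed (use y0 in simp)

text \<open>\<open>wheel_strings\<close> treats n full strings. The blocks are then released one by
  one: with \<open>d\<close> free blocks, prolonged ends are handled by the wheel condition and a
  further string of length l by the case d - 1, so \<open>vanishing_of_strings\<close>
  applies.\<close>

lemma wheel_unique:
	assumes G: "symp N G" "wheel N l G" and N: "N = l * n" and l: "l \<ge> 1"
		and keys: "\<And>ga. ga \<in> keys G ==> keys ga \<subseteq> {1..N}"
		and deg1: "\<And>ga. ga \<in> keys G ==> wt (pre 1) ga < 2 * n"
		and degl: "\<And>ga. ga \<in> keys G ==> m \<le> wt (pre l) ga \<and> wt (pre l) ga \<le> m + 2 * l * (n - 1)"
		and y0: "length y0 = n" "genr y0" "gl G (cl l y0) = 0"
	shows "G = 0"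
proof -
	have "d \<le> n ==> length S = n - d ==> genr (S @ y0) ==> length A = l * d ==> gl G (cl l S @ A) = 0" for d S A
	proof (induction d arbitrary: S A)
		case 0
		then show ?case using wheel_strings[OF G N degl y0, of n S] y0(1) by simp
	next
		case (Suc d)
		obtain s where s: "l = Suc s" using l by (cases l) auto
		let ?S = "map (%y. (y, l)) S"
		have fst: "map fst ?S = S" by (simp add: o_def)
		have nS: "n = length S + Suc d" using Suc.prems by simp
		have strings: "gl G (cl l S @ str l T @ A') = 0" if A': "length A' = l * d" for T A'
		proof -
			obtain p where p: "\<And>y. poly p y = gl G (map (%f. poly f y)
					(map (%c. [:c:]) (cl l S) @ map (%i. [:0, t ^ i:]) [0..<l] @ map (%c. [:c:]) A'))"
				using gl_poly by blast
			have p': "poly p y = gl G (cl l S @ str l y @ A')" for y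
				unfolding p by (simp add: o_def str_def mult.commute)
			have "poly p T = 0"
			proof (rule poly_eq_0_off_countable[OF countable_not_indep[of "S @ y0"]])
				fix y assume "y \<notin> {y. y = 0 \<or> (\<exists>x\<in>set (S @ y0). \<not> indep y x)}"
				then have "genr ((S @ [y]) @ y0)"
					using Suc.prems(3) indep_sym by (auto simp: genr_append genr_single genr_Cons)
				then show "poly p y = 0"
					using Suc.IH[of "S @ [y]" A'] A' nS Suc.prems(1) by (simp add: p' cl_append cl_Cons cl_Nil)
			qed
			then show ?thesis by (simp add: p')
		qed
		have "gl G (conf ?S @ A) = 0"
		proof (rule vanishing_of_strings[OF G(1) deg1, where s = s])
			show "genr (map fst ?S)" using Suc.prems(3) unfolding fst by (simp add: genr_append)
			show "length ?S \<le> n" using nS by simp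
			show "s * (n - length ?S) + length (conf ?S) < N" unfolding conf_cl by (simp add: N s nS algebra_simps)
			show "length A + length (conf ?S) = N" unfolding conf_cl using Suc.prems(4) by (simp add: N nS algebra_simps)
		next
			fix x and B :: "complex list" assume x: "x \<in> ends ?S" and B: "length B + 1 + length (conf ?S) = N"
			obtain y where y: "y \<in> set S" "x = t powi int l * y \<or> x = t powi (- 1) * y"
				using x unfolding ends_def by auto
			then have "x = t ^ l * y \<or> t * x = y" by (auto simp: power_int_minus)
			then show "gl G (conf ?S @ x # B) = 0"
				unfolding conf_cl using B by (intro wheel_ends[OF G _ y(1)]) (simp_all add: conf_cl)
		next
			fix y and B :: "complex list" assume B: "length B + Suc s + length (conf ?S) = N"
			then have "length B = l * d" unfolding conf_cl by (simp add: N s nS algebra_simps)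
			then show "gl G (conf ?S @ str (Suc s) y @ B) = 0"
				using strings unfolding conf_cl s by blast
		qed
		then show ?case by (simp only: conf_cl)
	qed
	from this[of n "[]"] have all: "gl G A = 0" if "length A = N" for A
		using that y0(2) N by (simp add: cl_Nil)
	show ?thesis
	proof (rule ev_eq_0_imp)
		fix w
		have "ev w G = gl G (map w [1..<Suc N])"
			unfolding gl_def
		proof (rule pev_cong)
			fix al i assume "al \<in> keys G" "i \<in> keys al"
			then have "i \<in> {1..N}" using keys by blast
			then show "w i = (if i \<in> {1..length (map w [1..<Suc N])} then map w [1..<Suc N] ! (i - 1) else 0)"
				by (auto simp del: upt_Suc)
		qed
		then show "ev w G = 0" using all by (simp del: upt_Suc)
	qed
qed

text \<open>Polynomial dependence on each free value, and finally on y, reduces the condition to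
  distinct values, where the Vandermonde product may be divided out.\<close>

lemma wheelI:
	assumes base: "\<And>y A. length A + Suc l = N ==> distinct (str (Suc l) y @ A) ==> gl G (str (Suc l) y @ A) = 0"
	shows "wheel N l G"
proof -
	have rest: "gl G (str (Suc l) y @ B @ C) = 0"
		if "length B + length C + Suc l = N" "distinct (str (Suc l) y @ B)" for y B C
		using that
	proof (induction C arbitrary: B)
		case Nil
		then show ?case using base[of B y] by simp
	next
		case (Cons c C)
		obtain p where p: "\<And>z. poly p z = gl G (map (%f. poly f z)
				(map (%c. [:c:]) (str (Suc l) y @ B) @ [[:0, 1:]] @ map (%c. [:c:]) C))"
			using gl_poly by blast
		have p': "poly p z = gl G (str (Suc l) y @ B @ z # C)" for z
			unfolding p by (simp add: o_def)
		have "poly p c = 0"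
		proof (rule poly_eq_0_off_countable[of "set (str (Suc l) y @ B)"])
			show "countable (set (str (Suc l) y @ B))" by (rule countable_finite) simp
			fix z assume "z \<notin> set (str (Suc l) y @ B)"
			then show "poly p z = 0"
				using Cons.IH[of "B @ [z]"] Cons.prems by (simp add: p')
		qed
		then show ?case by (simp add: p')
	qed
	show ?thesis
		unfolding wheel_def
	proof (intro allI impI)
		fix y and A :: "complex list" assume N: "length A + Suc l = N"
		obtain p where p: "\<And>z. poly p z = gl G (map (%f. poly f z)
				(map (%i. [:0, t ^ i:]) [0..<Suc l] @ map (%c. [:c:]) A))"
			using gl_poly by blast
		have p': "poly p z = gl G (str (Suc l) z @ A)" for z
			unfolding p by (simp add: o_def str_def mult.commute)
		have "poly p y = 0"
		proof (rule poly_eq_0_off_countable[of "{0}"])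
			fix z :: complex assume z: "z \<notin> {0}"
			have "inj_on (%i. t ^ i * z) {0..<Suc l}"
			proof (rule inj_onI)
				fix i j assume "t ^ i * z = t ^ j * z"
				then have "t powi int i = t powi int j" using z by simp
				then have "int i = int j" unfolding t_powi_inj .
				then show "i = j" by simp
			qed
			then have "distinct (str (Suc l) z)" by (simp add: str_def distinct_map del: upt_Suc)
			then show "poly p z = 0" using rest[of "[]" A z] N by (simp add: p')
		qed simp
		then show "gl G (str (Suc l) y @ A) = 0" by (simp add: p')
	qed
qed

text \<open>If \<open>I\<close> contains an entry of the string but not the next one, its
  coefficient has a factor t x_i - x_(i+1) = 0. Otherwise \<open>I\<close> meets the string in a
  final segment, which multiplication by q moves in front of the rest because q t^(l+1) = 1; the
  shifted point still contains a full string.\<close>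

lemma wheel_Lop:
	assumes G: "symp N G" "wheel N l G" and q: "q * t ^ Suc l = 1"
	shows "wheel N l (Lop kp q t N G)"
proof -
	let ?G = "Lop kp q t N G"
	have base: "gl ?G (str (Suc l) y @ A) = 0" if N: "length A + Suc l = N" and d: "distinct (str (Suc l) y @ A)" for y A
	proof -
		define xs where "xs = str (Suc l) y @ A"
		define x where "x = (%i. if i \<in> {1..N} then xs ! (i - 1) else 0)"
		have lx: "length xs = N" using N by (simp add: xs_def)
		have inj: "inj_on x {1..N}"
			using d lx by (auto simp: inj_on_def x_def xs_def[symmetric] nth_eq_iff_index_eq)
		have xi: "x i = t ^ (i - 1) * y" if "i \<in> {1..Suc l}" for i
			using that N by (auto simp: x_def xs_def str_def nth_append simp del: upt_Suc)
		have "kp (card I) * t ^ (card I choose 2) * crs t I ({1..N} - I) x * ev (shp I q x) G = 0" if I: "I \<in> Pow {1..N}" for I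
		proof (cases "\<exists>i\<in>{1..l}. i \<in> I \<and> Suc i \<notin> I")
			case True
			then obtain i where i: "i \<in> {1..l}" "i \<in> I" "Suc i \<notin> I" by blast
			have "t * x i = x (Suc i)" using i(1) by (subst (1 2) xi) (auto simp: power_eq_if)
			moreover have "Suc i \<in> {1..N} - I" using i N by auto
			ultimately have "(\<Prod>j\<in>{1..N} - I. (t * x i - x j) / (x i - x j)) = 0"
				by (intro prod_zero bexI[of _ "Suc i"]) simp_all
			then have e: "\<exists>i\<in>I. (\<Prod>j\<in>{1..N} - I. (t * x i - x j) / (x i - x j)) = 0"
				using i(2) by (rule bexI)
			have "finite I" using I finite_subset by auto
			then have "crs t I ({1..N} - I) x = 0"
				unfolding crs_def by (rule prod_zero[OF _ e])
			then show ?thesis by simp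
		next
			case False
			\<comment> \<open>The number of string entries outside \<open>I\<close>, which come first; the
			  alternative \<open>i = 0\<close> covers a string contained in \<open>I\<close>.\<close>
			define p where "p = Max {i \<in> {0..Suc l}. i = 0 \<or> i \<notin> I}"
			have pin: "p \<in> {i \<in> {0..Suc l}. i = 0 \<or> i \<notin> I}" unfolding p_def by (rule Max_in) auto
			have up: "i \<in> I" if "p < i" "i \<le> Suc l" for i
			proof (rule ccontr)
				assume "i \<notin> I"
				then have "i \<le> p" unfolding p_def using that by (intro Max_ge) auto
				then show False using that by simp
			qed
			have cl: "i + j \<in> I" if "i \<in> I" "1 \<le> i" "i + j \<le> Suc l" for i j
				using that False by (induction j) auto
			have down: "i \<notin> I" if "1 \<le> i" "i \<le> p" for i
				using cl[of i "p - i"] that pin by auto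
			define zs where "zs = map (shp I q x) [1..<Suc N]"
			have "map (shp I q x) [1..<Suc (Suc l)] = str p y @ str (Suc l - p) (q * t ^ p * y)"
			proof (rule nth_equalityI)
				show "length (map (shp I q x) [1..<Suc (Suc l)]) = length (str p y @ str (Suc l - p) (q * t ^ p * y))"
					using pin by simp
				fix i assume "i < length (map (shp I q x) [1..<Suc (Suc l)])"
				then have i: "i < Suc l" by (simp del: upt_Suc)
				show "map (shp I q x) [1..<Suc (Suc l)] ! i = (str p y @ str (Suc l - p) (q * t ^ p * y)) ! i"
				proof (cases "i < p")
					case True
					then show ?thesis using i down[of "Suc i"]
						by (simp add: shp_def shf_def xi nth_append str_def del: upt_Suc)
				next
					case False
					then have "t ^ i = t ^ (i - p) * t ^ p" by (simp add: power_add[symmetric])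
					then show ?thesis using False i up[of "Suc i"]
						by (simp add: shp_def shf_def xi nth_append str_def del: upt_Suc)
				qed
			qed
			moreover have "[1..<Suc N] = [1..<Suc (Suc l)] @ [Suc (Suc l)..<Suc N]"
				using N upt_add_eq_append[of 1 "Suc (Suc l)" "N - Suc l"] by simp
			ultimately obtain B where B: "zs = str p y @ str (Suc l - p) (q * t ^ p * y) @ B"
				unfolding zs_def by (metis append_assoc map_append)
			have "str (Suc l) (q * t ^ p * y) = str (Suc l - p) (q * t ^ p * y) @ str p y"
			proof -
				have e: "t ^ (Suc l - p) * t ^ p = t ^ Suc l" using pin by (simp add: power_add[symmetric] del: power_Suc)
				have "t ^ (Suc l - p) * (q * t ^ p * y) = (q * (t ^ (Suc l - p) * t ^ p)) * y" by (simp only: mult_ac)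
				also have "\<dots> = y" by (simp only: e q mult_1)
				finally have z: "t ^ (Suc l - p) * (q * t ^ p * y) = y" .
				have "Suc l - p + p = Suc l" using pin by simp
				then show ?thesis using str_add[of "Suc l - p" p "q * t ^ p * y"] by (simp only: z)
			qed
			then have m: "mset zs = mset (str (Suc l) (q * t ^ p * y) @ B)" by (simp add: B)
			have lz: "length zs = N" by (simp add: zs_def)
			then have "length B + Suc l = N" using pin by (simp add: B)
			then have "gl G zs = 0" using gl_perm[OF G(1) lz m] G(2) unfolding wheel_def by simp
			moreover have "gl G zs = ev (shp I q x) G"
				unfolding gl_def lz using I
				by (intro arg_cong[of _ _ "%w. ev w G"]) (auto simp: zs_def fun_eq_iff x_def shp_def simp del: upt_Suc)
			ultimately show ?thesis by simp
		qed
		then have "ev x ?G = 0" unfolding ev_Lop[OF G(1) inj] by (intro sum.neutral) blast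
		then show ?thesis by (simp add: gl_def x_def xs_def[symmetric] lx)
	qed
	show ?thesis by (rule wheelI) (rule base)
qed

end

section \<open>The partition\<close>

lemma concat_blocks:
	"concat (map (%m. map (g m) [0..<l]) [0..<n]) = map (%i. g (i div l) (i mod l)) [0..<l * n]"
proof (induction n)
	case (Suc n)
	have "[0..<l * Suc n] = [0..<l * n] @ map (%j. l * n + j) [0..<l]"
		using upt_add_eq_append[of 0 "l * n" l] map_add_upt[of "l * n" l] by (simp add: add.commute)
	moreover have "map (%j. g ((l * n + j) div l) ((l * n + j) mod l)) [0..<l] = map (g n) [0..<l]"
		by (rule map_cong) auto
	ultimately show ?case using Suc by (simp add: o_def)
qed simp

lemma Y_partition_eq:
	assumes "k \<le> l"
	shows "Y_partition l n k = map (%i. 2 * (n - Suc (i div l)) + (if i mod l < l - k then 1 else 0)) [0..<l * n]"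
proof -
	have b: "replicate (l - k) (2 * (n - m) + 1) @ replicate k (2 * (n - m)) =
			map (%j. 2 * (n - m) + (if j < l - k then 1 else 0)) [0..<l]" for m
		using assms by (intro nth_equalityI) (auto simp: nth_append)
	have s: "[1..<Suc n] = map Suc [0..<n]" by (simp add: map_Suc_upt)
	show ?thesis
		unfolding Y_partition_def b s map_map o_def by (rule concat_blocks)
qed

context
	fixes l n k :: nat
	assumes l: "l \<ge> 1" and n: "n \<ge> 1" and k: "k \<le> l"
begin

abbreviation "YY \<equiv> Y_partition l n k"

lemma length_Y: "length YY = l * n"
	by (simp add: Y_partition_eq[OF k])

lemma Y_nth: "i < l * n ==> YY ! i = 2 * (n - Suc (i div l)) + (if i mod l < l - k then 1 else 0)"
	by (simp add: Y_partition_eq[OF k])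

lemma Y_shift: "i + l < l * n ==> YY ! i = YY ! (i + l) + 2"
proof -
	assume i: "i + l < l * n"
	have "(i + l) div l < n" by (rule less_mult_imp_div_less) (use i in "simp add: mult.commute")
	then show ?thesis using i l by (simp add: Y_nth)
qed

lemma Y_decreasing: "i \<le> j ==> j < l * n ==> YY ! j \<le> YY ! i"
proof -
	assume h: "i \<le> j" "j < l * n"
	have d: "i div l \<le> j div l" using h(1) by (rule div_le_mono)
	have jn: "j div l < n" using h(2) l by (simp add: div_less_iff_less_mult mult.commute)
	show ?thesis
	proof (cases "i div l = j div l")
		case True
		then have "i mod l \<le> j mod l" using h(1) by (metis add_le_cancel_left mult_div_mod_eq)
		then show ?thesis using h True by (simp add: Y_nth)
	next
		case False
		then have "Suc (n - Suc (j div l)) \<le> n - Suc (i div l)" using d jn by linarith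
		then show ?thesis using h by (simp add: Y_nth)
	qed
qed

lemma Y_is_partition: "is_partition (l * n) YY"
	unfolding is_partition_def sorted_wrt_iff_nth_less by (simp add: length_Y Y_decreasing)

lemma Y_shift_iter: "i + d < l * n ==> l * a \<le> d ==> YY ! (i + d) + 2 * a \<le> YY ! i"
proof (induction a arbitrary: i d)
	case (Suc a)
	have "YY ! ((i + l) + (d - l)) + 2 * a \<le> YY ! (i + l)"
		using Suc.prems by (intro Suc.IH) auto
	moreover have "YY ! i = YY ! (i + l) + 2" using Suc.prems by (intro Y_shift) auto
	moreover have "(i + l) + (d - l) = i + d" using Suc.prems(2) by simp
	ultimately show ?case by simp
qed (simp add: Y_decreasing)

text \<open>With \<open>q = t\<^bsup>-(l+1)\<^esup>\<close> the spectral variables are \<open>t\<^bsup>N-1-s\<^esup>\<close> for the following values \<open>s\<close>.\<close>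

definition spec :: "nat list => nat => nat"
	where "spec mu i = Suc l * mu ! i + i"

text \<open>Equal values at i < j with Y_i = Y_j + d force j = i + (l+1) d, but over that distance Y
  falls by at least 2 d.\<close>

lemma spec_Y_inj: "inj_on (spec YY) {..<l * n}"
proof -
	have "False" if "i < j" "j < l * n" "spec YY i = spec YY j" for i j
	proof -
		have e: "Suc l * YY ! i + i = Suc l * YY ! j + j" using that(3) by (simp add: spec_def)
		have "YY ! j \<le> YY ! i" using that by (intro Y_decreasing) auto
		then obtain d where Yi: "YY ! i = YY ! j + d" using le_Suc_ex by blast
		have d: "j = i + Suc l * d" using e unfolding Yi by (simp add: algebra_simps)
		then have "YY ! (i + Suc l * d) + 2 * d \<le> YY ! i" using that by (intro Y_shift_iter) auto
		then have "YY ! j + 2 * d \<le> YY ! j + d" unfolding Yi d[symmetric] .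
		then have "d = 0" by simp
		then show False using d that by simp
	qed
	then show ?thesis by (metis (no_types, lifting) inj_onI lessThan_iff linorder_neqE_nat)
qed

text \<open>At the first index i of difference, \<open>mu\<close> attains the value that Y has at i
  only later, at j = i + (l+1) d with mu_j = Y_i - d. The entry of \<open>mu\<close> before j must
  match some Y_b with b \<ge> i, and the fall of Y by 2 over every l places makes that entry smaller
  than mu_j.\<close>

lemma spec_determines_Y:
	assumes mu: "is_partition (l * n) mu" and eq: "spec mu ` {..<l * n} = spec YY ` {..<l * n}"
	shows "mu = YY"
proof (rule ccontr)
	let ?N = "l * n"
	assume "mu \<noteq> YY"
	have len: "length mu = ?N" using mu by (simp add: is_partition_def)
	have dec: "mu ! j \<le> mu ! i" if "i \<le> j" "j < ?N" for i j
		using mu that unfolding is_partition_def sorted_wrt_iff_nth_less by (cases "i = j") auto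
	have inj: "inj_on (spec mu) {..<?N}"
		using eq spec_Y_inj by (metis card_image eq_card_imp_inj_on finite_lessThan)
	define i where "i = (LEAST i. i < ?N \<and> mu ! i \<noteq> YY ! i)"
	have ex: "\<exists>i. i < ?N \<and> mu ! i \<noteq> YY ! i"
		using \<open>mu \<noteq> YY\<close> len length_Y nth_equalityI by metis
	have i: "i < ?N" "mu ! i \<noteq> YY ! i" using LeastI_ex[OF ex] by (auto simp: i_def)
	have before: "mu ! b = YY ! b" if "b < i" for b
		using not_less_Least[OF that[unfolded i_def]] that i(1) by auto
	have "spec YY i \<in> spec mu ` {..<?N}" using eq i(1) by auto
	then obtain j where j: "j < ?N" "spec mu j = spec YY i" by auto
	have "j \<noteq> i" using j(2) i(2) by (auto simp: spec_def simp del: mult_Suc)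
	moreover have "\<not> j < i"
	proof
		assume "j < i"
		then have "spec YY j = spec YY i" using j before by (simp add: spec_def)
		then show False using inj_onD[OF spec_Y_inj, of j i] \<open>j < i\<close> i(1) by auto
	qed
	ultimately have "i < j" by simp
	have e: "Suc l * mu ! j + j = Suc l * YY ! i + i" using j(2) by (simp add: spec_def)
	have "mu ! j < YY ! i"
	proof (rule ccontr)
		assume "\<not> mu ! j < YY ! i"
		then have "Suc l * YY ! i \<le> Suc l * mu ! j" by (intro mult_le_mono2) simp
		then show False using e \<open>i < j\<close> by linarith
	qed
	from less_imp_add_positive[OF this] obtain d where "0 < d" "mu ! j + d = YY ! i" by blast
	then have Yi: "YY ! i = mu ! j + d" "d > 0" by simp_all
	have jd: "j = i + Suc l * d" using e Yi by (simp add: algebra_simps)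
	define m where "m = j - 1"
	have m: "m < ?N" "i \<le> m" "j = Suc m" using \<open>i < j\<close> j(1) by (auto simp: m_def)
	have "spec mu m \<in> spec YY ` {..<?N}" using eq m(1) by auto
	then obtain b where b: "b < ?N" "spec mu m = spec YY b" by auto
	have "i \<le> b"
	proof (rule ccontr)
		assume "\<not> i \<le> b"
		then have "spec mu b = spec mu m" using b before by (simp add: spec_def)
		then show False using inj_onD[OF inj, of b m] b(1) m \<open>\<not> i \<le> b\<close> by auto
	qed
	define a where "a = b - i"
	have ba: "b = i + a" using \<open>i \<le> b\<close> by (simp add: a_def)
	have "Suc l * mu ! m + m = Suc l * YY ! b + b" using b(2) by (simp add: spec_def)
	then have 1: "Suc l * mu ! m + Suc l * d = Suc l * YY ! b + Suc a"
		using m(3) jd ba by simp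
	\<comment> \<open>Modulo l + 1 the value of \<open>spec\<close> is the index, so b is congruent to
	  m, that is, to i - 1.\<close>
	then have "Suc l dvd Suc a"
		by (metis dvd_add_right_iff dvd_triv_left add_mult_distrib2)
	then obtain a1 where a1: "Suc a = Suc l * Suc a1"
		by (metis Suc_diff_1 dvdE mult_0_right nat.distinct(1) neq0_conv)
	have "mu ! m + d = YY ! b + Suc a1"
	proof -
		have "Suc l * (mu ! m + d) = Suc l * (YY ! b + Suc a1)" using 1 a1 by (simp only: add_mult_distrib2)
		then show ?thesis by (simp only: mult_cancel1) simp
	qed
	moreover have "YY ! (i + a) + 2 * Suc a1 \<le> YY ! i"
		using b(1) ba a1 by (intro Y_shift_iter) auto
	moreover have "mu ! j \<le> mu ! m" using dec[of m j] m j(1) by simp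
	ultimately show False using Yi ba by simp
qed

lemma prod_one_plus: "finite A ==> (\<Prod>i\<in>A. 1 + f i) = (\<Sum>I\<in>Pow A. \<Prod>i\<in>I. f i :: 'a::comm_ring_1)"
	using prod_add[of A f "%_. 1"] by (simp add: add.commute)

text \<open>As a polynomial in c the eigenvalue is a product of linear factors whose roots recover
  the set of values of \<open>spec\<close>. By \<open>spec_determines_Y\<close> the finitely many
  differences from the polynomial of Y are nonzero, so some c is a root of none.\<close>

lemma separating_parameter:
	fixes q t :: complex
	assumes t: "norm t > 1" and q: "q * t ^ Suc l = 1"
	shows "\<exists>c. \<forall>mu\<in>below (l * n) YY - {YY}. eig (%r. c ^ r) q t (l * n) mu \<noteq> eig (%r. c ^ r) q t (l * n) YY"
proof -
	let ?N = "l * n"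
	define z where "z mu i = t ^ (?N - Suc i) * q ^ (mu ! i)" for mu i
	define p where "p mu = (\<Prod>i<?N. [:1, z mu i:])" for mu
	have t0: "t \<noteq> 0" using t by auto
	have eig: "eig (%r. c ^ r) q t ?N mu = poly (p mu) c" for c mu
	proof -
		have "poly (p mu) c = (\<Prod>i<?N. 1 + c * z mu i)" by (simp add: p_def poly_prod)
		also have "\<dots> = (\<Prod>i\<in>{1..?N}. 1 + c * (t ^ (?N - i) * q ^ (mu ! (i - 1))))"
			by (rule prod.reindex_bij_witness[of _ "%i. i - 1" Suc]) (auto simp: z_def)
		also have "\<dots> = eig (%r. c ^ r) q t ?N mu"
			by (simp add: prod_one_plus eig_def prod.distrib)
		finally show ?thesis by simp
	qed
	have zpow: "z mu i = t powi (int ?N - 1 - int (spec mu i))" if "i < ?N" for mu i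
	proof -
		have "q = t powi (- int (Suc l))"
			using q t0 by (simp only: power_int_minus power_int_of_nat) (simp add: field_simps)
		then have "q ^ (mu ! i) = t powi (- int (Suc l) * int (mu ! i))" by (metis power_int_mult power_int_of_nat)
		moreover have "t ^ (?N - Suc i) = t powi (int ?N - 1 - int i)"
		proof -
			have "int ?N - 1 - int i = int (?N - Suc i)" using that by simp
			then show ?thesis by (simp only: power_int_of_nat)
		qed
		ultimately have "z mu i = t powi (int ?N - 1 - int i) * t powi (- int (Suc l) * int (mu ! i))"
			by (simp add: z_def)
		also have "\<dots> = t powi ((int ?N - 1 - int i) + (- int (Suc l) * int (mu ! i)))"
			using t0 by (intro power_int_add[symmetric]) simp
		also have "(int ?N - 1 - int i) + (- int (Suc l) * int (mu ! i)) = int ?N - 1 - int (spec mu i)"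
			by (simp add: spec_def algebra_simps)
		finally show ?thesis .
	qed
	have root: "poly (p mu) (- 1 / t powi (int ?N - 1 - int s)) = 0 \<longleftrightarrow> s \<in> spec mu ` {..<?N}" for mu s
	proof -
		let ?c = "t powi (int ?N - 1 - int s)"
		have c: "?c \<noteq> 0" using t0 by simp
		have "poly (p mu) (- 1 / ?c) = 0 \<longleftrightarrow> (\<exists>i<?N. 1 + (- 1 / ?c) * z mu i = 0)"
			by (auto simp: p_def poly_prod)
		also have "\<dots> \<longleftrightarrow> (\<exists>i<?N. z mu i = ?c)" using c by (auto simp: field_simps)
		also have "\<dots> \<longleftrightarrow> (\<exists>i<?N. spec mu i = s)"
			using zpow t_powi_inj[OF t] by (metis (no_types, lifting) diff_eq_diff_eq diff_left_imp_eq of_nat_eq_iff)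
		finally show ?thesis by auto
	qed
	have ne: "p mu - p YY \<noteq> 0" if "mu \<in> below ?N YY - {YY}" for mu
	proof
		assume "p mu - p YY = 0"
		then have "spec mu ` {..<?N} = spec YY ` {..<?N}" using root[of mu] root[of YY] by auto
		then show False using spec_determines_Y[of mu] that by (auto simp: below_def)
	qed
	define P where "P = (\<Prod>mu\<in>below ?N YY - {YY}. p mu - p YY)"
	have "P \<noteq> 0" unfolding P_def using ne finite_below by (subst prod_zero_iff) auto
	then have "finite {c. poly P c = 0}" by (rule poly_roots_finite)
	then have "{c. poly P c = 0} \<noteq> UNIV" using infinite_UNIV_char_0[where 'a=complex] by metis
	then obtain c where "poly P c \<noteq> 0" by auto
	then have "poly (p mu) c \<noteq> poly (p YY) c" if "mu \<in> below ?N YY - {YY}" for mu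
		using that finite_below[of ?N YY] by (auto simp: P_def poly_prod)
	then show ?thesis unfolding eig by blast
qed

lemma sum_take_Y: "sum_list (take l YY) = 2 * l * (n - 1) + (l - k)"
proof -
	have ln: "l \<le> l * n" using n by simp
	have "take l YY = map (%i. 2 * (n - 1) + (if i < l - k then 1 else 0)) [0..<l]"
	proof (rule nth_equalityI)
		fix i assume "i < length (take l YY)"
		then have i: "i < l" by simp
		then have "i < l * n" using ln by linarith
		then show "take l YY ! i = map (%i. 2 * (n - 1) + (if i < l - k then 1 else 0)) [0..<l] ! i"
			using i by (simp add: Y_nth)
	qed (use ln in "simp add: length_Y")
	moreover have "sum_list (map (%i. 2 * (n - 1) + (if i < l - k then 1 else 0)) [0..<l]) = (\<Sum>i<l. 2 * (n - 1) + (if i < l - k then 1 else 0))"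
		by (simp add: sum_list_distinct_conv_sum_set atLeast0LessThan)
	moreover have "(\<Sum>i<l. if i < l - k then 1 else 0) = l - (k :: nat)"
	proof -
		have "(\<Sum>i<l. if i < l - k then 1 else 0) = (\<Sum>i<l - k. 1 :: nat)"
			by (rule sum.mono_neutral_cong_right) (use k in auto)
		then show ?thesis by simp
	qed
	ultimately show ?thesis by (simp add: sum.distrib)
qed

lemma sum_drop_Y: "sum_list (drop (l * n - l) YY) = l - k"
proof -
	have e: "l * n - l = l * (n - 1)" "l * (n - 1) + l = l * n" using n by (cases n; simp)+
	have "drop (l * n - l) YY = map (%i. if i < l - k then 1 else 0) [0..<l]"
		unfolding e(1)
	proof (rule nth_equalityI)
		show len: "length (drop (l * (n - 1)) YY) = length (map (%i. if i < l - k then 1 else 0) [0..<l])"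
			using e(2) by (simp add: length_Y)
		fix i assume "i < length (drop (l * (n - 1)) YY)"
		then have i: "i < l" using len by simp
		then have "l * (n - 1) + i < l * n" using e(2) by linarith
		moreover have "(l * (n - 1) + i) div l = n - 1" "(l * (n - 1) + i) mod l = i" using i by auto
		ultimately show "drop (l * (n - 1)) YY ! i = map (%i. if i < l - k then 1 else 0) [0..<l] ! i"
			using i by (simp add: Y_nth length_Y)
	qed
	moreover have "sum_list (map (%i. if i < l - k then 1 else 0) [0..<l]) = (\<Sum>i<l. if i < l - k then 1 else 0 :: nat)"
		by (simp add: sum_list_distinct_conv_sum_set atLeast0LessThan)
	moreover have "(\<Sum>i<l. if i < l - k then 1 else 0) = (\<Sum>i<l - k. 1 :: nat)"
		by (rule sum.mono_neutral_cong_right) (use k in auto)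
	ultimately show ?thesis by simp
qed

text \<open>The degree bounds required by \<open>wheel_unique\<close>. The lower one comes from
  symmetry: the reversed exponent is dominated by Y too, which bounds the sum of all entries but the
  first l from above.\<close>

lemma mspan_Y_degrees:
	assumes "mspan (l * n) (below (l * n) YY) G" "ga \<in> keys G"
	shows "keys ga \<subseteq> {1..l * n}" "wt (pre 1) ga < 2 * n"
		"l - k \<le> wt (pre l) ga \<and> wt (pre l) ga \<le> (l - k) + 2 * l * (n - 1)"
proof -
	let ?N = "l * n"
	have ln: "1 \<le> ?N" "l \<le> ?N" using l n by auto
	have sym: "symp ?N G" using assms(1) by (simp add: mspan_def)
	obtain al where al: "ga = mon al" "dominated al YY"
		using assms unfolding mspan_below[OF length_Y] by blast
	have len: "length al = ?N" using al(2) by (simp add: dominated_def length_Y)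
	show "keys ga \<subseteq> {1..?N}" using keys_mon[of al] len by (simp add: al(1))
	have dom: "sum_list (take j al) \<le> sum_list (take j YY)" if "j \<le> ?N" for j
		using al(2) that len by (simp add: dominated_def)
	have "wt (pre 1) ga \<le> sum_list (take 1 YY)" using dom[of 1] ln wt_pre[of 1 al] len by (simp add: al(1))
	also have "\<dots> = YY ! 0" using ln length_Y by (cases YY) auto
	also have "YY ! 0 \<le> 2 * (n - 1) + 1" using ln by (simp add: Y_nth)
	also have "\<dots> < 2 * n" using n by linarith
	finally show "wt (pre 1) ga < 2 * n" .
	have w: "wt (pre l) ga = sum_list (take l al)" using wt_pre[of l al] ln len by (simp add: al(1))
	have "mon (rev al) \<in> keys G"
		using assms(2) symp_lookup[OF sym, of "rev al" al] len by (simp add: in_keys_iff al(1))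
	then obtain bt where bt: "mon (rev al) = mon bt" "dominated bt YY"
		using assms unfolding mspan_below[OF length_Y] by blast
	then have "dominated (rev al) YY" using mon_inject[of "rev al" bt] len by (simp add: dominated_def length_Y)
	then have "sum_list (take (?N - l) (rev al)) \<le> sum_list (take (?N - l) YY)" using len by (simp add: dominated_def)
	moreover have "take (?N - l) (rev al) = rev (drop l al)" using len ln by (simp add: take_rev)
	ultimately have "sum_list (drop l al) \<le> sum_list (take (?N - l) YY)" by simp
	moreover have "sum_list al = sum_list (take l al) + sum_list (drop l al)"
		by (metis append_take_drop_id sum_list_append)
	moreover have "sum_list YY = sum_list (take (?N - l) YY) + sum_list (drop (?N - l) YY)"
		by (metis append_take_drop_id sum_list_append)
	moreover have "sum_list al = sum_list YY" using al(2) by (simp add: dominated_def)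
	ultimately show "l - k \<le> wt (pre l) ga \<and> wt (pre l) ga \<le> (l - k) + 2 * l * (n - 1)"
		using dom[of l] ln w sum_take_Y sum_drop_Y by auto
qed

theorem macdonald_poly_of_wheel:
	fixes q t :: complex
	assumes t: "norm t > 1" and q: "q * t ^ Suc l = 1"
		and F: "mspan (l * n) (below (l * n) YY) F" "wheel t (l * n) l F"
		and y0: "length y0 = n" "genr t y0" "gl F (cl t l y0) \<noteq> 0"
		and nz: "lookup F (mon YY) \<noteq> 0"
	shows "F = scl (lookup F (mon YY)) (macdonald_poly q t (l * n) YY)"
proof -
	let ?N = "l * n"
	obtain c where c: "\<And>mu. mu \<in> below ?N YY - {YY} ==>
			eig (%r. c ^ r) q t ?N mu \<noteq> eig (%r. c ^ r) q t ?N YY"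
		using separating_parameter[OF t q] by blast
	have sym: "symp ?N F" using F(1) by (simp add: mspan_def)
	let ?L = "Lop (%r. c ^ r) q t ?N F"
	\<comment> \<open>The only candidate for an eigenvalue: it makes \<open>G\<close> vanish at the one
	  configuration that decides.\<close>
	define e where "e = gl ?L (cl t l y0) / gl F (cl t l y0)"
	define G where "G = ?L - scl e F"
	have gl_lin: "gl G xs = gl ?L xs - e * gl F xs" for xs
		by (simp add: G_def gl_def rhom_simps[OF rhom_ev] pev_scl[OF rhom_id])
	have span: "mspan ?N (below ?N YY) G"
		unfolding G_def by (intro mspan_simps mspan_below_Lop[OF length_Y] F)
	have "G = 0"
	proof (rule wheel_unique[OF t _ _ refl l])
		show "symp ?N G" using span by (simp add: mspan_def)
		show "wheel t ?N l G"
			using wheel_Lop[OF t sym F(2) q] F(2) unfolding wheel_def[OF t] gl_lin by simp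
		show "gl G (cl t l y0) = 0" using y0(3) by (simp add: gl_lin e_def)
		fix ga assume "ga \<in> keys G"
		note d = mspan_Y_degrees[OF span this]
		show "keys ga \<subseteq> {1..?N}" "wt (pre 1) ga < 2 * n"
			"l - k \<le> wt (pre l) ga \<and> wt (pre l) ga \<le> (l - k) + 2 * l * (n - 1)" by (rule d)+
	qed (use y0 in auto)
	then have "?L = scl e F" by (simp add: G_def)
	then show ?thesis
		by (rule macdonald_poly_eq[OF Y_is_partition F(1) _ nz]) (rule c)
qed

end

section \<open>The symmetric polynomial of the matrix element\<close>

lemma prod_pairs_Suc:
	"(\<Prod>(a, b)\<in>pairs (Suc N). f a b) = (\<Prod>b\<in>{1..N}. f 1 (Suc b)) * (\<Prod>(a, b)\<in>pairs N. f (Suc a) (Suc b) :: 'a::comm_monoid_mult)"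
proof -
	have "pairs (Suc N) = (%b. (1, Suc b)) ` {1..N} \<union> (%(a, b). (Suc a, Suc b)) ` pairs N"
	proof (intro equalityI subsetI)
		fix p assume p: "p \<in> pairs (Suc N)"
		obtain a b where ab: "p = (a, b)" by force
		show "p \<in> (%b. (1, Suc b)) ` {1..N} \<union> (%(a, b). (Suc a, Suc b)) ` pairs N"
		proof (cases "a = 1")
			case True
			then show ?thesis using p ab by (intro UnI1 image_eqI[of _ _ "b - 1"]) (auto simp: pairs_def)
		next
			case False
			then show ?thesis using p ab by (intro UnI2 image_eqI[of _ _ "(a - 1, b - 1)"]) (auto simp: pairs_def)
		qed
	qed (auto simp: pairs_def)
	moreover have "(%b. (1, Suc b)) ` {1..N} \<inter> (%(a, b). (Suc a, Suc b)) ` pairs N = {}"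
		by (auto simp: pairs_def)
	moreover have "inj_on (%b. (1::nat, Suc b)) {1..N}" "inj_on (%(a, b). (Suc a, Suc b)) (pairs N)"
		by (auto simp: inj_on_def)
	ultimately show ?thesis
		by (simp add: prod.union_disjoint prod.reindex split_def)
qed

text \<open>After division by the Vandermonde factor a pair of equal letters has degree 2 and any
  other pair degree 0, and the earlier variable takes it at top degree; hence twice the number of
  later occurrences. The rest is the explicit power of the variable in
  \<open>term_poly\<close>.\<close>

fun bet :: "(nat => nat) => nat list => nat list" where
	"bet kp [] = []"
| "bet kp (x # xs) = (2 * count_list xs x + (1 - kp x)) # bet kp xs"

text \<open>The exponent of Q in the leading coefficient of a term: by \<open>grade_dfac\<close>
  each later letter that is not larger, equality included, contributes one Q.\<close>

fun ginv :: "nat list => nat" where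
	"ginv [] = 0"
| "ginv (x # xs) = length (filter (%y. y \<le> x) xs) + ginv xs"

lemma length_bet [simp]: "length (bet kp xs) = length xs"
	by (induction xs) auto

lemma bet_nth: "i < length xs ==> bet kp xs ! i = 2 * count_list (drop (Suc i) xs) (xs ! i) + (1 - kp (xs ! i))"
proof (induction xs arbitrary: i)
	case (Cons x xs)
	then show ?case by (cases i) auto
qed simp

lemma sum_drop_count:
	"(\<Sum>b\<in>{i<..length xs}. if xs ! (b - 1) = v then 1 else 0) = count_list (drop i xs) v"
proof -
	have c: "count_list ys v = (\<Sum>m<length ys. if ys ! m = v then 1 else 0)" for ys
		by (induction ys) (auto simp: sum.lessThan_Suc_shift simp del: sum.lessThan_Suc)
	show ?thesis unfolding c
		by (rule sum.reindex_bij_witness[of _ "%m. Suc (i + m)" "%b. b - 1 - i"]) auto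
qed

lemma bet_sum:
	assumes "a \<in> {1..length xs}"
	shows "bet kp xs ! (a - 1) = (\<Sum>b\<in>{a<..length xs}. if xs ! (b - 1) = xs ! (a - 1) then 2 else 0) + (1 - kp (xs ! (a - 1)))"
proof -
	have "(\<Sum>b\<in>{a<..length xs}. if xs ! (b - 1) = xs ! (a - 1) then 2 else 0) =
			2 * (\<Sum>b\<in>{a<..length xs}. if xs ! (b - 1) = xs ! (a - 1) then 1 else 0 :: nat)"
		unfolding sum_distrib_left by (intro sum.cong) auto
	also have "\<dots> = 2 * count_list (drop a xs) (xs ! (a - 1))" by (simp only: sum_drop_count)
	finally show ?thesis using assms bet_nth[of "a - 1" xs kp] by auto
qed

lemma sum_pairs_fst:
	"(\<Sum>(a, b)\<in>pairs N. f a b) = (\<Sum>a\<in>{1..N}. \<Sum>b\<in>{a<..N}. f a b :: nat)"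
proof -
	have "pairs N = Sigma {1..N} (%i. {i<..N})" by (auto simp: pairs_def)
	then show ?thesis by (simp add: sum.Sigma)
qed

lemma bet_weight:
	assumes "length xs = N"
	shows "(\<Sum>(a, b)\<in>pairs N. e a * (if xs ! (a - 1) = xs ! (b - 1) then 2 else 0)) +
		(\<Sum>a\<in>{1..N}. e a * (1 - kp (xs ! (a - 1)))) = wt e (mon (bet kp xs))"
proof -
	have "wt e (mon (bet kp xs)) = (\<Sum>a\<in>{1..N}. e a * lookup (mon (bet kp xs)) a)"
		by (rule wt_superset) (use keys_mon[of "bet kp xs"] assms in auto)
	also have "\<dots> = (\<Sum>a\<in>{1..N}. e a * ((\<Sum>b\<in>{a<..N}. if xs ! (b - 1) = xs ! (a - 1) then 2 else 0) + (1 - kp (xs ! (a - 1)))))"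
	proof (intro sum.cong refl)
		fix a assume a: "a \<in> {1..N}"
		then have "lookup (mon (bet kp xs)) a = bet kp xs ! (a - 1)"
			using assms by (simp add: lookup_mon)
		moreover have "bet kp xs ! (a - 1) = (\<Sum>b\<in>{a<..N}. if xs ! (b - 1) = xs ! (a - 1) then 2 else 0) + (1 - kp (xs ! (a - 1)))"
			using bet_sum[of a xs kp] a unfolding assms by blast
		ultimately show "e a * lookup (mon (bet kp xs)) a =
			e a * ((\<Sum>b\<in>{a<..N}. if xs ! (b - 1) = xs ! (a - 1) then 2 else 0) + (1 - kp (xs ! (a - 1))))"
			by (simp only:)
	qed
	also have "\<dots> = (\<Sum>a\<in>{1..N}. \<Sum>b\<in>{a<..N}. e a * (if xs ! (a - 1) = xs ! (b - 1) then 2 else 0)) +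
			(\<Sum>a\<in>{1..N}. e a * (1 - kp (xs ! (a - 1))))"
		unfolding distrib_left sum.distrib sum_distrib_left
		by (intro arg_cong2[where f = "(+)"] sum.cong refl arg_cong2[where f = "(*)"]) auto
	finally show ?thesis by (simp only: sum_pairs_fst)
qed

text \<open>Read from the right, the occurrences of a letter see 0, 1, 2, ... equal letters behind
  them, so the multiset depends on the multiplicities only.\<close>

lemma mset_bet:
	assumes "finite X" "set xs \<subseteq> X"
	shows "mset (bet kp xs) = (\<Sum>x\<in>X. image_mset (%p. 2 * p + (1 - kp x)) (mset_set {..<count_list xs x}))"
	using assms(2)
proof (induction xs)
	case (Cons x xs)
	then have x: "x \<in> X" by simp
	have "(\<Sum>z\<in>X. image_mset (%p. 2 * p + (1 - kp z)) (mset_set {..<count_list (x # xs) z})) =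
			(\<Sum>z\<in>X. (if z = x then {#2 * count_list xs x + (1 - kp x)#} else {#}) +
				image_mset (%p. 2 * p + (1 - kp z)) (mset_set {..<count_list xs z}))"
		by (intro sum.cong refl) (auto simp: lessThan_Suc)
	also have "\<dots> = {#2 * count_list xs x + (1 - kp x)#} + mset (bet kp xs)"
		using Cons assms(1) x by (simp add: sum.distrib sum.delta)
	finally show ?case by simp
qed simp

text \<open>The factor of a pair f^i(x) f^j(y), x being the earlier variable, combined with the
  prefactor (y - Q x)/(y - x) and multiplied by x - y; see \<open>pfac_eq\<close>.\<close>

definition dfac :: "'a::comm_ring_1 => nat => nat => 'a => 'a => 'a"
	where "dfac Q i j x y = (if i = j then (x - Q * y) * (Q * x - y) * (x - y)
		else if i < j then x - Q * y else Q * x - y)"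

lemma dfac_anti: "dfac Q j i y x = - dfac Q i j x y"
	by (simp add: dfac_def algebra_simps)

lemma rhom_dfac: "rhom h ==> h (dfac Q i j x y) = dfac (h Q) i j (h x) (h y)"
	by (simp add: dfac_def rhom_simps)

section \<open>Words assigning tensor factors to variables, and the polynomial F\<close>

locale level_data =
	fixes l n k :: nat and ks :: "nat list" and Q t :: complex
	assumes l1: "l \<ge> 1" and n1: "n \<ge> 1" and kl: "k \<le> l"
		and ksl: "length ks = l" and ks01: "set ks \<subseteq> {0, 1}" and ksum: "sum_list ks = k"
		and tQ: "t = inverse Q" and tn: "norm t > 1"
begin

definition kp :: "nat => nat" where "kp x = ks ! (x - 1)"

lemma kp01: "x \<in> {1..l} ==> kp x = 0 \<or> kp x = 1"
proof -
	assume "x \<in> {1..l}"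
	then have "ks ! (x - 1) \<in> set ks" using ksl by (intro nth_mem) auto
	then show ?thesis using ks01 by (auto simp: kp_def)
qed

lemma card_ones: "card {x \<in> {1..l}. kp x = 1} = k"
proof -
	have "k = (\<Sum>i<l. ks ! i)" using ksum ksl by (simp add: sum_list_sum_nth atLeast0LessThan)
	also have "\<dots> = (\<Sum>x\<in>{1..l}. kp x)"
		by (rule sum.reindex_bij_witness[of _ "%x. x - 1" Suc]) (auto simp: kp_def)
	also have "\<dots> = (\<Sum>x\<in>{1..l}. if kp x = 1 then 1 else 0)"
		by (intro sum.cong refl) (use kp01 in force)
	also have "\<dots> = card {x \<in> {1..l}. kp x = 1}" by (simp add: sum.If_cases Int_def)
	finally show ?thesis by simp
qed

lemma card_zeros: "card {x \<in> {1..l}. kp x = 0} = l - k"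
proof -
	have e: "{x \<in> {1..l}. kp x = 0} = {1..l} - {x \<in> {1..l}. kp x = 1}" using kp01 by force
	have "card ({1..l} - {x \<in> {1..l}. kp x = 1}) = card {1..l} - card {x \<in> {1..l}. kp x = 1}"
		by (rule card_Diff_subset) auto
	then show ?thesis unfolding e card_ones by simp
qed

text \<open>Charge balance: E^n raises the charge of every tensor factor by 2 n and f^i lowers the
  i-th one by 2, so between equal vectors only words with every letter n times contribute.\<close>

definition assigns :: "nat list set"
	where "assigns = {xs. set xs \<subseteq> {1..l} \<and> length xs = l * n \<and> (\<forall>x\<in>{1..l}. count_list xs x = n)}"

lemma finite_assigns: "finite assigns"
	by (rule finite_subset[OF _ finite_lists_length_eq[of "{1..l}" "l * n"]]) (auto simp: assigns_def)

lemma mset_bet_assigns: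
	assumes "xs \<in> assigns"
	shows "mset (bet kp xs) = mset (Y_partition l n k)"
proof -
	have "mset (bet kp xs) = (\<Sum>x\<in>{1..l}. image_mset (%p. 2 * p + (1 - kp x)) (mset_set {..<n}))"
		using assms by (subst mset_bet[of "{1..l}"]) (auto simp: assigns_def)
	also have "\<dots> = (\<Sum>x\<in>{1..l}. \<Sum>p<n. {#2 * p + (1 - kp x)#})"
	proof (intro sum.cong refl)
		fix x
		show "image_mset (%p. 2 * p + (1 - kp x)) (mset_set {..<n}) = (\<Sum>p<n. {#2 * p + (1 - kp x)#})"
			by (induction n) (simp_all add: lessThan_Suc)
	qed
	also have "\<dots> = (\<Sum>p<n. \<Sum>x\<in>{1..l}. {#2 * p + (1 - kp x)#})" by (rule sum.swap)
	also have "\<dots> = (\<Sum>p<n. replicate_mset (l - k) (2 * p + 1) + replicate_mset k (2 * p))"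
	proof (intro sum.cong refl)
		fix p
		have split: "{1..l} = {x \<in> {1..l}. kp x = 0} \<union> {x \<in> {1..l}. kp x = 1}" using kp01 by blast
		have c: "(\<Sum>x\<in>A. {#v#}) = replicate_mset (card A) v" if "finite A" for A :: "nat set" and v :: nat
			using that by (induction A rule: finite_induct) auto
		have "(\<Sum>x\<in>{1..l}. {#2 * p + (1 - kp x)#}) =
			(\<Sum>x\<in>{x \<in> {1..l}. kp x = 0}. {#2 * p + 1#}) + (\<Sum>x\<in>{x \<in> {1..l}. kp x = 1}. {#2 * p#})"
			by (subst split, subst sum.union_disjoint) auto
		then show "(\<Sum>x\<in>{1..l}. {#2 * p + (1 - kp x)#}) = replicate_mset (l - k) (2 * p + 1) + replicate_mset k (2 * p)"
			by (simp add: c card_ones[simplified] card_zeros[simplified])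
	qed
	also have "\<dots> = mset (Y_partition l n k)"
	proof -
		have "mset (concat (map f [1..<Suc m])) = (\<Sum>j\<in>{1..m}. mset (f j))" for f :: "nat => nat list" and m
			by (induction m) (simp_all add: add.commute)
		then have "mset (Y_partition l n k) = (\<Sum>m\<in>{1..n}. replicate_mset (l - k) (2 * (n - m) + 1) + replicate_mset k (2 * (n - m)))"
			by (simp add: Y_partition_def)
		also have "\<dots> = (\<Sum>p<n. replicate_mset (l - k) (2 * p + 1) + replicate_mset k (2 * p))"
			by (rule sum.reindex_bij_witness[of _ "%p. n - p" "%m. n - m"]) auto
		finally show ?thesis by simp
	qed
	finally show ?thesis .
qed

text \<open>Up to a power of \<open>q\<close>, the contribution of the assignment \<open>xs\<close> of the summands \<open>f\<^sup>1, \<dots>, f\<^sup>l\<close> to the variables, with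
	the denominators \<open>w\<^sub>a - w\<^sub>b\<close> cleared; its leading exponent is \<open>bet kp xs\<close>.\<close>

definition term_poly :: "nat list => complex mpol"
	where "term_poly xs = (\<Prod>(a, b)\<in>pairs (l * n). dfac (single 0 Q) (xs ! (a - 1)) (xs ! (b - 1)) (var a) (var b))
		* (\<Prod>a\<in>{1..l * n}. var a ^ (1 - kp (xs ! (a - 1))))"

definition RF :: "complex mpol" where "RF = (\<Sum>xs\<in>assigns. term_poly xs)"

text \<open>Transposing two variables together with the letters at their places reverses the sign of
  the product of \<open>dfac\<close>, and the transposed words run through \<open>assigns\<close>
  again.\<close>

lemma RF_antisymmetric:
	assumes ab: "a \<in> {1..l * n}" "b \<in> {1..l * n}" "a < b"
	shows "subst (%i. var (Transposition.transpose a b i)) RF = - RF"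
proof -
	let ?t = "Transposition.transpose a b" and ?N = "l * n"
	let ?s = "subst (%i. var (?t i)) :: complex mpol => _"
	have perm: "?t permutes {1..?N}" using ab by (intro permutes_swap_id) auto
	define p where "p xs = map (%i. xs ! (?t i - 1)) [1..<Suc ?N]" for xs :: "nat list"
	have p_nth: "p xs ! (i - 1) = xs ! (?t i - 1)" if "i \<in> {1..?N}" for xs i
		using that by (auto simp: p_def simp del: upt_Suc)
	have tr: "?t i \<in> {1..?N}" if "i \<in> {1..?N}" for i using permutes_in_image[OF perm, of i] that by blast
	have lp: "length (p xs) = ?N" for xs by (simp add: p_def del: upt_Suc)
	have pp: "p (p xs) = xs" if "length xs = ?N" for xs
	proof (rule nth_equalityI)
		fix i assume "i < length (p (p xs))"
		then have i: "Suc i \<in> {1..?N}" by (simp add: lp)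
		show "p (p xs) ! i = xs ! i" using p_nth[OF i, of "p xs"] p_nth[OF tr[OF i], of xs] by simp
	qed (simp add: lp that)
	have mp: "mset (p xs) = mset xs" if "length xs = ?N" for xs
	proof -
		have "mset (p xs) = image_mset (%i. xs ! (i - 1)) (image_mset ?t (mset_set {1..?N}))"
			by (simp add: p_def atLeastLessThanSuc_atLeastAtMost multiset.map_comp o_def del: upt_Suc)
		also have "image_mset ?t (mset_set {1..?N}) = mset_set {1..?N}"
			using perm by (simp add: image_mset_mset_set permutes_inj_on permutes_image)
		also have "image_mset (%i. xs ! (i - 1)) (mset_set {1..?N}) = mset (map (%i. xs ! (i - 1)) [1..<Suc ?N])"
			by (simp add: atLeastLessThanSuc_atLeastAtMost del: upt_Suc)
		also have "map (%i. xs ! (i - 1)) [1..<Suc ?N] = xs"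
			using that by (simp add: list_eq_iff_nth_eq del: upt_Suc)
		finally show ?thesis .
	qed
	have pin: "p xs \<in> assigns" if "xs \<in> assigns" for xs
		using that mp[of xs] unfolding assigns_def
		by (auto simp: lp) (metis atLeastAtMost_iff in_mono mset_eq_setD, metis mset_eq_setD atLeastAtMost_iff in_mono,
			metis atLeastAtMost_iff count_mset)
	have bij: "bij_betw p assigns assigns"
		by (rule bij_betw_byWitness[of _ p]) (use pp pin in "auto simp: assigns_def")
	have "?s (term_poly (p xs)) = - term_poly xs" if "xs \<in> assigns" for xs
	proof -
		let ?g = "%i j. dfac (single 0 Q) (xs ! (i - 1)) (xs ! (j - 1)) (var i) (var j :: complex mpol)"
		have c: "?s (single 0 Q) = single 0 Q"
			by (simp add: subst_def pev_single rhom_single0)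
		have "(\<Prod>(i, j)\<in>pairs ?N. ?s (dfac (single 0 Q) (p xs ! (i - 1)) (p xs ! (j - 1)) (var i) (var j))) =
			(\<Prod>(i, j)\<in>pairs ?N. ?g (?t i) (?t j))"
		proof (intro prod.cong refl)
			fix z assume z: "z \<in> pairs ?N"
			obtain i j where ij: "z = (i, j)" by force
			have "i \<in> {1..?N}" "j \<in> {1..?N}" using z ij by (auto simp: pairs_def)
			then show "(case z of (i, j) => ?s (dfac (single 0 Q) (p xs ! (i - 1)) (p xs ! (j - 1)) (var i) (var j))) =
				(case z of (i, j) => ?g (?t i) (?t j))"
				by (simp only: ij split_conv rhom_dfac[OF rhom_subst] c p_nth subst_var)
		qed
		also have "\<dots> = - (\<Prod>(i, j)\<in>pairs ?N. ?g i j)"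
			by (rule prod_pairs_transpose[OF ab]) (rule dfac_anti)
		finally have 1: "(\<Prod>(i, j)\<in>pairs ?N. ?s (dfac (single 0 Q) (p xs ! (i - 1)) (p xs ! (j - 1)) (var i) (var j))) =
			- (\<Prod>(i, j)\<in>pairs ?N. ?g i j)" .
		have "(\<Prod>i\<in>{1..?N}. ?s (var i ^ (1 - kp (p xs ! (i - 1))))) = (\<Prod>i\<in>{1..?N}. var (?t i) ^ (1 - kp (xs ! (?t i - 1))))"
			by (intro prod.cong refl) (simp add: rhom_simps[OF rhom_subst] p_nth del: One_nat_def)
		also have "\<dots> = (\<Prod>i\<in>{1..?N}. var i ^ (1 - kp (xs ! (i - 1))))"
			by (rule prod.permute[OF perm, unfolded o_def, symmetric])
		finally have 2: "(\<Prod>i\<in>{1..?N}. ?s (var i ^ (1 - kp (p xs ! (i - 1))))) = (\<Prod>i\<in>{1..?N}. var i ^ (1 - kp (xs ! (i - 1))))" .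
		show ?thesis
			unfolding term_poly_def rhom_simps(4)[OF rhom_subst] rhom_prod[OF rhom_subst] 2
			using 1 by (simp add: split_def)
	qed
	then have "(\<Sum>xs\<in>assigns. ?s (term_poly (p xs))) = - RF"
		by (simp add: RF_def sum_negf)
	moreover have "(\<Sum>xs\<in>assigns. ?s (term_poly (p xs))) = (\<Sum>xs\<in>assigns. ?s (term_poly xs))"
		by (rule sum.reindex_bij_betw[OF bij])
	ultimately show ?thesis by (simp add: RF_def rhom_sum[OF rhom_subst])
qed

definition FF :: "complex mpol" where "FF = (SOME G. RF = vdm (l * n) var * G)"

lemma RF_FF: "RF = vdm (l * n) var * FF"
proof -
	have "vdm (l * n) var dvd RF" by (rule vdm_dvd_antisymmetric) (rule RF_antisymmetric)
	then show ?thesis unfolding FF_def dvd_def by (rule someI_ex)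
qed

lemma symp_FF: "symp (l * n) FF"
	by (rule symp_quotient) (simp only: RF_FF[symmetric] RF_antisymmetric)

lemma grade_dfac:
	fixes x y :: "complex mpol" and i j :: nat
	assumes ge: "grade e x = monom x dx" "grade e y = monom y dy" "dy \<le> dx"
	defines "D \<equiv> dfac (single 0 Q) i j x y"
	shows "degree (grade e D) \<le> dx + dx * (if i = j then 2 else 0)"
		"dy < dx ==> coeff (grade e D) (dx + dx * (if i = j then 2 else 0)) =
			(if j \<le> i then single 0 Q else 1) * x ^ (1 + (if i = j then 2 else 0))"
proof -
	let ?Q = "single 0 Q :: complex mpol"
	have gQ: "grade e ?Q = [:?Q:]" by (simp add: grade_single wt_def monom_0)
	have g1: "grade e (x - ?Q * y) = monom x dx - smult ?Q (monom y dy)"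
		"grade e (?Q * x - y) = smult ?Q (monom x dx) - monom y dy"
		"grade e (x - y) = monom x dx - monom y dy"
		by (simp_all add: rhom_simps[OF rhom_grade] gQ ge)
	have d: "degree (grade e (x - ?Q * y)) \<le> dx" "degree (grade e (?Q * x - y)) \<le> dx" "degree (grade e (x - y)) \<le> dx"
		unfolding g1 smult_monom using ge(3)
		by (auto intro!: degree_diff_le intro: order_trans[OF degree_monom_le])
	have c: "dy < dx ==> coeff (grade e (x - ?Q * y)) dx = x" "dy < dx ==> coeff (grade e (?Q * x - y)) dx = ?Q * x"
		"dy < dx ==> coeff (grade e (x - y)) dx = x"
		unfolding g1 smult_monom by simp_all
	have d2: "degree (grade e ((x - ?Q * y) * (?Q * x - y))) \<le> dx + dx"
		using d(1,2) degree_mult_le[of "grade e (x - ?Q * y)" "grade e (?Q * x - y)"] by (simp add: rhom_simps(4)[OF rhom_grade])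
	have d3: "degree (grade e ((x - ?Q * y) * (?Q * x - y) * (x - y))) \<le> (dx + dx) + dx"
		using d2 d(3) degree_mult_le[of "grade e ((x - ?Q * y) * (?Q * x - y))" "grade e (x - y)"]
		by (simp add: rhom_simps(4)[OF rhom_grade])
	show "degree (grade e D) \<le> dx + dx * (if i = j then 2 else 0)"
		unfolding D_def dfac_def using d d3 by (simp add: mult_2_right)
	assume lt: "dy < dx"
	have "coeff (grade e ((x - ?Q * y) * (?Q * x - y) * (x - y))) ((dx + dx) + dx) = (x * (?Q * x)) * x"
		unfolding rhom_simps(4)[OF rhom_grade, of _ "(x - ?Q * y) * (?Q * x - y)"] coeff_mult_bounded[OF d2 d(3)]
		unfolding rhom_simps(4)[OF rhom_grade, of _ "x - ?Q * y"] coeff_mult_bounded[OF d(1,2)]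
		by (simp add: c lt)
	moreover have "(x * (?Q * x)) * x = ?Q * x ^ 3" by (simp add: power3_eq_cube mult_ac)
	moreover have "dx + dx * 2 = (dx + dx) + dx" by simp
	ultimately have same: "coeff (grade e ((x - ?Q * y) * (?Q * x - y) * (x - y))) (dx + dx * 2) = ?Q * x ^ 3"
		by (simp only:)
	consider "i = j" | "i < j" | "j < i" by linarith
	then show "coeff (grade e D) (dx + dx * (if i = j then 2 else 0)) =
			(if j \<le> i then ?Q else 1) * x ^ (1 + (if i = j then 2 else 0))"
	proof cases
		case 1
		then show ?thesis using same by (simp add: D_def dfac_def power3_eq_cube)
	next
		case 2
		then show ?thesis using c(1)[OF lt] by (simp add: D_def dfac_def)
	next
		case 3
		then show ?thesis using c(2)[OF lt] by (simp add: D_def dfac_def)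
	qed
qed

text \<open>The bound allows ties among the weights, as the gradings that express dominance have
  them; the top coefficient is computed for strictly decreasing weights, where each factor has a
  single leading term.\<close>

lemma term_poly_grade:
	assumes xs: "xs \<in> assigns" and e: "\<And>i j. (i, j) \<in> pairs (l * n) ==> e j \<le> e i"
	shows "degree (grade e (term_poly xs)) \<le> vdeg e (l * n) + wt e (mon (bet kp xs))"
		"(\<And>i j. (i, j) \<in> pairs (l * n) ==> e j < e i) ==>
			coeff (grade e (term_poly xs)) (vdeg e (l * n) + wt e (mon (bet kp xs))) =
				(\<Prod>(i, j)\<in>pairs (l * n). var i) * single (mon (bet kp xs)) (\<Prod>(i, j)\<in>pairs (l * n). if xs ! (j - 1) \<le> xs ! (i - 1) then Q else 1)"
proof -
	let ?N = "l * n" and ?Q = "single 0 Q :: complex mpol"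
	let ?same = "%a b. if xs ! (a - 1) = xs ! (b - 1) then 2 else (0::nat)"
	have len: "length xs = ?N" using xs by (simp add: assigns_def)
	let ?D = "%p. dfac ?Q (xs ! (fst p - 1)) (xs ! (snd p - 1)) (var (fst p)) (var (snd p))"
	have dD: "degree (grade e (?D p)) \<le> e (fst p) + e (fst p) * ?same (fst p) (snd p)" if "p \<in> pairs ?N" for p
		using grade_dfac(1)[OF grade_var grade_var, of e "snd p" "fst p"] e[of "fst p" "snd p"] that by auto
	have 1: "degree (\<Prod>p\<in>pairs ?N. grade e (?D p)) \<le> (\<Sum>p\<in>pairs ?N. e (fst p) + e (fst p) * ?same (fst p) (snd p)) \<and>
		coeff (\<Prod>p\<in>pairs ?N. grade e (?D p)) (\<Sum>p\<in>pairs ?N. e (fst p) + e (fst p) * ?same (fst p) (snd p)) =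
		(\<Prod>p\<in>pairs ?N. coeff (grade e (?D p)) (e (fst p) + e (fst p) * ?same (fst p) (snd p)))"
		by (rule coeff_prod_bounded) (rule dD)
	have gp: "grade e (var a ^ m) = monom (var a ^ m) (e a * m)" for a m
		by (simp add: rhom_simps[OF rhom_grade] grade_var monom_power')
	have 2: "degree (\<Prod>a\<in>{1..?N}. grade e (var a ^ (1 - kp (xs ! (a - 1)))) :: complex mpol poly) \<le> (\<Sum>a\<in>{1..?N}. e a * (1 - kp (xs ! (a - 1)))) \<and>
		coeff (\<Prod>a\<in>{1..?N}. grade e (var a ^ (1 - kp (xs ! (a - 1)))) :: complex mpol poly) (\<Sum>a\<in>{1..?N}. e a * (1 - kp (xs ! (a - 1)))) =
		(\<Prod>a\<in>{1..?N}. coeff (grade e (var a ^ (1 - kp (xs ! (a - 1))))) (e a * (1 - kp (xs ! (a - 1)))))"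
		by (rule coeff_prod_bounded) (unfold gp, rule degree_monom_le)
	have v: "(\<Sum>p\<in>pairs ?N. e (fst p) + e (fst p) * ?same (fst p) (snd p)) + (\<Sum>a\<in>{1..?N}. e a * (1 - kp (xs ! (a - 1)))) =
		vdeg e ?N + wt e (mon (bet kp xs))"
	proof -
		have "(\<Sum>p\<in>pairs ?N. e (fst p)) = vdeg e ?N"
			unfolding vdeg_def by (intro sum.cong refl) (use e in "auto simp: max_absorb1")
		moreover have "(\<Sum>p\<in>pairs ?N. e (fst p) * ?same (fst p) (snd p)) + (\<Sum>a\<in>{1..?N}. e a * (1 - kp (xs ! (a - 1)))) = wt e (mon (bet kp xs))"
			using bet_weight[OF len, of e kp] by (simp add: split_def)
		ultimately show ?thesis by (simp add: sum.distrib)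
	qed
	have g: "grade e (term_poly xs) = (\<Prod>p\<in>pairs ?N. grade e (?D p)) * (\<Prod>a\<in>{1..?N}. grade e (var a ^ (1 - kp (xs ! (a - 1)))))"
		by (simp add: term_poly_def rhom_simps(4)[OF rhom_grade] rhom_prod[OF rhom_grade] split_def)
	show "degree (grade e (term_poly xs)) \<le> vdeg e ?N + wt e (mon (bet kp xs))"
		unfolding g v[symmetric] by (rule order_trans[OF degree_mult_le]) (use 1 2 in "intro add_mono; blast")
	assume lt: "\<And>i j. (i, j) \<in> pairs ?N ==> e j < e i"
	have "coeff (grade e (term_poly xs)) (vdeg e ?N + wt e (mon (bet kp xs))) =
		(\<Prod>p\<in>pairs ?N. coeff (grade e (?D p)) (e (fst p) + e (fst p) * ?same (fst p) (snd p))) *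
		(\<Prod>a\<in>{1..?N}. coeff (grade e (var a ^ (1 - kp (xs ! (a - 1))))) (e a * (1 - kp (xs ! (a - 1)))))"
		unfolding g v[symmetric] using 1 2 by (subst coeff_mult_bounded) auto
	also have "(\<Prod>a\<in>{1..?N}. coeff (grade e (var a ^ (1 - kp (xs ! (a - 1))))) (e a * (1 - kp (xs ! (a - 1))))) =
		(\<Prod>a\<in>{1..?N}. var a ^ (1 - kp (xs ! (a - 1))))"
		by (intro prod.cong refl) (simp add: gp)
	also have "(\<Prod>p\<in>pairs ?N. coeff (grade e (?D p)) (e (fst p) + e (fst p) * ?same (fst p) (snd p))) =
		(\<Prod>p\<in>pairs ?N. (if xs ! (snd p - 1) \<le> xs ! (fst p - 1) then ?Q else 1) * (var (fst p) * var (fst p) ^ ?same (fst p) (snd p)))"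
	proof (intro prod.cong refl)
		fix p assume p: "p \<in> pairs ?N"
		then have "e (snd p) < e (fst p)" using lt[of "fst p" "snd p"] by simp
		then show "coeff (grade e (?D p)) (e (fst p) + e (fst p) * ?same (fst p) (snd p)) =
			(if xs ! (snd p - 1) \<le> xs ! (fst p - 1) then ?Q else 1) * (var (fst p) * var (fst p) ^ ?same (fst p) (snd p))"
			using grade_dfac(2)[OF grade_var grade_var, of e "snd p" "fst p" "xs ! (fst p - 1)" "xs ! (snd p - 1)"] by simp
	qed
	also have "\<dots> = (\<Prod>p\<in>pairs ?N. if xs ! (snd p - 1) \<le> xs ! (fst p - 1) then ?Q else 1) * ((\<Prod>p\<in>pairs ?N. var (fst p)) *
			(\<Prod>p\<in>pairs ?N. var (fst p) ^ ?same (fst p) (snd p)))"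
		by (simp add: prod.distrib)
	also have "(\<Prod>p\<in>pairs ?N. if xs ! (snd p - 1) \<le> xs ! (fst p - 1) then ?Q else 1) =
			single 0 (\<Prod>p\<in>pairs ?N. if xs ! (snd p - 1) \<le> xs ! (fst p - 1) then Q else 1)"
		unfolding rhom_prod[OF rhom_single0] by (intro prod.cong) auto
	finally have c: "coeff (grade e (term_poly xs)) (vdeg e ?N + wt e (mon (bet kp xs))) =
		single 0 (\<Prod>p\<in>pairs ?N. if xs ! (snd p - 1) \<le> xs ! (fst p - 1) then Q else 1) *
		((\<Prod>p\<in>pairs ?N. var (fst p)) * ((\<Prod>p\<in>pairs ?N. var (fst p) ^ ?same (fst p) (snd p)) *
			(\<Prod>a\<in>{1..?N}. var a ^ (1 - kp (xs ! (a - 1))))))"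
		by (simp only: mult.assoc)
	have "(\<Prod>p\<in>pairs ?N. var (fst p) ^ ?same (fst p) (snd p)) * (\<Prod>a\<in>{1..?N}. var a ^ (1 - kp (xs ! (a - 1)))) =
			single (mon (bet kp xs)) (1::complex)"
	proof -
		have "pairs ?N = Sigma {1..?N} (%i. {i<..?N})" by (auto simp: pairs_def)
		then have "(\<Prod>p\<in>pairs ?N. var (fst p) ^ ?same (fst p) (snd p)) =
			(\<Prod>a\<in>{1..?N}. \<Prod>b\<in>{a<..?N}. var a ^ ?same a b :: complex mpol)"
			by (simp add: prod.Sigma split_def)
		also have "\<dots> = (\<Prod>a\<in>{1..?N}. var a ^ (\<Sum>b\<in>{a<..?N}. ?same a b))"
			by (simp only: power_sum)
		finally have "(\<Prod>p\<in>pairs ?N. var (fst p) ^ ?same (fst p) (snd p)) * (\<Prod>a\<in>{1..?N}. var a ^ (1 - kp (xs ! (a - 1)))) =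
			(\<Prod>a\<in>{1..?N}. var a ^ ((\<Sum>b\<in>{a<..?N}. ?same a b) + (1 - kp (xs ! (a - 1)))) :: complex mpol)"
			by (simp add: prod.distrib power_add)
		also have "\<dots> = (\<Prod>a\<in>{1..?N}. var a ^ lookup (mon (bet kp xs)) a)"
		proof (intro prod.cong refl)
			fix a assume a: "a \<in> {1..?N}"
			have "lookup (mon (bet kp xs)) a = bet kp xs ! (a - 1)"
				using a len by (simp add: lookup_mon)
			also have "\<dots> = (\<Sum>b\<in>{a<..?N}. if xs ! (b - 1) = xs ! (a - 1) then 2 else 0) + (1 - kp (xs ! (a - 1)))"
				using bet_sum[of a xs kp] a unfolding len by blast
			also have "(\<Sum>b\<in>{a<..?N}. if xs ! (b - 1) = xs ! (a - 1) then 2 else 0) = (\<Sum>b\<in>{a<..?N}. ?same a b)"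
				by (intro sum.cong refl) auto
			finally show "var a ^ ((\<Sum>b\<in>{a<..?N}. ?same a b) + (1 - kp (xs ! (a - 1)))) =
				(var a ^ lookup (mon (bet kp xs)) a :: complex mpol)" by (simp only:)
		qed
		also have "\<dots> = monv var (mon (bet kp xs))"
			by (rule monv_superset[symmetric]) (use keys_mon[of "bet kp xs"] len in auto)
		finally show ?thesis by (simp only: monv_var)
	qed
	then show "coeff (grade e (term_poly xs)) (vdeg e ?N + wt e (mon (bet kp xs))) =
		(\<Prod>(i, j)\<in>pairs ?N. var i) * single (mon (bet kp xs)) (\<Prod>(i, j)\<in>pairs ?N. if xs ! (j - 1) \<le> xs ! (i - 1) then Q else 1)"
		unfolding c by (simp add: split_def mult.left_commute[of "single 0 _"] mult_single)
qed

text \<open>The leading exponents of all terms are permutations of Y, and partial sums are largest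
  in decreasing order; the degree bounds of \<open>mspan_below_iff\<close> follow after division by
  the Vandermonde product.\<close>

lemma mspan_FF: "mspan (l * n) (below (l * n) (Y_partition l n k)) FF"
proof -
	let ?N = "l * n" and ?Y = "Y_partition l n k"
	note Ylen = length_Y[OF l1 n1 kl]
	have Ypart: "sorted_wrt (\<ge>) ?Y" using Y_is_partition[OF l1 n1 kl] by (simp add: is_partition_def)
	have deg: "degree (grade e FF) \<le> d"
		if e: "\<And>i j. (i, j) \<in> pairs ?N ==> e j \<le> e i" and d: "\<And>xs. xs \<in> assigns ==> wt e (mon (bet kp xs)) \<le> d" for e d
	proof (rule degree_grade_quotient[of e ?N])
		show "degree (grade e (vdm ?N var * FF)) \<le> vdeg e ?N + d"
			unfolding RF_FF[symmetric] RF_def rhom_sum[OF rhom_grade]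
			by (intro degree_sum_le finite_assigns order_trans[OF term_poly_grade(1)]) (use e d in auto)
	qed
	have len: "length (bet kp xs) = ?N" if "xs \<in> assigns" for xs using that by (simp add: assigns_def)
	have "homog ?N (sum_list ?Y) FF"
	proof (rule homog_quotient[OF vdm_var_nonzero homog_vdm])
		have "homog ?N (card (pairs ?N) + sum_list ?Y) (term_poly xs)" if xs: "xs \<in> assigns" for xs
		proof -
			have lx: "length xs = ?N" using xs by (simp add: assigns_def)
			have hQ: "homog ?N 0 (single 0 Q)" by (auto simp: homog_def wt_def)
			have hD: "homog ?N (1 + (if i = j then 2 else 0)) (dfac (single 0 Q) i j (var a) (var b))"
				if "a \<in> {1..?N}" "b \<in> {1..?N}" for i j a b
			proof -
				have v: "homog ?N 1 (var a :: complex mpol)" "homog ?N 1 (var b :: complex mpol)"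
					by (rule homog_simps(8)[OF that(1)], rule homog_simps(8)[OF that(2)])
				have Qv: "homog ?N 1 (single 0 Q * var a)" "homog ?N 1 (single 0 Q * var b)"
					using homog_simps(1)[OF hQ v(1)] homog_simps(1)[OF hQ v(2)] by simp_all
				have h: "homog ?N 1 (var a - single 0 Q * var b)" "homog ?N 1 (single 0 Q * var a - var b)"
					"homog ?N 1 (var a - var b :: complex mpol)"
					by (rule homog_simps(3)[OF v(1) Qv(2)], rule homog_simps(3)[OF Qv(1) v(2)], rule homog_simps(3)[OF v])
				show ?thesis
					using homog_simps(1)[OF homog_simps(1)[OF h(1,2)] h(3)] h by (simp add: dfac_def numeral_3_eq_3)
			qed
			have "homog ?N m (var a ^ m :: complex mpol)" if a: "a \<in> {1..?N}" for a m
			proof (induction m)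
				case (Suc m)
				show ?case using homog_simps(1)[OF homog_simps(8)[OF a] Suc] by simp
			qed (simp add: homog_simps(6))
			then have "homog ?N ((\<Sum>p\<in>pairs ?N. 1 + (if xs ! (fst p - 1) = xs ! (snd p - 1) then 2 else 0)) +
					(\<Sum>a\<in>{1..?N}. 1 - kp (xs ! (a - 1)))) (term_poly xs)"
				unfolding term_poly_def split_def
				by (intro homog_simps(1) homog_prod hD) (auto simp: pairs_def)
			moreover have "(\<Sum>p\<in>pairs ?N. 1 + (if xs ! (fst p - 1) = xs ! (snd p - 1) then 2 else 0)) +
					(\<Sum>a\<in>{1..?N}. 1 - kp (xs ! (a - 1))) = card (pairs ?N) + sum_list ?Y"
			proof -
				have "(\<Sum>(a, b)\<in>pairs ?N. pre ?N a * (if xs ! (a - 1) = xs ! (b - 1) then 2 else 0)) +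
					(\<Sum>a\<in>{1..?N}. pre ?N a * (1 - kp (xs ! (a - 1)))) = wt (pre ?N) (mon (bet kp xs))"
					by (rule bet_weight[OF lx])
				also have "\<dots> = sum_list (bet kp xs)" using wt_pre[of ?N "bet kp xs"] lx by simp
				also have "\<dots> = sum_list ?Y" using mset_bet_assigns[OF xs] by (metis sum_mset_sum_list)
				finally have "(\<Sum>(a, b)\<in>pairs ?N. pre ?N a * (if xs ! (a - 1) = xs ! (b - 1) then 2 else 0)) +
					(\<Sum>a\<in>{1..?N}. pre ?N a * (1 - kp (xs ! (a - 1)))) = sum_list ?Y" .
				moreover have "(\<Sum>(a, b)\<in>pairs ?N. pre ?N a * (if xs ! (a - 1) = xs ! (b - 1) then 2 else 0)) =
					(\<Sum>p\<in>pairs ?N. if xs ! (fst p - 1) = xs ! (snd p - 1) then 2 else 0)"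
					by (intro sum.cong refl) (auto simp: pairs_def pre_def)
				moreover have "(\<Sum>a\<in>{1..?N}. pre ?N a * (1 - kp (xs ! (a - 1)))) = (\<Sum>a\<in>{1..?N}. 1 - kp (xs ! (a - 1)))"
					by (intro sum.cong refl) (auto simp: pre_def)
				ultimately show ?thesis by (simp only: sum.distrib) simp
			qed
			ultimately show ?thesis by simp
		qed
		then show "homog ?N (card (pairs ?N) + sum_list ?Y) (vdm ?N var * FF)"
			unfolding RF_FF[symmetric] RF_def by (rule homog_sum)
	qed
	moreover have "degree (grade (pre j) FF) \<le> sum_list (take j ?Y)" if "j \<le> ?N" for j
	proof (rule deg)
		fix xs assume xs: "xs \<in> assigns"
		show "wt (pre j) (mon (bet kp xs)) \<le> sum_list (take j ?Y)"
			using that len[OF xs] sum_take_le_sorted[OF mset_bet_assigns[OF xs] Ypart] by (simp add: wt_pre)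
	qed (auto simp: pairs_def pre_def)
	moreover have "degree (grade (%i. if i = m then 1 else 0) FF) \<le> 0" if "m \<notin> {1..?N}" for m
	proof (rule deg)
		fix xs assume "xs \<in> assigns"
		then have "m \<notin> keys (mon (bet kp xs))" using keys_mon[of "bet kp xs"] len that by auto
		then show "wt (%i. if i = m then 1 else 0) (mon (bet kp xs)) \<le> 0" by (auto simp: wt_def intro!: sum.neutral)
	qed (use that in "auto simp: pairs_def")
	ultimately show ?thesis unfolding mspan_below_iff[OF Ylen symp_FF] by blast
qed

text \<open>Words whose \<open>bet\<close> is another permutation of Y have a strictly smaller
  \<open>psum\<close> and do not reach the top degree of the stair grading.\<close>

lemma FF_leading:
	"lookup FF (mon (Y_partition l n k)) =
		(\<Sum>xs\<in>{xs \<in> assigns. bet kp xs = Y_partition l n k}. \<Prod>(i, j)\<in>pairs (l * n). if xs ! (j - 1) \<le> xs ! (i - 1) then Q else 1)"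
proof -
	let ?N = "l * n" and ?Y = "Y_partition l n k" and ?e = "stair (l * n)"
	let ?V = "\<Prod>(i, j)\<in>pairs ?N. var i :: complex mpol"
	let ?c = "%xs. \<Prod>(i, j)\<in>pairs ?N. if xs ! (j - 1) \<le> xs ! (i - 1) then Q else 1"
	note Ylen = length_Y[OF l1 n1 kl]
	have Ypart: "sorted_wrt (\<ge>) ?Y" using Y_is_partition[OF l1 n1 kl] by (simp add: is_partition_def)
	have dec: "?e j < ?e i" if "(i, j) \<in> pairs ?N" for i j using that by (auto simp: pairs_def stair_def)
	have V: "coeff (grade ?e (vdm ?N (var :: nat => complex mpol))) (vdeg ?e ?N) = ?V"
		using grade_vdm_scv(2)[of ?e ?N "%_. 1 :: complex"] unfolding scv_1
		by (auto intro!: prod.cong simp: split_def dest: dec)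
	have "coeff (grade ?e (vdm ?N var * FF)) (vdeg ?e ?N + psum ?Y) = ?V * single (mon ?Y) (lookup FF (mon ?Y))"
		unfolding rhom_simps(4)[OF rhom_grade]
		by (subst coeff_mult_bounded) (simp_all add: degree_grade_vdm mspan_stair[OF Ylen mspan_FF] V)
	moreover have "coeff (grade ?e (term_poly xs)) (vdeg ?e ?N + psum ?Y) =
			(if bet kp xs = ?Y then ?V * single (mon ?Y) (?c xs) else 0)" if xs: "xs \<in> assigns" for xs
	proof -
		have lb: "length (bet kp xs) = ?N" using xs by (simp add: assigns_def)
		have w: "wt ?e (mon (bet kp xs)) = psum (bet kp xs)" by (rule wt_stair[OF lb])
		have dom: "dominated (bet kp xs) ?Y"
			unfolding dominated_def using mset_bet_assigns[OF xs] sum_take_le_sorted[OF mset_bet_assigns[OF xs] Ypart] lb Ylen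
			by (auto simp: sum_mset_sum_list[symmetric])
		show ?thesis
		proof (cases "bet kp xs = ?Y")
			case True
			then show ?thesis using term_poly_grade(2)[OF xs, of ?e] dec w by (simp add: less_imp_le)
		next
			case False
			then have "psum (bet kp xs) < psum ?Y" using dominated_psum[OF dom] order_le_neq_trans by blast
			then have "degree (grade ?e (term_poly xs)) < vdeg ?e ?N + psum ?Y"
				using term_poly_grade(1)[OF xs, of ?e] dec w by (simp add: less_imp_le)
			then show ?thesis using False by (simp add: coeff_eq_0)
		qed
	qed
	ultimately have "?V * single (mon ?Y) (lookup FF (mon ?Y)) =
			(\<Sum>xs\<in>assigns. if bet kp xs = ?Y then ?V * single (mon ?Y) (?c xs) else 0)"
		unfolding RF_FF[symmetric] RF_def rhom_sum[OF rhom_grade] coeff_sum by simp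
	also have "\<dots> = (\<Sum>xs\<in>{xs \<in> assigns. bet kp xs = ?Y}. ?V * single (mon ?Y) (?c xs))"
		by (rule sum.inter_filter[symmetric]) (rule finite_assigns)
	also have "\<dots> = ?V * single (mon ?Y) (\<Sum>xs\<in>{xs \<in> assigns. bet kp xs = ?Y}. ?c xs)"
		by (simp only: sum_distrib_left[symmetric] single_sum)
	finally have "?V * single (mon ?Y) (lookup FF (mon ?Y)) =
		?V * single (mon ?Y) (\<Sum>xs\<in>{xs \<in> assigns. bet kp xs = ?Y}. ?c xs)" .
	moreover have "?V \<noteq> 0"
	proof -
		have "var i \<noteq> (0 :: complex mpol)" for i by (metis lookup_single_eq lookup_zero var_def zero_neq_one)
		moreover have "finite (pairs ?N)" by simp
		ultimately show ?thesis by (simp only: prod_zero_iff split_def) blast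
	qed
	ultimately have "single (mon ?Y) (lookup FF (mon ?Y)) =
		single (mon ?Y) (\<Sum>xs\<in>{xs \<in> assigns. bet kp xs = ?Y}. ?c xs)"
		using mult_left_cancel[of ?V "single (mon ?Y) (lookup FF (mon ?Y))"] by blast
	then have "lookup (single (mon ?Y) (lookup FF (mon ?Y))) (mon ?Y) =
		lookup (single (mon ?Y) (\<Sum>xs\<in>{xs \<in> assigns. bet kp xs = ?Y}. ?c xs)) (mon ?Y)"
		by (simp only:)
	then show ?thesis by (simp only: lookup_single_eq)
qed

end

context level_data
begin

lemma Q_eq: "Q = inverse t" "t * Q = 1" "Q * t = 1" "Q \<noteq> 0" "t \<noteq> 0" "Q \<noteq> t"
proof -
	show t0: "t \<noteq> 0" using tn by auto
	show Q: "Q = inverse t" by (simp add: tQ)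
	show "t * Q = 1" "Q * t = 1" "Q \<noteq> 0" using t0 by (simp_all add: Q)
	have "norm Q < 1" using tn by (simp add: Q norm_inverse inverse_less_1_iff)
	then show "Q \<noteq> t" using tn by auto
qed

lemma ev_term_poly:
	"ev x (term_poly xs) = (\<Prod>(a, b)\<in>pairs (l * n). dfac Q (xs ! (a - 1)) (xs ! (b - 1)) (x a) (x b))
		* (\<Prod>a\<in>{1..l * n}. x a ^ (1 - kp (xs ! (a - 1))))"
proof -
	have c: "ev x (single 0 Q) = Q" by (simp add: pev_single[OF rhom_id])
	show ?thesis
		unfolding term_poly_def rhom_simps(4)[OF rhom_ev] rhom_prod[OF rhom_ev]
		by (intro arg_cong2[where f = "(*)"] prod.cong refl)
			(auto simp: rhom_dfac[OF rhom_ev] c pev_var[OF rhom_id] rhom_simps(7)[OF rhom_ev] simp del: One_nat_def)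
qed

text \<open>Along a string \<open>x\<^sub>a = Q x\<^bsub>a+1\<^esub>\<close>, so a term survives only if the assignment strictly decreases.\<close>

lemma ev_term_poly_nonzero_string:
	assumes "ev x (term_poly xs) \<noteq> 0" "a \<in> {1..<l * n}" "x (Suc a) = t * x a"
	shows "xs ! a < xs ! (a - 1)"
proof (rule ccontr)
	assume "\<not> xs ! a < xs ! (a - 1)"
	moreover have "x a = Q * x (Suc a)" using assms(3) Q_eq by simp
	ultimately have "dfac Q (xs ! (a - 1)) (xs ! (Suc a - 1)) (x a) (x (Suc a)) = 0"
		by (auto simp: dfac_def)
	moreover have "(a, Suc a) \<in> pairs (l * n)" using assms(2) by (auto simp: pairs_def)
	moreover have "finite (pairs (l * n))" by simp
	ultimately have "(\<Prod>(a, b)\<in>pairs (l * n). dfac Q (xs ! (a - 1)) (xs ! (b - 1)) (x a) (x b)) = 0"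
		by (intro prod_zero) (auto intro!: bexI[of _ "(a, Suc a)"] simp del: One_nat_def)
	with assms(1) show False unfolding ev_term_poly by simp
qed

lemma ev_RF: "ev x RF = (\<Sum>xs\<in>assigns. ev x (term_poly xs))"
	by (simp add: RF_def rhom_sum[OF rhom_ev])

lemma ev_RF_FF: "ev x RF = vdm (l * n) x * ev x FF"
	unfolding RF_FF rhom_simps(4)[OF rhom_ev] by (simp add: rhom_vdm[OF rhom_ev] pev_var[OF rhom_id])

lemma wheel_FF: "wheel t (l * n) l FF"
proof (rule wheelI[OF tn])
	fix y A assume len: "length A + Suc l = l * n" and dis: "distinct (str t (Suc l) y @ A)"
	let ?zs = "str t (Suc l) y @ A"
	define x where "x i = (if i \<in> {1..length ?zs} then ?zs ! (i - 1) else 0)" for i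
	have lz: "length ?zs = l * n" using len tn by simp
	have step: "x (Suc a) = t * x a" if "a \<in> {1..l}" for a
		using that tn by (auto simp: x_def str_def nth_append simp del: upt_Suc)
			(cases a, auto simp: mult.assoc)
	have "ev x (term_poly xs) = 0" if xs: "xs \<in> assigns" for xs
	proof (rule ccontr)
		assume nz: "ev x (term_poly xs) \<noteq> 0"
		have dec: "xs ! a < xs ! (a - 1)" if "a \<in> {1..l}" for a
			by (rule ev_term_poly_nonzero_string[OF nz _ step[OF that]]) (use that len in auto)
		\<comment> \<open>Starting from at most l, strict decrease over l + 1 letters would have to reach
		  0.\<close>
		have "xs ! a + a \<le> l" if "a \<le> l" for a
			using that
		proof (induction a)
			case 0
			have "xs ! 0 \<in> set xs" using xs l1 n1 by (intro nth_mem) (auto simp: assigns_def)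
			then show ?case using xs by (auto simp: assigns_def)
		next
			case (Suc a)
			then show ?case using dec[of "Suc a"] by simp
		qed
		then have "xs ! l = 0" by force
		moreover have "xs ! l \<in> set xs"
		proof (rule nth_mem)
			have "length xs = l * n" using xs by (simp add: assigns_def)
			then show "l < length xs" using len by linarith
		qed
		ultimately show False using xs by (auto simp: assigns_def)
	qed
	then have "vdm (l * n) x * ev x FF = 0" unfolding ev_RF_FF[symmetric] ev_RF by simp
	moreover have "vdm (l * n) x \<noteq> 0"
	proof -
		have "inj_on x {1..l * n}"
		proof (rule inj_onI)
			fix i j assume ij: "i \<in> {1..l * n}" "j \<in> {1..l * n}" "x i = x j"
			then have "?zs ! (i - 1) = ?zs ! (j - 1)" using lz by (simp add: x_def)
			then have "i - 1 = j - 1" using ij lz by (subst (asm) nth_eq_iff_index_eq[OF dis]) auto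
			then show "i = j" using ij by auto
		qed
		then show ?thesis by (simp add: vdm_eq_0_iff)
	qed
	ultimately show "gl FF ?zs = 0" by (simp add: gl_def x_def[abs_def])
qed

lemma exists_genr: "\<exists>ys. length ys = m \<and> genr t ys"
proof (induction m)
	case 0
	show ?case by (intro exI[of _ "[]"]) (simp add: genr_def[OF tn])
next
	case (Suc m)
	then obtain ys where ys: "length ys = m" "genr t ys" by blast
	have "uncountable (UNIV :: complex set)"
		by (metis uncountable_UNIV_complex)
	then obtain y where "y \<notin> {y. y = 0 \<or> (\<exists>x\<in>set ys. \<not> indep t y x)}"
		using countable_not_indep[OF tn, of ys] by (metis UNIV_eq_I)
	then show ?case using ys by (intro exI[of _ "y # ys"]) (auto simp: genr_Cons[OF tn])
qed

text \<open>The only word that decreases strictly along each of n strings of length l.\<close>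

definition desc :: "nat list" where "desc = concat (replicate n (rev [1..<Suc l]))"

lemma desc_eq: "desc = map (%p. l - p mod l) [0..<l * n]"
proof -
	have "rev [1..<Suc l] = map (%i. l - i) [0..<l]"
		by (rule nth_equalityI) (auto simp: rev_nth simp del: upt_Suc)
	then have "desc = concat (map (%m. map (%i. l - i) [0..<l]) [0..<n])"
		by (simp add: desc_def map_replicate_const)
	then show ?thesis using concat_blocks[of "%_ i. l - i" l n] by simp
qed

lemma desc_assigns: "desc \<in> assigns"
proof -
	have c: "count_list (concat (replicate m (rev [1..<Suc l]))) x = m" if "x \<in> {1..l}" for x m
	proof (induction m)
		case (Suc m)
		have "count_list (rev [1..<Suc l]) x = count (mset [1..<Suc l]) x" by (metis count_mset mset_rev)
		also have "\<dots> = 1" using that by (simp add: atLeastLessThanSuc_atLeastAtMost del: upt_Suc)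
		finally show ?case using Suc by (simp del: upt_Suc)
	qed simp
	show ?thesis
		unfolding assigns_def
	proof (intro CollectI conjI ballI)
		show "set desc \<subseteq> {1..l}" by (auto simp: desc_def)
		show "length desc = l * n" by (simp add: desc_eq)
		show "count_list desc x = n" if "x \<in> {1..l}" for x using c[OF that] by (simp only: desc_def)
	qed
qed

lemma cl_nth: "length ys = n ==> cl t l ys = map (%p. t ^ (p mod l) * ys ! (p div l)) [0..<l * n]"
proof -
	assume ys: "length ys = n"
	have "cl t l ys = concat (map (%m. map (%i. t ^ i * ys ! m) [0..<l]) [0..<n])"
		unfolding cl_def[OF tn] str_def[OF tn] ys[symmetric] by (subst map_nth[symmetric, of ys]) (simp only: map_map o_def)
	then show ?thesis using concat_blocks[of "%m i. t ^ i * ys ! m" l n] by simp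
qed

text \<open>A strictly decreasing sequence of l letters in {1..l} is l, ..., 1, so a single term
  survives at generic strings; its factors are nonzero, within a string because powers of t differ
  and across strings by genericity.\<close>

lemma FF_generic_nonzero:
	assumes ys: "length ys = n" "genr t ys"
	shows "gl FF (cl t l ys) \<noteq> 0"
proof -
	let ?N = "l * n"
	define x where "x i = (if i \<in> {1..?N} then cl t l ys ! (i - 1) else 0)" for i
	have x: "x (Suc p) = t ^ (p mod l) * ys ! (p div l)" if "p < ?N" for p
		using that ys by (simp add: x_def cl_nth)
	have y0: "ys ! m \<noteq> 0" if "m < n" for m
		using ys that by (metis genr_def[OF tn] nth_mem)
	have div: "p div l < n" if "p < ?N" for p using that by (simp add: less_mult_imp_div_less mult.commute)
	have ind: "t powi a * ys ! m \<noteq> t powi b * ys ! m'" if "m < n" "m' < n" "m \<noteq> m'" for m m' a b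
	proof -
		have "indep t (ys ! m) (ys ! m')" if "m < m'" "m' < n" for m m'
			using ys that by (auto simp: genr_def[OF tn] sorted_wrt_iff_nth_less)
		then have "indep t (ys ! m) (ys ! m')" using that indep_sym[OF tn] by (metis linorder_neqE_nat)
		then show ?thesis by (rule indep_powi[OF tn])
	qed
	have one: "xs = desc" if xs: "xs \<in> assigns" and nz: "ev x (term_poly xs) \<noteq> 0" for xs
	proof -
		have len: "length xs = ?N" using xs by (simp add: assigns_def)
		have range: "xs ! p \<in> {1..l}" if "p < ?N" for p
			using xs that len nth_mem[of p xs] by (auto simp: assigns_def simp del: nth_mem)
		have dec: "xs ! Suc p < xs ! p" if "Suc p < ?N" "Suc (p mod l) < l" for p
		proof -
			have m: "Suc p mod l = Suc (p mod l)" using that by (simp add: mod_Suc)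
			have d: "Suc p div l = p div l" using that by (simp add: div_Suc m)
			have "x (Suc (Suc p)) = t * x (Suc p)" using that x[of p] x[of "Suc p"] by (simp add: m d)
			from ev_term_poly_nonzero_string[OF nz _ this] that show ?thesis by simp
		qed
		have eq: "xs ! (l * m + i) = l - i" if m: "m < n" and i: "i < l" for m i
		proof -
			have bd: "l * m + j < ?N" if "j < l" for j
			proof -
				have "l * m + j < l * Suc m" using that by simp
				also have "\<dots> \<le> ?N" using m by (intro mult_le_mono2) auto
				finally show ?thesis .
			qed
			have up: "xs ! (l * m + j) + j \<le> l" if "j < l" for j
				using that
			proof (induction j)
				case 0
				show ?case using range[OF bd[of 0]] l1 by simp
			next
				case (Suc j)
				then show ?case using dec[of "l * m + j"] bd[of "Suc j"] by simp
			qed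
			have low: "j < xs ! (l * m + (l - 1 - j))" if "j < l" for j
				using that
			proof (induction j)
				case 0
				show ?case using range[OF bd[of "l - 1"]] l1 by simp
			next
				case (Suc j)
				define i where "i = l - 1 - Suc j"
				have i: "l - 1 - j = Suc i" "Suc i < l" using Suc.prems by (auto simp: i_def)
				have "Suc (l * m + i) < ?N" using bd[of "Suc i"] i by simp
				moreover have "Suc ((l * m + i) mod l) < l" using i by simp
				ultimately have "xs ! Suc (l * m + i) < xs ! (l * m + i)" by (rule dec)
				moreover have "l - 1 - Suc j = i" by (simp only: i_def)
				moreover have "j < xs ! (l * m + Suc i)" using Suc.IH Suc.prems unfolding i(1) by linarith
				ultimately show ?case by simp
			qed
			show ?thesis using up[OF i] low[of "l - 1 - i"] i by simp
		qed
		show ?thesis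
		proof (rule nth_equalityI)
			fix p assume "p < length xs"
			then have p: "p < ?N" by (simp add: len)
			have "p mod l < l" using l1 by (intro mod_less_divisor) auto
			then show "xs ! p = desc ! p" using eq[OF div[OF p], of "p mod l"] p by (simp add: desc_eq)
		qed (simp add: len desc_eq)
	qed
	have "ev x (term_poly desc) \<noteq> 0"
	proof -
		have "dfac Q (desc ! p) (desc ! p') (x (Suc p)) (x (Suc p')) \<noteq> 0" if pp: "p < p'" "p' < ?N" for p p'
		proof -
			have px: "x (Suc p) = t powi (int (p mod l)) * ys ! (p div l)" "x (Suc p') = t powi (int (p' mod l)) * ys ! (p' div l)"
				"Q * x (Suc p) = t powi (int (p mod l) - 1) * ys ! (p div l)" "Q * x (Suc p') = t powi (int (p' mod l) - 1) * ys ! (p' div l)"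
				using x[of p] x[of p'] pp Q_eq(5) by (simp_all add: Q_eq(1) power_int_diff field_simps)
			show ?thesis
			proof (cases "p div l = p' div l")
				case True
				have pm: "p = l * (p div l) + p mod l" "p' = l * (p' div l) + p' mod l" by simp_all
				have lt: "p mod l < p' mod l" using pp pm True by (metis add_less_cancel_left)
				have "p' mod l < l" using l1 by (intro mod_less_divisor) auto
				then have "desc ! p' < desc ! p" using lt pp by (simp add: desc_eq)
				then have "dfac Q (desc ! p) (desc ! p') (x (Suc p)) (x (Suc p')) = Q * x (Suc p) - x (Suc p')"
					by (simp add: dfac_def)
				also have "\<dots> = (t powi (int (p mod l) - 1) - t powi int (p' mod l)) * ys ! (p' div l)"
					unfolding px(2,3) True left_diff_distrib ..
				also have "\<dots> \<noteq> 0"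
					using t_powi_inj[OF tn, of "int (p mod l) - 1" "int (p' mod l)"] lt y0[OF div[OF pp(2)]] by (simp del: of_nat_mod)
				finally show ?thesis .
			next
				case False
				then have ne: "t powi a * ys ! (p div l) \<noteq> t powi b * ys ! (p' div l)" for a b
					using ind[OF div div, of p p'] pp by simp
				have "x (Suc p) \<noteq> Q * x (Suc p')" unfolding px(4) unfolding px(1) by (rule ne)
				moreover have "Q * x (Suc p) \<noteq> x (Suc p')" unfolding px(3) unfolding px(2) by (rule ne)
				moreover have "x (Suc p) \<noteq> x (Suc p')" unfolding px(1,2) by (rule ne)
				ultimately show ?thesis by (simp add: dfac_def)
			qed
		qed
		then have "dfac Q (desc ! (a - 1)) (desc ! (b - 1)) (x a) (x b) \<noteq> 0" if "(a, b) \<in> pairs ?N" for a b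
			using that by (cases a; cases b) (auto simp: pairs_def)
		moreover have "x a \<noteq> 0" if "a \<in> {1..?N}" for a
			using that x[of "a - 1"] y0[OF div[of "a - 1"]] Q_eq(5) by (cases a) auto
		ultimately show ?thesis
			unfolding ev_term_poly by (force simp: prod_zero_iff split_def simp del: One_nat_def)
	qed
	moreover have "ev x RF = ev x (term_poly desc)"
	proof -
		have "ev x RF = (\<Sum>xs\<in>{desc}. ev x (term_poly xs))"
			unfolding ev_RF by (intro sum.mono_neutral_right finite_assigns) (use desc_assigns one in blast)+
		then show ?thesis by simp
	qed
	ultimately have "ev x FF \<noteq> 0" unfolding ev_RF_FF by auto
	moreover have "length (cl t l ys) = ?N" using ys tn by simp
	ultimately show ?thesis by (simp add: gl_def x_def[abs_def])
qed

end

subsection \<open>The leading coefficient\<close>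

lemma sum_rank:
	fixes A :: "nat set"
	assumes "finite A"
	shows "(\<Sum>x\<in>A. f (card {y \<in> A. y < x})) = (\<Sum>j<card A. f j :: 'a::comm_monoid_add)"
	using assms
proof (induction A rule: finite_linorder_max_induct)
	case (insert b A)
	have b: "b \<notin> A" using insert by auto
	have "{y \<in> insert b A. y < b} = A" using insert by auto
	moreover have "{y \<in> insert b A. y < x} = {y \<in> A. y < x}" if "x \<in> A" for x
		using insert that by fastforce
	ultimately show ?case using insert b by (simp add: add.commute)
qed simp

text \<open>The Q-factorial: the first letter contributes Q to the power of its rank, and what
  follows is a permutation of the remaining letters.\<close>

lemma sum_permutations_ginv:
	assumes "finite A"
	shows "(\<Sum>u\<in>permutations_of_set A. Q ^ ginv u) = (\<Prod>i\<in>{1..card A}. \<Sum>j<i. Q ^ j :: 'a::comm_semiring_1)"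
	using assms
proof (induction "card A" arbitrary: A)
	case (Suc m)
	then have ne: "A \<noteq> {}" by auto
	have "(\<Sum>u\<in>permutations_of_set A. Q ^ ginv u) =
			(\<Sum>x\<in>A. \<Sum>u\<in>(#) x ` permutations_of_set (A - {x}). Q ^ ginv u)"
		unfolding permutations_of_set_nonempty[OF ne]
		by (rule sum.UNION_disjoint) (use Suc in auto)
	also have "\<dots> = (\<Sum>x\<in>A. \<Sum>u\<in>permutations_of_set (A - {x}). Q ^ card {y \<in> A. y < x} * Q ^ ginv u)"
	proof (rule sum.cong[OF refl])
		fix x assume x: "x \<in> A"
		have "length (filter (%y. y \<le> x) u) = card {y \<in> A. y < x}" if "u \<in> permutations_of_set (A - {x})" for u
		proof -
			have u: "set u = A - {x}" "distinct u" using that by (auto simp: permutations_of_set_def)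
			have "set (filter (%y. y \<le> x) u) = {y \<in> A. y < x}" unfolding set_filter u(1) by auto
			then show ?thesis using distinct_card[of "filter (%y. y \<le> x) u"] u(2) by simp
		qed
		then show "(\<Sum>u\<in>(#) x ` permutations_of_set (A - {x}). Q ^ ginv u) =
			(\<Sum>u\<in>permutations_of_set (A - {x}). Q ^ card {y \<in> A. y < x} * Q ^ ginv u)"
			by (subst sum.reindex) (simp_all add: power_add)
	qed
	also have "\<dots> = (\<Sum>x\<in>A. Q ^ card {y \<in> A. y < x} * (\<Prod>i\<in>{1..m}. \<Sum>j<i. Q ^ j))"
	proof (rule sum.cong[OF refl])
		fix x assume x: "x \<in> A"
		have c: "card (A - {x}) = m" using x Suc by simp
		show "(\<Sum>u\<in>permutations_of_set (A - {x}). Q ^ card {y \<in> A. y < x} * Q ^ ginv u) =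
			Q ^ card {y \<in> A. y < x} * (\<Prod>i\<in>{1..m}. \<Sum>j<i. Q ^ j)"
			unfolding sum_distrib_left[symmetric] using Suc.hyps(1)[of "A - {x}"] Suc.prems unfolding c by simp
	qed
	also have "\<dots> = (\<Sum>j<Suc m. Q ^ j) * (\<Prod>i\<in>{1..m}. \<Sum>j<i. Q ^ j)"
		using sum_rank[OF Suc.prems, of "%j. Q ^ j"] Suc.hyps(2) by (simp add: sum_distrib_right[symmetric])
	also have "\<dots> = (\<Prod>i\<in>{1..Suc m}. \<Sum>j<i. Q ^ j)"
		by (simp add: mult.commute del: sum.lessThan_Suc)
	finally show ?case by (simp only: Suc.hyps(2)[symmetric])
qed simp

lemma ginv_append: "ginv (u @ v) = ginv u + ginv v + (\<Sum>x\<leftarrow>u. length (filter (%y. y \<le> x) v))"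
	by (induction u) simp_all

lemma ginv_prod:
	"length xs = N ==> (\<Prod>(i, j)\<in>pairs N. if xs ! (j - 1) \<le> xs ! (i - 1) then Q else 1) = (Q ^ ginv xs :: 'a::comm_semiring_1)"
proof (induction xs arbitrary: N)
	case Nil
	have "pairs 0 = {}" by (auto simp: pairs_def)
	then show ?case using Nil by simp
next
	case (Cons x xs)
	obtain M where N: "N = Suc M" "length xs = M" using Cons.prems by auto
	have h: "(\<Prod>b\<in>{1..M}. if xs ! (b - 1) \<le> x then Q else 1) = Q ^ length (filter (%y. y \<le> x) xs)"
	proof -
		have "(\<Prod>b\<in>{1..M}. if xs ! (b - 1) \<le> x then Q else 1) = (\<Prod>b<length xs. if xs ! b \<le> x then Q else 1)"
			unfolding N(2)[symmetric] by (rule prod.reindex_bij_witness[of _ Suc "%b. b - 1"]) auto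
		also have "\<dots> = Q ^ length (filter (%y. y \<le> x) xs)"
			by (induction xs) (simp_all add: prod.lessThan_Suc_shift del: prod.lessThan_Suc)
		finally show ?thesis .
	qed
	have "(\<Prod>(a, b)\<in>pairs M. if (x # xs) ! (Suc b - 1) \<le> (x # xs) ! (Suc a - 1) then Q else 1) =
			(\<Prod>(a, b)\<in>pairs M. if xs ! (b - 1) \<le> xs ! (a - 1) then Q else 1)"
		by (intro prod.cong refl) (auto simp: pairs_def nth_Cons')
	moreover have "(\<Prod>b\<in>{1..M}. if (x # xs) ! (Suc b - 1) \<le> (x # xs) ! (1 - 1) then Q else 1) =
			(\<Prod>b\<in>{1..M}. if xs ! (b - 1) \<le> x then Q else 1)"
		by (intro prod.cong refl) (auto simp: nth_Cons')
	ultimately show ?case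
		unfolding N(1) prod_pairs_Suc using Cons.IH[OF N(2)] h by (simp only: ginv.simps power_add)
qed

text \<open>Parity of 2 p + e separates \<open>1 - kp x\<close> from the number of later
  occurrences. A letter repeated within the block would see more occurrences behind its first copy
  than behind its last, hence the letters are distinct.\<close>

lemma bet_append_eq:
	assumes "e \<le> 1"
	shows "bet kp (u @ w) = replicate (length u) (2 * p + e) @ ys \<longleftrightarrow>
		(\<forall>x\<in>set u. 1 - kp x = e \<and> count_list w x = p) \<and> distinct u \<and> bet kp w = ys"
proof (induction u)
	case (Cons x u)
	have h: "2 * count_list (u @ w) x + (1 - kp x) = 2 * p + e \<longleftrightarrow> 1 - kp x = e \<and> count_list u x + count_list w x = p"
		using assms by (cases "kp x") (auto simp: le_Suc_eq, presburger+)
	have step: "bet kp ((x # u) @ w) = replicate (length (x # u)) (2 * p + e) @ ys \<longleftrightarrow>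
			(1 - kp x = e \<and> count_list u x + count_list w x = p) \<and> bet kp (u @ w) = replicate (length u) (2 * p + e) @ ys"
		using h by simp
	have "count_list u x \<noteq> 0 \<longleftrightarrow> x \<in> set u" by (simp add: count_list_0_iff)
	then have "x \<notin> set u ==> count_list u x + count_list w x = p \<longleftrightarrow> count_list w x = p"
			"x \<in> set u ==> count_list w x = p ==> count_list u x + count_list w x \<noteq> p" by linarith+
	then show ?case unfolding step Cons.IH list.set distinct.simps by blast
qed simp

context level_data
begin

fun blocks :: "nat => nat list" where
	"blocks 0 = []"
| "blocks (Suc p) = replicate (l - k) (2 * p + 1) @ replicate k (2 * p + 0) @ blocks p"

lemma Y_partition_blocks: "Y_partition l n k = blocks n"
proof -
	have "blocks m = concat (map (%p. replicate (l - k) (2 * p + 1) @ replicate k (2 * p)) (rev [0..<m]))" for m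
		by (induction m) simp_all
	moreover have "map (%m. n - m) [1..<Suc n] = rev [0..<n]"
		by (rule nth_equalityI) (auto simp: rev_nth simp del: upt_Suc)
	then have "map (%m. replicate (l - k) (2 * (n - m) + 1) @ replicate k (2 * (n - m))) [1..<Suc n] =
			map (%p. replicate (l - k) (2 * p + 1) @ replicate k (2 * p)) (rev [0..<n])"
		by (metis (no_types, lifting) map_map[unfolded o_def, of "%p. replicate (l - k) (2 * p + 1) @ replicate k (2 * p)" "%m. n - m"])
	ultimately show ?thesis by (simp only: Y_partition_def)
qed

definition Zs where "Zs = {x \<in> {1..l}. kp x = 0}"
definition Os where "Os = {x \<in> {1..l}. kp x = 1}"

lemma zeros_ones: "finite Zs" "finite Os" "card Zs = l - k" "card Os = k" "Zs \<union> Os = {1..l}" "Zs \<inter> Os = {}"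
proof -
	show "card Zs = l - k" "card Os = k" by (simp_all only: Zs_def Os_def card_zeros card_ones)
	show "Zs \<union> Os = {1..l}" unfolding Zs_def Os_def using kp01 by blast
qed (auto simp: Zs_def Os_def)

text \<open>The words that contribute to the leading coefficient, for a partition of
  \<open>p\<close> blocks; peeling off the first block gives a recursion.\<close>

definition lev :: "nat => nat list set"
	where "lev p = {xs. set xs \<subseteq> {1..l} \<and> (\<forall>x\<in>{1..l}. count_list xs x = p) \<and> bet kp xs = blocks p}"

lemma length_blocks: "length (blocks p) = l * p"
	by (induction p) (use kl in auto)

lemma length_lev: "xs \<in> lev p ==> length xs = l * p"
	unfolding lev_def by (metis (mono_tags, lifting) length_bet length_blocks mem_Collect_eq)

lemma count_perm: "finite A ==> u \<in> permutations_of_set A ==> count_list u x = (if x \<in> A then 1 else 0)"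
	by (metis count_list_0_iff count_mset distinct_count_atmost_1 permutations_of_setD)

lemma length_perm: "u \<in> permutations_of_set A ==> length u = card A"
	by (metis distinct_card permutations_of_setD)

text \<open>By parity the first l - k exponents belong to letters of charge 0 and the next k to
  letters of charge 1; distinctness and counting make each half a permutation of all letters of its
  kind.\<close>

lemma lev_Suc_iff:
	assumes "length u = l - k" "length v = k"
	shows "u @ v @ w \<in> lev (Suc p) \<longleftrightarrow> u \<in> permutations_of_set Zs \<and> v \<in> permutations_of_set Os \<and> w \<in> lev p"
proof -
	have b: "bet kp (u @ v @ w) = blocks (Suc p) \<longleftrightarrow>
			(\<forall>x\<in>set u. 1 - kp x = 1 \<and> count_list (v @ w) x = p) \<and> distinct u \<and>
			(\<forall>x\<in>set v. 1 - kp x = 0 \<and> count_list w x = p) \<and> distinct v \<and> bet kp w = blocks p"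
		using bet_append_eq[of 1 kp u "v @ w" p "replicate k (2 * p + 0) @ blocks p"]
			bet_append_eq[of 0 kp v w p "blocks p"] assms by (simp only: blocks.simps)
	show ?thesis
	proof
		assume L: "u @ v @ w \<in> lev (Suc p)"
		then have h: "\<forall>x\<in>set u. 1 - kp x = 1 \<and> count_list (v @ w) x = p" "distinct u"
				"\<forall>x\<in>set v. 1 - kp x = 0 \<and> count_list w x = p" "distinct v" "bet kp w = blocks p"
			and r: "set u \<subseteq> {1..l}" "set v \<subseteq> {1..l}" "set w \<subseteq> {1..l}"
			and c: "\<And>x. x \<in> {1..l} ==> count_list (u @ v @ w) x = Suc p"
			unfolding lev_def using b by auto
		have u: "set u = Zs"
		proof (rule card_subset_eq)
			show "set u \<subseteq> Zs" using h(1) r(1) by (fastforce simp: Zs_def)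
			show "card (set u) = card Zs" using h(2) assms zeros_ones by (simp add: distinct_card)
		qed (rule zeros_ones)
		have v: "set v = Os"
		proof (rule card_subset_eq)
			show "set v \<subseteq> Os" using h(3) r(2) kp01 by (fastforce simp: Os_def)
			show "card (set v) = card Os" using h(4) assms zeros_ones by (simp add: distinct_card)
		qed (rule zeros_ones)
		have uv: "u \<in> permutations_of_set Zs" "v \<in> permutations_of_set Os" using u v h by auto
		moreover have "count_list w x = p" if x: "x \<in> {1..l}" for x
		proof -
			have "x \<in> Zs \<and> x \<notin> Os \<or> x \<notin> Zs \<and> x \<in> Os" using x zeros_ones(5,6) by blast
			then show ?thesis
				using c[OF x] count_perm[OF zeros_ones(1) uv(1), of x] count_perm[OF zeros_ones(2) uv(2), of x] by auto
		qed
		then have "w \<in> lev p" using h r by (simp add: lev_def)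
		ultimately show "u \<in> permutations_of_set Zs \<and> v \<in> permutations_of_set Os \<and> w \<in> lev p" by blast
	next
		assume A: "u \<in> permutations_of_set Zs \<and> v \<in> permutations_of_set Os \<and> w \<in> lev p"
		then have uv: "set u = Zs" "distinct u" "set v = Os" "distinct v" by (auto simp: permutations_of_set_def)
		have w: "set w \<subseteq> {1..l}" "\<And>x. x \<in> {1..l} ==> count_list w x = p" "bet kp w = blocks p"
			using A by (auto simp: lev_def)
		have cu: "count_list u x = (if x \<in> Zs then 1 else 0)" "count_list v x = (if x \<in> Os then 1 else 0)" for x
			by (rule count_perm[OF zeros_ones(1)], use A in simp, rule count_perm[OF zeros_ones(2)], use A in simp)
		have "bet kp (u @ v @ w) = blocks (Suc p)"
			unfolding b using uv w zeros_ones(6) by (auto simp: cu) (auto simp: Zs_def Os_def)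
		then show "u @ v @ w \<in> lev (Suc p)"
			unfolding lev_def using uv w zeros_ones(5,6) by (auto simp: cu)
	qed
qed

text \<open>Inversions between the two halves of a block.\<close>

definition cross :: nat where "cross = (\<Sum>x\<in>Zs. card {y \<in> Os. y \<le> x})"

text \<open>Every letter occurs p times in \<open>w\<close>, so a letter x of the first block has p
  x letters of \<open>w\<close> that do not exceed it.\<close>

lemma ginv_lev:
	assumes "u \<in> permutations_of_set Zs" "v \<in> permutations_of_set Os" "w \<in> lev p"
	shows "ginv (u @ v @ w) = ginv u + ginv v + ginv w + cross + p * (\<Sum>x\<in>{1..l}. x)"
proof -
	have w: "set w \<subseteq> {1..l}" "\<And>x. x \<in> {1..l} ==> count_list w x = p"
		using assms by (auto simp: lev_def)
	have len: "length (filter (%y. y \<le> x) w) = p * x" if "x \<in> {1..l}" for x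
	proof -
		have "length (filter (%y. y \<le> x) w) = (\<Sum>y\<in>{1..l}. count_list (filter (%y. y \<le> x) w) y)"
			using w(1) by (subst sum_count_set) auto
		also have "\<dots> = (\<Sum>y\<in>{1..l}. if y \<le> x then p else 0)"
		proof (intro sum.cong refl)
			fix y assume "y \<in> {1..l}"
			have "count_list (filter (%y. y \<le> x) w) y = (if y \<le> x then count_list w y else 0)"
				by (induction w) auto
			then show "count_list (filter (%y. y \<le> x) w) y = (if y \<le> x then p else 0)"
				using w(2) \<open>y \<in> {1..l}\<close> by simp
		qed
		also have "\<dots> = (\<Sum>y\<in>{1..x}. p)"
			using that by (intro sum.mono_neutral_cong_right) auto
		finally show ?thesis by simp
	qed
	have sm: "(\<Sum>x\<leftarrow>u. f x) = (\<Sum>x\<in>A. f x)" if "u \<in> permutations_of_set A" for u A and f :: "nat => nat"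
		using that by (metis permutations_of_setD sum_list_distinct_conv_sum_set)
	have "(\<Sum>x\<leftarrow>u. length (filter (%y. y \<le> x) (v @ w))) = (\<Sum>x\<in>Zs. card {y \<in> Os. y \<le> x} + p * x)"
		unfolding sm[OF assms(1)]
	proof (intro sum.cong refl)
		fix x assume x: "x \<in> Zs"
		have "length (filter (%y. y \<le> x) v) = card {y \<in> Os. y \<le> x}"
		proof -
			have v: "set v = Os" "distinct v" using assms(2) by (auto simp: permutations_of_set_def)
			have "set (filter (%y. y \<le> x) v) = {y \<in> Os. y \<le> x}" unfolding set_filter v(1) ..
			then show ?thesis using distinct_card[of "filter (%y. y \<le> x) v"] v(2) by simp
		qed
		moreover have "x \<in> {1..l}" using x zeros_ones by blast
		ultimately show "length (filter (%y. y \<le> x) (v @ w)) = card {y \<in> Os. y \<le> x} + p * x"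
			using len[of x] by simp
	qed
	moreover have "(\<Sum>x\<leftarrow>v. length (filter (%y. y \<le> x) w)) = (\<Sum>x\<in>Os. p * x)"
		unfolding sm[OF assms(2)] using len zeros_ones by (intro sum.cong refl) blast
	moreover have "(\<Sum>x\<in>{1..l}. x) = (\<Sum>x\<in>Zs. x) + (\<Sum>x\<in>Os. x)"
		unfolding zeros_ones(5)[symmetric] by (rule sum.union_disjoint) (rule zeros_ones)+
	ultimately show ?thesis
		by (simp add: ginv_append cross_def sum.distrib sum_distrib_left[symmetric] distrib_left)
qed

definition qsum :: "nat => complex" where "qsum m = (\<Prod>i\<in>{1..m}. \<Sum>j<i. Q ^ j)"

lemma sum_lev_Suc:
	"(\<Sum>xs\<in>lev (Suc p). Q ^ ginv xs) =
		Q ^ (cross + p * (\<Sum>x\<in>{1..l}. x)) * (qsum (l - k) * qsum k) * (\<Sum>xs\<in>lev p. Q ^ ginv xs)"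
proof -
	let ?PZ = "permutations_of_set Zs" and ?PO = "permutations_of_set Os"
	have split: "xs = take (l - k) xs @ take k (drop (l - k) xs) @ drop l xs" if "xs \<in> lev (Suc p)" for xs
	proof -
		have "drop l xs = drop k (drop (l - k) xs)" using kl by simp
		then show ?thesis by (metis append_take_drop_id)
	qed
	have inj: "take (l - k) xs \<in> ?PZ \<and> take k (drop (l - k) xs) \<in> ?PO \<and> drop l xs \<in> lev p"
		if xs: "xs \<in> lev (Suc p)" for xs
	proof (subst lev_Suc_iff[symmetric])
		show "length (take (l - k) xs) = l - k" "length (take k (drop (l - k) xs)) = k"
			using length_lev[OF xs] kl by simp_all
		show "take (l - k) xs @ take k (drop (l - k) xs) @ drop l xs \<in> lev (Suc p)"
			using split[OF xs] xs by simp
	qed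
	have lZ: "length u = l - k" if "u \<in> ?PZ" for u using length_perm[OF that] zeros_ones by simp
	have lO: "length u = k" if "u \<in> ?PO" for u using length_perm[OF that] zeros_ones by simp
	have "(\<Sum>xs\<in>lev (Suc p). Q ^ ginv xs) = (\<Sum>(u, v, w)\<in>?PZ \<times> ?PO \<times> lev p. Q ^ ginv (u @ v @ w))"
	proof (rule sum.reindex_bij_witness[of _ "%(u, v, w). u @ v @ w" "%xs. (take (l - k) xs, take k (drop (l - k) xs), drop l xs)"])
		fix xs assume xs: "xs \<in> lev (Suc p)"
		show "(case (take (l - k) xs, take k (drop (l - k) xs), drop l xs) of (u, v, w) => u @ v @ w) = xs"
			using split[OF xs] by simp
		then show "(case (take (l - k) xs, take k (drop (l - k) xs), drop l xs) of (u, v, w) => Q ^ ginv (u @ v @ w)) = Q ^ ginv xs"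
			by simp
		show "(take (l - k) xs, take k (drop (l - k) xs), drop l xs) \<in> ?PZ \<times> ?PO \<times> lev p"
			using inj[OF xs] by simp
	next
		fix z assume z: "z \<in> ?PZ \<times> ?PO \<times> lev p"
		obtain u v w where uvw: "z = (u, v, w)" by (cases z)
		have "length u = l - k" "length v = k" using z uvw lZ lO by auto
		then show "(take (l - k) (case z of (u, v, w) => u @ v @ w), take k (drop (l - k) (case z of (u, v, w) => u @ v @ w)),
				drop l (case z of (u, v, w) => u @ v @ w)) = z"
			using uvw kl by simp
		show "(case z of (u, v, w) => u @ v @ w) \<in> lev (Suc p)"
			using z uvw lZ lO by (auto simp: lev_Suc_iff)
	qed
	also have "\<dots> = (\<Sum>(u, v, w)\<in>?PZ \<times> ?PO \<times> lev p. Q ^ ginv u * (Q ^ ginv v * (Q ^ (cross + p * (\<Sum>x\<in>{1..l}. x)) * Q ^ ginv w)))"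
		by (intro sum.cong refl) (auto simp: ginv_lev power_add mult_ac)
	also have "\<dots> = (\<Sum>u\<in>?PZ. Q ^ ginv u) * ((\<Sum>v\<in>?PO. Q ^ ginv v) * (Q ^ (cross + p * (\<Sum>x\<in>{1..l}. x)) * (\<Sum>w\<in>lev p. Q ^ ginv w)))"
		by (simp only: sum.cartesian_product[symmetric] sum_distrib_left[symmetric] sum_distrib_right[symmetric])
	finally show ?thesis
		by (simp add: sum_permutations_ginv zeros_ones qsum_def mult_ac)
qed

lemma lev_0: "lev 0 = {[]}"
proof (intro equalityI subsetI)
	fix xs assume "xs \<in> lev 0"
	then show "xs \<in> {[]}" using length_lev[of xs 0] by simp
next
	fix xs assume "xs \<in> {[] :: nat list}"
	then show "xs \<in> lev 0" by (simp add: lev_def)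
qed

lemma sum_lev:
	"(\<Sum>xs\<in>lev m. Q ^ ginv xs) = Q ^ (m * cross + (\<Sum>p<m. p) * (\<Sum>x\<in>{1..l}. x)) * (qsum (l - k) * qsum k) ^ m"
proof (induction m)
	case (Suc m)
	then show ?case by (simp only: sum_lev_Suc) (simp add: power_add distrib_right mult_ac)
qed (simp add: lev_0)

lemma FF_leading_value:
	"lookup FF (mon (Y_partition l n k)) =
		Q ^ (n * cross + (\<Sum>p<n. p) * (\<Sum>x\<in>{1..l}. x)) * (qsum (l - k) * qsum k) ^ n"
proof -
	have "{xs \<in> assigns. bet kp xs = Y_partition l n k} = lev n"
		using length_lev[of _ n] unfolding assigns_def lev_def Y_partition_blocks by auto
	moreover have "(\<Sum>xs\<in>lev n. \<Prod>(i, j)\<in>pairs (l * n). if xs ! (j - 1) \<le> xs ! (i - 1) then Q else 1) = (\<Sum>xs\<in>lev n. Q ^ ginv xs)"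
		by (intro sum.cong refl ginv_prod length_lev)
	ultimately show ?thesis unfolding FF_leading by (simp only: sum_lev)
qed

text \<open>\<open>cross\<close> depends on which tensor factors are charged, and so does the power
  of q collected from the zero modes. The identity lets these dependences cancel, so that the
  constant depends on k only.\<close>

lemma cross_eq: "2 * int cross + (\<Sum>j\<in>{1..l}. int (kp j) * (2 * int j - 1 - int l)) = int k * (int l - int k)"
proof -
	have o: "int (card {y \<in> Os. y \<le> x}) = int x - 1 - int (card {z \<in> Zs. z < x})" if x: "x \<in> Zs" for x
	proof -
		have "{1..<x} = {y \<in> Os. y \<le> x} \<union> {z \<in> Zs. z < x}"
		proof (rule set_eqI)
			fix y
			have "y \<in> {1..l} ==> y \<in> Zs \<or> y \<in> Os" using zeros_ones(5) by blast
			moreover have "y \<in> Os ==> y \<noteq> x" using x zeros_ones(6) by blast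
			ultimately show "y \<in> {1..<x} \<longleftrightarrow> y \<in> {y \<in> Os. y \<le> x} \<union> {z \<in> Zs. z < x}"
				using x by (auto simp: Os_def Zs_def)
		qed
		moreover have "card ({y \<in> Os. y \<le> x} \<union> {z \<in> Zs. z < x}) = card {y \<in> Os. y \<le> x} + card {z \<in> Zs. z < x}"
			using zeros_ones by (intro card_Un_disjoint) auto
		ultimately have "x - 1 = card {y \<in> Os. y \<le> x} + card {z \<in> Zs. z < x}" by (metis card_atLeastLessThan)
		moreover have "x \<ge> 1" using x by (simp add: Zs_def)
		ultimately show ?thesis by linarith
	qed
	have tri: "2 * (\<Sum>j<m. int j) = int m * (int m - 1)" for m :: nat
		by (induction m) (auto simp: algebra_simps)
	have "2 * int cross = (\<Sum>x\<in>Zs. 2 * (int x - 1)) - 2 * (\<Sum>x\<in>Zs. int (card {z \<in> Zs. z < x}))"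
		by (simp add: cross_def o sum_subtractf sum_distrib_left)
	also have "(\<Sum>x\<in>Zs. int (card {z \<in> Zs. z < x})) = (\<Sum>j<l - k. int j)"
		using sum_rank[OF zeros_ones(1), of int] zeros_ones by simp
	finally have 1: "2 * int cross = (\<Sum>x\<in>Zs. 2 * (int x - 1)) - int (l - k) * (int (l - k) - 1)"
		by (simp only: tri)
	have "(\<Sum>j\<in>{1..l}. int (kp j) * (2 * int j - 1 - int l)) = (\<Sum>j\<in>Os. 2 * int j - 1 - int l)"
		using kp01 by (intro sum.mono_neutral_cong_right) (force simp: Os_def)+
	moreover have "(\<Sum>j\<in>{1..l}. 2 * int j - 1 - int l) = (\<Sum>j\<in>Zs. 2 * int j - 1 - int l) + (\<Sum>j\<in>Os. 2 * int j - 1 - int l)"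
		unfolding zeros_ones(5)[symmetric] by (rule sum.union_disjoint) (rule zeros_ones)+
	moreover have "(\<Sum>j\<in>{1..l}. 2 * int j - 1 - int l) = 0"
	proof -
		have "(\<Sum>j\<in>{1..m}. 2 * int j - 1) = int m * int m" for m
			by (induction m) (auto simp: algebra_simps)
		then show ?thesis by (simp add: sum_subtractf)
	qed
	moreover have "(\<Sum>x\<in>Zs. 2 * (int x - 1)) - (\<Sum>j\<in>Zs. 2 * int j - 1 - int l) = int (l - k) * (int l - 1)"
		by (simp add: sum_subtractf[symmetric] zeros_ones)
	ultimately show ?thesis using 1 kl by (simp add: of_nat_diff algebra_simps)
qed

end

section \<open>Summation of operator families against functionals\<close>

abbreviation bv :: "'b => 'b \<Rightarrow>\<^sub>0 complex" where "bv b \<equiv> single b 1"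

definition lin :: "(('b \<Rightarrow>\<^sub>0 complex) => 'c \<Rightarrow>\<^sub>0 complex) => bool"
	where "lin X \<longleftrightarrow> (\<forall>v. X v = lin_ext (%b. X (bv b)) v)"

lemma lin_lin_ext [simp]: "lin (lin_ext g)"
	by (simp add: lin_def lin_ext_single scl_simps)

lemma lin_iff: "lin X \<longleftrightarrow> (\<exists>g. X = lin_ext g)"
proof
	assume "lin X"
	then have "\<forall>v. X v = lin_ext (%b. X (bv b)) v" by (rule lin_def[THEN iffD1])
	then have "X = lin_ext (%b. X (bv b))" by (intro ext) (rule spec)
	then show "\<exists>g. X = lin_ext g" by (rule exI[where x = "%b. X (bv b)"])
qed auto

lemma lin_comp: "lin X ==> lin Y ==> lin (%v. X (Y v))"
	by (auto simp: lin_iff lin_ext_lin_ext)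

lemma lin_add: "lin X ==> X (u + v) = X u + X v"
	and lin_scl: "lin X ==> X (scl c v) = scl c (X v)"
	and lin_0: "lin X ==> X 0 = 0"
	by (auto simp: lin_iff lin_ext_add lin_ext_scl lin_ext_0)

lemma lin_expand: "lin X ==> X v = (\<Sum>b\<in>keys v. scl (lookup v b) (X (bv b)))"
	by (auto simp: lin_iff lin_ext_single scl_simps) (simp add: lin_ext_def)

lemma linI:
	fixes X :: "('b \<Rightarrow>\<^sub>0 complex) => ('c \<Rightarrow>\<^sub>0 complex)"
	assumes "\<And>u v. X (u + v) = X u + X v" "\<And>c v. X (scl c v) = scl c (X v)"
	shows "lin X"
proof -
	have z: "X 0 = 0" using assms(2)[of 0 0] by (simp add: scl_simps)
	have s: "X (sum f A) = (\<Sum>a\<in>A. X (f a))" if "finite A" for f and A :: "'b set"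
		using that by (induction A rule: finite_induct) (simp_all add: z assms(1))
	have "X v = (\<Sum>b\<in>keys v. scl (lookup v b) (X (bv b)))" for v
	proof -
		have "v = (\<Sum>b\<in>keys v. scl (lookup v b) (bv b))"
			by (simp add: scl_simps flip: poly_mapping_sum_single)
		then have "X v = X (\<Sum>b\<in>keys v. scl (lookup v b) (bv b))" by (rule arg_cong)
		also have "\<dots> = (\<Sum>b\<in>keys v. scl (lookup v b) (X (bv b)))"
			by (simp only: s[OF finite_keys] assms(2))
		finally show ?thesis .
	qed
	then show ?thesis unfolding lin_def lin_ext_def by (rule allI)
qed

lemma lin_simps: "lin (%v. v)" "lin (%v. 0)" "lin X ==> lin (%v. scl c (X v))"
	by (auto intro!: linI simp: scl_simps lin_add lin_scl mult.commute)

lemma lin_sum: "(\<And>i. i \<in> A ==> lin (X i)) ==> lin (%v. \<Sum>i\<in>A. X i v)"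
proof (induction A rule: infinite_finite_induct)
	case (insert i A)
	then have "lin (%v. \<Sum>i\<in>A. X i v)" "lin (X i)" by auto
	then have "lin (%v. X i v + (\<Sum>i\<in>A. X i v))"
		using lin_add[of "%v. \<Sum>i\<in>A. X i v"] lin_scl[of "%v. \<Sum>i\<in>A. X i v"]
		by (intro linI) (simp_all only: lin_add lin_scl scl_simps add_ac)
	then show ?case using insert by simp
qed (auto simp: lin_simps)

text \<open>\<open>La\<close> lists the values of a functional on the basis and, unlike a vector,
  may have infinite support; \<open>nap\<close> is the corresponding sum of absolute values for a
  majorant.\<close>

definition ap :: "('b => complex) => ('b \<Rightarrow>\<^sub>0 complex) => complex"
	where "ap La v = (\<Sum>b\<in>keys v. lookup v b * La b)"

definition nap :: "('b => real) => ('b \<Rightarrow>\<^sub>0 complex) => real"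
	where "nap om v = (\<Sum>b\<in>keys v. norm (lookup v b) * om b)"

lemma ap_superset: "finite A ==> keys v \<subseteq> A ==> ap La v = (\<Sum>b\<in>A. lookup v b * La b)"
	unfolding ap_def by (intro sum.mono_neutral_left) (auto simp: in_keys_iff)

lemma nap_superset: "finite A ==> keys v \<subseteq> A ==> nap om v = (\<Sum>b\<in>A. norm (lookup v b) * om b)"
	unfolding nap_def by (intro sum.mono_neutral_left) (auto simp: in_keys_iff)

lemma ap_add: "ap La (u + v) = ap La u + ap La v"
proof -
	have "keys (u + v) \<subseteq> keys u \<union> keys v" by (rule keys_add)
	then show ?thesis
		by (simp add: ap_superset[of "keys u \<union> keys v"] lookup_add distrib_right sum.distrib)
qed

lemma ap_single [simp]: "ap La (single b c) = c * La b"
	by (simp add: ap_superset[of "{b}"])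

lemma ap_0 [simp]: "ap La 0 = 0" by (simp add: ap_def)

lemma ap_scl: "ap La (scl c v) = c * ap La v"
proof -
	have "keys (scl c v) \<subseteq> keys v" by (auto simp: in_keys_iff lookup_scl)
	then show ?thesis
		by (simp add: ap_superset[of "keys v"] lookup_scl sum_distrib_left mult_ac)
qed

lemma ap_sum: "ap La (sum f A) = (\<Sum>a\<in>A. ap La (f a))"
	by (induction A rule: infinite_finite_induct) (simp_all add: ap_add)

lemma ap_lin: "lin X ==> ap La (X u) = (\<Sum>b\<in>keys u. lookup u b * ap La (X (bv b)))"
	by (subst lin_expand) (simp_all add: ap_sum ap_scl)

lemma nap_single [simp]: "nap om (single b c) = norm c * om b"
	by (simp add: nap_superset[of "{b}"])

lemma nap_0 [simp]: "nap om 0 = 0" by (simp add: nap_def)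

lemma nap_scl: "nap om (scl c v) = norm c * nap om v"
proof -
	have "keys (scl c v) \<subseteq> keys v" by (auto simp: in_keys_iff lookup_scl)
	then show ?thesis
		by (simp add: nap_superset[of "keys v"] lookup_scl sum_distrib_left norm_mult mult_ac)
qed

definition maj :: "('b => complex) => ('b => real) => bool"
	where "maj La om \<longleftrightarrow> (\<forall>b. norm (La b) \<le> om b)"

lemma maj_nonneg: "maj La om ==> 0 \<le> om b"
	unfolding maj_def by (metis norm_ge_zero order_trans)

lemma nap_add: "maj La om ==> nap om (u + v) \<le> nap om u + nap om v"
proof -
	assume d: "maj La om"
	have "keys (u + v) \<subseteq> keys u \<union> keys v" by (rule keys_add)
	moreover have "norm (lookup u b + lookup v b) * om b \<le>
			norm (lookup u b) * om b + norm (lookup v b) * om b" for b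
		unfolding distrib_right[symmetric] by (intro mult_right_mono norm_triangle_ineq maj_nonneg[OF d])
	ultimately show ?thesis
		by (simp add: nap_superset[of "keys u \<union> keys v"] lookup_add sum.distrib[symmetric] sum_mono)
qed

lemma nap_sum: "maj La om ==> nap om (sum f A) \<le> (\<Sum>a\<in>A. nap om (f a))"
	by (induction A rule: infinite_finite_induct) (auto intro: order_trans[OF nap_add])

lemma nap_lin: "maj La om ==> lin X ==>
		nap om (X u) \<le> (\<Sum>b\<in>keys u. norm (lookup u b) * nap om (X (bv b)))"
	by (subst lin_expand) (auto intro: order_trans[OF nap_sum] simp: nap_scl)

lemma nap_nonneg: "maj La om ==> 0 \<le> nap om v"
	unfolding nap_def by (intro sum_nonneg mult_nonneg_nonneg) (auto simp: maj_nonneg)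

lemma norm_ap: "maj La om ==> norm (ap La v) \<le> nap om v"
	unfolding nap_def ap_def by (intro sum_norm_le) (auto simp: norm_mult maj_def intro: mult_left_mono)

lemma has_sum_sum:
	fixes f :: "'a => 'b => complex"
	shows "(\<And>a. a \<in> A ==> (f a has_sum s a) I) ==> ((%i. \<Sum>a\<in>A. f a i) has_sum (\<Sum>a\<in>A. s a)) I"
	by (induction A rule: infinite_finite_induct) (auto intro: has_sum_add)

text \<open>\<open>adm I c X La om La' om'\<close>: the functional \<open>\<Sum>\<^sub>i c\<^sub>i La \<circ> X\<^sub>i\<close> converges absolutely to \<open>La'\<close> on every basis vector;
	the majorant \<open>om\<close> is carried along because without it products of such families could not be summed.\<close>

definition adm :: "'i set => ('i => complex) => ('i => ('b \<Rightarrow>\<^sub>0 complex) => ('b \<Rightarrow>\<^sub>0 complex)) =>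
		('b => complex) => ('b => real) => ('b => complex) => ('b => real) => bool"
	where "adm I c X La om La' om' \<longleftrightarrow> maj La om \<and> (\<forall>i\<in>I. lin (X i)) \<and>
		(\<forall>b F. finite F \<longrightarrow> F \<subseteq> I \<longrightarrow> (\<Sum>i\<in>F. norm (c i) * nap om (X i (bv b))) \<le> om' b) \<and>
		(\<forall>b. ((%i. c i * ap La (X i (bv b))) has_sum La' b) I)"

lemma admD:
	assumes "adm I c X La om La' om'"
	shows "maj La om" "\<And>i. i \<in> I ==> lin (X i)"
		"\<And>b F. finite F ==> F \<subseteq> I ==> (\<Sum>i\<in>F. norm (c i) * nap om (X i (bv b))) \<le> om' b"
		"\<And>b. ((%i. c i * ap La (X i (bv b))) has_sum La' b) I"
	using assms unfolding adm_def by blast+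

lemma summable_of_bound:
	fixes f :: "'i => complex"
	assumes "\<And>F. finite F ==> F \<subseteq> I ==> (\<Sum>i\<in>F. norm (f i)) \<le> B"
	shows "f summable_on I"
proof (rule abs_summable_summable)
	have "bdd_above (sum (%i. norm (f i)) ` {F. F \<subseteq> I \<and> finite F})"
		by (rule bdd_aboveI[of _ B]) (use assms in blast)
	then show "Infinite_Sum.abs_summable_on f I" by (simp only: abs_summable_iff_bdd_above)
qed

lemma adm_maj: "adm I c X La om La' om' ==> maj La' om'"
	unfolding maj_def
proof
	fix b assume a: "adm I c X La om La' om'"
	have "norm (\<Sum>i\<in>F. c i * ap La (X i (bv b))) \<le> om' b" if "finite F" "F \<subseteq> I" for F
	proof -
		have "norm (\<Sum>i\<in>F. c i * ap La (X i (bv b))) \<le> (\<Sum>i\<in>F. norm (c i) * nap om (X i (bv b)))"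
			by (intro sum_norm_le) (auto simp: norm_mult intro!: mult_left_mono norm_ap admD(1)[OF a])
		then show ?thesis using admD(3)[OF a that] by (rule order_trans)
	qed
	then have "\<forall>\<^sub>F F in finite_subsets_at_top I. norm (\<Sum>i\<in>F. c i * ap La (X i (bv b))) \<le> om' b"
		by (intro eventually_finite_subsets_at_top_weakI)
	then show "norm (La' b) \<le> om' b"
		using admD(4)[OF a, of b, unfolded has_sum_def] by (intro Lim_norm_ubound) auto
qed

text \<open>Fubini, with the majorants as absolute bounds. A functional meets the left operator
  first, so \<open>X\<close> is summed against \<open>La\<close> and then \<open>Y\<close> against
  the resulting \<open>La'\<close>.\<close>

lemma adm_comp:
	assumes a: "adm I c X La om La' om'" and b: "adm J d Y La' om' La'' om''"
	shows "adm (I \<times> J) (%(i, j). c i * d j) (%(i, j) v. X i (Y j v)) La om La'' om''"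
	unfolding adm_def
proof (intro conjI allI impI ballI)
	note dm = admD(1)[OF a]
	show "maj La om" by (rule dm)
	show "lin (case p of (i, j) => %v. X i (Y j v))" if "p \<in> I \<times> J" for p
		using that admD(2)[OF a] admD(2)[OF b] by (auto intro: lin_comp)
	have inner: "(\<Sum>i\<in>F. norm (c i) * nap om (X i u)) \<le> nap om' u" if "finite F" "F \<subseteq> I" for F u
	proof -
		have "(\<Sum>i\<in>F. norm (c i) * nap om (X i u)) \<le>
				(\<Sum>i\<in>F. norm (c i) * (\<Sum>b\<in>keys u. norm (lookup u b) * nap om (X i (bv b))))"
			by (intro sum_mono mult_left_mono nap_lin[OF dm]) (use that admD(2)[OF a] in auto)
		also have "\<dots> = (\<Sum>b\<in>keys u. norm (lookup u b) * (\<Sum>i\<in>F. norm (c i) * nap om (X i (bv b))))"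
			by (subst sum_distrib_left, subst sum.swap, simp add: sum_distrib_left mult_ac)
		also have "\<dots> \<le> nap om' u"
			unfolding nap_def by (intro sum_mono mult_left_mono admD(3)[OF a that, unfolded nap_def]) auto
		finally show ?thesis .
	qed
	show bd: "(\<Sum>p\<in>F. norm (case p of (i, j) => c i * d j) * nap om ((case p of (i, j) => %v. X i (Y j v)) (bv e))) \<le> om'' e"
		if F: "finite F" "F \<subseteq> I \<times> J" for e F
	proof -
		have "(\<Sum>p\<in>F. norm (case p of (i, j) => c i * d j) * nap om ((case p of (i, j) => %v. X i (Y j v)) (bv e))) \<le>
				(\<Sum>p\<in>fst ` F \<times> snd ` F. norm (c (fst p)) * norm (d (snd p)) * nap om (X (fst p) (Y (snd p) (bv e))))"
			using F nap_nonneg[OF dm] by (intro sum_le_included[where i = "%x. x"]) (force simp: norm_mult)+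
		also have "\<dots> = (\<Sum>j\<in>snd ` F. norm (d j) * (\<Sum>i\<in>fst ` F. norm (c i) * nap om (X i (Y j (bv e)))))"
			by (simp add: sum.cartesian_product' sum_distrib_left mult_ac) (rule sum.swap)
		also have "\<dots> \<le> (\<Sum>j\<in>snd ` F. norm (d j) * nap om' (Y j (bv e)))"
			using F by (intro sum_mono mult_left_mono inner) auto
		also have "\<dots> \<le> om'' e" using F by (intro admD(3)[OF b]) auto
		finally show ?thesis .
	qed
	fix e
	let ?g = "%p. c (fst p) * d (snd p) * ap La (X (fst p) (Y (snd p) (bv e)))"
	have "?g summable_on I \<times> J"
	proof (rule summable_of_bound)
		fix F assume F: "finite F" "F \<subseteq> I \<times> J"
		have "(\<Sum>p\<in>F. norm (?g p)) \<le>
			(\<Sum>p\<in>F. norm (case p of (i, j) => c i * d j) * nap om ((case p of (i, j) => %v. X i (Y j v)) (bv e)))"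
			by (intro sum_mono) (auto simp: norm_mult intro!: mult_left_mono norm_ap[OF dm])
		then show "(\<Sum>p\<in>F. norm (?g p)) \<le> om'' e" using bd[OF F, of e] by linarith
	qed
	then have sm: "(%(j, i). ?g (i, j)) summable_on J \<times> I" by (subst summable_on_swap) (simp add: split_def)
	have "((%i. c i * ap La (X i u)) has_sum ap La' u) I" for u
	proof -
		have h: "((%i. \<Sum>b\<in>keys u. lookup u b * (c i * ap La (X i (bv b)))) has_sum ap La' u) I"
			unfolding ap_def[of La'] by (intro has_sum_sum has_sum_cmult_right admD(4)[OF a])
		have e: "(\<Sum>b\<in>keys u. lookup u b * (c i * ap La (X i (bv b)))) = c i * ap La (X i u)"
			if "i \<in> I" for i
			by (simp add: ap_lin[OF admD(2)[OF a that], of La u] sum_distrib_left mult_ac)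
		show ?thesis by (rule has_sum_cong[THEN iffD1, OF e h])
	qed
	from has_sum_cmult_right[OF this[of "Y j (bv e)" for j], of "d j" j for j]
	have "((%i. ?g (i, j)) has_sum d j * ap La' (Y j (bv e))) I" for j
		by (simp add: mult.left_commute mult.assoc)
	then have "((%(j, i). ?g (i, j)) has_sum La'' e) (J \<times> I)"
		by (intro has_sum_SigmaI[OF _ admD(4)[OF b] sm]) simp
	then have "((%(i, j). ?g (i, j)) has_sum La'' e) (I \<times> J)" by (subst (asm) has_sum_swap) (simp add: split_def)
	then show "((%p. (case p of (i, j) => c i * d j) * ap La ((case p of (i, j) => %v. X i (Y j v)) (bv e))) has_sum La'' e) (I \<times> J)"
		by (simp add: split_def)
qed

text \<open>Regroups the index set along the fibres of \<open>g\<close>. Fibres may be infinite, but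
  on each basis vector only finitely many operators of a fibre act nontrivially, so \<open>Z\<close>
  is a finite sum there.\<close>

lemma adm_push:
	assumes a: "adm I c X La om La' om'" and g: "g ` I \<subseteq> K" "\<And>i. i \<in> I ==> c i = d (g i)"
		and Z: "\<And>k. k \<in> K ==> lin (Z k)"
			"\<And>k b. k \<in> K ==> finite {i \<in> I. g i = k \<and> X i (bv b) \<noteq> 0}"
			"\<And>k b. k \<in> K ==> Z k (bv b) = (\<Sum>i\<in>{i \<in> I. g i = k \<and> X i (bv b) \<noteq> 0}. X i (bv b))"
	shows "adm K d Z La om La' om'"
	unfolding adm_def
proof (intro conjI allI impI ballI)
	note dm = admD(1)[OF a]
	show "maj La om" by (rule dm)
	show "lin (Z k)" if "k \<in> K" for k using Z(1) that .
	let ?S = "%b k. {i \<in> I. g i = k \<and> X i (bv b) \<noteq> 0}"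
	show "(\<Sum>k\<in>F. norm (d k) * nap om (Z k (bv b))) \<le> om' b" if F: "finite F" "F \<subseteq> K" for b F
	proof -
		have "(\<Sum>k\<in>F. norm (d k) * nap om (Z k (bv b))) \<le> (\<Sum>k\<in>F. \<Sum>i\<in>?S b k. norm (c i) * nap om (X i (bv b)))"
		proof (rule sum_mono)
			fix k assume k: "k \<in> F"
			then have "norm (d k) * nap om (Z k (bv b)) \<le> norm (d k) * (\<Sum>i\<in>?S b k. nap om (X i (bv b)))"
				unfolding Z(3)[OF subsetD[OF F(2) k]] by (intro mult_left_mono nap_sum[OF dm]) auto
			also have "\<dots> = (\<Sum>i\<in>?S b k. norm (c i) * nap om (X i (bv b)))"
				unfolding sum_distrib_left using g(2) by (intro sum.cong refl) auto
			finally show "norm (d k) * nap om (Z k (bv b)) \<le> (\<Sum>i\<in>?S b k. norm (c i) * nap om (X i (bv b)))" .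
		qed
		also have "\<dots> = (\<Sum>i\<in>(\<Union>k\<in>F. ?S b k). norm (c i) * nap om (X i (bv b)))"
			by (rule sum.UNION_disjoint[symmetric]) (use F Z(2) in auto)
		also have "\<dots> \<le> om' b" by (intro admD(3)[OF a]) (use F Z(2) in auto)
		finally show ?thesis .
	qed
	fix b
	let ?f = "%i. c i * ap La (X i (bv b))"
	have "(?f has_sum La' b) I" by (rule admD(4)[OF a])
	then have "((%p. ?f (snd p)) has_sum La' b) (Sigma K (%k. {i \<in> I. g i = k}))"
		by (subst has_sum_reindex_bij_witness[of _ "%i. (g i, i)" snd]) (use g in auto)
	then show "((%k. d k * ap La (Z k (bv b))) has_sum La' b) K"
	proof (rule has_sum_SigmaD)
		fix k assume k: "k \<in> K"
		have "d k * ap La (Z k (bv b)) = (\<Sum>i\<in>?S b k. ?f i)"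
			unfolding Z(3)[OF k] ap_sum sum_distrib_left using g(2) by (intro sum.cong refl) auto
		then show "((%y. ?f (snd (k, y))) has_sum d k * ap La (Z k (bv b))) {i \<in> I. g i = k}"
			by (intro has_sum_finite_neutralI[OF Z(2)[OF k, of b]]) auto
	qed
qed

lemma adm_Sigma:
	assumes a: "\<And>j. j \<in> J ==> adm (I j) (%i. c (j, i)) (%i. X (j, i)) La om (La' j) (om' j)"
		and d: "maj La om"
		and b: "\<And>b F. finite F ==> F \<subseteq> J ==> (\<Sum>j\<in>F. om' j b) \<le> om'' b" and s: "\<And>b. ((%j. La' j b) has_sum La'' b) J"
	shows "adm (Sigma J I) c X La om La'' om''"
	unfolding adm_def
proof (intro conjI allI impI ballI)
	show "maj La om" by (rule d)
	show "lin (X p)" if "p \<in> Sigma J I" for p using that admD(2)[OF a] by auto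
	show bd: "(\<Sum>p\<in>F. norm (c p) * nap om (X p (bv b))) \<le> om'' b" if F: "finite F" "F \<subseteq> Sigma J I" for b F
	proof -
		let ?G = "%j. snd ` {p \<in> F. fst p = j}"
		have "F = Sigma (fst ` F) ?G" by force
		then have "(\<Sum>p\<in>F. norm (c p) * nap om (X p (bv b))) = (\<Sum>p\<in>Sigma (fst ` F) ?G. norm (c p) * nap om (X p (bv b)))" by simp
		also have "\<dots> = (\<Sum>j\<in>fst ` F. \<Sum>i\<in>?G j. norm (c (j, i)) * nap om (X (j, i) (bv b)))"
			using F by (subst sum.Sigma) (auto simp: split_def)
		also have "\<dots> \<le> (\<Sum>j\<in>fst ` F. om' j b)" using F by (intro sum_mono admD(3)[OF a]) auto
		also have "\<dots> \<le> om'' b" using F by (intro b) auto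
		finally show ?thesis .
	qed
	fix b
	have "(%p. c p * ap La (X p (bv b))) summable_on Sigma J I"
	proof (rule summable_of_bound)
		fix F assume F: "finite F" "F \<subseteq> Sigma J I"
		have "(\<Sum>p\<in>F. norm (c p * ap La (X p (bv b)))) \<le> (\<Sum>p\<in>F. norm (c p) * nap om (X p (bv b)))"
			by (intro sum_mono) (auto simp: norm_mult intro!: mult_left_mono norm_ap[OF d])
		then show "(\<Sum>p\<in>F. norm (c p * ap La (X p (bv b)))) \<le> om'' b" using bd[OF F, of b] by linarith
	qed
	then show "((%p. c p * ap La (X p (bv b))) has_sum La'' b) (Sigma J I)"
		by (intro has_sum_SigmaI[OF _ s]) (auto intro: admD(4)[OF a])
qed

text \<open>Passing one current turns a coherent functional into a combination of several, one for
  each tensor factor; the next current is then summed against the whole combination.\<close>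

lemma adm_lin_comb:
	assumes a: "\<And>j. j \<in> J ==> adm I c X (La j) (om j) (La' j) (om' j)" and J: "J \<noteq> {}"
		and s: "\<And>j. j \<in> J ==> norm (s j) \<le> S j"
	shows "adm I c X (%b. \<Sum>j\<in>J. s j * La j b) (%b. \<Sum>j\<in>J. S j * om j b)
		(%b. \<Sum>j\<in>J. s j * La' j b) (%b. \<Sum>j\<in>J. S j * om' j b)"
	unfolding adm_def
proof (intro conjI allI impI ballI)
	show "maj (%b. \<Sum>j\<in>J. s j * La j b) (%b. \<Sum>j\<in>J. S j * om j b)"
		unfolding maj_def
	proof (intro allI sum_norm_le)
		fix b j assume j: "j \<in> J"
		show "norm (s j * La j b) \<le> S j * om j b"
			unfolding norm_mult using admD(1)[OF a[OF j]] s[OF j] order_trans[OF norm_ge_zero s[OF j]]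
			by (intro mult_mono) (auto simp: maj_def)
	qed
	show "lin (X i)" if "i \<in> I" for i using J admD(2)[OF a] that by blast
	have n: "nap (%b. \<Sum>j\<in>J. S j * om j b) v = (\<Sum>j\<in>J. S j * nap (om j) v)" for v
		unfolding nap_def sum_distrib_left by (subst sum.swap) (simp add: mult_ac)
	have p: "ap (%b. \<Sum>j\<in>J. s j * La j b) v = (\<Sum>j\<in>J. s j * ap (La j) v)" for v
		unfolding ap_def sum_distrib_left by (subst sum.swap) (simp add: mult_ac)
	show "(\<Sum>i\<in>F. norm (c i) * nap (%b. \<Sum>j\<in>J. S j * om j b) (X i (bv b))) \<le> (\<Sum>j\<in>J. S j * om' j b)"
		if F: "finite F" "F \<subseteq> I" for b F
	proof -
		have "(\<Sum>i\<in>F. norm (c i) * nap (%b. \<Sum>j\<in>J. S j * om j b) (X i (bv b))) =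
				(\<Sum>j\<in>J. S j * (\<Sum>i\<in>F. norm (c i) * nap (om j) (X i (bv b))))"
			unfolding n sum_distrib_left by (subst sum.swap) (simp add: mult_ac)
		also have "\<dots> \<le> (\<Sum>j\<in>J. S j * om' j b)"
			by (intro sum_mono mult_left_mono admD(3)[OF a F] order_trans[OF norm_ge_zero s])
		finally show ?thesis .
	qed
	have "((%i. \<Sum>j\<in>J. s j * (c i * ap (La j) (X i (bv b)))) has_sum (\<Sum>j\<in>J. s j * La' j b)) I" for b
		by (intro has_sum_sum has_sum_cmult_right admD(4)[OF a])
	then show "((%i. c i * ap (%b. \<Sum>j\<in>J. s j * La j b) (X i (bv b))) has_sum (\<Sum>j\<in>J. s j * La' j b)) I" for b
		by (simp add: p sum_distrib_left mult_ac)
qed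

subsection \<open>Operator-valued series\<close>

definition lins :: "'b opser => bool" where "lins X \<longleftrightarrow> (\<forall>p. lin (X p))"

lemma linsD: "lins X ==> lin (X p)" by (simp add: lins_def)

text \<open>Makes the sum over modes in a product finite on each basis vector; on infinite support
  \<open>Sum_any\<close> would silently be 0.\<close>

definition locfin :: "'b opser => 'b opser => bool"
	where "locfin X Y \<longleftrightarrow> (\<forall>b p. finite {i. X i (Y (p - i) (bv b)) \<noteq> 0})"

definition finmodes :: "'b opser => bool"
	where "finmodes X \<longleftrightarrow> (\<forall>b. finite {i. X i (bv b) \<noteq> 0})"

text \<open>\<open>\<epsilon> = 0\<close> expresses that \<open>D\<close> is preserved, \<open>\<epsilon> = 1\<close> that the mode \<open>p\<close> raises \<open>D\<close> by \<open>p\<close>.\<close>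

definition graded :: "('b => int) => int => 'b opser => bool"
	where "graded D \<epsilon> X \<longleftrightarrow> (\<forall>p b b'. b' \<in> keys (X p (bv b)) \<longrightarrow> D b' = D b + \<epsilon> * p)"

lemma lin_nonzero: "lin Z ==> Z v \<noteq> 0 ==> \<exists>b\<in>keys v. Z (bv b) \<noteq> 0"
proof (rule ccontr)
	assume Z: "lin Z" "Z v \<noteq> 0" "\<not> (\<exists>b\<in>keys v. Z (bv b) \<noteq> 0)"
	have "Z v = (\<Sum>b\<in>keys v. scl (lookup v b) (Z (bv b)))" by (rule lin_expand[OF Z(1)])
	also have "\<dots> = 0" using Z(3) by (intro sum.neutral) (auto simp: scl_simps)
	finally show False using Z(2) by simp
qed

lemma keys_sumD: "b \<in> keys (sum f A) ==> \<exists>i\<in>A. b \<in> keys (f i)"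
	by (metis in_keys_iff lookup_sum sum.not_neutral_contains_not_neutral)

lemma keys_lin:
	assumes "lin Z" "b' \<in> keys (Z v)"
	shows "\<exists>b\<in>keys v. b' \<in> keys (Z (bv b))"
proof -
	have "b' \<in> keys (\<Sum>b\<in>keys v. scl (lookup v b) (Z (bv b)))"
		using assms(2) unfolding lin_expand[OF assms(1), of v] .
	then have "\<exists>b\<in>keys v. b' \<in> keys (scl (lookup v b) (Z (bv b)))"
		by (rule keys_sumD)
	then show ?thesis by (auto simp: in_keys_iff lookup_scl)
qed

lemma finite_support_lin:
	assumes "\<And>i. lin (Z i)" "\<And>b. finite {i. Z i (bv b) \<noteq> 0}"
	shows "finite {i. Z i v \<noteq> 0}"
proof (rule finite_subset)
	show "{i. Z i v \<noteq> 0} \<subseteq> (\<Union>b\<in>keys v. {i. Z i (bv b) \<noteq> 0})" using lin_nonzero[OF assms(1)] by fast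
qed (use assms in auto)

lemma lin_Sum_any:
	assumes Z: "\<And>i. lin (Z i)" "\<And>b. finite {i. Z i (bv b) \<noteq> 0}"
	shows "lin (%v. Sum_any (%i. Z i v))"
proof (rule linI)
	note f = finite_support_lin[OF Z]
	show "Sum_any (%i. Z i (u + v)) = Sum_any (%i. Z i u) + Sum_any (%i. Z i v)" for u v
		by (simp add: lin_add[OF Z(1)] Sum_any.distrib[OF f f])
	fix c v
	have "(\<Sum>i\<in>A. scl c (Z i v)) = scl c (\<Sum>i\<in>A. Z i v)" for A
		by (induction A rule: infinite_finite_induct) (auto simp: scl_simps)
	then show "Sum_any (%i. Z i (scl c v)) = scl c (Sum_any (%i. Z i v))"
		by (subst (1 2) Sum_any.expand_superset[OF f[of v]]) (auto simp: lin_scl[OF Z(1)] scl_simps)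
qed

lemma lins_star: "lins X ==> lins Y ==> locfin X Y ==> lins (X \<star> Y)"
	unfolding lins_def ser_mult_def[abs_def] locfin_def by (intro allI lin_Sum_any) (auto intro: lin_comp)

lemma locfin_finmodes: "lins X ==> finmodes Y ==> locfin X Y"
	unfolding locfin_def
proof (intro allI)
	fix b p assume X: "lins X" "finmodes Y"
	have "{i. X i (Y (p - i) (bv b)) \<noteq> 0} \<subseteq> (%j. p - j) ` {j. Y j (bv b) \<noteq> 0}"
	proof
		fix i assume i: "i \<in> {i. X i (Y (p - i) (bv b)) \<noteq> 0}"
		then have "Y (p - i) (bv b) \<noteq> 0" using lin_0[OF linsD[OF X(1)]] by auto
		then show "i \<in> (%j. p - j) ` {j. Y j (bv b) \<noteq> 0}" by (intro image_eqI[of _ _ "p - i"]) auto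
	qed
	then show "finite {i. X i (Y (p - i) (bv b)) \<noteq> 0}" by (rule finite_subset) (use X in "auto simp: finmodes_def")
qed

lemma finmodes_star:
	assumes X: "lins X" "finmodes X" and Y: "lins Y" "finmodes Y"
	shows "finmodes (X \<star> Y)"
	unfolding finmodes_def
proof
	fix b
	let ?J = "{j. Y j (bv b) \<noteq> 0}" and ?I = "%j. {i. X i (Y j (bv b)) \<noteq> 0}"
	have fI: "finite (?I j)" for j
		using finite_support_lin[of X "Y j (bv b)"] X by (auto simp: lins_def finmodes_def)
	have "{p. (X \<star> Y) p (bv b) \<noteq> 0} \<subseteq> (\<Union>j\<in>?J. (%i. i + j) ` ?I j)"
	proof
		fix p assume "p \<in> {p. (X \<star> Y) p (bv b) \<noteq> 0}"
		then have "Sum_any (%i. X i (Y (p - i) (bv b))) \<noteq> 0" by (simp add: ser_mult_def)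
		then obtain i where i: "X i (Y (p - i) (bv b)) \<noteq> 0" by (rule Sum_any.not_neutral_obtains_not_neutral)
		then have "Y (p - i) (bv b) \<noteq> 0" using lin_0[OF linsD[OF X(1)]] by auto
		with i show "p \<in> (\<Union>j\<in>?J. (%i. i + j) ` ?I j)" by (intro UN_I[of "p - i"] image_eqI[of _ _ i]) auto
	qed
	then show "finite {p. (X \<star> Y) p (bv b) \<noteq> 0}" by (rule finite_subset) (use Y fI in "auto simp: finmodes_def")
qed

lemma graded_star:
	assumes X: "lins X" "graded D \<epsilon> X" and Y: "graded D \<epsilon> Y" and f: "locfin X Y"
	shows "graded D \<epsilon> (X \<star> Y)"
	unfolding graded_def
proof (intro allI impI)
	fix p b b' assume "b' \<in> keys ((X \<star> Y) p (bv b))"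
	then have "b' \<in> keys (\<Sum>i\<in>{i. X i (Y (p - i) (bv b)) \<noteq> 0}. X i (Y (p - i) (bv b)))"
		unfolding ser_mult_def using f by (simp add: Sum_any.expand_set)
	then obtain i where "b' \<in> keys (X i (Y (p - i) (bv b)))" using keys_sumD by fast
	then obtain b1 where "b1 \<in> keys (Y (p - i) (bv b))" "b' \<in> keys (X i (bv b1))"
		using keys_lin[OF linsD[OF X(1)]] by blast
	then have "D b1 = D b + \<epsilon> * (p - i)" "D b' = D b1 + \<epsilon> * i" using X(2) Y unfolding graded_def by blast+
	then show "D b' = D b + \<epsilon> * p" by (simp add: algebra_simps)
qed

abbreviation oadm :: "'b opser => complex => ('b => complex) => ('b => real) => ('b => complex) => ('b => real) => bool"
	where "oadm X z \<equiv> adm UNIV (%p. z powi p) X"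

lemma oadm_lins: "oadm X z La om La' om' ==> lins X"
	using admD(2) by (fastforce simp: lins_def)

lemma oadm_star:
	assumes a: "oadm X z La om La' om'" and b: "oadm Y z La' om' La'' om''" and f: "locfin X Y" and z: "z \<noteq> 0"
	shows "oadm (X \<star> Y) z La om La'' om''"
proof (rule adm_push[OF adm_comp[OF a b], of "%(i, j). i + j"])
	show "lin ((X \<star> Y) k)" for k using lins_star[OF oadm_lins[OF a] oadm_lins[OF b] f] by (rule linsD)
	let ?P = "%k b. {ij \<in> UNIV \<times> UNIV. (case ij of (i, j) => i + j) = k \<and> (case ij of (i, j) => %v. X i (Y j v)) (bv b) \<noteq> 0}"
	have P: "?P k b = (%i. (i, k - i)) ` {i. X i (Y (k - i) (bv b)) \<noteq> 0}" for k b by force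
	show "finite (?P k b)" for k b unfolding P using f by (simp add: locfin_def)
	show "(X \<star> Y) k (bv b) = (\<Sum>i\<in>?P k b. (case i of (i, j) => %v. X i (Y j v)) (bv b))" for k b
		unfolding P ser_mult_def by (subst sum.reindex) (auto simp: inj_on_def Sum_any.expand_set)
qed (use z in "auto simp: power_int_add")

lemma adm_scale:
	assumes a: "adm I c X La om La' om'" and s: "norm s \<le> S"
	shows "adm I c X (%b. s * La b) (%b. S * om b) (%b. s * La' b) (%b. S * om' b)"
	unfolding adm_def
proof (intro conjI allI impI ballI)
	have S: "0 \<le> S" using s norm_ge_zero order_trans by blast
	show "maj (%b. s * La b) (%b. S * om b)"
		using admD(1)[OF a] s S by (auto simp: maj_def norm_mult intro!: mult_mono)
	show "lin (X i)" if "i \<in> I" for i using admD(2)[OF a that] .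
	have n: "nap (%b. S * om b) v = S * nap om v" "ap (%b. s * La b) v = s * ap La v" for v
		by (simp_all add: nap_def ap_def sum_distrib_left mult_ac)
	show "(\<Sum>i\<in>F. norm (c i) * nap (%b. S * om b) (X i (bv b))) \<le> S * om' b" if "finite F" "F \<subseteq> I" for b F
		using mult_left_mono[OF admD(3)[OF a that, where b = b] S] by (simp add: n sum_distrib_left mult_ac)
	show "((%i. c i * ap (%b. s * La b) (X i (bv b))) has_sum s * La' b) I" for b
		using has_sum_cmult_right[OF admD(4)[OF a, where b = b], of s] by (simp add: n mult_ac)
qed

lemma adm_scale_op:
	assumes a: "adm I c X La om La' om'"
	shows "adm I c (%i v. scl s (X i v)) La om (%b. s * La' b) (%b. norm s * om' b)"
	unfolding adm_def
proof (intro conjI allI impI ballI)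
	show "maj La om" by (rule admD(1)[OF a])
	show "lin (%v. scl s (X i v))" if "i \<in> I" for i using admD(2)[OF a that] by (rule lin_simps)
	show "(\<Sum>i\<in>F. norm (c i) * nap om (scl s (X i (bv b)))) \<le> norm s * om' b" if "finite F" "F \<subseteq> I" for b F
		using mult_left_mono[OF admD(3)[OF a that, where b = b] norm_ge_zero[of s]] by (simp add: nap_scl sum_distrib_left mult_ac)
	show "((%i. c i * ap La (scl s (X i (bv b)))) has_sum s * La' b) I" for b
		using has_sum_cmult_right[OF admD(4)[OF a, where b = b], of s] by (simp add: ap_scl mult_ac)
qed

lemma lins_const: "lin A ==> lins (ser_const A)"
	unfolding lins_def
proof
	fix p assume "lin A"
	moreover have "ser_const A p = (if p = 0 then A else (%v. 0))" by (auto simp: ser_const_def)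
	ultimately show "lin (ser_const A p)" by (simp add: lin_simps)
qed

lemma locfin_const: "locfin (ser_const A) Y"
	unfolding locfin_def by (intro allI, rule finite_subset[of _ "{0}"]) (auto simp: ser_const_def)

lemma finmodes_const: "finmodes (ser_const A)"
	unfolding finmodes_def by (intro allI, rule finite_subset[of _ "{0}"]) (auto simp: ser_const_def)

lemma oadm_const:
	assumes "lin A" "maj La om" "\<And>b. La' b = ap La (A (bv b))" "\<And>b. om' b = nap om (A (bv b))"
	shows "oadm (ser_const A) z La om La' om'"
	unfolding adm_def
proof (intro conjI allI impI ballI)
	show "lin (ser_const A p)" for p using lins_const[OF assms(1)] by (rule linsD)
	show "(\<Sum>i\<in>F. norm (z powi i) * nap om (ser_const A i (bv b))) \<le> om' b" if F: "finite F" for b F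
	proof -
		have "(\<Sum>i\<in>F. norm (z powi i) * nap om (ser_const A i (bv b))) = (\<Sum>i\<in>F. if i = 0 then om' b else 0)"
			by (intro sum.cong refl) (auto simp: ser_const_def assms(4))
		also have "\<dots> \<le> om' b" using F nap_nonneg[OF assms(2)] by (simp add: assms(4))
		finally show ?thesis .
	qed
	show "((%i. z powi i * ap La (ser_const A i (bv b))) has_sum La' b) UNIV" for b
		by (rule has_sum_finite_neutralI[of "{0}"]) (auto simp: ser_const_def assms(3))
qed (rule assms)

lemma lins_rescale: "lins X ==> lins (ser_rescale c X)"
	unfolding lins_def ser_rescale_def[abs_def] by (auto intro: lin_simps)

lemma finmodes_rescale: "finmodes X ==> finmodes (ser_rescale c X)"
	unfolding finmodes_def
proof
	fix b assume "\<forall>b. finite {i. X i (bv b) \<noteq> 0}"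
	moreover have "{i. ser_rescale c X i (bv b) \<noteq> 0} \<subseteq> {i. X i (bv b) \<noteq> 0}"
		by (auto simp: ser_rescale_def scl_simps)
	ultimately show "finite {i. ser_rescale c X i (bv b) \<noteq> 0}" using finite_subset by blast
qed

lemma oadm_rescale:
	assumes a: "oadm X (c * z) La om La' om'"
	shows "oadm (ser_rescale c X) z La om La' om'"
	unfolding adm_def
proof (intro conjI allI impI ballI)
	show "lin (ser_rescale c X p)" for p using lins_rescale[OF oadm_lins[OF a]] by (rule linsD)
	show "(\<Sum>i\<in>F. norm (z powi i) * nap om (ser_rescale c X i (bv b))) \<le> om' b" if F: "finite F" for b F
		using admD(3)[OF a F, where b = b] by (simp add: ser_rescale_def nap_scl power_int_mult_distrib norm_mult mult_ac)
	show "((%i. z powi i * ap La (ser_rescale c X i (bv b))) has_sum La' b) UNIV" for b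
		using admD(4)[OF a, where b = b] by (simp add: ser_rescale_def ap_scl power_int_mult_distrib mult_ac)
qed (rule admD(1)[OF a])

text \<open>\<open>s = 1\<close> for creation and \<open>s = -1\<close> for annihilation series.\<close>

definition onesided :: "int => 'b opser => bool"
	where "onesided s X \<longleftrightarrow> (s = 1 \<or> s = - 1) \<and> (\<forall>p v. s * p \<le> 0 \<longrightarrow> X p v = 0)"

text \<open>Each factor moves the mode by at least 1 in the direction \<open>s\<close>, so the j-th
  power starts at distance j and every mode of the exponential is a finite sum.\<close>

lemma ser_pow_onesided:
	assumes X: "onesided s X" "lins X"
	shows "lins (ser_pow X j) \<and> locfin X (ser_pow X j) \<and> (\<forall>p v. s * p < int j \<longrightarrow> ser_pow X j p v = 0)"
proof (induction j)
	have lf: "locfin X Y" if Y: "\<forall>p v. s * p < int j \<longrightarrow> Y p v = 0" for Y j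
		unfolding locfin_def
	proof (intro allI, rule finite_subset)
		fix b p
		show "{i. X i (Y (p - i) (bv b)) \<noteq> 0} \<subseteq> {- \<bar>p\<bar>..\<bar>p\<bar>}"
		proof
			fix i assume i: "i \<in> {i. X i (Y (p - i) (bv b)) \<noteq> 0}"
			then have "\<not> s * i \<le> 0" using X(1) unfolding onesided_def by blast
			moreover have "Y (p - i) (bv b) \<noteq> 0" using i lin_0[OF linsD[OF X(2)]] by auto
			then have "\<not> s * (p - i) < int j" using Y by blast
			ultimately show "i \<in> {- \<bar>p\<bar>..\<bar>p\<bar>}" using X(1) by (auto simp: onesided_def)
		qed
	qed simp
	{
		case 0
		have z: "\<forall>p v. s * p < int 0 \<longrightarrow> ser_pow X 0 p v = 0" using X(1) by (auto simp: ser_const_def)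
		show ?case using lf[OF z] z lins_const[OF lin_simps(1)] by (simp add: id_def)
	next
		case (Suc j)
		have z: "\<forall>p v. s * p < int (Suc j) \<longrightarrow> ser_pow X (Suc j) p v = 0"
		proof (intro allI impI)
			fix p v assume p: "s * p < int (Suc j)"
			have "X i (ser_pow X j (p - i) v) = 0" for i
			proof (cases "s * i \<le> 0")
				case True
				then show ?thesis using X(1) by (simp add: onesided_def)
			next
				case False
				then have "s * (p - i) < int j" using p by (simp add: right_diff_distrib)
				then have "ser_pow X j (p - i) v = 0" using Suc by blast
				then show ?thesis using lin_0[OF linsD[OF X(2)]] by simp
			qed
			then show "ser_pow X (Suc j) p v = 0" by (simp add: ser_mult_def)
		qed
		show ?case using lf[OF z] z lins_star[OF X(2)] Suc by auto
	}
qed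

lemma lins_exp:
	assumes X: "onesided s X" "lins X"
	shows "finite {j. scl (1 / fact j) (ser_pow X j p v) \<noteq> 0}" "lins (ser_exp X)" "s * p < 0 ==> ser_exp X p v = 0"
proof -
	note P = ser_pow_onesided[OF X]
	have f: "finite {j. scl (1 / fact j) (ser_pow X j p v) \<noteq> 0}" for p v
	proof (rule finite_subset)
		show "{j. scl (1 / fact j) (ser_pow X j p v) \<noteq> 0} \<subseteq> {..nat (s * p)}"
		proof
			fix j assume "j \<in> {j. scl (1 / fact j) (ser_pow X j p v) \<noteq> 0}"
			then have "\<not> s * p < int j" using P[of j] by (auto simp: scl_simps)
			then show "j \<in> {..nat (s * p)}" by auto
		qed
	qed simp
	show "finite {j. scl (1 / fact j) (ser_pow X j p v) \<noteq> 0}" by (rule f)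
	show "lins (ser_exp X)"
		unfolding lins_def ser_exp_def[abs_def]
		by (intro allI lin_Sum_any f lin_simps(3)) (use P in "auto simp: lins_def")
	show "ser_exp X p v = 0" if "s * p < 0"
	proof -
		have "ser_pow X j p v = 0" for j using P[of j] that by auto
		then show ?thesis by (simp add: ser_exp_def scl_simps)
	qed
qed

lemma graded_exp:
	assumes X: "onesided s X" "lins X" "graded D \<epsilon> X"
	shows "graded D \<epsilon> (ser_exp X)"
proof -
	have "graded D \<epsilon> (ser_pow X j)" for j
	proof (induction j)
		case 0
		show ?case by (auto simp: graded_def ser_const_def)
	next
		case (Suc j)
		then show ?case using graded_star[OF X(2,3)] ser_pow_onesided[OF X(1,2)] by auto
	qed
	moreover have "\<exists>j. b' \<in> keys (ser_pow X j p v)" if "b' \<in> keys (ser_exp X p v)" for b' p v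
	proof -
		have "b' \<in> keys (\<Sum>j\<in>{j. scl (1 / fact j) (ser_pow X j p v) \<noteq> 0}. scl (1 / fact j) (ser_pow X j p v))"
			using that unfolding ser_exp_def Sum_any.expand_set .
		then obtain j where "b' \<in> keys (scl (1 / fact j) (ser_pow X j p v))" using keys_sumD by fast
		then show ?thesis by (auto simp: in_keys_iff lookup_scl)
	qed
	ultimately show ?thesis unfolding graded_def by blast
qed

text \<open>\<open>La j\<close> is the functional after j applications of \<open>X\<close>. A
  sequence rather than an eigenvalue covers creation modes, where it is geometric, as well as
  annihilation modes, where it consists of derivatives.\<close>

lemma oadm_exp:
	assumes a: "\<And>i. oadm X z (La i) (om i) (La (Suc i)) (om (Suc i))" and X: "onesided s X" and z: "z \<noteq> 0"
		and b: "\<And>b F. finite F ==> (\<Sum>j\<in>F. om j b / fact j) \<le> om' b" and v: "\<And>b. ((%j. La j b / fact j) has_sum La' b) UNIV"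
	shows "oadm (ser_exp X) z (La 0) (om 0) La' om'"
proof -
	note l = oadm_lins[OF a]
	note P = ser_pow_onesided[OF X l]
	have "oadm (ser_pow X j) z (La i) (om i) (La (i + j)) (om (i + j))" for i j
	proof (induction j arbitrary: i)
		case 0
		show ?case using admD(1)[OF a, of i] by (auto intro!: oadm_const simp: lin_simps id_def)
	next
		case (Suc j)
		show ?case using oadm_star[OF a Suc[of "Suc i"] _ z] P by simp
	qed
	from adm_scale_op[OF this[of _ 0], of "1 / fact j" j for j]
	have "oadm (%p v. scl (1 / fact j) (ser_pow X j p v)) z (La 0) (om 0) (%b. La j b / fact j) (%b. om j b / fact j)" for j
		by (simp add: norm_divide)
	then have S: "adm (UNIV \<times> UNIV) (%(j, p). z powi p) (%(j, p) v. scl (1 / fact j) (ser_pow X j p v)) (La 0) (om 0) La' om'"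
		using b v admD(1)[OF a, of 0] by (intro adm_Sigma) auto
	show ?thesis
	proof (rule adm_push[OF S, of snd])
		show "lin (ser_exp X k)" for k using lins_exp(2)[OF X l] by (rule linsD)
		let ?P = "%k b. {jp \<in> UNIV \<times> UNIV. snd jp = k \<and> (case jp of (j, p) => %v. scl (1 / fact j) (ser_pow X j p v)) (bv b) \<noteq> 0}"
		have e: "?P k b = (%j. (j, k)) ` {j. scl (1 / fact j) (ser_pow X j k (bv b)) \<noteq> 0}" for k b by force
		show "finite (?P k b)" for k b unfolding e using lins_exp(1)[OF X l] by simp
		show "ser_exp X k (bv b) = (\<Sum>i\<in>?P k b. (case i of (j, p) => %v. scl (1 / fact j) (ser_pow X j p v)) (bv b))" for k b
			unfolding e ser_exp_def by (subst sum.reindex) (auto simp: inj_on_def Sum_any.expand_set)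
	qed auto
qed

subsection \<open>Coherent functionals on the Fock space\<close>

definition coh :: "int => (nat => 'a::comm_ring_1) => fbasis => 'a"
	where "coh h ph b = (if fst b = h then monv ph (snd b) else 0)"

lemma coh_shift: "coh h u (h', mu + single m (Suc 0)) = u m * coh h u (h', mu)"
	by (simp add: coh_def monv_add)

lemma norm_monv_le:
	fixes ph :: "nat => complex"
	shows "(\<And>m. norm (ph m) \<le> ph' m) ==> norm (monv ph mu) \<le> monv ph' mu"
	unfolding monv_def by (auto simp: prod_norm[symmetric] norm_power intro!: prod_mono power_mono)

lemma maj_coh: "(\<And>m. norm (ph m) \<le> ph' m) ==> maj (coh h ph) (coh h ph')"
	by (simp add: maj_def coh_def norm_monv_le)

lemma lin_boson [simp]: "lin (boson q m)"
	by (simp add: boson_def)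

lemma sum_le_has_sum:
	fixes f :: "'i => real"
	assumes "(f has_sum S) A" "finite F" "F \<subseteq> A" "\<And>x. x \<in> A ==> 0 \<le> f x"
	shows "sum f F \<le> S"
	by (rule has_sum_mono2[OF has_sum_finite[OF assms(2)] assms(1,3)]) (use assms in auto)

lemma has_sum_exp:
	fixes y :: complex
	shows "((%j. y ^ j / fact j) has_sum exp y) UNIV"
proof (rule norm_summable_imp_has_sum)
	have "(%j. y ^ j /\<^sub>R fact j) = (%j. y ^ j / fact j)"
		by (auto simp: scaleR_conv_of_real field_simps)
	then show "(%j. y ^ j / fact j) sums exp y" using exp_converges[of y] by simp
	show "summable (%j. norm (y ^ j / fact j))"
		using summable_exp[of "norm y"] by (simp add: norm_divide norm_power field_simps)
qed

lemma sum_exp_le: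
	fixes Y :: real
	assumes "0 \<le> Y" "finite F"
	shows "(\<Sum>j\<in>F. Y ^ j / fact j) \<le> exp Y"
proof -
	have "(\<Sum>j\<in>F. inverse (fact j) * Y ^ j) \<le> suminf (%j. inverse (fact j) * Y ^ j)"
		by (rule sum_le_suminf[OF summable_exp]) (use assms in auto)
	then show ?thesis using assms by (simp add: exp_def scaleR_conv_of_real field_simps)
qed

lemma wt_add_single: "wt e (mu + single m 1) = wt e mu + e m"
proof -
	let ?A = "insert m (keys mu)"
	have "keys (mu + single m 1) \<subseteq> ?A"
		by (auto simp: in_keys_iff lookup_add lookup_single when_def split: if_splits)
	then have "wt e (mu + single m 1) = (\<Sum>i\<in>?A. e i * lookup mu i + (if i = m then e i else 0))"
		by (subst wt_superset[of ?A]) (auto intro!: sum.cong simp: lookup_add lookup_single when_def distrib_left)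
	also have "\<dots> = wt e mu + e m"
		by (subst wt_superset[of ?A mu]) (auto simp: sum.distrib sum.delta' simp del: sum.insert_if sum.insert)
	finally show ?thesis .
qed

definition creation :: "complex => (int => complex) => fbasis opser"
	where "creation q bt = (%p v. if p > 0 then scl (bt p) (boson q (- p) v) else 0)"

definition annihilation :: "complex => (int => complex) => fbasis opser"
	where "annihilation q ga = (%p v. if p < 0 then scl (ga p) (boson q (- p) v) else 0)"

lemma lins_modes: "lins (creation q bt)" "lins (annihilation q ga)"
proof -
	have "creation q bt p = (if p > 0 then (%v. scl (bt p) (boson q (- p) v)) else (%v. 0))"
		"annihilation q ga p = (if p < 0 then (%v. scl (ga p) (boson q (- p) v)) else (%v. 0))" for p
		by (auto simp: creation_def annihilation_def)
	then show "lins (creation q bt)" "lins (annihilation q ga)" by (auto simp: lins_def lin_simps)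
qed

lemma onesided_modes: "onesided 1 (creation q bt)" "onesided (- 1) (annihilation q ga)"
	by (auto simp: onesided_def creation_def annihilation_def)

lemma creation_bv: "creation q bt p (bv (h, mu)) =
		(if p > 0 then single (h, mu + single (nat p) 1) (bt p) else 0)"
	by (simp add: creation_def boson_single scl_simps)

definition hk :: "complex => nat => complex"
	where "hk q m = qnum q (2 * int m) * qnum q (int m) / of_nat m"

lemma annihilation_bv: "annihilation q ga p (bv (h, mu)) =
		(if p < 0 then single (h, mu - single (nat (- p)) 1)
			(ga p * (hk q (nat (- p)) * of_nat (lookup mu (nat (- p))))) else 0)"
	by (simp add: annihilation_def boson_single scl_simps hk_def)

lemma graded_modes:
	"graded fst 0 (creation q bt)" "graded fst 0 (annihilation q ga)"
	"graded (%b. int (wt (%m. m) (snd b))) 1 (annihilation q ga)"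
proof -
	show "graded fst 0 (creation q bt)" "graded fst 0 (annihilation q ga)"
		by (auto simp: graded_def creation_bv annihilation_bv split: if_splits)
	have "int (wt (%m. m) (mu - single m 1)) = int (wt (%m. m) mu) - int m"
		if "lookup mu m \<noteq> 0" for m mu
	proof -
		have "mu = (mu - single m 1) + single m 1"
			using that by (intro poly_mapping_eqI) (auto simp: lookup_add lookup_minus lookup_single when_def)
		then have "wt (%m. m) mu = wt (%m. m) (mu - single m 1) + m"
			by (metis wt_add_single)
		then show ?thesis by simp
	qed
	then show "graded (%b. int (wt (%m. m) (snd b))) 1 (annihilation q ga)"
		by (auto simp: graded_def annihilation_bv split: if_splits)
qed

text \<open>The energy of a basis vector is nonnegative, and mode p of the exponential, which is
  zero for p > 0, adds p to it.\<close>

lemma finmodes_annihilation_exp: "finmodes (ser_exp (annihilation q ga))"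
	unfolding finmodes_def
proof
	fix b
	let ?D = "%b::fbasis. int (wt (%m. m) (snd b))" and ?X = "ser_exp (annihilation q ga)"
	have g: "graded ?D 1 ?X" by (rule graded_exp[OF onesided_modes(2) lins_modes(2) graded_modes(3)])
	have "{i. ?X i (bv b) \<noteq> 0} \<subseteq> {- ?D b..0}"
	proof
		fix i assume i: "i \<in> {i. ?X i (bv b) \<noteq> 0}"
		then obtain b' where "b' \<in> keys (?X i (bv b))" by (auto simp flip: keys_eq_empty)
		then have "?D b' = ?D b + 1 * i" using g unfolding graded_def by blast
		then have "- ?D b \<le> i" using of_nat_0_le_iff[of "wt (%m. m) (snd b')"] by linarith
		moreover have "\<not> (- 1) * i < 0" using i lins_exp(3)[OF onesided_modes(2) lins_modes(2)] by blast
		ultimately show "i \<in> {- ?D b..0}" by simp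
	qed
	then show "finite {i. ?X i (bv b) \<noteq> 0}" by (rule finite_subset) simp
qed

text \<open>Appending a_(-m) multiplies the coherent value by \<open>ph m\<close>, so the exponent
  acts on the functional as the scalar \<open>y\<close> and its exponential as
  \<open>exp y\<close>.\<close>

lemma oadm_creation_exp:
	assumes ph: "\<And>m. norm (ph m) \<le> ph' m" and z: "z \<noteq> 0"
		and y: "((%p. z powi p * bt p * ph (nat p)) has_sum y) {0<..}"
		and Y: "((%p. norm (z powi p * bt p) * ph' (nat p)) has_sum Y) {0<..}"
	shows "oadm (ser_exp (creation q bt)) z (coh h ph) (coh h ph') (%b. exp y * coh h ph b) (%b. exp Y * coh h ph' b)"
proof -
	have mj: "maj (coh h ph) (coh h ph')" by (rule maj_coh[OF ph])
	have ph0: "0 \<le> ph' m" for m using ph[of m] norm_ge_zero order_trans by blast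
	have base: "oadm (creation q bt) z (coh h ph) (coh h ph') (%b. y * coh h ph b) (%b. Y * coh h ph' b)"
		unfolding adm_def
	proof (intro conjI allI impI ballI)
		show "maj (coh h ph) (coh h ph')" by (rule mj)
		show "lin (creation q bt p)" for p by (rule linsD[OF lins_modes(1)])
		fix b :: fbasis
		obtain h' mu where b: "b = (h', mu)" by force
		show "(\<Sum>p\<in>F. norm (z powi p) * nap (coh h ph') (creation q bt p (bv b))) \<le> Y * coh h ph' b" if F: "finite F" for F
		proof -
			have "(\<Sum>p\<in>F. norm (z powi p) * nap (coh h ph') (creation q bt p (bv b))) =
					(\<Sum>p\<in>F \<inter> {0<..}. norm (z powi p * bt p) * ph' (nat p)) * coh h ph' b"
				unfolding sum_distrib_right b using F
				by (intro sum.mono_neutral_cong_right) (auto simp: creation_bv coh_shift norm_mult simp del: single_add)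
			also have "\<dots> \<le> Y * coh h ph' b"
				using F by (intro mult_right_mono sum_le_has_sum[OF Y] maj_nonneg[OF mj] mult_nonneg_nonneg ph0) auto
			finally show ?thesis .
		qed
		have "((%p. z powi p * bt p * ph (nat p) * coh h ph b) has_sum y * coh h ph b) {0<..}"
			by (rule has_sum_cmult_left[OF y])
		then show "((%p. z powi p * ap (coh h ph) (creation q bt p (bv b))) has_sum y * coh h ph b) UNIV"
			unfolding b by (rule has_sum_cong_neutral[THEN iffD1, rotated 3]) (auto simp: creation_bv coh_shift mult_ac simp del: single_add)
	qed
	\<comment> \<open>Read off from the majorization at the vacuum of charge h, where both coherent
	  functionals equal 1.\<close>
	have "norm y \<le> Y" using adm_maj[OF base, unfolded maj_def, rule_format, of "(h, 0)"] by (simp add: coh_def)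
	then have Y0: "0 \<le> Y" and p: "norm (y ^ i) \<le> Y ^ i" for i
		using norm_ge_zero order_trans by (blast, auto simp: norm_power intro: power_mono)
	have step: "oadm (creation q bt) z (%b. y ^ i * coh h ph b) (%b. Y ^ i * coh h ph' b)
			(%b. y ^ Suc i * coh h ph b) (%b. Y ^ Suc i * coh h ph' b)" for i
		using adm_scale[OF base p[of i]] by (simp add: mult_ac)
	have "oadm (ser_exp (creation q bt)) z (%b. y ^ 0 * coh h ph b) (%b. Y ^ 0 * coh h ph' b)
			(%b. exp y * coh h ph b) (%b. exp Y * coh h ph' b)"
	proof (rule oadm_exp[where La = "%i b. y ^ i * coh h ph b" and om = "%i b. Y ^ i * coh h ph' b",
				OF step onesided_modes(1) z])
		show "(\<Sum>j\<in>F. Y ^ j * coh h ph' b / fact j) \<le> exp Y * coh h ph' b" if "finite F" for b F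
			using mult_right_mono[OF sum_exp_le[OF Y0 that] maj_nonneg[OF mj, of b]] by (simp add: sum_distrib_right)
		show "((%j. y ^ j * coh h ph b / fact j) has_sum exp y * coh h ph b) UNIV" for b
			using has_sum_cmult_left[OF has_sum_exp[of y], of "coh h ph b"] by simp
	qed
	then show ?thesis by simp
qed

text \<open>Exponentials of annihilation modes are Taylor shifts of \<open>ph\<close>; the \<open>i\<close>-th power of the exponent turns
	the coherent functional into its \<open>i\<close>-th derivative in the direction \<open>dl\<close>.\<close>

definition tay :: "(nat => 'a) => (nat => 'a) => (nat \<Rightarrow>\<^sub>0 nat) => 'a::real_normed_field poly"
	where "tay ph dl mu = monv (%m. [:ph m, dl m:]) mu"

definition dcoh :: "nat => int => (nat => 'a) => (nat => 'a) => fbasis => 'a::real_normed_field"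
	where "dcoh i h ph dl b = (if fst b = h then poly ((pderiv ^^ i) (tay ph dl (snd b))) 0 else 0)"

lemma pderiv_tay: "pderiv (tay ph dl mu) =
		(\<Sum>m\<in>keys mu. smult (of_nat (lookup mu m) * dl m) (tay ph dl (mu - single m 1)))"
	unfolding tay_def monv_def[of _ mu] pderiv_prod
proof (intro sum.cong refl)
	fix m assume m: "m \<in> keys mu"
	let ?u = "%m. [:ph m, dl m:]" and ?K = "keys mu" and ?nu = "mu - single m 1"
	have "monv ?u ?nu = (\<Prod>i\<in>?K. ?u i ^ lookup ?nu i)"
		by (rule monv_superset) (auto simp: in_keys_iff lookup_minus)
	also have "\<dots> = ?u m ^ (lookup mu m - 1) * (\<Prod>i\<in>?K - {m}. ?u i ^ lookup mu i)"
		using m by (subst prod.remove[of _ m])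
			(auto simp: lookup_minus lookup_single when_def intro!: arg_cong2[where f = "(*)"] prod.cong)
	finally have "monv ?u ?nu = ?u m ^ (lookup mu m - 1) * (\<Prod>i\<in>?K - {m}. ?u i ^ lookup mu i)" .
	moreover have "pderiv (?u m) = [:dl m:]" by (simp add: pderiv_pCons)
	ultimately show "(\<Prod>i\<in>?K - {m}. ?u i ^ lookup mu i) * pderiv (?u m ^ lookup mu m) =
			smult (of_nat (lookup mu m) * dl m) (monv ?u ?nu)"
		by (simp add: pderiv_power mult_ac smult_monom)
qed

lemma dcoh_Suc: "dcoh (Suc i) h ph dl (h', mu) =
		(\<Sum>m\<in>keys mu. of_nat (lookup mu m) * dl m * dcoh i h ph dl (h', mu - single m 1))"
	unfolding dcoh_def
	by (simp add: funpow_Suc_right pderiv_tay higher_pderiv_sum higher_pderiv_smult poly_sum del: funpow.simps)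

lemma dcoh_coeff: "dcoh i h ph dl b = (if fst b = h then fact i * coeff (tay ph dl (snd b)) i else 0)"
	by (simp add: dcoh_def poly_0_coeff_0 coeff_higher_pderiv pochhammer_fact)

lemma dcoh_0:
	fixes ph :: "nat => 'a::real_normed_field"
	shows "dcoh 0 h ph dl = coh h ph"
proof
	fix b
	have r: "rhom (%P :: 'a poly. poly P 0)" by (auto simp: rhom_def)
	show "dcoh 0 h ph dl b = coh h ph b" using rhom_monv[OF r] by (simp add: dcoh_def coh_def tay_def)
qed

lemma tay_sum:
	fixes ph :: "nat => 'a::real_normed_field"
	shows "(\<Sum>j\<le>degree (tay ph dl mu). coeff (tay ph dl mu) j) = monv (%m. ph m + dl m) mu"
proof -
	have r: "rhom (%P :: 'a poly. poly P 1)" by (auto simp: rhom_def)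
	have "poly (tay ph dl mu) 1 = monv (%m. ph m + dl m) mu" using rhom_monv[OF r] by (simp add: tay_def)
	then show ?thesis by (simp add: poly_altdef)
qed

text \<open>Coefficientwise majorization is stable under products, and it holds for the linear
  factors.\<close>

lemma norm_coeff_tay:
	fixes ph :: "nat => complex"
	assumes ph: "\<And>m. norm (ph m) \<le> ph' m" and dl: "\<And>m. norm (dl m) \<le> dl' m"
	shows "norm (coeff (tay ph dl mu) i) \<le> coeff (tay ph' dl' mu) i"
proof -
	define M where "M P P' \<longleftrightarrow> (\<forall>i. norm (coeff P i) \<le> coeff P' i)" for P :: "complex poly" and P' :: "real poly"
	have mult: "M (P * R) (P' * R')" if "M P P'" "M R R'" for P P' R R'
		unfolding M_def coeff_mult
	proof (intro allI sum_norm_le)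
		fix n j
		show "norm (coeff P j * coeff R (n - j)) \<le> coeff P' j * coeff R' (n - j)"
			using that norm_ge_zero order_trans unfolding M_def norm_mult by (intro mult_mono) blast+
	qed
	have one: "M 1 1" by (simp add: M_def)
	have lin: "M [:ph m, dl m:] [:ph' m, dl' m:]" for m
		using ph dl by (auto simp: M_def coeff_pCons split: nat.splits)
	have pow: "M (P ^ n) (P' ^ n)" if "M P P'" for P P' n
		by (induction n) (use mult[OF that] one in auto)
	have "M (\<Prod>i\<in>A. [:ph i, dl i:] ^ k i) (\<Prod>i\<in>A. [:ph' i, dl' i:] ^ k i)" for A k
		by (induction A rule: infinite_finite_induct) (use mult pow[OF lin] one in auto)
	then show ?thesis unfolding tay_def monv_def M_def by blast
qed

text \<open>Summing the derivatives divided by factorials evaluates the Taylor polynomial at 1,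
  which shifts the parameters by \<open>dl\<close>; the factor \<open>hk\<close> is the commutator
  of the modes.\<close>

lemma oadm_annihilation_exp:
	assumes ph: "\<And>m. norm (ph m) \<le> ph' m" and z: "z \<noteq> 0"
		and dl: "\<And>m. dl m = (if m = 0 then 0 else z powi (- int m) * ga (- int m) * hk q m)"
	shows "oadm (ser_exp (annihilation q ga)) z (coh h ph) (coh h ph')
		(coh h (%m. ph m + dl m)) (coh h (%m. ph' m + norm (dl m)))"
proof -
	let ?L = "%i. dcoh i h ph dl" and ?W = "%i. dcoh i h ph' (%m. norm (dl m))"
	have nt: "norm (coeff (tay ph dl mu) i) \<le> coeff (tay ph' (%m. norm (dl m)) mu) i" for mu i
		by (rule norm_coeff_tay) (auto intro: ph)
	then have t0: "0 \<le> coeff (tay ph' (%m. norm (dl m)) mu) i" for mu i using norm_ge_zero order_trans by blast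
	have mj: "maj (?L i) (?W i)" for i
		unfolding maj_def dcoh_coeff by (auto simp: norm_mult intro!: mult_left_mono nt)
	have step: "oadm (annihilation q ga) z (?L i) (?W i) (?L (Suc i)) (?W (Suc i))" for i
		unfolding adm_def
	proof (intro conjI allI impI ballI)
		show "maj (?L i) (?W i)" by (rule mj)
		show "lin (annihilation q ga p)" for p by (rule linsD[OF lins_modes(2)])
		fix b :: fbasis
		obtain h' mu where b: "b = (h', mu)" by force
		let ?B = "(%m. - int m) ` (keys mu - {0})"
		have B: "p < 0 ==> p \<notin> ?B ==> lookup mu (nat (- p)) = 0" for p
			by (rule ccontr) (auto simp: in_keys_iff image_iff dest!: bspec[of _ _ "nat (- p)"])
		have re: "(\<Sum>p\<in>?B. f p) = (\<Sum>m\<in>keys mu - {0}. f (- int m))" for f :: "int => 'x::comm_monoid_add"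
			by (subst sum.reindex) (auto simp: inj_on_def)
		have W: "(\<Sum>p\<in>?B. norm (z powi p) * nap (?W i) (annihilation q ga p (bv b))) = ?W (Suc i) b"
			unfolding re b dcoh_Suc
			by (rule sum.mono_neutral_cong_left) (auto simp: annihilation_bv dl norm_mult mult_ac simp del: of_nat_mult)
		have L: "(\<Sum>p\<in>?B. z powi p * ap (?L i) (annihilation q ga p (bv b))) = ?L (Suc i) b"
			unfolding re b dcoh_Suc
			by (rule sum.mono_neutral_cong_left) (auto simp: annihilation_bv dl mult_ac simp del: of_nat_mult)
		have z0: "annihilation q ga p (bv b) = 0" if "p \<notin> ?B" for p
			using B[of p] that by (auto simp: b annihilation_bv)
		show "(\<Sum>p\<in>F. norm (z powi p) * nap (?W i) (annihilation q ga p (bv b))) \<le> ?W (Suc i) b" if F: "finite F" for F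
		proof -
			have "(\<Sum>p\<in>F. norm (z powi p) * nap (?W i) (annihilation q ga p (bv b))) =
					(\<Sum>p\<in>F \<inter> ?B. norm (z powi p) * nap (?W i) (annihilation q ga p (bv b)))"
				using F z0 by (intro sum.mono_neutral_right) auto
			also have "\<dots> \<le> (\<Sum>p\<in>?B. norm (z powi p) * nap (?W i) (annihilation q ga p (bv b)))"
				by (intro sum_mono2) (auto intro!: mult_nonneg_nonneg nap_nonneg[OF mj])
			finally show ?thesis unfolding W .
		qed
		show "((%p. z powi p * ap (?L i) (annihilation q ga p (bv b))) has_sum ?L (Suc i) b) UNIV"
			by (rule has_sum_finite_neutralI[of ?B]) (use z0 in "auto simp: L")
	qed
	have "oadm (ser_exp (annihilation q ga)) z (?L 0) (?W 0)
		(coh h (%m. ph m + dl m)) (coh h (%m. ph' m + norm (dl m)))"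
	proof (rule oadm_exp[where La = ?L and om = ?W, OF step onesided_modes(2) z])
		fix b :: fbasis
		let ?T = "tay ph' (%m. norm (dl m)) (snd b)"
		show "(\<Sum>j\<in>F. ?W j b / fact j) \<le> coh h (%m. ph' m + norm (dl m)) b" if F: "finite F" for F
		proof -
			have "(\<Sum>j\<in>F. coeff ?T j) = (\<Sum>j\<in>F \<inter> {..degree ?T}. coeff ?T j)"
				using F by (intro sum.mono_neutral_right) (auto intro: le_degree)
			also have "\<dots> \<le> (\<Sum>j\<le>degree ?T. coeff ?T j)" by (intro sum_mono2) (auto intro: t0)
			finally show ?thesis by (simp add: dcoh_coeff coh_def tay_sum)
		qed
		have "((%j. coeff (tay ph dl (snd b)) j) has_sum monv (%m. ph m + dl m) (snd b)) UNIV"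
			by (rule has_sum_finite_neutralI[of "{..degree (tay ph dl (snd b))}"]) (auto simp: tay_sum coeff_eq_0)
		then show "((%j. ?L j b / fact j) has_sum coh h (%m. ph m + dl m) b) UNIV"
			by (simp add: dcoh_coeff coh_def)
	qed
	then show ?thesis by (simp only: dcoh_0)
qed

definition del_f :: "complex => complex => complex => nat => complex"
	where "del_f q r z m = (if m = 0 then 0 else z powi (- int m) * (r powi int m / qnum q (int m)) * hk q m)"

definition del_k :: "complex => complex => nat => complex"
	where "del_k q z m = (if m = 0 then 0 else z powi (- int m) * (q - inverse q) * hk q m)"

lemma f_current_alt: "f_current q r = ser_const (exp_alpha (- 1)) \<star> z_pow_minus_a0 \<star>
		ser_exp (creation q (%p. - (r powi p / qnum q p))) \<star>
		ser_exp (annihilation q (%p. r powi (- p) / qnum q (- p)))"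
	by (simp add: f_current_def creation_def annihilation_def)

lemma k_plus_alt: "k_plus q = ser_const (q_pow_a0 q) \<star> ser_exp (annihilation q (%p. q - inverse q))"
	by (simp add: k_plus_def annihilation_def)

lemma z_pow_bv: "z_pow_minus_a0 p (bv b) = (if p = - fst b then bv b else 0)"
	by (cases b) (simp add: z_pow_minus_a0_def lin_ext_single scl_simps)

lemma oadm_z_pow:
	assumes "maj (coh h ph) (coh h ph')"
	shows "oadm z_pow_minus_a0 z (coh h ph) (coh h ph')
		(%b. z powi (- h) * coh h ph b) (%b. norm (z powi (- h)) * coh h ph' b)"
	unfolding adm_def
proof (intro conjI allI impI ballI)
	show "lin (z_pow_minus_a0 p)" for p by (simp add: z_pow_minus_a0_def)
	show "(\<Sum>p\<in>F. norm (z powi p) * nap (coh h ph') (z_pow_minus_a0 p (bv b))) \<le> norm (z powi (- h)) * coh h ph' b"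
		if F: "finite F" for b F
	proof -
		have "(\<Sum>p\<in>F. norm (z powi p) * nap (coh h ph') (z_pow_minus_a0 p (bv b))) =
				(\<Sum>p\<in>F. if p = - fst b then norm (z powi (- h)) * coh h ph' b else 0)"
			by (intro sum.cong refl) (auto simp: z_pow_bv coh_def)
		then show ?thesis using F maj_nonneg[OF assms, of b] by simp
	qed
	show "((%p. z powi p * ap (coh h ph) (z_pow_minus_a0 p (bv b))) has_sum z powi (- h) * coh h ph b) UNIV" for b
		by (rule has_sum_finite_neutralI[of "{- fst b}"]) (auto simp: z_pow_bv coh_def)
qed (rule assms)

text \<open>The oscillator exponentials preserve the charge h, and on that charge only the mode -h
  of \<open>z_pow_minus_a0\<close> is nonzero.\<close>

lemma f_current_structure:
	fixes q :: complex and bt ga :: "int => complex"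
	defines "C \<equiv> ser_exp (creation q bt)" and "A \<equiv> ser_exp (annihilation q ga)"
	shows "locfin C A" "locfin z_pow_minus_a0 (C \<star> A)"
proof -
	have l: "lins C" "lins A" unfolding C_def A_def
		by (rule lins_exp(2)[OF onesided_modes(1) lins_modes(1)], rule lins_exp(2)[OF onesided_modes(2) lins_modes(2)])
	show f: "locfin C A" by (rule locfin_finmodes[OF l(1)]) (simp add: A_def finmodes_annihilation_exp)
	have g: "graded fst 0 (C \<star> A)"
		by (rule graded_star[OF l(1) _ _ f]; unfold C_def A_def)
			(rule graded_exp[OF onesided_modes(1) lins_modes(1) graded_modes(1)],
			 rule graded_exp[OF onesided_modes(2) lins_modes(2) graded_modes(2)])
	show "locfin z_pow_minus_a0 (C \<star> A)"
		unfolding locfin_def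
	proof (intro allI)
		fix b p
		have "{i. z_pow_minus_a0 i ((C \<star> A) (p - i) (bv b)) \<noteq> 0} \<subseteq> {- fst b}"
		proof
			fix i assume i: "i \<in> {i. z_pow_minus_a0 i ((C \<star> A) (p - i) (bv b)) \<noteq> 0}"
			have "lin (z_pow_minus_a0 i)" by (simp add: z_pow_minus_a0_def)
			from lin_nonzero[OF this] i obtain b' where b': "b' \<in> keys ((C \<star> A) (p - i) (bv b))"
				"z_pow_minus_a0 i (bv b') \<noteq> 0" by blast
			have "fst b' = fst b + 0 * (p - i)" using g b'(1) unfolding graded_def by blast
			then show "i \<in> {- fst b}" using b'(2) by (simp add: z_pow_bv split: if_splits)
		qed
		then show "finite {i. z_pow_minus_a0 i ((C \<star> A) (p - i) (bv b)) \<noteq> 0}" by (rule finite_subset) simp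
	qed
qed

text \<open>e^(-\<alpha>) lowers the charge by 2, so the functional pulled back through it lives on
  charge h + 2; there z^(-a_0) gives the exponent -(h + 2).\<close>

lemma f_current_step:
	assumes ph: "\<And>m. norm (ph m) \<le> ph' m" and z: "z \<noteq> 0"
		and y: "((%p. z powi p * - (r powi p / qnum q p) * ph (nat p)) has_sum y) {0<..}"
		and Y: "((%p. norm (z powi p * - (r powi p / qnum q p)) * ph' (nat p)) has_sum Y) {0<..}"
	shows "oadm (f_current q r) z (coh h ph) (coh h ph')
		(%b. z powi (- (h + 2)) * exp y * coh (h + 2) (%m. ph m + del_f q r z m) b)
		(%b. norm (z powi (- (h + 2))) * exp Y * coh (h + 2) (%m. ph' m + norm (del_f q r z m)) b)"
proof -
	let ?C = "ser_exp (creation q (%p. - (r powi p / qnum q p)))"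
		and ?A = "ser_exp (annihilation q (%p. r powi (- p) / qnum q (- p)))"
	note mj = maj_coh[where ph = ph and ph' = ph', OF ph]
	have s: "norm (exp y) \<le> exp Y"
		using adm_maj[OF oadm_creation_exp[OF ph z y Y, of q 0], unfolded maj_def, rule_format, of "(0, 0)"] by (simp add: coh_def)
	have 3: "oadm (?C \<star> ?A) z (coh (h + 2) ph) (coh (h + 2) ph') (%b. exp y * coh (h + 2) (%m. ph m + del_f q r z m) b)
			(%b. exp Y * coh (h + 2) (%m. ph' m + norm (del_f q r z m)) b)"
		by (rule oadm_star[OF oadm_creation_exp[OF ph z y Y] adm_scale[OF oadm_annihilation_exp[OF ph z] s] f_current_structure(1) z])
			(simp add: del_f_def)
	have 2: "oadm (z_pow_minus_a0 \<star> ?C \<star> ?A) z (coh (h + 2) ph) (coh (h + 2) ph')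
			(%b. z powi (- (h + 2)) * (exp y * coh (h + 2) (%m. ph m + del_f q r z m) b))
			(%b. norm (z powi (- (h + 2))) * (exp Y * coh (h + 2) (%m. ph' m + norm (del_f q r z m)) b))"
		by (rule oadm_star[OF oadm_z_pow[OF mj] adm_scale[OF 3 order_refl] f_current_structure(2) z])
	have 1: "oadm (ser_const (exp_alpha (- 1))) z (coh h ph) (coh h ph') (coh (h + 2) ph) (coh (h + 2) ph')"
		by (rule oadm_const[OF _ mj]) (auto simp: exp_alpha_def lin_ext_single scl_simps coh_def)
	show ?thesis
		using oadm_star[OF 1 2 locfin_const z] by (simp only: f_current_alt mult.assoc)
qed

lemma k_plus_step:
	assumes ph: "\<And>m. norm (ph m) \<le> ph' m" and z: "z \<noteq> 0"
	shows "oadm (k_plus q) z (coh h ph) (coh h ph')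
		(%b. q powi h * coh h (%m. ph m + del_k q z m) b)
		(%b. norm (q powi h) * coh h (%m. ph' m + norm (del_k q z m)) b)"
proof -
	have 1: "oadm (ser_const (q_pow_a0 q)) z (coh h ph) (coh h ph')
			(%b. q powi h * coh h ph b) (%b. norm (q powi h) * coh h ph' b)"
		by (rule oadm_const[OF _ maj_coh[OF ph]]) (auto simp: q_pow_a0_def lin_ext_single scl_simps coh_def)
	show ?thesis unfolding k_plus_alt
		by (rule oadm_star[OF 1 adm_scale[OF oadm_annihilation_exp[OF ph z] order_refl] locfin_const z]) (simp add: del_k_def)
qed

lemma finmodes_k_plus: "finmodes (k_plus q)"
	unfolding k_plus_alt
	by (rule finmodes_star) (auto simp: finmodes_const finmodes_annihilation_exp q_pow_a0_def
		intro: lins_const lins_exp(2)[OF onesided_modes(2) lins_modes(2)])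

subsection \<open>Tensor powers\<close>

lemma ap_lin_ext: "ap \<Phi> (lin_ext g v) = ap (%b. ap \<Phi> (g b)) v"
	unfolding lin_ext_def ap_sum ap_scl ap_def[of _ v] ..

lemma nap_lin_ext: "maj \<Phi> \<Omega> ==> nap \<Omega> (lin_ext g v) \<le> nap (%b. nap \<Omega> (g b)) v"
	unfolding lin_ext_def nap_def[of _ v] by (rule order_trans[OF nap_sum]) (simp_all add: nap_scl)

lemma at_factor_bv: "at_factor i A (bv bs) = lin_ext (%b. bv (bs[i - 1 := b])) (A (bv (bs ! (i - 1))))"
	by (simp add: at_factor_def lin_ext_single scl_simps)

lemma adm_at_factor:
	assumes a: "adm I c X La om La' om'" and mj: "maj \<Phi> \<Omega>"
		and \<Phi>: "\<And>bs. \<exists>s S. 0 \<le> S \<and> (\<forall>b. \<Phi> (bs[i - 1 := b]) = s * La b) \<and> (\<forall>b. \<Omega> (bs[i - 1 := b]) = S * om b) \<and>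
			\<Phi>' bs = s * La' (bs ! (i - 1)) \<and> \<Omega>' bs = S * om' (bs ! (i - 1))"
	shows "adm I c (%j. at_factor i (X j)) \<Phi> \<Omega> \<Phi>' \<Omega>'"
	unfolding adm_def
proof (intro conjI allI impI ballI)
	show "lin (at_factor i (X j))" for j by (simp add: at_factor_def)
	fix bs
	obtain s S where S: "0 \<le> S" and e: "\<And>b. \<Phi> (bs[i - 1 := b]) = s * La b" "\<And>b. \<Omega> (bs[i - 1 := b]) = S * om b"
		"\<Phi>' bs = s * La' (bs ! (i - 1))" "\<Omega>' bs = S * om' (bs ! (i - 1))" using \<Phi>[of bs] by blast
	note e' = e[unfolded One_nat_def]
	let ?u = "%j. X j (bv (bs ! (i - 1)))"
	have ape: "ap \<Phi> (at_factor i (X j) (bv bs)) = s * ap La (?u j)" for j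
		unfolding at_factor_bv ap_lin_ext by (simp add: e' ap_def sum_distrib_left mult_ac)
	have nape: "nap \<Omega> (at_factor i (X j) (bv bs)) \<le> S * nap om (?u j)" for j
		unfolding at_factor_bv by (rule order_trans[OF nap_lin_ext[OF mj]]) (simp add: e' nap_def sum_distrib_left mult_ac)
	show "(\<Sum>j\<in>F. norm (c j) * nap \<Omega> (at_factor i (X j) (bv bs))) \<le> \<Omega>' bs" if F: "finite F" "F \<subseteq> I" for F
	proof -
		have "(\<Sum>j\<in>F. norm (c j) * nap \<Omega> (at_factor i (X j) (bv bs))) \<le> (\<Sum>j\<in>F. norm (c j) * (S * nap om (?u j)))"
			by (intro sum_mono mult_left_mono nape) auto
		also have "\<dots> \<le> \<Omega>' bs"
			using mult_left_mono[OF admD(3)[OF a F] S] by (simp add: e' sum_distrib_left mult_ac)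
		finally show ?thesis .
	qed
	show "((%j. c j * ap \<Phi> (at_factor i (X j) (bv bs))) has_sum \<Phi>' bs) I"
		using has_sum_cmult_right[OF admD(4)[OF a], of s] by (simp add: ape e' mult_ac)
qed (rule mj)

definition lcoh :: "nat => (nat => int) => (nat => nat => 'a::comm_ring_1) => fbasis list => 'a"
	where "lcoh l h ph bs = (if length bs = l then \<Prod>j\<in>{1..l}. coh (h j) (ph j) (bs ! (j - 1)) else 0)"

lemma maj_lcoh: "(\<And>j m. norm (ph j m) \<le> ph' j m) ==> maj (lcoh l h ph) (lcoh l h ph')"
	unfolding maj_def lcoh_def
	by (auto simp: prod_norm[symmetric] simp del: split_paired_All intro!: prod_mono maj_coh[unfolded maj_def, rule_format])

text \<open>A series of operators takes a product of coherent functionals to a multiple of another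
  one, majorants included, so that steps can be chained by \<open>lstep_star\<close>.\<close>

definition lstep :: "nat => fbasis list opser => complex => (nat => int) => (nat => nat => complex) => (nat => nat => real) =>
		complex => real => (nat => int) => (nat => nat => complex) => (nat => nat => real) => bool"
	where "lstep l X z h ph ph' s S h1 ph1 ph1' \<longleftrightarrow>
		oadm X z (lcoh l h ph) (lcoh l h ph') (%b. s * lcoh l h1 ph1 b) (%b. S * lcoh l h1 ph1' b)"

lemma lstep_le: "lstep l X z h ph ph' s S h1 ph1 ph1' ==> norm s \<le> S"
proof -
	assume a: "lstep l X z h ph ph' s S h1 ph1 ph1'"
	let ?b = "map (%j. (h1 (Suc j), 0)) [0..<l]"
	have "lcoh l h1 ph1 ?b = 1" "lcoh l h1 ph1' ?b = 1"
		by (auto simp: lcoh_def coh_def intro!: prod.neutral)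
	then show ?thesis using adm_maj[OF a[unfolded lstep_def], unfolded maj_def, rule_format, of ?b] by simp
qed

lemma lstep_star:
	assumes a: "lstep l X z h ph ph' s S h1 ph1 ph1'" and b: "lstep l Y z h1 ph1 ph1' s2 S2 h2 ph2 ph2'"
		and f: "locfin X Y" and z: "z \<noteq> 0"
	shows "lstep l (X \<star> Y) z h ph ph' (s * s2) (S * S2) h2 ph2 ph2'"
	using oadm_star[OF a[unfolded lstep_def] adm_scale[OF b[unfolded lstep_def] lstep_le[OF a]] f z]
	by (simp only: lstep_def mult.assoc)

lemma lcoh_update:
	assumes i: "i \<in> {1..l}"
	shows "lcoh l h u (bs[i - 1 := b]) =
		(if length bs = l then \<Prod>j\<in>{1..l} - {i}. coh (h j) (u j) (bs ! (j - 1)) else 0) * coh (h i) (u i) b"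
proof -
	have "(\<Prod>j\<in>{1..l} - {i}. coh (h j) (u j) (bs[i - 1 := b] ! (j - 1))) = (\<Prod>j\<in>{1..l} - {i}. coh (h j) (u j) (bs ! (j - 1)))"
		using i by (intro prod.cong refl) (auto simp: nth_list_update)
	then show ?thesis unfolding lcoh_def using i by (subst prod.remove[of _ i]) (auto simp: mult.commute)
qed

lemma lcoh_upd_fun:
	assumes i: "i \<in> {1..l}"
	shows "lcoh l (h(i := h1)) (u(i := v)) bs =
		(if length bs = l then \<Prod>j\<in>{1..l} - {i}. coh (h j) (u j) (bs ! (j - 1)) else 0) * coh h1 v (bs ! (i - 1))"
	unfolding lcoh_def using i by (subst prod.remove[of _ i]) (auto intro!: prod.cong simp: mult.commute)

lemma lstep_at:
	assumes a: "oadm X z (coh (h i) (ph i)) (coh (h i) (ph' i)) (%b. s * coh h1 ph1 b) (%b. S * coh h1 ph1' b)"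
		and i: "i \<in> {1..l}" and ph: "\<And>j m. norm (ph j m) \<le> ph' j m"
	shows "lstep l (ser_at_factor i X) z h ph ph' s S (h(i := h1)) (ph(i := ph1)) (ph'(i := ph1'))"
	unfolding lstep_def ser_at_factor_def
proof (rule adm_at_factor[OF a maj_lcoh[OF ph]])
	fix bs :: "fbasis list"
	let ?r = "%u. if length bs = l then \<Prod>j\<in>{1..l} - {i}. coh (h j) (u j) (bs ! (j - 1)) else 0"
	have "0 \<le> ?r ph'"
		by (auto intro!: prod_nonneg maj_nonneg[OF maj_coh[OF ph]])
	then show "\<exists>s' S'. 0 \<le> S' \<and> (\<forall>b. lcoh l h ph (bs[i - 1 := b]) = s' * coh (h i) (ph i) b) \<and>
			(\<forall>b. lcoh l h ph' (bs[i - 1 := b]) = S' * coh (h i) (ph' i) b) \<and>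
			s * lcoh l (h(i := h1)) (ph(i := ph1)) bs = s' * (s * coh h1 ph1 (bs ! (i - 1))) \<and>
			S * lcoh l (h(i := h1)) (ph'(i := ph1')) bs = S' * (S * coh h1 ph1' (bs ! (i - 1)))"
		by (intro exI[of _ "?r ph"] exI[of _ "?r ph'"]) (simp add: lcoh_update[OF i, unfolded One_nat_def] lcoh_upd_fun[OF i] del: split_paired_All)
qed

lemma finmodes_at: "finmodes X ==> finmodes (ser_at_factor i X)"
	unfolding finmodes_def
proof
	fix bs assume "\<forall>b. finite {p. X p (bv b) \<noteq> 0}"
	moreover have "{p. ser_at_factor i X p (bv bs) \<noteq> 0} \<subseteq> {p. X p (bv (bs ! (i - 1))) \<noteq> 0}"
		by (auto simp: ser_at_factor_def at_factor_bv lin_ext_0)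
	ultimately show "finite {p. ser_at_factor i X p (bv bs) \<noteq> 0}" using finite_subset by blast
qed

definition k_chain :: "complex => complex => nat => nat list => fbasis list opser"
	where "k_chain q r l js = foldr (\<star>) (map (%j. ser_at_factor j (ser_rescale (q ^ (l - j) * r) (k_plus q))) js) (ser_const id)"

lemma k_chain_step:
	assumes "distinct js" "set js \<subseteq> {1..l}" and ph: "\<And>j m. norm (ph j m) \<le> ph' j m" and z: "z \<noteq> 0" "q \<noteq> 0" "r \<noteq> 0"
	shows "finmodes (k_chain q r l js) \<and> lins (k_chain q r l js) \<and>
		lstep l (k_chain q r l js) z h ph ph' (\<Prod>j\<in>set js. q powi h j) (\<Prod>j\<in>set js. norm (q powi h j)) h
			(%j m. ph j m + (if j \<in> set js then del_k q (q ^ (l - j) * r * z) m else 0))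
			(%j m. ph' j m + (if j \<in> set js then norm (del_k q (q ^ (l - j) * r * z) m) else 0))"
	using assms(1,2) ph
proof (induction js arbitrary: ph ph')
	case Nil
	have "oadm (ser_const id) z (lcoh l h ph) (lcoh l h ph') (lcoh l h ph) (lcoh l h ph')"
		by (rule oadm_const) (auto simp: lin_simps id_def intro: maj_lcoh[OF Nil(3)])
	then show ?case by (simp add: k_chain_def finmodes_const lins_const lin_simps id_def lstep_def)
next
	case (Cons j js)
	let ?X = "ser_at_factor j (ser_rescale (q ^ (l - j) * r) (k_plus q))" and ?w = "q ^ (l - j) * r * z"
	let ?p = "ph(j := %m. ph j m + del_k q ?w m)" and ?p' = "ph'(j := %m. ph' j m + norm (del_k q ?w m))"
	have w: "?w \<noteq> 0" using z by simp
	have "lstep l ?X z h ph ph' (q powi h j) (norm (q powi h j)) (h(j := h j)) ?p ?p'"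
		by (rule lstep_at[OF oadm_rescale[OF k_plus_step[OF Cons.prems(3) w]]]) (use Cons.prems in auto)
	then have 1: "lstep l ?X z h ph ph' (q powi h j) (norm (q powi h j)) h ?p ?p'" by simp
	have le: "norm (?p i m) \<le> ?p' i m" for i m
		using Cons.prems(3) by (auto intro: order_trans[OF norm_triangle_ineq] add_mono)
	have d: "distinct js" "set js \<subseteq> {1..l}" using Cons.prems by auto
	have IH: "finmodes (k_chain q r l js)" "lins (k_chain q r l js)"
		"lstep l (k_chain q r l js) z h ?p ?p' (\<Prod>j\<in>set js. q powi h j) (\<Prod>j\<in>set js. norm (q powi h j)) h
			(%i m. ?p i m + (if i \<in> set js then del_k q (q ^ (l - i) * r * z) m else 0))
			(%i m. ?p' i m + (if i \<in> set js then norm (del_k q (q ^ (l - i) * r * z) m) else 0))"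
		using Cons.IH[of ?p ?p', OF d le] by (blast, blast, simp only:)
	have lX: "lins ?X" and fX: "finmodes ?X"
		using oadm_lins[OF 1[unfolded lstep_def]] by (auto intro: finmodes_at finmodes_rescale finmodes_k_plus)
	have lf: "locfin ?X (k_chain q r l js)" by (rule locfin_finmodes[OF lX IH(1)])
	have e: "k_chain q r l (j # js) = ?X \<star> k_chain q r l js" by (simp add: k_chain_def)
	have f: "(%i m. ?p i m + (if i \<in> set js then del_k q (q ^ (l - i) * r * z) m else 0)) =
			(%i m. ph i m + (if i \<in> set (j # js) then del_k q (q ^ (l - i) * r * z) m else 0))"
		"(%i m. ?p' i m + (if i \<in> set js then norm (del_k q (q ^ (l - i) * r * z) m) else 0)) =
			(%i m. ph' i m + (if i \<in> set (j # js) then norm (del_k q (q ^ (l - i) * r * z) m) else 0))"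
		using Cons.prems(1) by (auto simp: fun_eq_iff)
	show ?case
		using finmodes_star[OF lX fX IH(2,1)] lins_star[OF lX IH(2) lf] lstep_star[OF 1 IH(3) lf z(1)] Cons.prems(1)
		unfolding e f by simp
qed

lemma f_level_summand_step:
	assumes i: "i \<in> {1..l}" and ph: "\<And>j m. norm (ph j m) \<le> ph' j m" and z: "z \<noteq> 0" "q \<noteq> 0" "r \<noteq> 0"
		and y: "((%p. (q ^ (l - i) * z) powi p * - (r powi p / qnum q p) * ph i (nat p)) has_sum y) {0<..}"
		and Y: "((%p. norm ((q ^ (l - i) * z) powi p * - (r powi p / qnum q p)) * ph' i (nat p)) has_sum Y) {0<..}"
	shows "\<exists>S. lstep l (f_level_summand q r l i) z h ph ph'
		((q ^ (l - i) * z) powi (- (h i + 2)) * exp y * (\<Prod>j\<in>{i<..l}. q powi h j)) S (h(i := h i + 2))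
		(%j m. ph j m + (if j = i then del_f q r (q ^ (l - j) * z) m else if i < j \<and> j \<le> l then del_k q (q ^ (l - j) * r * z) m else 0))
		(%j m. ph' j m + norm (if j = i then del_f q r (q ^ (l - j) * z) m else if i < j \<and> j \<le> l then del_k q (q ^ (l - j) * r * z) m else 0))"
proof -
	let ?w = "q ^ (l - i) * z"
	let ?p = "ph(i := %m. ph i m + del_f q r ?w m)" and ?p' = "ph'(i := %m. ph' i m + norm (del_f q r ?w m))"
	have w: "?w \<noteq> 0" using z by simp
	have le: "norm (?p j m) \<le> ?p' j m" for j m
		using ph by (auto intro: order_trans[OF norm_triangle_ineq] add_mono)
	have 1: "lstep l (ser_at_factor i (ser_rescale (q ^ (l - i)) (f_current q r))) z h ph ph'
			(?w powi (- (h i + 2)) * exp y) (norm (?w powi (- (h i + 2))) * exp Y) (h(i := h i + 2)) ?p ?p'"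
		by (rule lstep_at[where h = h and ph = ph and ph' = ph', OF oadm_rescale[OF f_current_step[OF ph w y Y]] i ph])
	have s: "set [Suc i..<Suc l] = {i<..l}" by auto
	have d: "distinct [Suc i..<Suc l]" "set [Suc i..<Suc l] \<subseteq> {1..l}" using i by (auto simp del: upt_Suc)
	have K: "finmodes (k_chain q r l [Suc i..<Suc l])"
		"lstep l (k_chain q r l [Suc i..<Suc l]) z (h(i := h i + 2)) ?p ?p' (\<Prod>j\<in>{i<..l}. q powi (h(i := h i + 2)) j)
			(\<Prod>j\<in>{i<..l}. norm (q powi (h(i := h i + 2)) j)) (h(i := h i + 2))
			(%j m. ?p j m + (if j \<in> {i<..l} then del_k q (q ^ (l - j) * r * z) m else 0))
			(%j m. ?p' j m + (if j \<in> {i<..l} then norm (del_k q (q ^ (l - j) * r * z) m) else 0))"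
		using k_chain_step[of "[Suc i..<Suc l]" l ?p ?p' z q r "h(i := h i + 2)", OF d le z] unfolding s by (blast, simp only:)
	have pr: "(\<Prod>j\<in>{i<..l}. q powi (h(i := h i + 2)) j) = (\<Prod>j\<in>{i<..l}. q powi h j)" by (intro prod.cong) auto
	have e: "f_level_summand q r l i = ser_at_factor i (ser_rescale (q ^ (l - i)) (f_current q r)) \<star> k_chain q r l [Suc i..<Suc l]"
		by (simp add: f_level_summand_def k_chain_def)
	have f: "(%j m. ?p j m + (if j \<in> {i<..l} then del_k q (q ^ (l - j) * r * z) m else 0)) =
			(%j m. ph j m + (if j = i then del_f q r (q ^ (l - j) * z) m else if i < j \<and> j \<le> l then del_k q (q ^ (l - j) * r * z) m else 0))"
		"(%j m. ?p' j m + (if j \<in> {i<..l} then norm (del_k q (q ^ (l - j) * r * z) m) else 0)) =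
			(%j m. ph' j m + norm (if j = i then del_f q r (q ^ (l - j) * z) m else if i < j \<and> j \<le> l then del_k q (q ^ (l - j) * r * z) m else 0))"
		by (auto simp: fun_eq_iff)
	have "locfin (ser_at_factor i (ser_rescale (q ^ (l - i)) (f_current q r))) (k_chain q r l [Suc i..<Suc l])"
		by (rule locfin_finmodes[OF oadm_lins[OF 1[unfolded lstep_def]] K(1)])
	from lstep_star[OF 1 K(2) this z(1)] show ?thesis unfolding e f pr by blast
qed

subsection \<open>The matrix element as a sum over assignments\<close>

text \<open>Indexed by positive elements of \<open>int\<close>, the type of the modes.\<close>

lemma has_sum_log:
	assumes x: "norm x < 1"
	shows "((%p::int. x powi p / of_int p) has_sum - Ln (1 - x)) {0<..}"
proof -
	have s: "summable (%m. norm (x ^ m / of_nat m))"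
	proof (rule summable_comparison_test')
		show "summable (%m. norm x ^ m)" using x by (intro summable_geometric) auto
		show "norm (norm (x ^ m / of_nat m)) \<le> norm x ^ m" if "m \<ge> 1" for m
			using that by (simp add: norm_divide norm_power field_simps) (simp add: mult_le_cancel_right1)
	qed
	have "(%m. - ((- 1) ^ Suc m / of_nat m * (- x) ^ m)) sums - Ln (1 + - x)"
		by (intro sums_minus Ln_series) (use x in simp)
	moreover have "- ((- 1) ^ Suc m / of_nat m * (- x) ^ m) = x ^ m / of_nat m" for m
	proof -
		have "(- 1) ^ m * (- x) ^ m = x ^ m" by (simp only: power_mult_distrib[symmetric]) simp
		moreover have "- ((- 1) ^ Suc m / of_nat m * (- x) ^ m) = ((- 1) ^ m * (- x) ^ m) / of_nat m"
			by (simp only: power_Suc times_divide_eq_left mult_minus_left mult_1 minus_divide_left minus_minus)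
		ultimately show ?thesis by (simp only:)
	qed
	ultimately have "(%m. x ^ m / of_nat m) sums - Ln (1 + - x)" by (simp only:)
	from norm_summable_imp_has_sum[OF s this] have "((%m::nat. x ^ m / of_nat m) has_sum - Ln (1 - x)) UNIV" by simp
	then have "((%m::nat. x ^ m / of_nat m) has_sum - Ln (1 - x)) {0<..}"
		by (rule has_sum_cong_neutral[THEN iffD1, rotated 3]) auto
	then show ?thesis
		by (subst has_sum_reindex_bij_witness[of _ int nat]) (auto simp: power_int_def)
qed

section \<open>Contractions of the currents and transport of the functional through all of
  them\<close>

locale main_data =
	fixes q r :: complex and l n k :: nat and ks :: "nat list"
	assumes q0: "0 < norm q" and q1: "norm q < 1" and rq: "r\<^sup>2 = q"
		and lnk: "l \<ge> 1" "n \<ge> 1" "k \<le> l"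
		and ks: "length ks = l" "set ks \<subseteq> {0, 1}" "sum_list ks = k"
begin

lemma q_nz: "q \<noteq> 0" "r \<noteq> 0" using q0 rq by auto

sublocale level_data l n k ks "q\<^sup>2" "inverse (q\<^sup>2)"
proof
	have "norm (q\<^sup>2) < 1" using q1 by (simp add: norm_power power_less_one_iff)
	then show "1 < norm (inverse (q\<^sup>2))" using q_nz by (simp add: norm_inverse one_less_inverse_iff)
qed (use lnk ks in auto)

text \<open>\<open>P\<close> is the history: the summands chosen so far with their variables. The
  functional \<open><k| E^n\<close> starts at charge \<open>kp j - 2 n\<close>, and every passage of
  f^j moves it up by 2.\<close>

definition chg :: "(nat \<times> complex) list => nat => int"
	where "chg P j = int (kp j) - 2 * int n + 2 * int (count_list (map fst P) j)"

definition shift :: "nat => complex => nat => nat => complex"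
	where "shift i w j m = (if j = i then del_f q r (q ^ (l - j) * w) m
		else if i < j \<and> j \<le> l then del_k q (q ^ (l - j) * r * w) m else 0)"

definition par :: "(nat \<times> complex) list => nat => nat => complex"
	where "par P j m = (\<Sum>(i, w)\<leftarrow>P. shift i w j m)"

definition par' :: "(nat \<times> complex) list => nat => nat => real"
	where "par' P j m = (\<Sum>(i, w)\<leftarrow>P. norm (shift i w j m))"

text \<open>Contraction of an earlier f^i' at w' with a later f^i at w, where x = w / w'. For i' < i
  it comes from the k^+ of the former in factor i. For i < i' nothing contracts, since f^i' is the
  identity in factor i and the k^+ of the latter has no creation modes.\<close>

definition contr :: "nat => nat => complex => complex"
	where "contr i' i x = (if i' = i then (1 - x) * (1 - q\<^sup>2 * x)
		else if i' < i then (1 - q\<^sup>2 * x) / (1 - x / q\<^sup>2) else 1)"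

lemma par_snoc: "par (P @ [(i, w)]) = (%j m. par P j m + shift i w j m)"
		"par' (P @ [(i, w)]) = (%j m. par' P j m + norm (shift i w j m))"
		"chg (P @ [(i, w)]) = (chg P)(i := chg P i + 2)"
	by (auto simp: par_def par'_def chg_def fun_eq_iff)

lemma par_le: "norm (par P j m) \<le> par' P j m"
	unfolding par_def par'_def
	by (induction P) (auto intro: order_trans[OF norm_triangle_ineq] add_mono)

lemma qnum_nz: "p > 0 ==> qnum q p \<noteq> 0"
proof
	assume p: "p > 0" "qnum q p = 0"
	have "q - inverse q \<noteq> 0"
	proof
		assume "q - inverse q = 0"
		then have "q * q = 1" using q_nz by (simp add: field_simps)
		then have "norm q * norm q = 1" by (metis norm_mult norm_one)
		moreover have "norm q * norm q < 1 * 1" using q0 q1 by (intro mult_strict_mono) auto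
		ultimately show False by linarith
	qed
	then have "q powi p = q powi (- p)" using p by (simp add: qnum_def)
	then have "norm q powi p = norm q powi (- p)" by (metis norm_power_int)
	moreover have "norm q powi p * norm q powi (- p) = 1" using q0 by (simp add: power_int_minus)
	moreover have "norm q powi p * norm q powi p < 1 * 1"
		using p q0 q1 by (intro mult_strict_mono) (auto simp: power_int_def power_less_one_iff)
	ultimately show False by simp
qed

text \<open>With u = q^p the commutator collapses to u (u + 1/u) = u^2 + 1 against f and to u^2 -
  1/u^2 against k^+, up to the factor -x^p/p. So the exponent consists of logarithm series in x, q^2
  x and x/q^2; the last one dictates |x| < |q^2|.\<close>

lemma pair_series:
	assumes i: "i \<in> {1..l}" and w: "w \<noteq> 0" "w' \<noteq> 0" "norm w < norm (q\<^sup>2) * norm w'"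
	shows "\<exists>y. ((%p. (q ^ (l - i) * w) powi p * - (r powi p / qnum q p) * shift i' w' i (nat p)) has_sum y) {0<..} \<and>
		exp y = contr i' i (w / w')"
proof -
	let ?a = "%p. (q ^ (l - i) * w) powi p * - (r powi p / qnum q p) * shift i' w' i (nat p)"
	define x where "x = w / w'"
	let ?L = "%x p::int. x powi p / of_int p :: complex"
	have x2: "norm x < norm (q\<^sup>2)" using w by (simp add: x_def norm_divide divide_simps)
	have "norm (q\<^sup>2) \<le> 1" using q1 by (simp add: norm_power power_le_one)
	then have x1: "norm x < 1" and qx: "norm (q\<^sup>2 * x) < 1" and qx': "norm (x / q\<^sup>2) < 1"
		using x2 mult_mono[of "norm (q\<^sup>2)" 1 "norm x" "norm x"] q_nz
		by (simp_all add: norm_mult norm_divide divide_simps)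
	have ne: "1 - u \<noteq> 0" if "norm u < 1" for u :: complex using that by auto
	have pw: "?a p = (if i' = i then - (?L x p) - ?L (q\<^sup>2 * x) p else if i' < i then - (?L (q\<^sup>2 * x) p) + ?L (x / q\<^sup>2) p else 0)"
		if p: "p > 0" for p
	proof -
		define A B R C where "A = w powi p" and "B = w' powi p" and "R = r powi p" and "C = (q ^ (l - i)) powi p"
		define u where "u = q powi p"
		have nz: "A \<noteq> 0" "B \<noteq> 0" "R \<noteq> 0" "C \<noteq> 0" "u \<noteq> 0" "qnum q p \<noteq> 0" "of_int p \<noteq> (0::complex)"
			using w q_nz qnum_nz[OF p] p by (simp_all add: A_def B_def R_def C_def u_def)
		have RR: "R * R = u" unfolding R_def u_def rq[symmetric] by (simp add: power2_eq_square power_int_mult_distrib)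
		have q2: "qnum q (2 * p) * (q - inverse q) = u * u - 1 / (u * u)"
			"qnum q (2 * p) = qnum q p * (u + 1 / u)" "q - inverse q \<noteq> 0"
		proof -
			have a: "q powi (2 * p) = u * u" unfolding u_def using q_nz by (simp flip: power_int_add)
			have b: "q powi (- (2 * p)) = 1 / (u * u)" unfolding power_int_minus a by (simp add: divide_inverse)
			have c: "q powi (- p) = 1 / u" by (simp add: u_def power_int_minus divide_inverse)
			show d: "q - inverse q \<noteq> 0" using nz(6) by (auto simp: qnum_def)
			show "qnum q (2 * p) * (q - inverse q) = u * u - 1 / (u * u)" unfolding qnum_def a b using d by simp
			have "u * u - 1 / (u * u) = (u - 1 / u) * (u + 1 / u)" using nz(5) by (simp add: field_simps)
			then show "qnum q (2 * p) = qnum q p * (u + 1 / u)" unfolding qnum_def a b c u_def[symmetric] by simp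
		qed
		have hk: "hk q (nat p) = qnum q (2 * p) * qnum q p / of_int p" using p by (simp add: hk_def)
		have L: "?L x p = A / B / of_int p" "?L (q\<^sup>2 * x) p = u * u * (A / B) / of_int p" "?L (x / q\<^sup>2) p = A / B / (u * u) / of_int p"
			unfolding x_def A_def B_def u_def
			by (simp_all add: power_int_divide_distrib power_int_mult_distrib power2_eq_square)
		have z: "(q ^ (l - i) * w) powi p = C * A" "(q ^ (l - i) * w') powi (- p) = 1 / (C * B)"
			"(q ^ (l - i) * r * w') powi (- p) = 1 / (C * R * B)"
			by (simp_all add: power_int_mult_distrib power_int_minus A_def B_def C_def R_def divide_inverse)
		have s1: "shift i w' i (nat p) = 1 / (C * B) * (R / qnum q p) * (qnum q (2 * p) * qnum q p / of_int p)"
			using p by (simp add: shift_def del_f_def hk z R_def)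
		have s2: "shift i' w' i (nat p) = 1 / (C * R * B) * (q - inverse q) * (qnum q (2 * p) * qnum q p / of_int p)" if "i' < i"
			using p that i by (simp add: shift_def del_k_def hk z)
		have s3: "shift i' w' i (nat p) = 0" if "i < i'" using that by (simp add: shift_def)
		consider "i' = i" | "i' < i" | "i < i'" by linarith
		then show ?thesis
		proof cases
			case 1
			have "?a p = - (A / B) * (R * R) * (u + 1 / u) / of_int p"
				unfolding 1 s1 z(1) R_def[symmetric] unfolding q2(2) using nz by (simp add: field_simps)
			also have "\<dots> = - (?L x p) - ?L (q\<^sup>2 * x) p"
				unfolding RR L using nz by (simp add: field_simps)
			finally show ?thesis using 1 by simp
		next
			case 2
			have "?a p = - (A / B) * (qnum q (2 * p) * (q - inverse q)) / of_int p"
				unfolding s2[OF 2] z(1) R_def[symmetric] using nz by (simp add: field_simps)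
			also have "\<dots> = - (?L (q\<^sup>2 * x) p) + ?L (x / q\<^sup>2) p"
				unfolding q2(1) L using nz by (simp add: field_simps)
			finally show ?thesis using 2 by simp
		qed (simp add: s3)
	qed
	have hs: "(?a has_sum y) {0<..}"
		if "((%p. if i' = i then - (?L x p) - ?L (q\<^sup>2 * x) p else if i' < i then - (?L (q\<^sup>2 * x) p) + ?L (x / q\<^sup>2) p else 0) has_sum y) {0<..}" for y
		using that by (subst has_sum_cong[OF pw]) auto
	have E: "exp (- Ln (1 - u)) = 1 / (1 - u)" if "norm u < 1" for u
		using ne[OF that] by (simp add: exp_minus exp_Ln divide_inverse)
	note lg = has_sum_log
	consider "i' = i" | "i' < i" | "i < i'" by linarith
	then show ?thesis
	proof cases
		case 1
		have "(?a has_sum - (- Ln (1 - x)) + - (- Ln (1 - q\<^sup>2 * x))) {0<..}"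
			by (rule hs) (use has_sum_add[OF has_sum_uminusI[OF lg[OF x1]] has_sum_uminusI[OF lg[OF qx]]] in "simp add: 1")
		moreover have "exp (- (- Ln (1 - x)) + - (- Ln (1 - q\<^sup>2 * x))) = contr i' i (w / w')"
			using ne[OF x1] ne[OF qx] by (simp add: exp_add exp_Ln contr_def 1 x_def)
		ultimately show ?thesis by blast
	next
		case 2
		have "(?a has_sum - (- Ln (1 - q\<^sup>2 * x)) + - Ln (1 - x / q\<^sup>2)) {0<..}"
			by (rule hs) (use has_sum_add[OF has_sum_uminusI[OF lg[OF qx]] lg[OF qx']] 2 in simp)
		moreover have "exp (- (- Ln (1 - q\<^sup>2 * x)) + - Ln (1 - x / q\<^sup>2)) = contr i' i (w / w')"
			using 2 ne[OF qx] E[OF qx'] unfolding exp_add by (simp add: exp_Ln contr_def x_def)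
		ultimately show ?thesis by blast
	next
		case 3
		have "(?a has_sum 0) {0<..}" by (rule hs) (use 3 in simp)
		then show ?thesis using 3 by (intro exI[of _ 0]) (simp add: contr_def)
	qed
qed

definition apart :: "complex => complex => bool"
	where "apart w' w \<longleftrightarrow> w' \<noteq> 0 \<and> w \<noteq> 0 \<and> norm w < norm (q\<^sup>2) * norm w'"

lemma past_series:
	assumes i: "i \<in> {1..l}" and P: "\<forall>w'\<in>snd ` set P. apart w' w"
	shows "\<exists>y Y. ((%p. (q ^ (l - i) * w) powi p * - (r powi p / qnum q p) * par P i (nat p)) has_sum y) {0<..} \<and>
		((%p. norm ((q ^ (l - i) * w) powi p * - (r powi p / qnum q p)) * par' P i (nat p)) has_sum Y) {0<..} \<and>
		exp y = (\<Prod>(i', w')\<leftarrow>P. contr i' i (w / w'))"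
	using P
proof (induction P)
	case Nil
	show ?case by (intro exI[of _ 0]) (simp add: par_def par'_def)
next
	case (Cons iw P)
	obtain i' w' where iw: "iw = (i', w')" by force
	let ?c = "%p. (q ^ (l - i) * w) powi p * - (r powi p / qnum q p)"
	obtain y Y where y: "((%p. ?c p * par P i (nat p)) has_sum y) {0<..}" "((%p. norm (?c p) * par' P i (nat p)) has_sum Y) {0<..}"
		"exp y = (\<Prod>(i', w')\<leftarrow>P. contr i' i (w / w'))" using Cons.IH Cons.prems by auto
	have "apart w' w" using Cons.prems iw by auto
	then obtain y1 where y1: "((%p. ?c p * shift i' w' i (nat p)) has_sum y1) {0<..}" "exp y1 = contr i' i (w / w')"
		using pair_series[OF i, of w w'] by (auto simp: apart_def)
	have "(%p. norm (?c p * shift i' w' i (nat p))) summable_on {0<..}"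
		using has_sum_imp_summable[OF y1(1)] by (simp only: summable_on_iff_abs_summable_on_complex)
	then obtain Y1 where Y1: "((%p. norm (?c p) * norm (shift i' w' i (nat p))) has_sum Y1) {0<..}"
		unfolding norm_mult summable_on_def by blast
	have "((%p. ?c p * par (iw # P) i (nat p)) has_sum y1 + y) {0<..}"
		using has_sum_add[OF y1(1) y(1)] by (simp add: iw par_def distrib_left)
	moreover have "((%p. norm (?c p) * par' (iw # P) i (nat p)) has_sum Y1 + Y) {0<..}"
		using has_sum_add[OF Y1 y(2)] by (simp add: iw par'_def distrib_left)
	moreover have "exp (y1 + y) = (\<Prod>(i', w')\<leftarrow>iw # P. contr i' i (w / w'))"
		by (simp add: iw exp_add y y1)
	ultimately show ?case by blast
qed

text \<open>The scalar acquired when f^i(w) is passed after the history \<open>P\<close>: its zero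
  mode, the contractions with all earlier currents, and the charges seen by k^+ in the factors j >
  i.\<close>

definition weight :: "(nat \<times> complex) list => nat => complex => complex"
	where "weight P i w = (q ^ (l - i) * w) powi (- (chg P i + 2)) * (\<Prod>(i', w')\<leftarrow>P. contr i' i (w / w')) *
		(\<Prod>j\<in>{i<..l}. q powi chg P j)"

abbreviation "st P \<equiv> lcoh l (chg P) (par P)"
abbreviation "st' P \<equiv> lcoh l (chg P) (par' P)"

lemma f_level_step:
	assumes w: "w \<noteq> 0" and P: "\<forall>w'\<in>snd ` set P. apart w' w"
	shows "\<exists>S. (\<forall>i\<in>{1..l}. norm (weight P i w) \<le> S i) \<and> oadm (f_level q r l) w (st P) (st' P)
		(%b. \<Sum>i\<in>{1..l}. weight P i w * st (P @ [(i, w)]) b) (%b. \<Sum>i\<in>{1..l}. S i * st' (P @ [(i, w)]) b)"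
proof -
	have "\<exists>S. lstep l (f_level_summand q r l i) w (chg P) (par P) (par' P) (weight P i w) S
			(chg (P @ [(i, w)])) (par (P @ [(i, w)])) (par' (P @ [(i, w)]))" if i: "i \<in> {1..l}" for i
	proof -
		obtain y Y where y: "((%p. (q ^ (l - i) * w) powi p * - (r powi p / qnum q p) * par P i (nat p)) has_sum y) {0<..}"
			"((%p. norm ((q ^ (l - i) * w) powi p * - (r powi p / qnum q p)) * par' P i (nat p)) has_sum Y) {0<..}"
			"exp y = (\<Prod>(i', w')\<leftarrow>P. contr i' i (w / w'))" using past_series[of i P w, OF i P] by blast
		show ?thesis
			using f_level_summand_step[where ph = "par P" and ph' = "par' P" and h = "chg P", OF i par_le w q_nz y(1,2)]
			unfolding par_snoc weight_def y(3) shift_def by (simp only:)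
	qed
	then obtain S where S: "\<And>i. i \<in> {1..l} ==> lstep l (f_level_summand q r l i) w (chg P) (par P) (par' P) (weight P i w) (S i)
			(chg (P @ [(i, w)])) (par (P @ [(i, w)])) (par' (P @ [(i, w)]))" by metis
	let ?L = "%b. \<Sum>i\<in>{1..l}. weight P i w * st (P @ [(i, w)]) b" and ?W = "%b. \<Sum>i\<in>{1..l}. S i * st' (P @ [(i, w)]) b"
	have mj: "maj (st P) (st' P)" by (rule maj_lcoh[OF par_le])
	have sg: "adm (Sigma {1..l} (%_. UNIV)) (%(i, p). w powi p) (%(i, p). f_level_summand q r l i p) (st P) (st' P) ?L ?W"
	proof (rule adm_Sigma[where La' = "%i b. weight P i w * st (P @ [(i, w)]) b" and om' = "%i b. S i * st' (P @ [(i, w)]) b"])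
		show "adm UNIV (%p. case (i, p) of (i, p) => w powi p) (%p. case (i, p) of (i, p) => f_level_summand q r l i p) (st P) (st' P)
				(%b. weight P i w * st (P @ [(i, w)]) b) (%b. S i * st' (P @ [(i, w)]) b)" if "i \<in> {1..l}" for i
			using S[OF that] by (simp add: lstep_def)
		show "(\<Sum>i\<in>F. S i * st' (P @ [(i, w)]) b) \<le> ?W b" if "finite F" "F \<subseteq> {1..l}" for b F
		proof (rule sum_mono2)
			fix i assume "i \<in> {1..l} - F"
			then show "0 \<le> S i * st' (P @ [(i, w)]) b"
				by (intro mult_nonneg_nonneg order_trans[OF norm_ge_zero lstep_le[OF S]] maj_nonneg[OF maj_lcoh[OF par_le]]) auto
		qed (use that in auto)
	qed (auto intro: mj)
	have "oadm (f_level q r l) w (st P) (st' P) ?L ?W"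
	proof (rule adm_push[OF sg, of snd])
		let ?F = "%p b. {ip \<in> {1..l} \<times> UNIV. snd ip = p \<and> (case ip of (i, p) => f_level_summand q r l i p) (bv b) \<noteq> 0}"
		have F: "?F p b = (%i. (i, p)) ` {i \<in> {1..l}. f_level_summand q r l i p (bv b) \<noteq> 0}" for p b by force
		show "lin (f_level q r l p)" for p
			unfolding f_level_def[abs_def] using admD(2)[OF sg] by (intro lin_sum) fastforce
		show "finite (?F p b)" for p b unfolding F by simp
		show "f_level q r l p (bv b) = (\<Sum>i\<in>?F p b. (case i of (i, p) => f_level_summand q r l i p) (bv b))" for p b
			unfolding F f_level_def by (subst sum.reindex) (auto simp: inj_on_def intro: sum.mono_neutral_right)
	qed auto
	moreover have "\<forall>i\<in>{1..l}. norm (weight P i w) \<le> S i" using lstep_le[OF S] by blast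
	ultimately show ?thesis by blast
qed

fun weights :: "(nat \<times> complex) list => nat list => complex list => complex" where
	"weights P (i # xs) (w # ws) = weight P i w * weights (P @ [(i, w)]) xs ws"
| "weights P _ _ = 1"

definition words :: "nat => nat list set" where "words N = {xs. set xs \<subseteq> {1..l} \<and> length xs = N}"

lemma sum_words_Suc: "(\<Sum>xs\<in>words (Suc N). f xs) = (\<Sum>i\<in>{1..l}. \<Sum>xs\<in>words N. f (i # xs) :: 'x::comm_monoid_add)"
proof -
	have "words (Suc N) = (%(i, xs). i # xs) ` ({1..l} \<times> words N)"
	proof (rule set_eqI)
		fix xs show "xs \<in> words (Suc N) \<longleftrightarrow> xs \<in> (%(i, xs). i # xs) ` ({1..l} \<times> words N)"
			by (cases xs) (auto simp: words_def)
	qed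
	then show ?thesis by (simp add: sum.reindex inj_on_def sum.cartesian_product split_def)
qed

text \<open>The functional meets the current of the largest variable first, the order in which the
  contractions converge. The history grows along the induction, and of the majorant only its
  existence is passed on.\<close>

lemma foldr_step:
	assumes "\<And>w. w \<in> set ws ==> w \<noteq> 0" "sorted_wrt apart ws" "\<forall>w'\<in>snd ` set P. \<forall>w\<in>set ws. apart w' w"
	shows "\<exists>om. adm {ps. length ps = length ws} (%ps. \<Prod>i<length ws. ws ! i powi (ps ! i)) (foldr (f_level q r l)) (st P) (st' P)
		(%b. \<Sum>xs\<in>words (length ws). weights P xs ws * st (P @ zip xs ws) b) om"
	using assms
proof (induction ws arbitrary: P)
	case Nil
	have "words 0 = {[]}" by (auto simp: words_def)
	moreover have "adm {[]} (%ps. 1) (foldr (f_level q r l)) (st P) (st' P) (st P) (st' P)"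
	proof -
		have mj: "maj (st P) (st' P)" by (rule maj_lcoh[OF par_le])
		have "((%ps. 1 * ap (st P) (foldr (f_level q r l) ps (bv b))) has_sum st P b) {[]}" for b
			by (rule has_sum_finiteI) auto
		moreover have "(\<Sum>ps\<in>F. norm (1::complex) * nap (st' P) (foldr (f_level q r l) ps (bv b))) \<le> st' P b" if F: "F \<subseteq> {[]}" for F b
		proof -
			consider "F = {}" | "F = {[]}" using F by blast
			then show ?thesis by cases (simp_all add: maj_nonneg[OF mj])
		qed
		moreover have "lin (foldr (f_level q r l) [])" by (simp add: lin_simps id_def)
		ultimately show ?thesis unfolding adm_def using mj by blast
	qed
	ultimately show ?case by (auto simp del: split_paired_All)
next
	case (Cons w ws)
	let ?N = "length ws" and ?I = "{ps. length ps = length ws}" and ?c = "%ps. \<Prod>i<length ws. ws ! i powi (ps ! i)"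
	have w: "w \<noteq> 0" "\<forall>w'\<in>snd ` set P. apart w' w" using Cons.prems by auto
	obtain S where S: "\<And>i. i \<in> {1..l} ==> norm (weight P i w) \<le> S i"
		"oadm (f_level q r l) w (st P) (st' P) (%b. \<Sum>i\<in>{1..l}. weight P i w * st (P @ [(i, w)]) b)
			(%b. \<Sum>i\<in>{1..l}. S i * st' (P @ [(i, w)]) b)"
		using f_level_step[OF w] by blast
	let ?Q = "%i om. adm ?I ?c (foldr (f_level q r l)) (st (P @ [(i, w)])) (st' (P @ [(i, w)]))
			(%b. \<Sum>xs\<in>words ?N. weights (P @ [(i, w)]) xs ws * st ((P @ [(i, w)]) @ zip xs ws) b) om"
	have "\<exists>om. ?Q i om" for i
		by (rule Cons.IH) (use Cons.prems in "auto simp: apart_def")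
	then obtain om where om: "\<And>i. ?Q i (om i)" using choice[of ?Q] by blast
	have e: "(\<Sum>i\<in>{1..l}. weight P i w * (\<Sum>xs\<in>words ?N. weights (P @ [(i, w)]) xs ws * st ((P @ [(i, w)]) @ zip xs ws) b)) =
			(\<Sum>xs\<in>words (length (w # ws)). weights P xs (w # ws) * st (P @ zip xs (w # ws)) b)" for b
		by (simp add: sum_words_Suc sum_distrib_left mult.assoc)
	have "adm ?I ?c (foldr (f_level q r l)) (%b. \<Sum>i\<in>{1..l}. weight P i w * st (P @ [(i, w)]) b)
			(%b. \<Sum>i\<in>{1..l}. S i * st' (P @ [(i, w)]) b)
			(%b. \<Sum>xs\<in>words (length (w # ws)). weights P xs (w # ws) * st (P @ zip xs (w # ws)) b) (%b. \<Sum>i\<in>{1..l}. S i * om i b)"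
		unfolding e[symmetric] by (rule adm_lin_comb) (use om S(1) l1 in auto)
	note cmp = adm_comp[OF S(2) this]
	have "adm {ps. length ps = length (w # ws)} (%ps. \<Prod>i<length (w # ws). (w # ws) ! i powi (ps ! i)) (foldr (f_level q r l)) (st P) (st' P)
			(%b. \<Sum>xs\<in>words (length (w # ws)). weights P xs (w # ws) * st (P @ zip xs (w # ws)) b) (%b. \<Sum>i\<in>{1..l}. S i * om i b)"
	proof (rule adm_push[OF cmp, of "%(p, ps). p # ps"])
		fix ps :: "int list" assume "ps \<in> {ps. length ps = length (w # ws)}"
		then obtain p ps' where ps: "ps = p # ps'" "ps' \<in> ?I" by (auto simp: length_Suc_conv)
		show "lin (foldr (f_level q r l) ps)" using admD(2)[OF cmp, of "(p, ps')"] ps by (simp add: o_def)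
		let ?F = "%b. {i \<in> UNIV \<times> ?I. (case i of (p, ps) => p # ps) = ps \<and>
			(case i of (i, j) => %v. f_level q r l i (foldr (f_level q r l) j v)) (bv b) \<noteq> 0}"
		have F: "?F b = (if f_level q r l p (foldr (f_level q r l) ps' (bv b)) = 0 then {} else {(p, ps')})" for b
			using ps by auto
		show "finite (?F b)" for b unfolding F by simp
		show "foldr (f_level q r l) ps (bv b) =
				(\<Sum>i\<in>?F b. (case i of (i, j) => %v. f_level q r l i (foldr (f_level q r l) j v)) (bv b))" for b
			unfolding F using ps by simp
	qed (auto simp: prod.lessThan_Suc_shift simp del: prod.lessThan_Suc)
	then show ?case by blast
qed

definition raise :: "fbasis => fbasis" where "raise b = (fst b + 2, snd b)"

definition raise_at :: "nat list => fbasis list => fbasis list"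
	where "raise_at js bs = foldr (%j bs. bs[j - 1 := raise (bs ! (j - 1))]) js bs"

lemma raise_at:
	"foldr (%j. (\<circ>) (at_factor j (exp_alpha 1))) js id (bv bs) = bv (raise_at js bs)"
	"lin (foldr (%j. (\<circ>) (at_factor j (exp_alpha 1))) js id)"
	"length (raise_at js bs) = length bs"
proof (induction js)
	case (Cons j js)
	have A: "at_factor j (exp_alpha 1) (bv bs) = bv (bs[j - 1 := raise (bs ! (j - 1))])" for bs
		by (cases "bs ! (j - 1)") (simp add: at_factor_bv exp_alpha_def lin_ext_single scl_simps raise_def)
	show "foldr (%j. (\<circ>) (at_factor j (exp_alpha 1))) (j # js) id (bv bs) = bv (raise_at (j # js) bs)"
		unfolding foldr.simps o_apply Cons.IH(1) A by (simp add: raise_at_def)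
	show "lin (foldr (%j. (\<circ>) (at_factor j (exp_alpha 1))) (j # js) id)"
	proof -
		have "lin (at_factor j (exp_alpha 1))" by (simp add: at_factor_def[abs_def])
		from lin_comp[OF this Cons.IH(2)] show ?thesis
			unfolding foldr.simps o_apply comp_def[of "at_factor j (exp_alpha 1)" "foldr _ _ _"] .
	qed
	show "length (raise_at (j # js) bs) = length bs" using Cons.IH(3) by (simp add: raise_at_def)
qed (simp_all add: raise_at_def lin_simps id_def)

lemma raise_at_nth: "distinct js ==> 0 \<notin> set js ==> i < length bs ==>
		raise_at js bs ! i = (if Suc i \<in> set js then raise (bs ! i) else bs ! i)"
proof (induction js)
	case (Cons j js)
	have "raise_at (j # js) bs = (raise_at js bs)[j - 1 := raise (raise_at js bs ! (j - 1))]" by (simp add: raise_at_def)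
	then show ?case using Cons raise_at(3)[of js bs] by (cases "i = j - 1") (auto simp: nth_list_update)
qed (simp add: raise_at_def)

lemma E_op_pow:
	"lin (E_op l ^^ m)" "\<exists>bs'. (E_op l ^^ m) (bv bs) = bv bs' \<and> length bs' = length bs \<and>
		(length bs = l \<longrightarrow> bs' = map (%b. (fst b + 2 * int m, snd b)) bs)"
proof (induction m)
	case 0
	case 1
	show ?case by (simp add: lin_simps id_def)
next
	case 0
	case 2
	show ?case by (intro exI[of _ bs]) simp
next
	case (Suc m)
	case 1
	show ?case using lin_comp[OF raise_at(2) Suc.IH(1)] by (simp add: E_op_def o_def)
next
	case (Suc m)
	case 2
	obtain bs' where b: "(E_op l ^^ m) (bv bs) = bv bs'" "length bs' = length bs"
		"length bs = l \<longrightarrow> bs' = map (%b. (fst b + 2 * int m, snd b)) bs" using Suc.IH(2) by blast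
	have "raise_at [1..<Suc l] bs' = map (%b. (fst b + 2 * int (Suc m), snd b)) bs" if "length bs = l"
	proof (rule nth_equalityI)
		fix i assume "i < length (raise_at [1..<Suc l] bs')"
		then show "raise_at [1..<Suc l] bs' ! i = map (%b. (fst b + 2 * int (Suc m), snd b)) bs ! i"
			using that b by (subst raise_at_nth) (auto simp: raise_at(3) raise_def)
	qed (use that b in "simp add: raise_at(3)")
	then show ?case
		using b by (intro exI[of _ "raise_at [1..<Suc l] bs'"]) (auto simp: E_op_def raise_at(1,3) simp del: upt_Suc)
qed

lemma vac_nth: "j \<in> {1..l} ==> vac ks ! (j - 1) = (int (kp j), 0)" "length (vac ks) = l"
	using ks by (auto simp: vac_def kp_def)

text \<open>\<open><k| E^n\<close> is itself coherent, with all parameters 0: such a functional is 1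
  on the empty monomial and 0 on all others.\<close>

lemma mat_coeff_ap: "mat_coeff q r l n ks ps = ap (st []) (foldr (f_level q r l) ps (bv (vac ks)))"
proof -
	let ?d = "%b. if b = vac ks then 1 else 0 :: complex" and ?u = "foldr (f_level q r l) ps (bv (vac ks))"
	have lk: "lookup v (vac ks) = ap ?d v" for v
		by (subst ap_superset[of "insert (vac ks) (keys v)"]) (auto simp: if_distrib cong: if_cong)
	have "ap ?d ((E_op l ^^ n) (bv bs)) = st [] bs" for bs
	proof -
		obtain bs' where b: "(E_op l ^^ n) (bv bs) = bv bs'" "length bs' = length bs"
			"length bs = l ==> bs' = map (%b. (fst b + 2 * int n, snd b)) bs" using E_op_pow(2)[of n bs] by blast
		show ?thesis
		proof (cases "length bs = l")
			case True
			have m0: "monv (%m. 0) mu = (if mu = 0 then 1 else (0::complex))" for mu :: "nat \<Rightarrow>\<^sub>0 nat"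
				by (auto simp: monv_def in_keys_iff prod_zero_iff poly_mapping_eq_iff fun_eq_iff)
			have "bs' = vac ks \<longleftrightarrow> (\<forall>j\<in>{1..l}. bs' ! (j - 1) = vac ks ! (j - 1))"
			proof (intro iffI nth_equalityI)
				fix i assume R: "\<forall>j\<in>{1..l}. bs' ! (j - 1) = vac ks ! (j - 1)" and "i < length bs'"
				then show "bs' ! i = vac ks ! i" using bspec[OF R, of "Suc i"] b(2) True by simp
			qed (use b(2) True vac_nth(2) in simp_all)
			also have "\<dots> \<longleftrightarrow> (\<forall>j\<in>{1..l}. fst (bs ! (j - 1)) = chg [] j \<and> snd (bs ! (j - 1)) = 0)"
				using b(3)[OF True] True by (intro ball_cong refl) (auto simp: vac_nth chg_def prod_eq_iff simp del: One_nat_def)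
			finally have "?d bs' = (if \<forall>j\<in>{1..l}. fst (bs ! (j - 1)) = chg [] j \<and> snd (bs ! (j - 1)) = 0 then 1 else 0)" by simp
			also have "\<dots> = (\<Prod>j\<in>{1..l}. if fst (bs ! (j - 1)) = chg [] j \<and> snd (bs ! (j - 1)) = 0 then 1 else 0)"
				by (auto intro!: prod.neutral[symmetric] simp: prod_zero_iff)
			also have "\<dots> = st [] bs"
			proof -
				have "par [] = (%j m. 0)" by (auto simp: par_def fun_eq_iff)
				then show ?thesis using True by (auto simp: lcoh_def coh_def m0 intro!: prod.cong)
			qed
			finally show ?thesis using b(1) by simp
		next
			case False
			then have "bs' \<noteq> vac ks" using b(2) vac_nth(2) by auto
			then show ?thesis using b(1) False by (simp add: lcoh_def)
		qed
	qed
	then have "ap ?d ((E_op l ^^ n) ?u) = ap (st []) ?u" by (subst ap_lin[OF E_op_pow(1)]) (simp add: ap_def[of "st []"])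
	then show ?thesis by (simp add: mat_coeff_def lk)
qed

lemma mat_coeff_has_sum:
	assumes w: "\<And>i. i \<in> {1..l * n} ==> w i \<noteq> 0" "\<And>i j. (i, j) \<in> pairs (l * n) ==> norm (w j) < norm (q\<^sup>2) * norm (w i)"
	shows "((%ps. mat_coeff q r l n ks ps * (\<Prod>i=1..l * n. w i powi (ps ! (i - 1)))) has_sum
		(\<Sum>xs\<in>assigns. weights [] xs (map w [1..<Suc (l * n)]))) {ps. length ps = l * n}"
proof -
	let ?N = "l * n" and ?ws = "map w [1..<Suc (l * n)]"
	have s: "sorted_wrt apart ?ws"
		unfolding sorted_wrt_iff_nth_less using w by (auto simp: apart_def pairs_def simp del: upt_Suc)
	have n: "v \<noteq> 0" if "v \<in> set ?ws" for v using that w(1) by (auto simp del: upt_Suc)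
	obtain om where a: "adm {ps. length ps = length ?ws} (%ps. \<Prod>i<length ?ws. ?ws ! i powi (ps ! i)) (foldr (f_level q r l)) (st []) (st' [])
			(%b. \<Sum>xs\<in>words (length ?ws). weights [] xs ?ws * st ([] @ zip xs ?ws) b) om"
		using foldr_step[of ?ws "[]", OF n s] by auto
	have c: "(\<Prod>i<length ?ws. ?ws ! i powi (ps ! i)) = (\<Prod>i=1..?N. w i powi (ps ! (i - 1)))" for ps
		by (rule prod.reindex_bij_witness[of _ "%i. i - 1" Suc]) (auto simp del: upt_Suc)
	\<comment> \<open>On |k> the oscillator part of a coherent functional is 1, so only the charges
	  matter; they match exactly when every letter occurs n times.\<close>
	have v: "st (zip xs ?ws) (vac ks) = (if xs \<in> assigns then 1 else 0)" if xs: "xs \<in> words ?N" for xs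
	proof -
		have "map fst (zip xs ?ws) = xs" using xs by (simp add: words_def map_fst_zip del: upt_Suc)
		then have ch: "chg (zip xs ?ws) j = int (kp j) \<longleftrightarrow> count_list xs j = n" for j by (auto simp: chg_def)
		have "st (zip xs ?ws) (vac ks) = (\<Prod>j\<in>{1..l}. if count_list xs j = n then 1 else 0)"
			unfolding lcoh_def using vac_nth
			by (auto intro!: prod.cong simp: coh_def ch[symmetric] simp del: One_nat_def)
		also have "\<dots> = (if xs \<in> assigns then 1 else 0)"
			using xs by (auto simp: assigns_def words_def prod_zero_iff intro!: prod.neutral)
		finally show ?thesis .
	qed
	have "(\<Sum>xs\<in>words ?N. weights [] xs ?ws * st (zip xs ?ws) (vac ks)) = (\<Sum>xs\<in>words ?N. if xs \<in> assigns then weights [] xs ?ws else 0)"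
		by (intro sum.cong refl, simp only: v, simp)
	also have "\<dots> = (\<Sum>xs\<in>assigns. weights [] xs ?ws)"
	proof -
		have "finite (words ?N)" unfolding words_def by (rule finite_lists_length_eq) simp
		moreover have "{xs \<in> words ?N. xs \<in> assigns} = assigns" by (auto simp: words_def assigns_def)
		ultimately show ?thesis by (simp only: sum.inter_filter[symmetric])
	qed
	finally show ?thesis
		using admD(4)[OF a, of "vac ks"] unfolding c mat_coeff_ap by (simp add: mult.commute del: upt_Suc)
qed

end

section \<open>Powers of q and the assembly of the polynomial F\<close>

lemma prod_powi: "q \<noteq> 0 ==> (\<Prod>j\<in>A. q powi f j) = (q powi (\<Sum>j\<in>A. f j) :: 'a::field)"
	by (induction A rule: infinite_finite_induct) (auto simp: power_int_add)

lemma prod_count: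
	fixes xs :: "nat list"
	shows "(\<Prod>b\<in>{1..length xs}. if x = xs ! (b - 1) then y else 1) = (y ^ count_list xs x :: 'a::comm_semiring_1)"
	"set xs \<subseteq> {1..l} ==>
		(\<Prod>b\<in>{1..length xs}. if x < xs ! (b - 1) then y else 1) = y ^ (\<Sum>j\<in>{x<..l}. count_list xs j)"
proof -
	have re: "(\<Prod>b\<in>{1..m}. f (b - 1)) = (\<Prod>b<m. f b)" for f :: "nat => 'a" and m
		by (rule prod.reindex_bij_witness[of _ Suc "%b. b - 1"]) auto
	show "(\<Prod>b\<in>{1..length xs}. if x = xs ! (b - 1) then y else 1) = y ^ count_list xs x"
		unfolding re[of "%b. if x = xs ! b then y else 1"]
		by (induction xs) (auto simp: prod.lessThan_Suc_shift simp del: prod.lessThan_Suc)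
	assume "set xs \<subseteq> {1..l}"
	then show "(\<Prod>b\<in>{1..length xs}. if x < xs ! (b - 1) then y else 1) = y ^ (\<Sum>j\<in>{x<..l}. count_list xs j)"
		unfolding re[of "%b. if x < xs ! b then y else 1"]
	proof (induction xs)
		case (Cons z xs)
		have "(\<Sum>j\<in>{x<..l}. count_list (z # xs) j) = (\<Sum>j\<in>{x<..l}. (if j = z then 1 else 0) + count_list xs j)"
			by (intro sum.cong) auto
		also have "\<dots> = (if x < z then 1 else 0) + (\<Sum>j\<in>{x<..l}. count_list xs j)"
			
			unfolding sum.distrib using Cons.prems by (subst sum.delta) auto
		finally show ?case using Cons by (simp add: prod.lessThan_Suc_shift power_add del: prod.lessThan_Suc)
	qed simp
qed

context main_data
begin

abbreviation "Q \<equiv> q\<^sup>2"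

text \<open>The powers of q from the rescalings q^(l-i) and from the charges of |k> seen by k^+; the
  part of the k^+ charges caused by other letters goes into \<open>pfac\<close> as factors
  1/Q.\<close>

fun qexp :: "nat list => int" where
	"qexp [] = 0"
| "qexp (x # xs) = int (l - x) * (2 * int (count_list xs x) - int (kp x)) + (\<Sum>j\<in>{x<..l}. int (kp j)) + qexp xs"

text \<open>All that belongs to a pair of places: the square of the earlier variable x for equal
  letters, the charge seen by k^+, and the contraction with the later variable y.\<close>

definition pfac :: "nat => nat => complex => complex => complex"
	where "pfac i j x y = (if i = j then x\<^sup>2 else 1) * (if i < j then inverse Q else 1) * contr i j (y / x)"

text \<open>Since the word has to restore the charges of |k>, the current charge is expressed by the
  letters still to come. A general history \<open>P\<close> makes the induction possible; its
  contractions form a product of their own.\<close>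

lemma weights_eq:
	assumes "length xs = length ws" "set xs \<subseteq> {1..l}" "\<And>w. w \<in> set ws ==> w \<noteq> 0"
		"\<And>j. j \<in> {1..l} ==> chg P j = int (kp j) - 2 * int (count_list xs j)"
	shows "(\<Prod>a<length xs. ws ! a) * weights P xs ws = q powi qexp xs * (\<Prod>a<length xs. ws ! a ^ (1 - kp (xs ! a))) *
		(\<Prod>a<length xs. \<Prod>(i, w)\<leftarrow>P. contr i (xs ! a) (ws ! a / w)) *
		(\<Prod>(a, b)\<in>pairs (length xs). pfac (xs ! (a - 1)) (xs ! (b - 1)) (ws ! (a - 1)) (ws ! (b - 1)))"
	using assms
proof (induction xs arbitrary: P ws)
	case Nil
	have "pairs 0 = {}" by (auto simp: pairs_def)
	then show ?case by simp
next
	case (Cons x xs)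
	obtain w vs where ws: "ws = w # vs" "length xs = length vs" using Cons.prems(1) by (cases ws) auto
	have x: "x \<in> {1..l}" "w \<noteq> 0" and xs: "set xs \<subseteq> {1..l}" using Cons.prems ws by auto
	let ?c = "int (count_list xs x)" and ?N = "length xs"
	let ?PP = "\<Prod>(a, b)\<in>pairs ?N. pfac (xs ! (a - 1)) (xs ! (b - 1)) (vs ! (a - 1)) (vs ! (b - 1))"
	let ?O = "\<Prod>a<?N. \<Prod>(i, w)\<leftarrow>P. contr i (xs ! a) (vs ! a / w)" and ?A = "\<Prod>a<?N. contr x (xs ! a) (vs ! a / w)"
	have "chg (P @ [(x, w)]) j = int (kp j) - 2 * int (count_list xs j)" if "j \<in> {1..l}" for j
		using Cons.prems(4)[OF that] unfolding par_snoc by (auto split: if_splits)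
	then have IH: "(\<Prod>a<?N. vs ! a) * weights (P @ [(x, w)]) xs vs =
			q powi qexp xs * (\<Prod>a<?N. vs ! a ^ (1 - kp (xs ! a))) * (?O * ?A) * ?PP"
		using Cons.IH[of vs "P @ [(x, w)]"] Cons.prems ws by (simp add: prod.distrib)
	have chx: "- (chg P x + 2) = 2 * ?c - int (kp x)" using Cons.prems(4)[OF x(1)] by simp
	have "(\<Prod>j\<in>{x<..l}. q powi chg P j) = q powi (\<Sum>j\<in>{x<..l}. int (kp j) - 2 * int (count_list xs j))"
		unfolding prod_powi[OF q_nz(1)] using x Cons.prems(4) by (intro arg_cong2[where f = "(powi)"] sum.cong refl) auto
	also have "\<dots> = q powi (\<Sum>j\<in>{x<..l}. int (kp j)) * inverse Q ^ (\<Sum>j\<in>{x<..l}. count_list xs j)"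
		using q_nz by (simp add: sum_subtractf power_int_diff sum_distrib_left[symmetric] power_int_mult power_inverse divide_inverse
				flip: of_nat_sum)
	also have "inverse Q ^ (\<Sum>j\<in>{x<..l}. count_list xs j) = (\<Prod>b\<in>{1..?N}. if x < xs ! (b - 1) then inverse Q else 1)"
		by (rule prod_count(2)[OF xs, symmetric])
	finally have j: "(\<Prod>j\<in>{x<..l}. q powi chg P j) = q powi (\<Sum>j\<in>{x<..l}. int (kp j)) *
			(\<Prod>b\<in>{1..?N}. if x < xs ! (b - 1) then inverse Q else 1)" .
	have "w * (q ^ (l - x) * w) powi (2 * ?c - int (kp x)) = q powi (int (l - x) * (2 * ?c - int (kp x))) * (w ^ (1 - kp x) * (w\<^sup>2) ^ count_list xs x)"
	proof -
		have "w * w powi (2 * ?c - int (kp x)) = w ^ (1 - kp x) * (w\<^sup>2) ^ count_list xs x"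
		proof -
			have "w * w powi (2 * ?c - int (kp x)) = w powi (int (1 - kp x) + int (2 * count_list xs x))"
				using x kp01[OF x(1)] by (auto simp: power_int_add power_int_diff)
			then show ?thesis using x(2) by (simp only: power_int_add power_int_of_nat power_mult simp_thms disj_not1)
		qed
		then show ?thesis by (simp add: power_int_mult_distrib power_int_mult mult_ac)
	qed
	also have "(w\<^sup>2) ^ count_list xs x = (\<Prod>b\<in>{1..?N}. if x = xs ! (b - 1) then w\<^sup>2 else 1)"
		by (rule prod_count(1)[symmetric])
	finally have i: "w * (q ^ (l - x) * w) powi (2 * ?c - int (kp x)) = q powi (int (l - x) * (2 * ?c - int (kp x))) *
			(w ^ (1 - kp x) * (\<Prod>b\<in>{1..?N}. if x = xs ! (b - 1) then w\<^sup>2 else 1))" .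
	have pf: "(\<Prod>b\<in>{1..?N}. pfac x (xs ! (b - 1)) w (vs ! (b - 1))) =
			(\<Prod>b\<in>{1..?N}. if x = xs ! (b - 1) then w\<^sup>2 else 1) * (\<Prod>b\<in>{1..?N}. if x < xs ! (b - 1) then inverse Q else 1) * ?A"
	proof -
		have "(\<Prod>b\<in>{1..?N}. contr x (xs ! (b - 1)) (vs ! (b - 1) / w)) = ?A"
			by (rule prod.reindex_bij_witness[of _ Suc "%b. b - 1"]) auto
		then show ?thesis unfolding pfac_def prod.distrib by (simp only:)
	qed
	have "(\<Prod>a<length (x # xs). ws ! a) * weights P (x # xs) ws =
			(w * (q ^ (l - x) * w) powi (- (chg P x + 2))) * (\<Prod>j\<in>{x<..l}. q powi chg P j) *
			(\<Prod>(i', w')\<leftarrow>P. contr i' x (w / w')) * ((\<Prod>a<?N. vs ! a) * weights (P @ [(x, w)]) xs vs)"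
		unfolding ws(1) weights.simps weight_def by (simp add: prod.lessThan_Suc_shift mult_ac del: prod.lessThan_Suc)
	also have "\<dots> = (q powi (int (l - x) * (2 * ?c - int (kp x))) * q powi (\<Sum>j\<in>{x<..l}. int (kp j)) * q powi qexp xs) *
			(w ^ (1 - kp x) * (\<Prod>a<?N. vs ! a ^ (1 - kp (xs ! a)))) * ((\<Prod>(i', w')\<leftarrow>P. contr i' x (w / w')) * ?O) *
			((\<Prod>b\<in>{1..?N}. pfac x (xs ! (b - 1)) w (vs ! (b - 1))) * ?PP)"
		unfolding chx i j IH pf by (simp only: mult_ac)
	also have "q powi (int (l - x) * (2 * ?c - int (kp x))) * q powi (\<Sum>j\<in>{x<..l}. int (kp j)) * q powi qexp xs = q powi qexp (x # xs)"
		using q_nz by (simp add: power_int_add)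
	also have "(\<Prod>b\<in>{1..?N}. pfac x (xs ! (b - 1)) w (vs ! (b - 1))) * ?PP =
			(\<Prod>(a, b)\<in>pairs (length (x # xs)). pfac ((x # xs) ! (a - 1)) ((x # xs) ! (b - 1)) (ws ! (a - 1)) (ws ! (b - 1)))"
		unfolding list.size(4) One_nat_def add_Suc_right add_0_right prod_pairs_Suc ws
		by (intro arg_cong2[where f = "(*)"] prod.cong refl) (auto simp: pairs_def nth_Cons')
	finally show ?case
		unfolding ws(1) by (simp add: prod.lessThan_Suc_shift del: prod.lessThan_Suc qexp.simps)
qed

text \<open>The exponent depends on a word through its multiplicities only, hence is constant on
  \<open>assigns\<close>.\<close>

lemma qexp_sum: "set xs \<subseteq> {1..l} ==> qexp xs = (\<Sum>i\<in>{1..l}. int (l - i) * (int (count_list xs i) * (int (count_list xs i) - 1)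
		- int (count_list xs i) * int (kp i)) + int (count_list xs i) * (\<Sum>j\<in>{i<..l}. int (kp j)))"
proof (induction xs)
	case (Cons x xs)
	let ?h = "%i c. int (l - i) * (c * (c - 1) - c * int (kp i)) + c * (\<Sum>j\<in>{i<..l}. int (kp j))"
	have "(\<Sum>i\<in>{1..l}. ?h i (int (count_list (x # xs) i))) = (\<Sum>i\<in>{1..l}. ?h i (int (count_list xs i)) +
			(if i = x then int (l - x) * (2 * int (count_list xs x) - int (kp x)) + (\<Sum>j\<in>{x<..l}. int (kp j)) else 0))"
		by (intro sum.cong refl) (simp add: algebra_simps)
	also have "\<dots> = qexp (x # xs)" using Cons by (simp add: sum.distrib sum.delta)
	finally show ?case by simp
qed simp

definition e0 :: int
	where "e0 = int (n * (n - 1) * (l choose 2)) + int n * (\<Sum>j\<in>{1..l}. int (kp j) * (2 * int j - 1 - int l))"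

lemma qexp_assigns: "xs \<in> assigns ==> qexp xs = e0"
proof -
	assume xs: "xs \<in> assigns"
	have "qexp xs = (\<Sum>i\<in>{1..l}. int (l - i) * (int n * (int n - 1) - int n * int (kp i)) + int n * (\<Sum>j\<in>{i<..l}. int (kp j)))"
		using xs by (subst qexp_sum) (auto simp: assigns_def intro!: sum.cong)
	also have "\<dots> = int n * (int n - 1) * (\<Sum>i\<in>{1..l}. int (l - i)) +
			int n * ((\<Sum>i\<in>{1..l}. \<Sum>j\<in>{i<..l}. int (kp j)) - (\<Sum>i\<in>{1..l}. int (l - i) * int (kp i)))"
		by (simp add: sum.distrib sum_subtractf sum_distrib_left algebra_simps)
	also have "(\<Sum>i\<in>{1..l}. \<Sum>j\<in>{i<..l}. int (kp j)) = (\<Sum>j\<in>{1..l}. (int j - 1) * int (kp j))"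
	proof -
		have "(\<Sum>i\<in>{1..l}. \<Sum>j\<in>{i<..l}. int (kp j)) = (\<Sum>j\<in>{1..l}. \<Sum>i\<in>{1..<j}. int (kp j))"
			by (subst (1 2) sum.Sigma; simp?) (rule sum.reindex_bij_witness[of _ prod.swap prod.swap]; force)
		then show ?thesis by (simp add: of_nat_diff)
	qed
	also have "(\<Sum>j\<in>{1..l}. (int j - 1) * int (kp j)) - (\<Sum>i\<in>{1..l}. int (l - i) * int (kp i)) =
			(\<Sum>j\<in>{1..l}. int (kp j) * (2 * int j - 1 - int l))"
		unfolding sum_subtractf[symmetric] by (intro sum.cong refl) (simp add: of_nat_diff algebra_simps)
	also have "(\<Sum>i\<in>{1..l}. int (l - i)) = int (l choose 2)"
	proof -
		have "(\<Sum>i\<in>{1..l}. int (l - i)) = (\<Sum>i<l. int i)"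
			by (rule sum.reindex_bij_witness[of _ "%i. l - i" "%i. l - i"]) auto
		also have "\<dots> = int (l choose 2)" by (induction l) (simp_all add: numeral_2_eq_2)
		finally show ?thesis .
	qed
	finally show ?thesis using n1 by (simp add: e0_def of_nat_diff)
qed

text \<open>For i < j the contraction has the denominator 1 - y/(Q x), which the numerator of the
  prefactor cancels; in all cases only x - y remains below.\<close>

lemma pfac_eq:
	assumes "x \<noteq> 0" "x \<noteq> y" "Q * x \<noteq> y"
	shows "pfac i j x y * ((y - Q * x) / (y - x)) = dfac Q i j x y / (x - y)"
proof -
	have 1: "(y - Q * x) / (y - x) = (Q * x - y) / (x - y)" using assms(2) by (simp add: divide_simps) (simp add: algebra_simps)
	have 2: "1 - y / x / Q = (Q * x - y) / (Q * x)" "1 - Q * (y / x) = (x - Q * y) / x" "1 - y / x = (x - y) / x"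
		using assms(1) q_nz by (simp_all add: field_simps)
	have nz: "x - y \<noteq> 0" "Q * x - y \<noteq> 0" "Q \<noteq> 0" using assms q_nz by auto
	consider "i = j" | "i < j" | "j < i" by linarith
	then show ?thesis
	proof cases
		case 1
		then show ?thesis unfolding pfac_def contr_def \<open>(y - Q * x) / (y - x) = _\<close> 2 dfac_def
			using assms(1) nz(1) by (simp add: power2_eq_square field_simps)
	next
		case 2
		have "inverse Q * (A / x / (B / (Q * x))) * (B / D) = A / D" if "B \<noteq> 0" for A B D
			using that assms(1) nz(3) by (simp add: field_simps)
		from this[OF nz(2)] show ?thesis using 2 assms nz(3) unfolding pfac_def contr_def 1 \<open>1 - y / x / Q = _\<close> \<open>1 - Q * (y / x) = _\<close> dfac_def
			by simp
	next
		case 3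
		then show ?thesis unfolding pfac_def contr_def 1 dfac_def by simp
	qed
qed

lemma sum_weights:
	assumes w: "\<And>i. i \<in> {1..l * n} ==> w i \<noteq> 0" "\<And>i j. (i, j) \<in> pairs (l * n) ==> w i \<noteq> w j \<and> Q * w i \<noteq> w j"
	shows "(\<Prod>i\<in>{1..l * n}. w i) * (\<Sum>xs\<in>assigns. weights [] xs (map w [1..<Suc (l * n)])) *
		(\<Prod>(i, j)\<in>pairs (l * n). (w j - Q * w i) / (w j - w i)) = q powi e0 * ev w FF"
proof -
	let ?N = "l * n" and ?ws = "map w [1..<Suc (l * n)]"
	have wn: "?ws ! (a - 1) = w a" if "a \<in> {1..?N}" for a using that by (cases a) (simp_all del: upt_Suc)
	have re: "(\<Prod>a<?N. f a) = (\<Prod>a\<in>{1..?N}. f (a - 1))" for f :: "nat => complex"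
		by (rule prod.reindex_bij_witness[of _ "%b. b - 1" Suc]) auto
	have "(\<Prod>i\<in>{1..?N}. w i) * weights [] xs ?ws * (\<Prod>(i, j)\<in>pairs ?N. (w j - Q * w i) / (w j - w i)) =
			q powi e0 * (ev w (term_poly xs) / vdm ?N w)" if xs: "xs \<in> assigns" for xs
	proof -
		have len: "length xs = ?N" "set xs \<subseteq> {1..l}" using xs by (auto simp: assigns_def)
		have "chg [] j = int (kp j) - 2 * int (count_list xs j)" if "j \<in> {1..l}" for j
			using xs that by (simp add: chg_def assigns_def)
		then have "(\<Prod>a<length xs. ?ws ! a) * weights [] xs ?ws = q powi qexp xs * (\<Prod>a<length xs. ?ws ! a ^ (1 - kp (xs ! a))) *
				(\<Prod>a<length xs. \<Prod>(i, w)\<leftarrow>[]. contr i (xs ! a) (?ws ! a / w)) *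
				(\<Prod>(a, b)\<in>pairs (length xs). pfac (xs ! (a - 1)) (xs ! (b - 1)) (?ws ! (a - 1)) (?ws ! (b - 1)))"
			using len w(1) by (intro weights_eq) (auto simp del: upt_Suc)
		then have "(\<Prod>a\<in>{1..?N}. w a) * weights [] xs ?ws = q powi e0 * (\<Prod>a\<in>{1..?N}. w a ^ (1 - kp (xs ! (a - 1)))) *
				(\<Prod>(a, b)\<in>pairs ?N. pfac (xs ! (a - 1)) (xs ! (b - 1)) (?ws ! (a - 1)) (?ws ! (b - 1)))"
			unfolding len(1) re qexp_assigns[OF xs] by (simp add: wn[unfolded One_nat_def] del: upt_Suc)
		moreover have "(\<Prod>(a, b)\<in>pairs ?N. pfac (xs ! (a - 1)) (xs ! (b - 1)) (?ws ! (a - 1)) (?ws ! (b - 1))) *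
				(\<Prod>(i, j)\<in>pairs ?N. (w j - Q * w i) / (w j - w i)) =
				(\<Prod>(a, b)\<in>pairs ?N. dfac Q (xs ! (a - 1)) (xs ! (b - 1)) (w a) (w b)) / vdm ?N w"
			unfolding vdm_def prod.distrib[symmetric] prod_dividef[symmetric] split_def
		proof (rule prod.cong[OF refl])
			fix p assume p: "p \<in> pairs ?N"
			then have "fst p \<in> {1..?N}" "snd p \<in> {1..?N}" "(fst p, snd p) \<in> pairs ?N" by (auto simp: pairs_def)
			then show "pfac (xs ! (fst p - 1)) (xs ! (snd p - 1)) (?ws ! (fst p - 1)) (?ws ! (snd p - 1)) *
					((w (snd p) - Q * w (fst p)) / (w (snd p) - w (fst p))) =
					dfac Q (xs ! (fst p - 1)) (xs ! (snd p - 1)) (w (fst p)) (w (snd p)) / (w (fst p) - w (snd p))"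
				using w(1)[of "fst p"] w(2)[of "fst p" "snd p"] pfac_eq by (simp only: wn) blast
		qed
		ultimately show ?thesis unfolding ev_term_poly by (simp only: mult.assoc) (simp add: mult_ac)
	qed
	then have "(\<Prod>i\<in>{1..?N}. w i) * (\<Sum>xs\<in>assigns. weights [] xs ?ws) * (\<Prod>(i, j)\<in>pairs ?N. (w j - Q * w i) / (w j - w i)) =
			q powi e0 * (ev w RF / vdm ?N w)"
		unfolding sum_distrib_left sum_distrib_right ev_RF sum_divide_distrib by (rule sum.cong[OF refl])
	moreover have "vdm ?N w \<noteq> 0"
		unfolding vdm_def using w(2) by (simp add: prod_zero_iff) force
	ultimately show ?thesis unfolding ev_RF_FF by simp
qed

text \<open>The geometric sum 1 + Q + ... + Q^m equals q^m [m+1].\<close>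

lemma qsum_qfact: "qsum m = q ^ (\<Sum>i<m. i) * qfact q m"
proof (induction m)
	case (Suc m)
	have d: "q - inverse q \<noteq> 0" using qnum_nz[of 1] by (auto simp: qnum_def)
	have Q1: "Q \<noteq> 1" using d q_nz by (auto simp: power2_eq_square field_simps)
	have "(\<Sum>j<Suc m. Q ^ j) = (Q ^ Suc m - 1) / (Q - 1)" using Q1 by (rule geometric_sum)
	also have "\<dots> = q ^ m * qnum q (int (Suc m))"
	proof -
		have p: "q powi int (Suc m) = q ^ Suc m" "q powi - int (Suc m) = 1 / q ^ Suc m" "Q ^ Suc m = q ^ Suc m * q ^ Suc m"
			by (simp_all add: power_int_minus divide_inverse power2_eq_square power_mult_distrib del: of_nat_Suc power_Suc)
		have "Q - 1 = q * (q - inverse q)" using q_nz by (simp add: power2_eq_square right_diff_distrib)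
		moreover have "q ^ Suc m * q ^ Suc m - 1 = q * (q ^ m * (q ^ Suc m - 1 / q ^ Suc m))"
			using q_nz by (simp add: right_diff_distrib)
		ultimately show ?thesis using d q_nz unfolding qnum_def p by (simp add: divide_simps)
	qed
	finally show ?case using Suc by (simp add: qsum_def qfact_def power_add mult_ac del: sum.lessThan_Suc of_nat_Suc)
		(simp add: mult_ac power_add)
qed (simp add: qsum_def qfact_def)

text \<open>The exponents of \<open>q\<close> are compared after doubling, which avoids the division in binomial coefficients.\<close>

lemma gamma_eq: "q powi e0 * lookup FF (mon (Y_partition l n k)) = gamma_const q l n k"
proof -
	let ?T = "%m. (\<Sum>i<m. i) :: nat"
	have tri: "2 * int (?T m) = int m * (int m - 1)" "2 * int (m choose 2) = int m * (int m - 1)" for m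
		by (induction m) (auto simp: algebra_simps numeral_2_eq_2)
	have T: "2 * int (\<Sum>x\<in>{1..l}. x) = int l * (int l + 1)" by (induction l) (auto simp: algebra_simps)
	\<comment> \<open>The part of \<open>e0\<close> that depends on which factors are charged;
	  \<open>cross_eq\<close> trades it for \<open>cross\<close>.\<close>
	define C where "C = (\<Sum>j\<in>{1..l}. int (kp j) * (2 * int j - 1 - int l))"
	let ?E = "n * cross + ?T n * (\<Sum>x\<in>{1..l}. x)" and ?G = "l\<^sup>2 * n * (n - 1) + n * (l choose 2)"
	have "2 * (e0 + int (2 * ?E + n * (?T (l - k) + ?T k))) = 2 * int ?G"
	proof -
		have nn: "int (n - 1) = int n - 1" and lk: "int (l - k) = int l - int k" using n1 kl by (simp_all add: of_nat_diff)
		have x: "2 * int cross = int k * (int l - int k) - C" using cross_eq by (simp add: C_def)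
		have a: "2 * e0 = int n * (int n - 1) * (2 * int (l choose 2)) + 2 * int n * C"
			unfolding e0_def C_def[symmetric] by (simp add: nn algebra_simps)
		have b: "2 * int (2 * ?E + n * (?T (l - k) + ?T k)) = 2 * int n * (2 * int cross) +
				(2 * int (?T n)) * (2 * int (\<Sum>x\<in>{1..l}. x)) + int n * (2 * int (?T (l - k)) + 2 * int (?T k))"
			by (simp only: of_nat_add of_nat_mult of_nat_numeral algebra_simps)
		have c: "2 * int ?G = 2 * (int l)\<^sup>2 * int n * (int n - 1) + int n * (2 * int (l choose 2))"
			by (simp only: of_nat_add of_nat_mult of_nat_power nn) (simp add: algebra_simps)
		show ?thesis unfolding distrib_left[of 2 e0] a b c unfolding tri T x lk by (simp add: algebra_simps power2_eq_square)
	qed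
	then have E: "int ?G = e0 + int (2 * ?E + n * (?T (l - k) + ?T k))"
		by (subst (asm) mult_left_cancel) (rule zero_neq_numeral[symmetric], rule sym)
	have "lookup FF (mon (Y_partition l n k)) = q ^ (2 * ?E + n * (?T (l - k) + ?T k)) * (qfact q k * qfact q (l - k)) ^ n"
		unfolding FF_leading_value qsum_qfact by (simp add: power_mult_distrib mult_ac flip: power_mult power_add) (simp add: mult_ac power_mult_distrib power_add power_mult)
	then have "q powi e0 * lookup FF (mon (Y_partition l n k)) =
			q powi e0 * q powi int (2 * ?E + n * (?T (l - k) + ?T k)) * (qfact q k * qfact q (l - k)) ^ n"
		by (simp only: power_int_of_nat mult.assoc)
	also have "\<dots> = q powi int ?G * (qfact q k * qfact q (l - k)) ^ n"
		unfolding E power_int_add[OF disjI1[OF q_nz(1)]] ..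
	finally show ?thesis by (simp only: power_int_of_nat gamma_const_def)
qed

end

section \<open>The matrix element as a rational function\<close>

lemma ordered_region_mono: "R \<le> R' ==> ordered_region N R' \<subseteq> ordered_region N R"
	unfolding ordered_region_def by (auto intro: order.strict_trans1[OF mult_right_mono])

lemma ordered_region_pairs:
	assumes w: "w \<in> ordered_region N R" and R: "1 \<le> R" and ij: "(i, j) \<in> pairs N"
	shows "R * norm (w j) < norm (w i)"
proof -
	have step: "R * norm (w (Suc m)) < norm (w m)" if "m \<in> {1..<N}" for m
		using w that by (simp add: ordered_region_def)
	have "Suc i \<le> j" using ij by (simp add: pairs_def)
	then have "j \<le> N \<longrightarrow> R * norm (w j) < norm (w i)"
	proof (induction j rule: dec_induct)
		case base
		show ?case using step[of i] ij by (simp add: pairs_def)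
	next
		case (step m)
		show ?case
		proof
			assume m: "Suc m \<le> N"
			then have "R * norm (w (Suc m)) < norm (w m)" using \<open>Suc i \<le> m\<close> ij by (intro \<open>\<And>m. m \<in> {1..<N} ==> _\<close>) auto
			also have "\<dots> \<le> R * norm (w m)" using R by (simp add: mult_le_cancel_right1)
			also have "\<dots> < norm (w i)" using step.IH m by simp
			finally show "R * norm (w (Suc m)) < norm (w i)" .
		qed
	qed
	then show ?thesis using ij by (simp add: pairs_def)
qed

text \<open>On the curve \<open>w\<^sub>i = z ^ e i\<close> with rapidly decreasing exponents a nonzero polynomial has only finitely many
	zeros, and the curve enters every ordered region.\<close>

lemma poly_eq_0_on_region:
	fixes D :: "complex mpol"
	assumes D: "\<And>w. w \<in> ordered_region N R ==> ev w D = 0"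
	shows "D = 0"
proof (rule ccontr)
	assume "D \<noteq> 0"
	then obtain e p where p: "p \<noteq> 0" "\<And>z. poly p z = ev (%i. z ^ e i) D"
		"\<And>i. i \<in> {1..<N} ==> e i > e (Suc i)" using kronecker_substitution[of D N] by metis
	have "complex_of_real ` {max R 1<..} \<subseteq> {z. poly p z = 0}"
	proof
		fix z assume "z \<in> complex_of_real ` {max R 1<..}"
		then have z: "norm z > R" "norm z > 1" by auto
		have "R * norm (z ^ e (Suc i)) < norm (z ^ e i)" if "i \<in> {1..<N}" for i
		proof -
			have "R * norm (z ^ e (Suc i)) < norm z * norm (z ^ e (Suc i))" using z by (intro mult_strict_right_mono) auto
			also have "\<dots> = norm z ^ Suc (e (Suc i))" by (simp add: norm_power)
			also have "\<dots> \<le> norm z ^ e i" using z p(3)[OF that] by (intro power_increasing) auto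
			finally show ?thesis by (simp add: norm_power)
		qed
		then have "(%i. z ^ e i) \<in> ordered_region N R" using z(2) by (auto simp: ordered_region_def)
		then show "z \<in> {z. poly p z = 0}" using D p(2) by simp
	qed
	then have "finite (complex_of_real ` {max R 1<..})" using poly_roots_finite[OF p(1)] finite_subset by blast
	then have "finite {max R 1<..}" by (rule finite_imageD) (auto simp: inj_on_def)
	then show False using infinite_Ioi by blast
qed

text \<open>The value may be witnessed by another representative of the fraction, so the claim is
  cross-multiplied and holds even at zeros of \<open>b\<close>.\<close>

lemma rat_has_value_Fract:
	assumes "rat_has_value (Fraction_Field.Fract a b) w v" "b \<noteq> 0"
	shows "ev w a = v * ev w b"
proof -
	obtain c d where c: "Fraction_Field.Fract a b = Fraction_Field.Fract c d" "ev w d \<noteq> 0" "v = ev w c / ev w d"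
		using assms(1) by (auto simp: rat_has_value_def mpol_eval_pev)
	then have "d \<noteq> 0" using rhom_simps(1)[OF rhom_ev, of w] by metis
	then have "a * d = c * b" using c(1) assms(2) by (simp add: Fraction_Field.eq_fract)
	then have "ev w a * ev w d = ev w c * ev w b" by (metis rhom_simps(4)[OF rhom_ev])
	then have "ev w a = ev w c * ev w b / ev w d" using c(2) by (simp add: eq_divide_eq)
	then show ?thesis by (simp add: c(3))
qed

lemma rational_function_unique:
	assumes "\<And>w. w \<in> ordered_region N R ==> \<exists>v. rat_has_value M w v \<and> rat_has_value M' w v"
	shows "M = M'"
proof -
	obtain a b where M: "M = Fraction_Field.Fract a b" "b \<noteq> 0" by (cases M) auto
	obtain a' b' where M': "M' = Fraction_Field.Fract a' b'" "b' \<noteq> 0" by (cases M') auto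
	have "a * b' - a' * b = 0"
	proof (rule poly_eq_0_on_region)
		fix w assume "w \<in> ordered_region N R"
		then obtain v where "ev w a = v * ev w b" "ev w a' = v * ev w b'"
			using assms rat_has_value_Fract M M' by metis
		then show "ev w (a * b' - a' * b) = 0" by (simp add: rhom_simps[OF rhom_ev])
	qed
	then show ?thesis using M M' by (simp add: Fraction_Field.eq_fract)
qed

context main_data
begin

definition num :: "complex mpol"
	where "num = scl (q powi e0) FF * (\<Prod>(i, j)\<in>pairs (l * n). var j - var i)"

definition den :: "complex mpol"
	where "den = (\<Prod>i=1..l * n. var i) * (\<Prod>(i, j)\<in>pairs (l * n). var j - scl Q (var i))"

lemma matrix_element_eq: "matrix_element q r l n ks = Fraction_Field.Fract num den"
proof -
	\<comment> \<open>Consecutive moduli with ratio above 1/|q^2| make all pairs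
	  \<open>apart\<close>.\<close>
	let ?N = "l * n" and ?R0 = "inverse (norm Q)"
	let ?S = "%w v. ((%ps. mat_coeff q r l n ks ps * (\<Prod>i=1..?N. w i powi (ps ! (i - 1)))) has_sum v) {ps. length ps = ?N}"
	have Q: "0 < norm Q" "norm Q < 1" using q0 q1 by (simp_all add: norm_power power_less_one_iff)
	then have R1: "1 \<le> ?R0" by (simp add: one_le_inverse)
	have val: "\<exists>v. rat_has_value (Fraction_Field.Fract num den) w v \<and> ?S w v" if w: "w \<in> ordered_region ?N ?R0" for w
	proof -
		have nz: "w i \<noteq> 0" if "i \<in> {1..?N}" for i using w that by (simp add: ordered_region_def)
		have lt: "norm (w j) < norm Q * norm (w i)" if "(i, j) \<in> pairs ?N" for i j
			using ordered_region_pairs[OF w R1 that] Q by (simp add: field_simps)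
		have ne: "w i \<noteq> w j \<and> Q * w i \<noteq> w j" if p: "(i, j) \<in> pairs ?N" for i j
		proof -
			have "norm Q * norm (w i) \<le> norm (w i)" using Q by (intro mult_left_le_one_le) auto
			then show ?thesis using lt[OF p] norm_mult[of Q "w i"] by fastforce
		qed
		let ?v = "\<Sum>xs\<in>assigns. weights [] xs (map w [1..<Suc ?N])"
		let ?P = "\<Prod>i=1..?N. w i" and ?A = "\<Prod>(i, j)\<in>pairs ?N. w j - Q * w i" and ?B = "\<Prod>(i, j)\<in>pairs ?N. w j - w i"
		have P: "?P \<noteq> 0" using nz by (simp add: prod_zero_iff)
		have AB: "?A \<noteq> 0" "?B \<noteq> 0" using ne by (force simp: prod_zero_iff)+
		have "?P * ?v * (?A / ?B) = q powi e0 * ev w FF"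
			using sum_weights[OF nz ne] by (simp add: prod_dividef split_def del: upt_Suc)
		then have v: "?v = q powi e0 * ev w FF * ?B / (?P * ?A)"
			using P AB by (simp add: field_simps del: upt_Suc)
		have "ev w num = q powi e0 * ev w FF * ?B" "ev w den = ?P * ?A"
			by (simp_all add: num_def den_def rhom_simps[OF rhom_ev] rhom_prod[OF rhom_ev] pev_scl[OF rhom_id] pev_var[OF rhom_id] split_def)
		then have "rat_has_value (Fraction_Field.Fract num den) w ?v"
			unfolding rat_has_value_def mpol_eval_pev using v P AB by (intro exI[of _ num] exI[of _ den]) simp
		moreover have "?S w ?v" by (rule mat_coeff_has_sum[OF nz lt])
		ultimately show ?thesis by blast
	qed
	show ?thesis
		unfolding matrix_element_def
	proof (rule the_equality)
		show "\<exists>R. \<forall>w\<in>ordered_region ?N R. \<exists>v. rat_has_value (Fraction_Field.Fract num den) w v \<and> ?S w v"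
			using val by blast
		fix M assume "\<exists>R. \<forall>w\<in>ordered_region ?N R. \<exists>v. rat_has_value M w v \<and> ?S w v"
		then obtain R where R: "\<forall>w\<in>ordered_region ?N R. \<exists>v. rat_has_value M w v \<and> ?S w v" by blast
		show "M = Fraction_Field.Fract num den"
		proof (rule rational_function_unique)
			\<comment> \<open>On the smaller of the two regions both functions are values of the same series,
			  hence agree.\<close>
			fix w assume w: "w \<in> ordered_region ?N (max R ?R0)"
			have "w \<in> ordered_region ?N R" "w \<in> ordered_region ?N ?R0"
				using w by (auto intro: subsetD[OF ordered_region_mono, rotated])
			then obtain v v' where "rat_has_value M w v" "?S w v" "rat_has_value (Fraction_Field.Fract num den) w v'" "?S w v'"
				using R val by blast
			then show "\<exists>v. rat_has_value M w v \<and> rat_has_value (Fraction_Field.Fract num den) w v"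
				using has_sum_unique by blast
		qed
	qed
qed

text \<open>As no q-number [p] with p > 0 vanishes, \<open>gamma_const\<close> is nonzero; by
  \<open>gamma_eq\<close> this is also what guarantees a nonzero leading coefficient.\<close>

lemma FF_macdonald:
	"scl (q powi e0) FF = scl (gamma_const q l n k) (macdonald_poly (q ^ (2 * (l + 1))) (inverse Q) (l * n) (Y_partition l n k))"
proof -
	have gnz: "gamma_const q l n k \<noteq> 0"
		using qnum_nz q_nz by (simp add: gamma_const_def qfact_def prod_zero_iff)
	have nz: "lookup FF (mon (Y_partition l n k)) \<noteq> 0" using gamma_eq gnz by auto
	obtain y0 where y0: "length y0 = n" "genr (inverse Q) y0" using exists_genr by blast
	have "q ^ (2 * (l + 1)) = Q ^ Suc l" by (simp only: power_mult Suc_eq_plus1)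
	then have "q ^ (2 * (l + 1)) * inverse Q ^ Suc l = 1"
		using q_nz by (simp only: power_inverse) (simp del: power_Suc)
	from macdonald_poly_of_wheel[OF lnk tn this mspan_FF wheel_FF y0 FF_generic_nonzero[OF y0] nz]
	have "FF = scl (lookup FF (mon (Y_partition l n k)))
		(macdonald_poly (q ^ (2 * (l + 1))) (inverse Q) (l * n) (Y_partition l n k))" .
	then have "scl (q powi e0) FF = scl (q powi e0) (scl (lookup FF (mon (Y_partition l n k)))
		(macdonald_poly (q ^ (2 * (l + 1))) (inverse Q) (l * n) (Y_partition l n k)))" by (rule arg_cong)
	then show ?thesis by (simp only: scl_simps gamma_eq)
qed

lemma matrix_element_times_factors:
	"(\<Prod>i=1..l * n. to_fract (var i)) * matrix_element q r l n ks
		* (\<Prod>(i, j)\<in>pairs (l * n). to_fract (var j - scl Q (var i)) / to_fract (var j - var i)) = to_fract (scl (q powi e0) FF)"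
proof -
	let ?N = "l * n"
	let ?P = "\<Prod>i=1..?N. var i :: complex mpol" and ?A = "\<Prod>(i, j)\<in>pairs ?N. var j - scl Q (var i) :: complex mpol"
		and ?B = "\<Prod>(i, j)\<in>pairs ?N. var j - var i :: complex mpol"
	have ev: "ev w (var i) = w i" for w :: "nat => complex" and i by (rule pev_var[OF rhom_id])
	have v0: "var i \<noteq> (0 :: complex mpol)" for i
	proof
		assume "var i = (0 :: complex mpol)"
		then show False using ev[of "%_. 1" i] rhom_simps(1)[OF rhom_ev, of "%_. 1 :: complex"] by simp
	qed
	have ne: "var j - scl c (var i) \<noteq> (0 :: complex mpol)" if "(i, j) \<in> pairs ?N" for i j c
	proof
		assume "var j - scl c (var i) = (0 :: complex mpol)"
		then have "ev (%m. if m = j then 1 else 0) (var j - scl c (var i)) = 0" using rhom_simps(1)[OF rhom_ev] by metis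
		then show False using that by (simp add: rhom_simps[OF rhom_ev] pev_scl[OF rhom_id] ev pairs_def)
	qed
	have ne1: "var j - var i \<noteq> (0 :: complex mpol)" if "(i, j) \<in> pairs ?N" for i j
		using ne[OF that, of 1] by (simp add: scl_simps)
	have nz: "to_fract ?P \<noteq> 0" "to_fract ?A \<noteq> 0" "to_fract ?B \<noteq> 0"
		using v0 ne ne1 by (auto simp: prod_zero_iff)
	have "matrix_element q r l n ks = to_fract (scl (q powi e0) FF) * to_fract ?B / (to_fract ?P * to_fract ?A)"
		unfolding matrix_element_eq Fract_conv_to_fract num_def den_def rhom_simps(4)[OF rhom_to_fract] ..
	moreover have "(\<Prod>i=1..?N. to_fract (var i)) = to_fract ?P"
		by (simp add: rhom_prod[OF rhom_to_fract])
	moreover have "(\<Prod>(i, j)\<in>pairs ?N. to_fract (var j - scl Q (var i)) / to_fract (var j - var i)) = to_fract ?A / to_fract ?B"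
		unfolding rhom_prod[OF rhom_to_fract] prod_dividef[symmetric] by (intro prod.cong refl) auto
	ultimately show ?thesis using nz by (simp only:) (simp add: field_simps)
qed

end

theorem mainTheorem2:
	fixes q r :: complex and l n k :: nat and ks :: "nat list"
	assumes "0 < norm q" and "norm q < 1" and "r\<^sup>2 = q"
		and "l \<ge> 1" and "n \<ge> 1" and "k \<le> l"
		and "length ks = l" and "set ks \<subseteq> {0, 1}" and "sum_list ks = k"
	shows "(\<Prod>i=1..l * n. to_fract (var i)) * matrix_element q r l n ks
			* (\<Prod>(i, j)\<in>{(i, j). 1 \<le> i \<and> i < j \<and> j \<le> l * n}.
					 to_fract (var j - scl (q\<^sup>2) (var i)) / to_fract (var j - var i))
		= to_fract (scl (gamma_const q l n k)
				(macdonald_poly (q ^ (2 * (l + 1))) (inverse (q\<^sup>2)) (l * n) (Y_partition l n k)))"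
proof -
	interpret main_data q r l n k ks by (rule main_data.intro) (fact assms)+
	show ?thesis using matrix_element_times_factors unfolding FF_macdonald pairs_def .
qed

end
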